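(* In the setting of the context, let $v$ be a place of one of the four kinds ($P_\infty$), ($P_\sigma$), ($\infty_i$), (M), $s=s_v$, $r=\sigma_v(\pi)-s$. (K1) Suppose $r=0$, and that every attaining generator of $C$ other than those defining the place ($t_1$, $y$ in ($P_\infty$), ($P_\sigma$); none in ($\infty_i$), (M)) is an upper generator $t_k$ that is either primitive with $\lambda_k\in\operatorname{Const}_{\partial_v}(\kappa_v)$ or hyperexponential with $\lambda_k=\mu_k\bar t_k$, $\mu_k\in\operatorname{Const}_{\partial_v}(\kappa_v)^*$, and that $\rho_v\in\operatorname{Const}_{\partial_v}(\kappa_v)$ is not a $\mathbb Q$-linear combination of the $\mu_k$ of the attaining hyperexponential generators (with none of them, this says $\rho_v\neq0$, which is $r=0$). Then $N_v=\{0\}$, and hence the first kernel hypothesis holds. The hypotheses on the coefficients (that $\rho_v$, the $\lambda_k$ and the $\mu_k$ are $\partial_v$-constants) hold in particular when $\rho_v$, the $\lambda_k$ and the $\mu_k$ lie in $\overline F(\bar t_{k'}:\ t_{k'}\text{ non-attaining})$. (K2) Suppose $v$ is of kind ($\infty_i$) or (M) for an independent monomial $t_i$ (with $p=t_i$ if $t_i$ is hyperexponential, $p=t_i\mp\sqrt{-1}$ if hypertangent, in case (M)). Then a kernel hypothesis holds: the first, with $N_v=\{0\}$, if $t_i$ is hyperexponential or hypertangent, and the second, with $r=1$, if $t_i$ is primitive. (K3) Suppose $r\ge1$ and that the tower consists of $t_1=x$ with $Dx=1$, no radical, and a single further generator $t_i$, $v$ being of kind ($\infty_i$) for that generator, so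 that $\kappa_v=\overline F(x)$ and $\partial_v=d/dx$. Then the second kernel hypothesis holds if and only if the rational function $\rho_v^{(r)}$ has a nonzero residue. (K4) Suppose $v$ is of kind ($P_\infty$) or ($P_\sigma$), $r\ge1$, and every upper generator attains the shift and is hyperexponential or hypertangent with $\lambda_k=\mu_k\bar t_k$, resp. $\lambda_k=\mu_k(1+\bar t_k^2)$, $\mu_k\in\overline F^*$, the $\mu_k$ of the hyperexponential generators being linearly independent over $\mathbb Q$. Then the second kernel hypothesis holds.
   Context: All fields have characteristic $0$; $\overline F$ is an algebraic closure of $F$. $(L,D)$ is a differential field built as follows: (T1) $K_0=F(t_1,\dots,t_j)$ with $DF\subseteq F$, each $t_i$ transcendental over $F(t_1,\dots,t_{i-1})$, $Dt_i\in F(t_1,\dots,t_i)$; (T2) $y^m=q\in F[t_1,\dots,t_j]=:R_0$, $q$ $m$-th-power-free, $Y^m-q$ irreducible over $\overline F(t_1,\dots,t_j)$; (T3) the upper generators $t_{j+1},\dots,t_n$ are successively transcendental over the field below, $Dt_i\in K_0(y)(t_{j+1},\dots,t_i)$; (T4) $L=K_0(y)(t_{j+1},\dots,t_n)$ has field of constants $F$. $D$ extends to $\overline F L$ with $D\overline F=0$. $\mathcal O$ is the integral closure of $R_0$ in $K_0(y)$, $\mathcal A=\mathcal O[t_{j+1},\dots,t_n]$, $\overline F\mathcal A=\overline F\otimes_F\mathcal A$ (Krull). For a height-one prime $P$ of $\overline F\mathcal A$: $\eta_P:=\max(0,\sup_{a\ne0}(-v_P(Da)))$ over $a\in\overline F\mathcal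 A$; $P$ is special if $\eta_P+v_P(D\pi)\ge1$ for a uniformiser $\pi$. $P$ is of type E if it is extended from $\overline F\mathcal O$, and moving if $P\cap\overline F\mathcal O=0$; moving primes correspond to monic irreducibles of $T=\overline F K_0(y)[t_{j+1},\dots,t_n]$. Shift and leading part. For a normalised discrete valuation $v$ of $\overline F L$ with valuation ring $\mathcal V_v$, uniformiser $\pi$, residue field $\kappa_v$ (bars are residue classes): $\sigma_v(h)=v(Dh)-v(h)$ for $Dh\neq0$; $s_v=\min_h\sigma_v(h)$ (finite at the places below). With $s=s_v$: $\partial_v\bar c=\overline{\pi^{-s}Dc}$ is a derivation of $\kappa_v$, $\operatorname{Const}_{\partial_v}(\kappa_v)$ its field of constants; $\rho_v=\overline{\pi^{-s-1}D\pi}$; for $r=\sigma_v(\pi)-s$, $\rho_v^{(r)}=\overline{\pi^{-s-1-r}D\pi}$; $N_v=\{a\in\mathbb Z:\partial_v\bar c=-a\rho_v\bar c\text{ for some }\bar c\in\kappa_v^*\}$. First kernel hypothesis: $r=0$ and $N_v\cap\mathbb Z_{<0}=\emptyset$. Second kernel hypothesis: $r\ge1$, $\operatorname{Const}_{\partial_v}(\kappa_v)=\overline F$, and $\rho_v^{(r)}$ is not of the form $\partial_v\bar c$, $\bar c\in\kappa_v$. The four kinds of places, each with a coefficient field $C\subset\overline F L$ on which $v$ is trivial and which maps isomorphically onto $\kappa_v$: ($P_\infty$) $j=1$ and $v$ is the Gauss extension $v(\sum_\alpha a_\alpha t^\alpha)=\min_\alpha v_P(a_\alpha)$ ($a_\alpha\in\overline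 F K_0(y)$, monomials in $t_2,\dots,t_n$) of a place $P$ of the curve $\overline F(t_1)(y)$ over $t_1=\infty$; $C=\overline F(t_2,\dots,t_n)$. ($P_\sigma$) $j=1$ and $v=v_P$ for a special type E prime $P$ over an irreducible $\sigma\in\overline F[t_1]$, i.e. the Gauss extension of a place of the curve over $\sigma$; $C=\overline F(t_2,\dots,t_n)$. ($\infty_i$) $v$ is the degree valuation in an upper variable $t_i$, $i>j$, over $C=C_i:=\overline F K_0(y)(t_{j+1},\dots,\widehat{t_i},\dots,t_n)$, with $\pi=1/t_i$. (M) $v=v_P$ for a moving special prime $P$ whose monic irreducible $p$ is linear in some upper variable $t_i$ with coefficients free of $t_i$; $\pi=p$, $C=C_i$ (via $t_i\mapsto$ the root of $p$). The generators of $C$ are the $t_k$ (those lying in $C$) and $y$ when $y\in C$. A generator $c_k$ of $C$ attains the shift ("is attaining") if $v(Dc_k)=s_v$, equivalently $\partial_v\bar c_k\neq0$. For generators $t_k$, $\lambda_k:=\partial_v\bar t_k$. An upper generator $t_k$ is primitive, hyperexponential or hypertangent if $Dt_k$, $Dt_k/t_k$, $Dt_k/(1+t_k^2)$ respectively lies in the field below $t_k$ (a monomial means one of these); it is independent if no $Dt_{k'}$, $k'\neq k$, involves $t_k$.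
   Formalization: (K4) as printed is false: π is taken as a uniformiser of the curve place (in F̄K_0(y)), and, for Const = F̄, the μ_k of hyperexponential t_k together with 2√-1 μ_k of hypertangent t_k are assumed Q-independent; without hypertangents this is the printed condition. *)

theory Defs
  imports "HOL-Computational_Algebra.Computational_Algebra"
begin

section \<open>Subrings, subfields and ideals of an ambient field\<close>

text \<open>All rings and fields of the construction are subsets of one ambient field of
  characteristic zero; generated subrings, subfields and ideals are hulls.\<close>

definition is_subring :: "'a::comm_ring_1 set \<Rightarrow> bool" where
  "is_subring R \<longleftrightarrow> 0 \<in> R \<and> 1 \<in> R \<and>
     (\<forall>x\<in>R. - x \<in> R) \<and> (\<forall>x\<in>R. \<forall>y\<in>R. x + y \<in> R \<and> x * y \<in> R)"

definition is_subfield :: "'a::field set \<Rightarrow> bool" where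
  "is_subfield K \<longleftrightarrow> is_subring K \<and> (\<forall>x\<in>K. inverse x \<in> K)"

abbreviation ring_gen :: "'a::comm_ring_1 set \<Rightarrow> 'a set" where
  "ring_gen S \<equiv> is_subring hull S"

abbreviation field_gen :: "'a::field set \<Rightarrow> 'a set" where
  "field_gen S \<equiv> is_subfield hull S"

definition polys_over :: "'a::zero set \<Rightarrow> 'a poly set" where
  "polys_over R = {p. \<forall>i. coeff p i \<in> R}"

definition algebraic_over :: "'a::field set \<Rightarrow> 'a \<Rightarrow> bool" where
  "algebraic_over K x \<longleftrightarrow> (\<exists>p\<in>polys_over K. p \<noteq> 0 \<and> poly p x = 0)"

definition integral_over :: "'a::field set \<Rightarrow> 'a \<Rightarrow> bool" where
  "integral_over R x \<longleftrightarrow> (\<exists>p\<in>polys_over R. lead_coeff p = 1 \<and> poly p x = 0)"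

definition is_alg_closure :: "'a::field set \<Rightarrow> 'a set \<Rightarrow> bool" where
  "is_alg_closure F Fb \<longleftrightarrow> is_subfield Fb \<and> F \<subseteq> Fb \<and> (\<forall>x\<in>Fb. algebraic_over F x) \<and>
     (\<forall>p\<in>polys_over Fb. degree p > 0 \<longrightarrow> (\<exists>x\<in>Fb. poly p x = 0))"

definition unit_in :: "'a::comm_ring_1 set \<Rightarrow> 'a \<Rightarrow> bool" where
  "unit_in R x \<longleftrightarrow> x \<in> R \<and> (\<exists>y\<in>R. x * y = 1)"

definition irreducible_in :: "'a::comm_ring_1 set \<Rightarrow> 'a \<Rightarrow> bool" where
  "irreducible_in R p \<longleftrightarrow> p \<in> R \<and> p \<noteq> 0 \<and> \<not> unit_in R p \<and>
     (\<forall>a\<in>R. \<forall>b\<in>R. p = a * b \<longrightarrow> unit_in R a \<or> unit_in R b)"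

definition power_free_in :: "'a::comm_ring_1 set \<Rightarrow> nat \<Rightarrow> 'a \<Rightarrow> bool" where
  "power_free_in R m q \<longleftrightarrow> (\<forall>g\<in>R. \<forall>h\<in>R. q = g ^ m * h \<longrightarrow> unit_in R g)"

definition is_ideal :: "'a::comm_ring_1 set \<Rightarrow> 'a set \<Rightarrow> bool" where
  "is_ideal R I \<longleftrightarrow> I \<subseteq> R \<and> 0 \<in> I \<and> (\<forall>x\<in>I. \<forall>y\<in>I. x + y \<in> I) \<and> (\<forall>a\<in>R. \<forall>x\<in>I. a * x \<in> I)"

definition is_prime_ideal :: "'a::comm_ring_1 set \<Rightarrow> 'a set \<Rightarrow> bool" where
  "is_prime_ideal R P \<longleftrightarrow> is_ideal R P \<and> P \<noteq> R \<and>
     (\<forall>a\<in>R. \<forall>b\<in>R. a * b \<in> P \<longrightarrow> a \<in> P \<or> b \<in> P)"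

text \<open>In a domain the height-one primes are the minimal nonzero primes.\<close>

definition is_height_one_prime :: "'a::field set \<Rightarrow> 'a set \<Rightarrow> bool" where
  "is_height_one_prime R P \<longleftrightarrow> is_prime_ideal R P \<and> P \<noteq> {0} \<and>
     (\<forall>Q. is_prime_ideal R Q \<and> Q \<subseteq> P \<longrightarrow> Q = {0} \<or> Q = P)"

definition localization_at :: "'a::field set \<Rightarrow> 'a set \<Rightarrow> 'a set" where
  "localization_at R P = {a / b | a b. a \<in> R \<and> b \<in> R \<and> b \<notin> P}"

definition is_derivation_on :: "'a::field set \<Rightarrow> ('a \<Rightarrow> 'a) \<Rightarrow> bool" where
  "is_derivation_on E D \<longleftrightarrow> (\<forall>x\<in>E. D x \<in> E) \<and>
     (\<forall>x\<in>E. \<forall>y\<in>E. D (x + y) = D x + D y \<and> D (x * y) = D x * y + x * D y)"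


section \<open>Discrete valuations and residue fields\<close>

text \<open>A valuation is an integer-valued function used on nonzero elements only; the value
  infinity at 0 is expressed by guards.\<close>

definition is_discrete_valuation :: "'a::field set \<Rightarrow> ('a \<Rightarrow> int) \<Rightarrow> bool" where
  "is_discrete_valuation E v \<longleftrightarrow>
     (\<forall>x\<in>E - {0}. \<forall>y\<in>E - {0}. v (x * y) = v x + v y \<and>
        (x + y \<noteq> 0 \<longrightarrow> min (v x) (v y) \<le> v (x + y))) \<and>
     (\<exists>x\<in>E - {0}. v x = 1)"

definition val_ring :: "'a::field set \<Rightarrow> ('a \<Rightarrow> int) \<Rightarrow> 'a set" where
  "val_ring E v = {x\<in>E. x \<noteq> 0 \<longrightarrow> 0 \<le> v x}"

definition val_ideal :: "'a::field set \<Rightarrow> ('a \<Rightarrow> int) \<Rightarrow> 'a set" where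
  "val_ideal E v = {x\<in>E. x \<noteq> 0 \<longrightarrow> 1 \<le> v x}"

definition is_uniformiser :: "'a::field set \<Rightarrow> ('a \<Rightarrow> int) \<Rightarrow> 'a \<Rightarrow> bool" where
  "is_uniformiser E v \<pi> \<longleftrightarrow> \<pi> \<in> E \<and> \<pi> \<noteq> 0 \<and> v \<pi> = 1"

text \<open>A residue map is a ring homomorphism on the valuation ring whose kernel is the maximal
  ideal; its image is the residue field, so no particular model of the quotient is singled out.\<close>

definition is_residue_map :: "'a::field set \<Rightarrow> ('a \<Rightarrow> int) \<Rightarrow> ('a \<Rightarrow> 'k::field) \<Rightarrow> bool" where
  "is_residue_map E v res \<longleftrightarrow> res 1 = 1 \<and>
     (\<forall>x\<in>val_ring E v. \<forall>y\<in>val_ring E v.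
        res (x + y) = res x + res y \<and> res (x * y) = res x * res y) \<and>
     (\<forall>x\<in>val_ring E v. res x = 0 \<longleftrightarrow> x \<in> val_ideal E v)"


section \<open>The tower\<close>

text \<open>\<open>Fld\<close> is the constant field \<open>F\<close> and \<open>Fb\<close> its algebraic closure, \<open>der\<close> the derivation \<open>D\<close>.
  The generators \<open>t\<^sub>k\<close> are indexed from 1: \<open>nlow = j\<close> lower ones, \<open>ngen = n\<close> in all. The radical
  \<open>y\<close> satisfies \<open>y\<^sup>m = q\<close> with \<open>m = rdeg\<close> and \<open>q = radicand\<close>; a tower without radical has \<open>rdeg = 1\<close>,
  and then \<open>q\<close> and \<open>y\<close> lie in \<open>F\<close>, because a 1st-power-free element is a unit.\<close>

record 'a tower =
  Fld :: "'a set"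
  Fb :: "'a set"
  der :: "'a \<Rightarrow> 'a"
  gen :: "nat \<Rightarrow> 'a"
  nlow :: nat
  ngen :: nat
  rdeg :: nat
  radicand :: 'a
  radical :: 'a

definition upper :: "'a tower \<Rightarrow> nat set" where
  "upper T = {nlow T + 1..ngen T}"

definition K0y :: "'a::field tower \<Rightarrow> 'a set" where
  "K0y T = field_gen (Fld T \<union> gen T ` {1..nlow T} \<union> {radical T})"

definition L_field :: "'a::field tower \<Rightarrow> 'a set" where
  "L_field T = field_gen (K0y T \<union> gen T ` upper T)"

text \<open>The compositum of the algebraic closure and \<open>L\<close>.\<close>

definition FbL :: "'a::field tower \<Rightarrow> 'a set" where
  "FbL T = field_gen (Fb T \<union> L_field T)"

definition FbK0y :: "'a::field tower \<Rightarrow> 'a set" where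
  "FbK0y T = field_gen (Fb T \<union> K0y T)"

text \<open>The field below the generator \<open>t\<^sub>k\<close>.\<close>

definition below :: "'a::field tower \<Rightarrow> nat \<Rightarrow> 'a set" where
  "below T k = (if k \<le> nlow T then field_gen (Fld T \<union> gen T ` {1..<k})
                else field_gen (K0y T \<union> gen T ` {nlow T + 1..<k}))"

definition R0 :: "'a::field tower \<Rightarrow> 'a set" where
  "R0 T = ring_gen (Fld T \<union> gen T ` {1..nlow T})"

definition is_tower :: "'a::field_char_0 tower \<Rightarrow> bool" where
  "is_tower T \<longleftrightarrow>
     is_subfield (Fld T) \<and> is_alg_closure (Fld T) (Fb T) \<and>
     1 \<le> nlow T \<and> nlow T \<le> ngen T \<and> 1 \<le> rdeg T \<and>
     is_derivation_on (FbL T) (der T) \<and> (\<forall>c\<in>Fld T. der T c \<in> Fld T) \<and>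
     (\<forall>c\<in>Fb T. der T c = 0) \<and>
     (\<forall>k\<in>{1..ngen T}. \<not> algebraic_over (below T k) (gen T k) \<and>
                    der T (gen T k) \<in> field_gen (below T k \<union> {gen T k})) \<and>
     radicand T \<in> R0 T \<and> radical T ^ rdeg T = radicand T \<and>
     power_free_in (R0 T) (rdeg T) (radicand T) \<and>
     irreducible_in (polys_over (field_gen (Fb T \<union> gen T ` {1..nlow T})))
       (monom 1 (rdeg T) - [:radicand T:]) \<and>
     {x \<in> L_field T. der T x = 0} = Fld T"

definition O_ring :: "'a::field tower \<Rightarrow> 'a set" where
  "O_ring T = {x \<in> K0y T. integral_over (R0 T) x}"

definition A_ring :: "'a::field tower \<Rightarrow> 'a set" where
  "A_ring T = ring_gen (O_ring T \<union> gen T ` upper T)"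

text \<open>\<open>F\<close> is relatively algebraically closed in \<open>L\<close> (its elements are all the constants),
  so the tensor products with \<open>Fb\<close> over \<open>F\<close> are the subrings generated inside \<open>FbL\<close>.\<close>

definition FbO :: "'a::field tower \<Rightarrow> 'a set" where
  "FbO T = ring_gen (Fb T \<union> O_ring T)"

definition FbA :: "'a::field tower \<Rightarrow> 'a set" where
  "FbA T = ring_gen (Fb T \<union> A_ring T)"

definition T_ring :: "'a::field tower \<Rightarrow> 'a set" where
  "T_ring T = ring_gen (FbK0y T \<union> gen T ` upper T)"


section \<open>Special primes and the four kinds of places\<close>

text \<open>The normalised valuation \<open>v\<^sub>P\<close> is the one whose valuation ring is the localization at \<open>P\<close>.\<close>

definition is_prime_valuation :: "'a::field tower \<Rightarrow> 'a set \<Rightarrow> ('a \<Rightarrow> int) \<Rightarrow> bool" where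
  "is_prime_valuation T P v \<longleftrightarrow>
     is_discrete_valuation (FbL T) v \<and> val_ring (FbL T) v = localization_at (FbA T) P"

text \<open>An element \<open>a\<close> with \<open>D a = 0\<close> contributes \<open>- \<infinity>\<close> to the supremum and is left out.\<close>

definition eta :: "'a::field tower \<Rightarrow> ('a \<Rightarrow> int) \<Rightarrow> int" where
  "eta T v = Sup (insert 0 {- v (der T a) | a. a \<in> FbA T \<and> a \<noteq> 0 \<and> der T a \<noteq> 0})"

definition is_special :: "'a::field tower \<Rightarrow> ('a \<Rightarrow> int) \<Rightarrow> bool" where
  "is_special T v \<longleftrightarrow>
     (\<exists>\<pi>. is_uniformiser (FbL T) v \<pi> \<and> (der T \<pi> = 0 \<or> eta T v + v (der T \<pi>) \<ge> 1))"

definition is_type_E :: "'a::field tower \<Rightarrow> 'a set \<Rightarrow> bool" where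
  "is_type_E T P \<longleftrightarrow> (\<exists>P0. is_prime_ideal (FbO T) P0 \<and> P = is_ideal (FbA T) hull P0)"

definition is_moving :: "'a::field tower \<Rightarrow> 'a set \<Rightarrow> bool" where
  "is_moving T P \<longleftrightarrow> P \<inter> FbO T = {0}"

text \<open>A polynomial in the upper generators is a sum over a finite set of exponent functions with
  nonzero coefficients; such a representation is unique.\<close>

definition is_gauss_extension ::
    "'a::field tower \<Rightarrow> ('a \<Rightarrow> int) \<Rightarrow> ('a \<Rightarrow> int) \<Rightarrow> bool" where
  "is_gauss_extension T w v \<longleftrightarrow>
     (\<forall>(S :: (nat \<Rightarrow> nat) set) a. finite S \<and> S \<noteq> {} \<and>
        (\<forall>\<alpha>\<in>S. (\<forall>i. i \<notin> upper T \<longrightarrow> \<alpha> i = 0) \<and> a \<alpha> \<in> FbK0y T - {0}) \<longrightarrow>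
        v (\<Sum>\<alpha>\<in>S. a \<alpha> * (\<Prod>i\<in>upper T. gen T i ^ \<alpha> i)) = Min ((\<lambda>\<alpha>. w (a \<alpha>)) ` S))"

text \<open>\<open>P_sigma\<close> is the kind over an irreducible of \<open>Fb[t\<^sub>1]\<close>, \<open>Upper_inf i\<close> the degree valuation
  in \<open>t\<^sub>i\<close>, \<open>Moving i\<close> a moving special prime linear in \<open>t\<^sub>i\<close>.\<close>

datatype kind = P_inf | P_sigma | Upper_inf nat | Moving nat

definition C_upper :: "'a::field tower \<Rightarrow> nat \<Rightarrow> 'a set" where
  "C_upper T i = field_gen (FbK0y T \<union> gen T ` (upper T - {i}))"

fun coeff_field :: "'a::field tower \<Rightarrow> kind \<Rightarrow> 'a set" where
  "coeff_field T P_inf = field_gen (Fb T \<union> gen T ` {2..ngen T})"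
| "coeff_field T P_sigma = field_gen (Fb T \<union> gen T ` {2..ngen T})"
| "coeff_field T (Upper_inf i) = C_upper T i"
| "coeff_field T (Moving i) = C_upper T i"

text \<open>In the last case \<open>\<pi>\<close> is the irreducible of the polynomial ring \<open>T_ring\<close> attached to the
  prime \<open>P\<close>. It is determined by \<open>P\<close> up to a unit of \<open>T_ring\<close>; no monomial order is fixed and
  every choice is allowed, in particular the monic one for any order.\<close>

fun is_place_of_kind :: "'a::field tower \<Rightarrow> kind \<Rightarrow> ('a \<Rightarrow> int) \<Rightarrow> 'a \<Rightarrow> bool" where
  "is_place_of_kind T P_inf v \<pi> \<longleftrightarrow>
     nlow T = 1 \<and> is_discrete_valuation (FbL T) v \<and> is_uniformiser (FbL T) v \<pi> \<and>
     (\<exists>w. is_discrete_valuation (FbK0y T) w \<and> (\<forall>c\<in>Fb T - {0}. w c = 0) \<and>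
          w (gen T 1) < 0 \<and> is_gauss_extension T w v)"
| "is_place_of_kind T P_sigma v \<pi> \<longleftrightarrow>
     nlow T = 1 \<and> is_uniformiser (FbL T) v \<pi> \<and>
     (\<exists>P \<sigma>. is_height_one_prime (FbA T) P \<and> is_prime_valuation T P v \<and>
            is_special T v \<and> is_type_E T P \<and>
            irreducible_in (ring_gen (Fb T \<union> {gen T 1})) \<sigma> \<and> \<sigma> \<in> P)"
| "is_place_of_kind T (Upper_inf i) v \<pi> \<longleftrightarrow>
     i \<in> upper T \<and> is_discrete_valuation (FbL T) v \<and>
     (\<forall>p\<in>polys_over (C_upper T i). p \<noteq> 0 \<longrightarrow> v (poly p (gen T i)) = - int (degree p)) \<and>
     \<pi> = 1 / gen T i"
| "is_place_of_kind T (Moving i) v \<pi> \<longleftrightarrow>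
     i \<in> upper T \<and>
     (\<exists>P. is_height_one_prime (FbA T) P \<and> is_prime_valuation T P v \<and>
          is_special T v \<and> is_moving T P \<and>
          irreducible_in (T_ring T) \<pi> \<and> P = {\<pi> * h | h. h \<in> T_ring T} \<inter> FbA T) \<and>
     (\<exists>a b. {a, b} \<subseteq> ring_gen (FbK0y T \<union> gen T ` (upper T - {i})) \<and>
            a \<noteq> 0 \<and> \<pi> = a * gen T i + b)"


section \<open>Shift, leading part and kernel hypotheses\<close>

definition shift_at :: "'a::field tower \<Rightarrow> ('a \<Rightarrow> int) \<Rightarrow> 'a \<Rightarrow> int" where
  "shift_at T v h = v (der T h) - v h"

definition shift :: "'a::field tower \<Rightarrow> ('a \<Rightarrow> int) \<Rightarrow> int" where
  "shift T v = (LEAST s. \<exists>h\<in>FbL T. der T h \<noteq> 0 \<and> s = shift_at T v h)"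

definition excess :: "'a::field tower \<Rightarrow> ('a \<Rightarrow> int) \<Rightarrow> 'a \<Rightarrow> int" where
  "excess T v \<pi> = shift_at T v \<pi> - shift T v"

definition kappa :: "'a::field tower \<Rightarrow> ('a \<Rightarrow> int) \<Rightarrow> ('a \<Rightarrow> 'k::field) \<Rightarrow> 'k set" where
  "kappa T v res = res ` val_ring (FbL T) v"

text \<open>By minimality of the shift the value does not depend on the representative chosen by
  \<open>inv_into\<close>.\<close>

definition del ::
    "'a::field tower \<Rightarrow> ('a \<Rightarrow> int) \<Rightarrow> 'a \<Rightarrow> ('a \<Rightarrow> 'k::field) \<Rightarrow> 'k \<Rightarrow> 'k" where
  "del T v \<pi> res x =
     res (\<pi> powi (- shift T v) * der T (inv_into (val_ring (FbL T) v) res x))"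

definition del_consts ::
    "'a::field tower \<Rightarrow> ('a \<Rightarrow> int) \<Rightarrow> 'a \<Rightarrow> ('a \<Rightarrow> 'k::field) \<Rightarrow> 'k set" where
  "del_consts T v \<pi> res = {x \<in> kappa T v res. del T v \<pi> res x = 0}"

definition rho_r ::
    "'a::field tower \<Rightarrow> ('a \<Rightarrow> int) \<Rightarrow> 'a \<Rightarrow> ('a \<Rightarrow> 'k::field) \<Rightarrow> int \<Rightarrow> 'k" where
  "rho_r T v \<pi> res r = res (\<pi> powi (- shift T v - 1 - r) * der T \<pi>)"

definition rho :: "'a::field tower \<Rightarrow> ('a \<Rightarrow> int) \<Rightarrow> 'a \<Rightarrow> ('a \<Rightarrow> 'k::field) \<Rightarrow> 'k" where
  "rho T v \<pi> res = res (\<pi> powi (- shift T v - 1) * der T \<pi>)"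

definition NN :: "'a::field tower \<Rightarrow> ('a \<Rightarrow> int) \<Rightarrow> 'a \<Rightarrow> ('a \<Rightarrow> 'k::field) \<Rightarrow> int set" where
  "NN T v \<pi> res =
     {a. \<exists>c \<in> kappa T v res - {0}. del T v \<pi> res c = - of_int a * rho T v \<pi> res * c}"

definition first_kernel_hyp ::
    "'a::field tower \<Rightarrow> ('a \<Rightarrow> int) \<Rightarrow> 'a \<Rightarrow> ('a \<Rightarrow> 'k::field) \<Rightarrow> bool" where
  "first_kernel_hyp T v \<pi> res \<longleftrightarrow> excess T v \<pi> = 0 \<and> NN T v \<pi> res \<inter> {..<0} = {}"

definition second_kernel_hyp ::
    "'a::field tower \<Rightarrow> ('a \<Rightarrow> int) \<Rightarrow> 'a \<Rightarrow> ('a \<Rightarrow> 'k::field) \<Rightarrow> bool" where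
  "second_kernel_hyp T v \<pi> res \<longleftrightarrow> excess T v \<pi> \<ge> 1 \<and>
     del_consts T v \<pi> res = res ` Fb T \<and>
     rho_r T v \<pi> res (excess T v \<pi>) \<notin> del T v \<pi> res ` kappa T v res"


section \<open>Generators\<close>

definition generators :: "'a::field tower \<Rightarrow> kind \<Rightarrow> 'a set" where
  "generators T kd = (gen T ` {1..ngen T} \<union> {radical T}) \<inter> coeff_field T kd"

fun place_generators :: "'a tower \<Rightarrow> kind \<Rightarrow> 'a set" where
  "place_generators T P_inf = {gen T 1, radical T}"
| "place_generators T P_sigma = {gen T 1, radical T}"
| "place_generators T (Upper_inf i) = {}"
| "place_generators T (Moving i) = {}"

definition attains :: "'a::field tower \<Rightarrow> ('a \<Rightarrow> int) \<Rightarrow> 'a \<Rightarrow> bool" where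
  "attains T v c \<longleftrightarrow> der T c \<noteq> 0 \<and> v (der T c) = shift T v"

definition lam ::
    "'a::field tower \<Rightarrow> ('a \<Rightarrow> int) \<Rightarrow> 'a \<Rightarrow> ('a \<Rightarrow> 'k::field) \<Rightarrow> nat \<Rightarrow> 'k" where
  "lam T v \<pi> res k = del T v \<pi> res (res (gen T k))"

definition primitive :: "'a::field tower \<Rightarrow> nat \<Rightarrow> bool" where
  "primitive T k \<longleftrightarrow> k \<in> upper T \<and> der T (gen T k) \<in> below T k"

definition hyperexponential :: "'a::field tower \<Rightarrow> nat \<Rightarrow> bool" where
  "hyperexponential T k \<longleftrightarrow> k \<in> upper T \<and> der T (gen T k) / gen T k \<in> below T k"

definition hypertangent :: "'a::field tower \<Rightarrow> nat \<Rightarrow> bool" where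
  "hypertangent T k \<longleftrightarrow> k \<in> upper T \<and> der T (gen T k) / (1 + (gen T k)\<^sup>2) \<in> below T k"

definition monomial_gen :: "'a::field tower \<Rightarrow> nat \<Rightarrow> bool" where
  "monomial_gen T k \<longleftrightarrow> primitive T k \<or> hyperexponential T k \<or> hypertangent T k"

definition independent_gen :: "'a::field tower \<Rightarrow> nat \<Rightarrow> bool" where
  "independent_gen T k \<longleftrightarrow> k \<in> upper T \<and>
     (\<forall>k'\<in>{1..ngen T} - {k}. der T (gen T k') \<in> field_gen (K0y T \<union> gen T ` (upper T - {k})))"

definition attaining_prim :: "'a::field tower \<Rightarrow> kind \<Rightarrow> ('a \<Rightarrow> int) \<Rightarrow> nat set" where
  "attaining_prim T kd v =
     {k \<in> upper T. gen T k \<in> coeff_field T kd \<and> attains T v (gen T k) \<and> primitive T k}"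

definition attaining_hyper :: "'a::field tower \<Rightarrow> kind \<Rightarrow> ('a \<Rightarrow> int) \<Rightarrow> nat set" where
  "attaining_hyper T kd v =
     {k \<in> upper T. gen T k \<in> coeff_field T kd \<and> attains T v (gen T k) \<and> hyperexponential T k}"

definition nonattaining_field ::
    "'a::field tower \<Rightarrow> kind \<Rightarrow> ('a \<Rightarrow> int) \<Rightarrow> ('a \<Rightarrow> 'k::field) \<Rightarrow> 'k set" where
  "nonattaining_field T kd v res =
     field_gen (res ` Fb T \<union>
       {res (gen T k) | k. k \<in> {1..ngen T} \<and> gen T k \<in> coeff_field T kd \<and> \<not> attains T v (gen T k)})"

text \<open>The hypothesis on the attaining generators splits into their shape, for a family \<open>\<mu>\<close>, and
  the condition that the coefficients lie in a subfield \<open>S\<close> of the residue field.\<close>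

definition attaining_shape ::
    "'a::field tower \<Rightarrow> kind \<Rightarrow> ('a \<Rightarrow> int) \<Rightarrow> 'a \<Rightarrow> ('a \<Rightarrow> 'k::field) \<Rightarrow> (nat \<Rightarrow> 'k) \<Rightarrow> bool" where
  "attaining_shape T kd v \<pi> res \<mu> \<longleftrightarrow>
     (\<forall>c \<in> generators T kd - place_generators T kd. attains T v c \<longrightarrow>
        (\<exists>k\<in>upper T. c = gen T k \<and>
           (primitive T k \<or>
            hyperexponential T k \<and> lam T v \<pi> res k = \<mu> k * res (gen T k) \<and> \<mu> k \<noteq> 0)))"

definition attaining_coeffs_in ::
    "'k set \<Rightarrow> 'a::field tower \<Rightarrow> kind \<Rightarrow> ('a \<Rightarrow> int) \<Rightarrow> 'a \<Rightarrow> ('a \<Rightarrow> 'k::field) \<Rightarrow>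
     (nat \<Rightarrow> 'k) \<Rightarrow> bool" where
  "attaining_coeffs_in S T kd v \<pi> res \<mu> \<longleftrightarrow> rho T v \<pi> res \<in> S \<and>
     (\<forall>k\<in>attaining_prim T kd v. lam T v \<pi> res k \<in> S) \<and>
     (\<forall>k\<in>attaining_hyper T kd v. \<mu> k \<in> S)"

definition rat_combination :: "'i set \<Rightarrow> ('i \<Rightarrow> 'k::field_char_0) \<Rightarrow> 'k \<Rightarrow> bool" where
  "rat_combination I \<mu> x \<longleftrightarrow> (\<exists>c :: 'i \<Rightarrow> rat. x = (\<Sum>k\<in>I. of_rat (c k) * \<mu> k))"

definition rat_independent :: "'i set \<Rightarrow> ('i \<Rightarrow> 'k::field_char_0) \<Rightarrow> bool" where
  "rat_independent I \<mu> \<longleftrightarrow>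
     (\<forall>c :: 'i \<Rightarrow> rat. (\<Sum>k\<in>I. of_rat (c k) * \<mu> k) = 0 \<longrightarrow> (\<forall>k\<in>I. c k = 0))"

text \<open>Over the algebraic closure a hypertangent generator \<open>u\<close> with \<open>\<partial>u = \<mu> (1 + u\<^sup>2)\<close> gives the
  exponential \<open>(u - \<iota>) / (u + \<iota>)\<close>, where \<open>\<iota>\<^sup>2 = -1\<close>, with logarithmic derivative \<open>2 \<iota> \<mu>\<close>.
  Rational relations between these exponents and the hyperexponential ones produce new constants:
  if \<open>\<partial>u = \<mu> (1 + u\<^sup>2)\<close> and \<open>\<partial>w = \<mu> (1 + w\<^sup>2)\<close>, then \<open>(u - w) / (1 + u w)\<close> is one.\<close>

definition exponent :: "'a::field tower \<Rightarrow> 'k::field \<Rightarrow> (nat \<Rightarrow> 'k) \<Rightarrow> nat \<Rightarrow> 'k" where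
  "exponent T \<iota> \<mu> k = (if hypertangent T k then 2 * \<iota> * \<mu> k else \<mu> k)"


section \<open>Residues of rational functions\<close>

text \<open>The residue at \<open>a\<close> of the rational function \<open>P / Q\<close>, read off its Laurent expansion in
  powers of \<open>X - a\<close>.\<close>

definition ratfun_residue :: "'k::field poly \<Rightarrow> 'k poly \<Rightarrow> 'k \<Rightarrow> 'k" where
  "ratfun_residue P Q a =
     fls_residue (fps_to_fls (fps_of_poly (P \<circ>\<^sub>p [:a, 1:])) /
                  fps_to_fls (fps_of_poly (Q \<circ>\<^sub>p [:a, 1:])))"

text \<open>For \<open>x\<close> transcendental over \<open>K\<close>. Only finite points are considered: the residues of a
  rational function sum to zero, so the one at infinity is determined by the others.\<close>

definition has_nonzero_residue :: "'k::field set \<Rightarrow> 'k \<Rightarrow> 'k \<Rightarrow> bool" where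
  "has_nonzero_residue K x f \<longleftrightarrow>
     (\<exists>P\<in>polys_over K. \<exists>Q\<in>polys_over K. Q \<noteq> 0 \<and> f = poly P x / poly Q x \<and>
        (\<exists>a\<in>K. ratfun_residue P Q a \<noteq> 0))"

end

(* At each of the four kinds of places the residue field is the isomorphic image of the coefficient
   field C, and the shift is an attained minimum because D lowers values by a bounded amount. When
   C(pi) is the whole field, the bound is read off polynomials in pi. For the Gauss extensions one
   differentiates the minimal equation of an element of the curve over the rational functions in a
   uniformiser, at the element and at a truncation of its expansion.

   For (K1) and (K4), the residue field is generated by generalised eigenvectors of del_v with
   constant eigenvalues. Those with distinct eigenvalues are independent, so an eigenvector in the
   field of fractions is a quotient of two of them: its eigenvalue is an integral combination of the
   mu_k. In (K4) the generators are true eigenvectors, once a hypertangent u is replaced by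
   (u - i)/(u + i); a solution f of del f = c with c constant would then be a quotient of two
   eigenvectors for one eigenvalue, hence a constant itself.

   For (K2), a solution of the kernel equation would make c * theta^n (theta the exponential attached
   to t_i) or c + t_i a constant of the tower, contradicting the transcendence of t_i over C; and a
   moving prime linear in an independent primitive t_i is never special, since D preserves its
   valuation ring and sends the uniformiser p to a unit. (K3) is partial fraction decomposition. *)

theory Submission
  imports Defs
begin

section \<open>Subrings, subfields and algebraic elements\<close>

text \<open>The contradictions for (K2) need the constants of the compositum with the closure k,
  while (T4) speaks of L only; they are lifted by differentiating a monic minimal equation. A
  relation between residues becomes one in the tower because v is trivial on C, so that C meets each
  residue class once, and because D maps C into itself when t_i is independent. For a Gauss
  extension the curve is merely algebraic over k(p0), p0 a uniformiser on it, so D is controlled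
  there by approximation. The precision v(q'(a)) + 1 pays for the division by q'(a) and for the loss
  of one in differentiating powers of p0. The comparison of components behind (K1) and (K4) is
  stated for a graded family G instead of the eigenspaces, because three choices are needed:
  generalised eigenvectors for N_v, true eigenvectors to show that no nonzero element of k is a
  derivative, and multiples of single monomials to exclude new constants. The last family is closed
  under addition only if the weight determines the monomial, which is the rational independence of
  the exponents.\<close>

lemma subring_hull: "is_subring (ring_gen X)"
  by (rule hull_in) (auto simp: is_subring_def)

lemma subfield_hull: "is_subfield (field_gen X)"
  by (rule hull_in) (auto simp: is_subfield_def is_subring_def)

lemma field_gen_subset: "X \<subseteq> K \<Longrightarrow> is_subfield K \<Longrightarrow> field_gen X \<subseteq> K"
  unfolding hull_def by blast

lemma ring_gen_subset: "X \<subseteq> K \<Longrightarrow> is_subring K \<Longrightarrow> ring_gen X \<subseteq> K"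
  unfolding hull_def by blast

lemma field_gen_inc: "x \<in> X \<Longrightarrow> x \<in> field_gen X"
  by (simp add: hull_inc)

lemma ring_gen_inc: "x \<in> X \<Longrightarrow> x \<in> ring_gen X"
  by (simp add: hull_inc)

lemma subring_closed:
  assumes "is_subring R"
  shows subring_0: "0 \<in> R" and subring_1: "1 \<in> R"
    and subring_add: "x \<in> R \<Longrightarrow> y \<in> R \<Longrightarrow> x + y \<in> R"
    and subring_mult: "x \<in> R \<Longrightarrow> y \<in> R \<Longrightarrow> x * y \<in> R"
    and subring_minus: "x \<in> R \<Longrightarrow> - x \<in> R"
    and subring_diff: "x \<in> R \<Longrightarrow> y \<in> R \<Longrightarrow> x - y \<in> R"
  using assms unfolding is_subring_def diff_conv_add_uminus by blast+

lemma subring_sum: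
  assumes "is_subring R" "\<And>i. i \<in> I \<Longrightarrow> f i \<in> R" shows "sum f I \<in> R"
  using assms(2) by (induction I rule: infinite_finite_induct)
    (auto intro: subring_closed[OF assms(1)])

lemma subring_prod:
  assumes "is_subring R" "\<And>i. i \<in> I \<Longrightarrow> f i \<in> R" shows "prod f I \<in> R"
  using assms(2) by (induction I rule: infinite_finite_induct)
    (auto intro: subring_closed[OF assms(1)])

lemma subring_power:
  assumes "is_subring R" "x \<in> R" shows "x ^ n \<in> R"
  by (induction n) (auto intro: subring_closed[OF assms(1)] assms(2))

lemma subring_of_nat:
  assumes "is_subring R" shows "of_nat n \<in> R"
  by (induction n) (auto intro: subring_closed[OF assms(1)])

lemma subring_of_int:
  assumes "is_subring R" shows "of_int n \<in> R"
  by (cases n rule: int_cases2) (auto intro: subring_closed[OF assms(1)] subring_of_nat[OF assms])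

lemma subfield_subring: "is_subfield K \<Longrightarrow> is_subring K"
  by (simp add: is_subfield_def)

lemma subfield_inverse: "is_subfield K \<Longrightarrow> x \<in> K \<Longrightarrow> inverse x \<in> K"
  by (simp add: is_subfield_def)

lemma subfield_divide: "is_subfield K \<Longrightarrow> x \<in> K \<Longrightarrow> y \<in> K \<Longrightarrow> x / y \<in> K"
  by (simp add: divide_inverse is_subfield_def is_subring_def)

lemmas subfield_0 = subring_0[OF subfield_subring]
  and subfield_1 = subring_1[OF subfield_subring]
  and subfield_add = subring_add[OF subfield_subring]
  and subfield_mult = subring_mult[OF subfield_subring]
  and subfield_minus = subring_minus[OF subfield_subring]
  and subfield_diff = subring_diff[OF subfield_subring]
  and subfield_sum = subring_sum[OF subfield_subring]
  and subfield_prod = subring_prod[OF subfield_subring]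
  and subfield_power = subring_power[OF subfield_subring]
  and subfield_of_nat = subring_of_nat[OF subfield_subring]
  and subfield_of_int = subring_of_int[OF subfield_subring]

lemma subfield_powi: "is_subfield K \<Longrightarrow> x \<in> K \<Longrightarrow> x powi n \<in> K"
  by (simp add: power_int_def subfield_power subfield_inverse)

lemmas subfield_closed = subfield_0 subfield_1 subfield_add subfield_mult subfield_minus
  subfield_diff subfield_power subfield_inverse subfield_divide subfield_of_nat subfield_of_int
  subfield_powi

text \<open>Quotients of elements of the generated ring already form a field. Through this, claims
  about a generated field are reduced to polynomial expressions in the generators.\<close>

lemma ring_gen_frac:
  assumes "z \<in> field_gen X"
  shows "\<exists>a\<in>ring_gen X. \<exists>b\<in>ring_gen X. b \<noteq> 0 \<and> z = a / b"
proof -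
  let ?Q = "{a / b |a b. a \<in> ring_gen X \<and> b \<in> ring_gen X \<and> b \<noteq> 0}"
  note R = subring_closed[OF subring_hull[of X]]
  have QI: "a / b \<in> ?Q" if "a \<in> ring_gen X" "b \<in> ring_gen X" "b \<noteq> 0" for a b
    using that by blast
  have 1: "a \<in> ?Q" if "a \<in> ring_gen X" for a
    using QI[OF that R(2)] by simp
  have "- x \<in> ?Q" "inverse x \<in> ?Q" if xQ: "x \<in> ?Q" for x
  proof -
    obtain a b where x: "x = a / b" "a \<in> ring_gen X" "b \<in> ring_gen X" "b \<noteq> 0" using xQ by auto
    show "- x \<in> ?Q" using QI[OF R(5)[OF x(2)] x(3,4)] x(1) by simp
    show "inverse x \<in> ?Q"
    proof (cases "a = 0")
      case True then show ?thesis using 1[OF R(1)] x(1) by simp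
    next
      case False then show ?thesis using QI[OF x(3,2)] x(1) by simp
    qed
  qed
  moreover have "x + y \<in> ?Q" "x * y \<in> ?Q" if xQ: "x \<in> ?Q" and yQ: "y \<in> ?Q" for x y
  proof -
    obtain a b where x: "x = a / b" "a \<in> ring_gen X" "b \<in> ring_gen X" "b \<noteq> 0" using xQ by auto
    obtain c d where y: "y = c / d" "c \<in> ring_gen X" "d \<in> ring_gen X" "d \<noteq> 0" using yQ by auto
    have e: "x + y = (a * d + c * b) / (b * d)" "x * y = (a * c) / (b * d)"
      using x y by (auto simp: add_frac_eq)
    have bd: "b * d \<in> ring_gen X" "b * d \<noteq> 0" using x y R(4) by auto
    have "a * d + c * b \<in> ring_gen X" "a * c \<in> ring_gen X"
      using x y by (auto intro: R(3,4))
    then show "x + y \<in> ?Q" "x * y \<in> ?Q" unfolding e using QI bd by blast+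
  qed
  moreover have "0 \<in> ?Q" "1 \<in> ?Q" using 1 R(1,2) by blast+
  ultimately have "is_subfield ?Q"
    unfolding is_subfield_def is_subring_def by presburger
  moreover have "X \<subseteq> ?Q"
    using 1 hull_subset[of X is_subring] by blast
  ultimately have "field_gen X \<subseteq> ?Q" by (rule field_gen_subset[rotated])
  with assms show ?thesis by blast
qed

lemma ring_gen_subset_field_gen: "ring_gen X \<subseteq> field_gen X"
  by (rule ring_gen_subset[OF hull_subset subfield_subring[OF subfield_hull]])

lemma field_gen_insert_absorb: "field_gen (field_gen X \<union> Y) = field_gen (X \<union> Y)"
proof
  have "field_gen X \<subseteq> field_gen (X \<union> Y)" by (rule hull_mono) auto
  moreover have "Y \<subseteq> field_gen (X \<union> Y)" using hull_subset[of "X \<union> Y" is_subfield] by auto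
  ultimately show "field_gen (field_gen X \<union> Y) \<subseteq> field_gen (X \<union> Y)"
    by (intro field_gen_subset subfield_hull) auto
  show "field_gen (X \<union> Y) \<subseteq> field_gen (field_gen X \<union> Y)"
    by (rule hull_mono) (auto simp: field_gen_inc)
qed

lemma field_gen_subfield: "is_subfield K \<Longrightarrow> field_gen K = K"
  by (rule hull_same)

lemma polys_over_coeff: "p \<in> polys_over K \<Longrightarrow> coeff p i \<in> K"
  by (simp add: polys_over_def)

lemma polys_over_0: "is_subring K \<Longrightarrow> 0 \<in> polys_over K"
  by (simp add: polys_over_def subring_0)

lemma polys_over_pCons: "is_subring K \<Longrightarrow> c \<in> K \<Longrightarrow> p \<in> polys_over K \<Longrightarrow> pCons c p \<in> polys_over K"
  by (auto simp: polys_over_def coeff_pCons split: nat.splits)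

lemma polys_over_pConsD: "pCons c p \<in> polys_over K \<Longrightarrow> c \<in> K \<and> p \<in> polys_over K"
  using polys_over_coeff[of "pCons c p" K 0] polys_over_coeff[of "pCons c p" K "Suc i" for i]
  by (auto simp: polys_over_def)

lemma polys_over_1: "is_subring K \<Longrightarrow> 1 \<in> polys_over K"
  by (auto simp: polys_over_def subring_0 subring_1 coeff_1)

lemma polys_over_monom: "is_subring K \<Longrightarrow> c \<in> K \<Longrightarrow> monom c n \<in> polys_over K"
  by (auto simp: polys_over_def subring_0)

lemma polys_over_add: "is_subring K \<Longrightarrow> p \<in> polys_over K \<Longrightarrow> q \<in> polys_over K \<Longrightarrow> p + q \<in> polys_over K"
  by (auto simp: polys_over_def subring_add)

lemma polys_over_minus: "is_subring K \<Longrightarrow> p \<in> polys_over K \<Longrightarrow> - p \<in> polys_over K"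
  by (auto simp: polys_over_def subring_minus)

lemma polys_over_diff: "is_subring K \<Longrightarrow> p \<in> polys_over K \<Longrightarrow> q \<in> polys_over K \<Longrightarrow> p - q \<in> polys_over K"
  by (auto simp: polys_over_def subring_diff)

lemma polys_over_smult: "is_subring K \<Longrightarrow> c \<in> K \<Longrightarrow> p \<in> polys_over K \<Longrightarrow> smult c p \<in> polys_over K"
  by (auto simp: polys_over_def subring_mult)

lemma polys_over_mult: "is_subring K \<Longrightarrow> p \<in> polys_over K \<Longrightarrow> q \<in> polys_over K \<Longrightarrow> p * q \<in> polys_over K"
  unfolding polys_over_def by (auto simp: coeff_mult intro!: subring_sum subring_mult)

lemma polys_over_pderiv: "is_subring K \<Longrightarrow> p \<in> polys_over K \<Longrightarrow> pderiv p \<in> polys_over K"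
  unfolding polys_over_def by (auto simp: coeff_pderiv simp del: of_nat_Suc intro!: subring_mult subring_of_nat)

lemma polys_over_const: "is_subring K \<Longrightarrow> c \<in> K \<Longrightarrow> [:c:] \<in> polys_over K"
  by (auto intro: polys_over_pCons polys_over_0)

lemma polys_over_mono: "K \<subseteq> L \<Longrightarrow> polys_over K \<subseteq> polys_over L"
  by (auto simp: polys_over_def)

lemma poly_closed: "is_subring K \<Longrightarrow> p \<in> polys_over K \<Longrightarrow> x \<in> K \<Longrightarrow> poly p x \<in> K"
  by (induction p) (auto dest!: polys_over_pConsD intro: subring_closed)

lemma polys_over_pcompose:
  assumes "is_subring K" "p \<in> polys_over K" "q \<in> polys_over K" shows "p \<circ>\<^sub>p q \<in> polys_over K"
  using assms(2)
proof (induction p)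
  case (pCons a p)
  then have "a \<in> K" "p \<circ>\<^sub>p q \<in> polys_over K" by (auto dest: polys_over_pConsD)
  then have "[:a:] + q * (p \<circ>\<^sub>p q) \<in> polys_over K"
    by (intro polys_over_add polys_over_mult polys_over_const assms)
  then show ?case by (simp add: pcompose_pCons)
qed (simp add: polys_over_0 assms)

lemma ring_gen_adjoin:
  assumes "is_subring M"
  shows "ring_gen (M \<union> {x}) = {poly p x |p. p \<in> polys_over M}" (is "_ = ?R")
proof
  have "is_subring ?R"
    unfolding is_subring_def
  proof (intro conjI ballI)
    have I: "poly p x \<in> ?R" if "p \<in> polys_over M" for p using that by blast
    show "0 \<in> ?R" using I[OF polys_over_0[OF assms]] by simp
    show "1 \<in> ?R" using I[OF polys_over_1[OF assms]] by simp
    fix a assume "a \<in> ?R" then obtain p where p: "a = poly p x" "p \<in> polys_over M" by auto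
    have "- a = poly (- p) x" using p by simp
    then show "- a \<in> ?R" using polys_over_minus[OF assms p(2)] by blast
    fix b assume "b \<in> ?R" then obtain q where q: "b = poly q x" "q \<in> polys_over M" by auto
    have "a + b = poly (p + q) x" "a * b = poly (p * q) x" using p q by simp_all
    then show "a + b \<in> ?R" "a * b \<in> ?R"
      using polys_over_add[OF assms p(2) q(2)] polys_over_mult[OF assms p(2) q(2)] by blast+
  qed
  moreover have "M \<union> {x} \<subseteq> ?R"
  proof -
    have "m \<in> ?R" if "m \<in> M" for m
      using polys_over_const[OF assms that] by (force intro!: exI[of _ "[:m:]"])
    moreover have "x \<in> ?R"
      using polys_over_pCons[OF assms subring_0[OF assms] polys_over_1[OF assms]]
      by (force intro!: exI[of _ "[:0,1:]"] simp: one_pCons)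
    ultimately show ?thesis by blast
  qed
  ultimately show "ring_gen (M \<union> {x}) \<subseteq> ?R" by (rule ring_gen_subset[rotated])
  show "?R \<subseteq> ring_gen (M \<union> {x})"
    using poly_closed[OF subring_hull, of _ "M \<union> {x}" x] hull_subset[of "M \<union> {x}" is_subring]
      polys_over_mono[of M "ring_gen (M \<union> {x})"] by blast
qed

lemma field_gen_adjoin:
  assumes "is_subring M" "z \<in> field_gen (M \<union> {x})"
  obtains p q where "p \<in> polys_over M" "q \<in> polys_over M" "poly q x \<noteq> 0" "z = poly p x / poly q x"
proof -
  obtain a b where ab: "a \<in> ring_gen (M \<union> {x})" "b \<in> ring_gen (M \<union> {x})" "b \<noteq> 0" "z = a / b"
    using ring_gen_frac[OF assms(2)] by auto
  obtain p where p: "p \<in> polys_over M" "a = poly p x"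
    using ab(1) unfolding ring_gen_adjoin[OF assms(1)] by auto
  obtain q where q: "q \<in> polys_over M" "b = poly q x"
    using ab(2) unfolding ring_gen_adjoin[OF assms(1)] by auto
  show ?thesis using that[of p q] p q ab by simp
qed

section \<open>Linear dependence and algebraic elements over a subfield\<close>

lemma linear_system_nontrivial:
  fixes c :: "'j \<Rightarrow> 'i \<Rightarrow> 'a::field"
  assumes K: "is_subfield K" and "finite I" "finite J" "card I < card J"
    and "\<And>j i. j \<in> J \<Longrightarrow> i \<in> I \<Longrightarrow> c j i \<in> K"
  shows "\<exists>d. (\<forall>j. d j \<in> K) \<and> (\<exists>j\<in>J. d j \<noteq> 0) \<and> (\<forall>i\<in>I. (\<Sum>j\<in>J. d j * c j i) = 0)"
  using assms(2-)
proof (induction I arbitrary: J c rule: finite_induct)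
  case empty
  then have "J \<noteq> {}" by auto
  then show ?case by (intro exI[of _ "\<lambda>_. 1"]) (auto simp: subfield_closed[OF K])
next
  case (insert b I)
  show ?case
  proof (cases "\<forall>j\<in>J. c j b = 0")
    case True
    have "card I < card J" using insert by simp
    from insert.IH[OF insert.prems(1) this, of c] insert.prems(3)
    obtain d where d: "\<forall>j. d j \<in> K" "\<exists>j\<in>J. d j \<noteq> 0" "\<forall>i\<in>I. (\<Sum>j\<in>J. d j * c j i) = 0" by auto
    then show ?thesis using True by (intro exI[of _ d]) auto
  next
    case False
    then obtain p where p: "p \<in> J" "c p b \<noteq> 0" by auto
    \<comment> \<open>Gaussian elimination: equation \<open>b\<close> removes the unknown at the
      pivot \<open>p\<close> from the remaining equations.\<close>
    define c' where "c' j i = c j i - c j b / c p b * c p i" for j i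
    have "\<exists>d. (\<forall>j. d j \<in> K) \<and> (\<exists>j\<in>J-{p}. d j \<noteq> 0) \<and> (\<forall>i\<in>I. (\<Sum>j\<in>J-{p}. d j * c' j i) = 0)"
    proof (rule insert.IH)
      show "finite (J - {p})" using insert by auto
      show "card I < card (J - {p})" using insert p by auto
      show "c' j i \<in> K" if "j \<in> J - {p}" "i \<in> I" for j i
        unfolding c'_def using that insert.prems(3) p
        by (intro subfield_diff[OF K] subfield_mult[OF K] subfield_divide[OF K]) auto
    qed
    then obtain d where d: "\<forall>j. d j \<in> K" "\<exists>j\<in>J-{p}. d j \<noteq> 0"
      "\<forall>i\<in>I. (\<Sum>j\<in>J-{p}. d j * c' j i) = 0" by auto
    \<comment> \<open>The value of the pivot unknown that equation \<open>b\<close> forces.\<close>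
    define e where "e = - (\<Sum>j\<in>J-{p}. d j * (c j b / c p b))"
    have eK: "e \<in> K" unfolding e_def using d insert.prems(3) p
      by (intro subfield_minus[OF K] subfield_sum[OF K] subfield_mult[OF K] subfield_divide[OF K]) auto
    have split: "(\<Sum>j\<in>J. (d(p := e)) j * c j i) = e * c p i + (\<Sum>j\<in>J-{p}. d j * c j i)" for i
    proof -
      have "(\<Sum>j\<in>J-{p}. (d(p := e)) j * c j i) = (\<Sum>j\<in>J-{p}. d j * c j i)"
        by (rule sum.cong) auto
      then show ?thesis using sum.remove[OF insert.prems(1) p(1), of "\<lambda>j. (d(p := e)) j * c j i"]
        by simp
    qed
    have val: "e * c p i + (\<Sum>j\<in>J-{p}. d j * c j i) = (\<Sum>j\<in>J-{p}. d j * c' j i)" for i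
      unfolding e_def c'_def by (simp add: algebra_simps sum_subtractf sum_distrib_left sum_distrib_right)
    have "c' j b = 0" for j using p unfolding c'_def by simp
    then have "\<forall>i\<in>insert b I. (\<Sum>j\<in>J. (d(p := e)) j * c j i) = 0"
      unfolding split val using d(3) by simp
    then show ?thesis using d eK by (intro exI[of _ "d(p := e)"]) auto
  qed
qed

text \<open>The sum runs over \<open>B\<close> itself, so the notion is meaningful for finite
  \<open>B\<close>. The coefficient function is total with all values in \<open>K\<close>, which
  spares side conditions when spans are combined.\<close>

definition lspan :: "'a::field set \<Rightarrow> 'a set \<Rightarrow> 'a set" where
  "lspan K B = {(\<Sum>b\<in>B. c b * b) |c. \<forall>b. c b \<in> K}"

lemma lspan_0: "is_subfield K \<Longrightarrow> 0 \<in> lspan K B"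
  unfolding lspan_def by (auto intro!: exI[of _ "\<lambda>_. 0"] simp: subfield_0)

lemma lspan_add:
  assumes "is_subfield K" "x \<in> lspan K B" "y \<in> lspan K B" shows "x + y \<in> lspan K B"
proof -
  obtain c d where "x = (\<Sum>b\<in>B. c b * b)" "\<forall>b. c b \<in> K" "y = (\<Sum>b\<in>B. d b * b)" "\<forall>b. d b \<in> K"
    using assms unfolding lspan_def by auto
  then show ?thesis unfolding lspan_def using assms(1)
    by (auto intro!: exI[of _ "\<lambda>b. c b + d b"] simp: algebra_simps sum.distrib subfield_add)
qed

lemma lspan_scale:
  assumes "is_subfield K" "x \<in> lspan K B" "a \<in> K" shows "a * x \<in> lspan K B"
proof -
  obtain c where "x = (\<Sum>b\<in>B. c b * b)" "\<forall>b. c b \<in> K" using assms unfolding lspan_def by auto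
  then show ?thesis unfolding lspan_def using assms
    by (auto intro!: exI[of _ "\<lambda>b. a * c b"] simp: sum_distrib_left subfield_mult mult_ac)
qed

lemma lspan_sum: "is_subfield K \<Longrightarrow> (\<And>i. i \<in> I \<Longrightarrow> f i \<in> lspan K B) \<Longrightarrow> sum f I \<in> lspan K B"
  by (induction I rule: infinite_finite_induct) (auto intro: lspan_0 lspan_add)

lemma lspan_base:
  assumes "is_subfield K" "finite B" "b \<in> B" shows "b \<in> lspan K B"
proof -
  have "(\<Sum>x\<in>B. (if x = b then 1 else 0) * x) = (\<Sum>x\<in>B. if x = b then x else 0)"
    by (rule sum.cong) auto
  then have "b = (\<Sum>x\<in>B. (if x = b then 1 else 0) * x)" using assms(2,3) by simp
  then show ?thesis unfolding lspan_def
    by (auto intro!: exI[of _ "\<lambda>x. if x = b then 1 else 0"] subfield_closed[OF assms(1)])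
qed

lemma lspan_mult:
  assumes K: "is_subfield K" and "finite A" "finite B" "x \<in> lspan K A" "y \<in> lspan K B"
  shows "x * y \<in> lspan K ((\<lambda>(a, b). a * b) ` (A \<times> B))"
proof -
  obtain c d where cd: "x = (\<Sum>b\<in>A. c b * b)" "\<forall>b. c b \<in> K" "y = (\<Sum>b\<in>B. d b * b)" "\<forall>b. d b \<in> K"
    using assms unfolding lspan_def by auto
  have "x * y = (\<Sum>a\<in>A. \<Sum>b\<in>B. (c a * d b) * (a * b))"
    unfolding cd sum_product by (simp add: mult_ac)
  also have "\<dots> \<in> lspan K ((\<lambda>(a, b). a * b) ` (A \<times> B))"
  proof (rule lspan_sum[OF K], rule lspan_sum[OF K], rule lspan_scale[OF K])
    fix a b assume "a \<in> A" "b \<in> B"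
    then show "a * b \<in> lspan K ((\<lambda>(a, b). a * b) ` (A \<times> B))"
      using assms by (intro lspan_base[OF K]) auto
    show "c a * d b \<in> K" using cd by (auto intro: subfield_mult[OF K])
  qed
  finally show ?thesis .
qed

text \<open>The first \<open>card B + 1\<close> powers lie in the span of \<open>card B\<close>
  elements, so they satisfy a nontrivial linear relation, which is the polynomial wanted. With this
  criterion, closure under sums and products needs no resultants.\<close>

lemma algebraic_of_powers:
  assumes K: "is_subfield K" and B: "finite B" and p: "\<And>n. z ^ n \<in> lspan K B"
  shows "algebraic_over K z"
proof -
  have "\<forall>n. \<exists>c. z ^ n = (\<Sum>b\<in>B. c b * b) \<and> (\<forall>b. c b \<in> K)" using p unfolding lspan_def by auto
  then obtain c where c: "\<And>n. z ^ n = (\<Sum>b\<in>B. c n b * b)" "\<And>n b. c n b \<in> K" by metis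
  obtain d where d: "\<forall>j. d j \<in> K" "\<exists>j\<in>{..card B}. d j \<noteq> 0"
    "\<forall>i\<in>B. (\<Sum>j\<in>{..card B}. d j * c j i) = 0"
    using linear_system_nontrivial[OF K B, of "{..card B}" c] c by auto
  define P where "P = (\<Sum>j\<in>{..card B}. monom (d j) j)"
  have cf: "coeff P j = (if j \<le> card B then d j else 0)" for j
    unfolding P_def by (simp add: coeff_sum if_distrib cong: if_cong)
  have "poly P z = (\<Sum>j\<in>{..card B}. d j * z ^ j)" unfolding P_def by (simp add: poly_sum poly_monom)
  also have "\<dots> = (\<Sum>j\<in>{..card B}. \<Sum>b\<in>B. (d j * c j b) * b)"
    by (subst c(1)) (simp add: sum_distrib_left mult_ac)
  also have "\<dots> = (\<Sum>b\<in>B. (\<Sum>j\<in>{..card B}. d j * c j b) * b)"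
    by (subst sum.swap) (simp add: sum_distrib_right)
  also have "\<dots> = 0" using d(3) by simp
  finally have "poly P z = 0" .
  moreover have "P \<in> polys_over K" using d(1) by (auto simp: polys_over_def cf subfield_0[OF K])
  moreover have "P \<noteq> 0" using d(2) cf by (metis atMost_iff coeff_0)
  ultimately show ?thesis unfolding algebraic_over_def by blast
qed

lemma powers_of_algebraic:
  assumes K: "is_subfield K" and a: "algebraic_over K x"
  obtains B where "finite B" "\<And>n. x ^ n \<in> lspan K B"
proof -
  obtain p where p: "p \<in> polys_over K" "p \<noteq> 0" "poly p x = 0" using a unfolding algebraic_over_def by auto
  define n where "n = degree p"
  have lc: "lead_coeff p \<noteq> 0" "lead_coeff p \<in> K" using p by (auto simp: polys_over_coeff)
  define B where "B = (\<lambda>i. x ^ i) ` {..<n}"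
  have fB: "finite B" unfolding B_def by auto
  have lt: "x ^ i \<in> lspan K B" if "i < n" for i
    using that by (intro lspan_base[OF K fB]) (auto simp: B_def)
  have "0 = (\<Sum>i<n. coeff p i * x ^ i) + lead_coeff p * x ^ n"
    using p(3) unfolding poly_altdef n_def by (simp add: lessThan_Suc_atMost[symmetric])
  then have "lead_coeff p * x ^ n = - (\<Sum>i<n. coeff p i * x ^ i)"
    by (metis add.commute eq_neg_iff_add_eq_0)
  then have "x ^ n = (- inverse (lead_coeff p)) * (\<Sum>i<n. coeff p i * x ^ i)"
    using lc by (simp add: field_simps)
  also have "\<dots> \<in> lspan K B"
    using lt lc p by (intro lspan_scale[OF K] lspan_sum[OF K] subfield_minus[OF K] subfield_inverse[OF K])
      (auto simp: polys_over_coeff)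
  finally have xn: "x ^ n \<in> lspan K B" .
  have le: "x ^ i \<in> lspan K B" if "i \<le> n" for i
    using that lt xn by (cases "i = n") auto
  have "x ^ m \<in> lspan K B" for m
  proof (induction m)
    case 0 show ?case using le[of 0] by simp
  next
    case (Suc m)
    then obtain c where c: "x ^ m = (\<Sum>b\<in>B. c b * b)" "\<forall>b. c b \<in> K" unfolding lspan_def by auto
    have "x ^ Suc m = (\<Sum>b\<in>B. c b * (x * b))" by (simp add: c(1) sum_distrib_left mult_ac)
    also have "\<dots> \<in> lspan K B"
    proof (rule lspan_sum[OF K], rule lspan_scale[OF K])
      fix b assume "b \<in> B"
      then obtain i where "i < n" "b = x ^ i" by (auto simp: B_def)
      then show "x * b \<in> lspan K B" using le[of "Suc i"] by simp
      show "c b \<in> K" using c by simp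
    qed
    finally show ?case .
  qed
  with fB show ?thesis using that by blast
qed

lemma algebraic_over_mono: "algebraic_over K x \<Longrightarrow> K \<subseteq> L \<Longrightarrow> algebraic_over L x"
  unfolding algebraic_over_def using polys_over_mono by blast

lemma algebraic_over_elem: "is_subfield K \<Longrightarrow> x \<in> K \<Longrightarrow> algebraic_over K x"
  unfolding algebraic_over_def
  by (intro bexI[of _ "[:- x, 1:]"]) (auto intro!: polys_over_pCons polys_over_0 subfield_subring subfield_closed)

text \<open>The powers of a sum or a product stay in the span of the pairwise products of two finite
  spanning sets; for an inverse the reciprocal polynomial vanishes.\<close>

lemma subfield_algebraic:
  assumes K: "is_subfield K" shows "is_subfield {x. algebraic_over K x}"
proof -
  have m: "algebraic_over K (x * y)" "algebraic_over K (x + y)"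
    if x: "algebraic_over K x" and y: "algebraic_over K y" for x y
  proof -
    obtain A where A: "finite A" "\<And>n. x ^ n \<in> lspan K A" by (rule powers_of_algebraic[OF K x]) blast
    obtain B where B: "finite B" "\<And>n. y ^ n \<in> lspan K B" by (rule powers_of_algebraic[OF K y]) blast
    let ?C = "(\<lambda>(a, b). a * b) ` (A \<times> B)"
    have fC: "finite ?C" using A B by auto
    have xy: "x ^ i * y ^ j \<in> lspan K ?C" for i j using lspan_mult[OF K A(1) B(1) A(2) B(2)] .
    show "algebraic_over K (x * y)"
      using xy by (intro algebraic_of_powers[OF K fC]) (simp add: power_mult_distrib)
    show "algebraic_over K (x + y)"
    proof (rule algebraic_of_powers[OF K fC])
      fix n
      have "(x + y) ^ n = (\<Sum>k\<le>n. of_nat (n choose k) * (x ^ k * y ^ (n - k)))"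
        by (simp add: binomial_ring mult.assoc)
      also have "\<dots> \<in> lspan K ?C"
        by (rule lspan_sum[OF K], rule lspan_scale[OF K xy subfield_of_nat[OF K]])
      finally show "(x + y) ^ n \<in> lspan K ?C" .
    qed
  qed
  have i: "algebraic_over K (inverse x)" if x: "algebraic_over K x" for x
  proof (cases "x = 0")
    case True then show ?thesis using x by simp
  next
    case False
    obtain p where p: "p \<in> polys_over K" "p \<noteq> 0" "poly p x = 0" using x unfolding algebraic_over_def by auto
    have "poly (reflect_poly p) (inverse x) = 0"
      using False p by (simp add: poly_reflect_poly_nz)
    moreover have "reflect_poly p \<in> polys_over K"
      using p K by (auto simp: polys_over_def coeff_reflect_poly subfield_0)
    ultimately show ?thesis using p(2) unfolding algebraic_over_def
      by (metis reflect_poly_0 coeff_0_reflect_poly leading_coeff_0_iff coeff_0)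
  qed
  note e = algebraic_over_elem[OF K]
  have n: "algebraic_over K (- x)" if "algebraic_over K x" for x
    using m(1)[OF e[OF subfield_minus[OF K subfield_1[OF K]]] that] by simp
  show ?thesis
    unfolding is_subfield_def is_subring_def
    using m i n e[OF subfield_0[OF K]] e[OF subfield_1[OF K]] by simp
qed

lemma algebraic_of_power:
  assumes K: "is_subfield K" and "algebraic_over K (x ^ n)" "n > 0" shows "algebraic_over K x"
proof -
  obtain p where p: "p \<in> polys_over K" "p \<noteq> 0" "poly p (x ^ n) = 0"
    using assms unfolding algebraic_over_def by auto
  let ?q = "p \<circ>\<^sub>p monom 1 n"
  have "poly ?q x = 0" using p by (simp add: poly_pcompose poly_monom)
  moreover have "?q \<in> polys_over K"
    using p K by (intro polys_over_pcompose polys_over_monom subfield_subring subfield_1)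
  moreover have "?q \<noteq> 0"
    using p(2) assms(3) by (simp add: pcompose_eq_0_iff degree_monom_eq)
  ultimately show ?thesis unfolding algebraic_over_def by blast
qed

lemma clear_denominators:
  assumes "p \<in> polys_over (field_gen X)"
  shows "\<exists>d\<in>ring_gen X. d \<noteq> 0 \<and> smult d p \<in> polys_over (ring_gen X)"
  using assms
proof (induction p)
  case 0
  then show ?case by (intro bexI[of _ 1]) (auto intro: polys_over_0 subring_1 subring_hull)
next
  case (pCons c p)
  then have "c \<in> field_gen X" "p \<in> polys_over (field_gen X)" by (auto dest: polys_over_pConsD)
  obtain a b where ab: "a \<in> ring_gen X" "b \<in> ring_gen X" "b \<noteq> 0" "c = a / b"
    using ring_gen_frac[OF \<open>c \<in> field_gen X\<close>] by auto
  obtain d where d: "d \<in> ring_gen X" "d \<noteq> 0" "smult d p \<in> polys_over (ring_gen X)"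
    using pCons.IH[OF \<open>p \<in> _\<close>] by auto
  have "smult (b * d) (pCons c p) = pCons (a * d) (smult b (smult d p))"
    using ab by simp
  also have "\<dots> \<in> polys_over (ring_gen X)"
    by (rule polys_over_pCons[OF subring_hull subring_mult[OF subring_hull ab(1) d(1)]
          polys_over_smult[OF subring_hull ab(2) d(3)]])
  finally have f: "smult (b * d) (pCons c p) \<in> polys_over (ring_gen X)" .
  have "b * d \<in> ring_gen X" "b * d \<noteq> 0" using ab d by (auto intro: subring_mult[OF subring_hull])
  with f show ?case by blast
qed

text \<open>Steinitz exchange: once denominators are cleared, the equation of \<open>x\<close> over
  M(y) is a polynomial relation between \<open>x\<close> and \<open>y\<close> over \<open>M\<close>,
  which may equally be read as an equation for \<open>y\<close>.\<close>

lemma algebraic_exchange: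
  assumes M: "is_subfield M" and x: "\<not> algebraic_over M x"
    and xy: "algebraic_over (field_gen (M \<union> {y})) x"
  shows "algebraic_over (field_gen (M \<union> {x})) y"
proof -
  note MR = subfield_subring[OF M]
  obtain p where p: "p \<in> polys_over (field_gen (M \<union> {y}))" "p \<noteq> 0" "poly p x = 0"
    using xy unfolding algebraic_over_def by auto
  obtain d where d: "d \<noteq> 0" "smult d p \<in> polys_over (ring_gen (M \<union> {y}))"
    using clear_denominators[OF p(1)] by auto
  define P where "P = smult d p"
  have P: "P \<noteq> 0" "poly P x = 0" using p d unfolding P_def by auto
  have "\<forall>i. \<exists>r. r \<in> polys_over M \<and> coeff P i = poly r y"
    using d(2) unfolding P_def ring_gen_adjoin[OF MR] polys_over_def by auto
  then obtain r where r: "\<And>i. r i \<in> polys_over M" "\<And>i. coeff P i = poly (r i) y" by metis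
  \<comment> \<open>The relation sorted by powers of \<open>y\<close>; its coefficients are
    polynomials in \<open>x\<close> over \<open>M\<close>.\<close>
  define Q where "Q = (\<Sum>i\<le>degree P. smult (x ^ i) (r i))"
  have "poly Q y = poly P x" unfolding Q_def poly_sum poly_altdef[of P x] using r(2) by (simp add: mult.commute)
  then have Qy: "poly Q y = 0" using P by simp
  have xM: "x \<in> field_gen (M \<union> {x})" "M \<subseteq> field_gen (M \<union> {x})"
    using hull_subset[of "M \<union> {x}" is_subfield] by auto
  have cQ: "coeff Q l = poly (\<Sum>i\<le>degree P. monom (coeff (r i) l) i) x" for l
    unfolding Q_def by (simp add: coeff_sum poly_sum poly_monom mult.commute)
  have "coeff Q l \<in> field_gen (M \<union> {x})" for l
  proof -
    have "coeff (r i) l \<in> field_gen (M \<union> {x})" for i using r(1) xM by (auto simp: polys_over_def)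
    then show ?thesis unfolding Q_def coeff_sum coeff_smult using xM
      by (intro subfield_sum subfield_mult subfield_power subfield_hull)
  qed
  then have Q1: "Q \<in> polys_over (field_gen (M \<union> {x}))" by (simp add: polys_over_def)
  \<comment> \<open>Transcendence of \<open>x\<close> over \<open>M\<close> keeps \<open>Q\<close>
    from vanishing: the coefficient at some power of \<open>y\<close> is a nonzero polynomial in
    \<open>x\<close>.\<close>
  have "r (degree P) \<noteq> 0" using r(2)[of "degree P"] P(1) by force
  then obtain l where l: "coeff (r (degree P)) l \<noteq> 0" using leading_coeff_0_iff by blast
  let ?S = "\<Sum>i\<le>degree P. monom (coeff (r i) l) i"
  have cS: "coeff ?S j = (if j \<le> degree P then coeff (r j) l else 0)" for j
    by (simp add: coeff_sum if_distrib cong: if_cong)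
  have "?S \<noteq> 0" using l cS[of "degree P"] by (metis coeff_0 order_refl)
  moreover have "?S \<in> polys_over M" using r(1) subfield_0[OF M] by (simp add: polys_over_def cS)
  ultimately have "coeff Q l \<noteq> 0" unfolding cQ using x unfolding algebraic_over_def by blast
  then show ?thesis unfolding algebraic_over_def using Q1 Qy by (intro bexI[of _ Q]) auto
qed

lemma transcendental_swap:
  assumes "is_subfield M" "\<not> algebraic_over M x" "\<not> algebraic_over (field_gen (M \<union> {x})) y"
  shows "\<not> algebraic_over (field_gen (M \<union> {y})) x"
  using algebraic_exchange assms by blast

text \<open>The tower gives transcendence over the earlier generators only. The later ones are moved
  below \<open>t i\<close> one at a time, by the exchange property.\<close>

lemma transcendental_over_others:
  fixes t :: "nat \<Rightarrow> 'a::field"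
  assumes "\<And>k. k \<in> {a+1..n} \<Longrightarrow> \<not> algebraic_over (field_gen (K \<union> t ` {a+1..<k})) (t k)"
    and "i \<in> {a+1..n}"
  shows "\<not> algebraic_over (field_gen (K \<union> t ` ({a+1..n} - {i}))) (t i)"
  using assms
proof (induction n)
  case 0 then show ?case by simp
next
  case (Suc n)
  show ?case
  proof (cases "i = Suc n")
    case True
    then have "{a+1..Suc n} - {i} = {a+1..<Suc n}" by auto
    then show ?thesis using Suc.prems True by metis
  next
    case False
    define M where "M = field_gen (K \<union> t ` ({a+1..n} - {i}))"
    have i: "i \<in> {a+1..n}" using False Suc.prems by auto
    have 1: "\<not> algebraic_over M (t i)" unfolding M_def using Suc.prems i by (intro Suc.IH) auto
    have "{a+1..n} - {i} \<union> {i} = {a+1..<Suc n}" using i by auto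
    then have "field_gen (M \<union> {t i}) = field_gen (K \<union> t ` {a+1..<Suc n})"
      unfolding M_def field_gen_insert_absorb by (metis Un_assoc image_Un image_insert image_empty)
    moreover have "Suc n \<in> {a+1..Suc n}" using i by auto
    ultimately have "\<not> algebraic_over (field_gen (M \<union> {t i})) (t (Suc n))"
      using Suc.prems(1) by metis
    with 1 have "\<not> algebraic_over (field_gen (M \<union> {t (Suc n)})) (t i)"
      by (rule transcendental_swap[rotated]) (simp add: M_def subfield_hull)
    moreover have "{a+1..n} - {i} \<union> {Suc n} = {a+1..Suc n} - {i}" using False i by auto
    then have "field_gen (M \<union> {t (Suc n)}) = field_gen (K \<union> t ` ({a+1..Suc n} - {i}))"
      unfolding M_def field_gen_insert_absorb by (metis Un_assoc image_Un image_insert image_empty)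
    ultimately show ?thesis by simp
  qed
qed

text \<open>The \<open>R\<close>-module spanned by the powers of \<open>t\<close> below the
  \<open>n\<close>-th is stable under multiplication by \<open>t\<close>, because the relation
  rewrites \<open>t ^ n\<close>.\<close>

lemma powers_of_integral:
  assumes R: "is_subring R" and c: "\<And>i. c i \<in> R" and n: "t ^ n = (\<Sum>i<n. c i * t ^ i)"
  shows "\<exists>r. (\<forall>i. r i \<in> R) \<and> t ^ m = (\<Sum>i<n. r i * t ^ i)"
proof (cases "n = 0")
  \<comment> \<open>For \<open>n = 0\<close> the hypothesis reads 1 = 0, so every equation
    holds.\<close>
  case True
  then have "t ^ m = 0" using n
    by (metis lessThan_0 mult_zero_right power_0 sum.empty zero_neq_one mult_1_right)
  then show ?thesis using True by (intro exI[of _ c]) (simp add: c)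
next
  case False
  then obtain n' where n': "n = Suc n'" by (cases n) auto
  show ?thesis
  proof (induction m)
    case 0
    have "t ^ 0 = (\<Sum>i<n. (if i = 0 then 1 else 0) * t ^ i)"
      unfolding n' by (simp only: sum.lessThan_Suc_shift) simp
    then show ?case by (intro exI[of _ "\<lambda>i. if i = 0 then 1 else 0"])
      (auto intro: subring_0[OF R] subring_1[OF R])
  next
    case (Suc m)
    then obtain r where r: "\<forall>i. r i \<in> R" "t ^ m = (\<Sum>i<n. r i * t ^ i)" by auto
    have "t ^ Suc m = (\<Sum>i<n. r i * t ^ Suc i)" by (simp add: r(2) sum_distrib_left mult_ac)
    also have "\<dots> = (\<Sum>i<n'. r i * t ^ Suc i) + r n' * t ^ n" by (simp add: n')
    also have "(\<Sum>i<n'. r i * t ^ Suc i) = (\<Sum>i<n. (if i = 0 then 0 else r (i - 1)) * t ^ i)"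
      unfolding n' by (subst sum.lessThan_Suc_shift) simp
    also have "r n' * t ^ n = (\<Sum>i<n. (r n' * c i) * t ^ i)"
      by (simp add: n sum_distrib_left mult_ac)
    also have "(\<Sum>i<n. (if i = 0 then 0 else r (i - 1)) * t ^ i) + (\<Sum>i<n. (r n' * c i) * t ^ i)
        = (\<Sum>i<n. ((if i = 0 then 0 else r (i - 1)) + r n' * c i) * t ^ i)"
      by (simp add: sum.distrib distrib_right)
    finally show ?case using r(1) c
      by (intro exI[of _ "\<lambda>i. (if i = 0 then 0 else r (i - 1)) + r n' * c i"])
        (auto intro!: subring_add[OF R] subring_mult[OF R] subring_0[OF R])
  qed
qed

lemma ring_gen_finite_span:
  assumes K: "is_subfield K" and "finite A" "\<And>a. a \<in> A \<Longrightarrow> algebraic_over K a"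
  shows "\<exists>B. finite B \<and> ring_gen (K \<union> A) \<subseteq> lspan K B"
  using assms(2,3)
proof (induction A rule: finite_induct)
  case empty
  have "x \<in> lspan K {1}" if "x \<in> K" for x
    using lspan_scale[OF K lspan_base[OF K, of "{1}" 1] that] by simp
  moreover have "ring_gen (K \<union> {}) = K" using hull_same[of is_subring K] subfield_subring[OF K] by simp
  ultimately show ?case by (metis finite.emptyI finite_insert subsetI)
next
  case (insert c A)
  then obtain B where B: "finite B" "ring_gen (K \<union> A) \<subseteq> lspan K B" by auto
  have ca: "algebraic_over K c" using insert by auto
  obtain B' where B': "finite B'" "\<And>n. c ^ n \<in> lspan K B'" by (rule powers_of_algebraic[OF K ca]) blast
  let ?C = "(\<lambda>(a, b). a * b) ` (B \<times> B')"
  have "x \<in> lspan K ?C" if x: "x \<in> ring_gen (K \<union> insert c A)" for x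
  proof -
    have "K \<union> insert c A \<subseteq> ring_gen (K \<union> A) \<union> {c}" using hull_subset[of "K \<union> A" is_subring] by auto
    then have "x \<in> ring_gen (ring_gen (K \<union> A) \<union> {c})" using x hull_mono by blast
    then obtain p where p: "x = poly p c" "p \<in> polys_over (ring_gen (K \<union> A))"
      unfolding ring_gen_adjoin[OF subring_hull] by auto
    show ?thesis unfolding p(1) poly_altdef using p(2) B B'
      by (intro lspan_sum[OF K] lspan_mult[OF K]) (auto simp: polys_over_def)
  qed
  moreover have "finite ?C" using B B' by auto
  ultimately show ?case by (intro exI[of _ ?C]) auto
qed

text \<open>Only the finitely many coefficients of the equation of \<open>t\<close> matter. The ring
  they generate is finite-dimensional over \<open>K\<close>, and \<open>t\<close> is integral over
  it, so all powers of \<open>t\<close> lie in one finite span.\<close>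

lemma algebraic_trans:
  assumes K: "is_subfield K" and t: "algebraic_over {x. algebraic_over K x} t"
  shows "algebraic_over K t"
proof -
  let ?N = "{x. algebraic_over K x}"
  have N: "is_subfield ?N" by (rule subfield_algebraic[OF K])
  obtain p where p: "p \<in> polys_over ?N" "p \<noteq> 0" "poly p t = 0" using t unfolding algebraic_over_def by auto
  define n where "n = degree p"
  define c where "c i = - (coeff p i / lead_coeff p)" for i
  have cN: "c i \<in> ?N" for i unfolding c_def
    using p(1) by (intro subfield_minus[OF N] subfield_divide[OF N]) (auto simp: polys_over_def)
  have lc: "lead_coeff p \<noteq> 0" using p by simp
  have "0 = (\<Sum>i<n. coeff p i * t ^ i) + lead_coeff p * t ^ n"
    using p(3) unfolding poly_altdef n_def by (simp add: lessThan_Suc_atMost[symmetric])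
  then have "lead_coeff p * t ^ n = - (\<Sum>i<n. coeff p i * t ^ i)"
    by (metis add.commute eq_neg_iff_add_eq_0)
  then have "t ^ n = - (\<Sum>i<n. coeff p i * t ^ i) / lead_coeff p"
    using lc by (metis nonzero_mult_div_cancel_left)
  also have "\<dots> = (\<Sum>i<n. c i * t ^ i)"
    unfolding c_def by (simp add: sum_divide_distrib sum_negf)
  finally have tn: "t ^ n = (\<Sum>i<n. c i * t ^ i)" .
  have "\<exists>B. finite B \<and> ring_gen (K \<union> c ` {..<n}) \<subseteq> lspan K B"
    using cN by (intro ring_gen_finite_span[OF K]) auto
  then obtain B where B: "finite B" "ring_gen (K \<union> c ` {..<n}) \<subseteq> lspan K B" by auto
  let ?R = "ring_gen (K \<union> c ` {..<n})"
  \<comment> \<open>Set to 0 from \<open>n\<close> on, because \<open>powers_of_integral\<close>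
    wants every value of the coefficient function in the ring.\<close>
  define c' where "c' i = (if i < n then c i else 0)" for i
  have c'R: "c' i \<in> ?R" for i unfolding c'_def
    using hull_subset[of "K \<union> c ` {..<n}" is_subring] subring_0[OF subring_hull] by auto
  have tn': "t ^ n = (\<Sum>i<n. c' i * t ^ i)" using tn by (simp add: c'_def)
  let ?P = "(\<lambda>i. t ^ i) ` {..<n}"
  show ?thesis
  proof (rule algebraic_of_powers[OF K])
    show "finite ((\<lambda>(a, b). a * b) ` (B \<times> ?P))" using B by auto
    fix m
    obtain r where r: "\<forall>i. r i \<in> ?R" "t ^ m = (\<Sum>i<n. r i * t ^ i)"
      using powers_of_integral[OF subring_hull c'R tn'] by blast
    show "t ^ m \<in> lspan K ((\<lambda>(a, b). a * b) ` (B \<times> ?P))"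
      unfolding r(2)
    proof (intro lspan_sum[OF K] lspan_mult[OF K])
      fix i assume "i \<in> {..<n}"
      then show "t ^ i \<in> lspan K ?P" by (intro lspan_base[OF K]) auto
    qed (use r(1) B in auto)
  qed
qed

section \<open>Algebraically closed subfields of the ambient field\<close>

definition alg_closed :: "'a::field set \<Rightarrow> bool" where
  "alg_closed k \<longleftrightarrow> is_subfield k \<and> (\<forall>p\<in>polys_over k. degree p > 0 \<longrightarrow> (\<exists>x\<in>k. poly p x = 0))"

lemma synthetic_div_closed:
  "is_subring k \<Longrightarrow> c \<in> k \<Longrightarrow> p \<in> polys_over k \<Longrightarrow> synthetic_div p c \<in> polys_over k"
  by (induction p) (auto dest!: polys_over_pConsD intro!: polys_over_pCons poly_closed polys_over_0)

lemma alg_closed_splits: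
  assumes "alg_closed k" "p \<in> polys_over k"
  shows "\<exists>c\<in>k. \<exists>rs. set rs \<subseteq> k \<and> p = smult c (\<Prod>r\<leftarrow>rs. [:- r, 1:])"
  using assms(2)
proof (induction "degree p" arbitrary: p rule: less_induct)
  case less
  have k: "is_subfield k" using assms(1) by (simp add: alg_closed_def)
  show ?case
  proof (cases "degree p = 0")
    case True
    then obtain c where "p = [:c:]" by (metis degree_eq_zeroE)
    then show ?thesis using less(2) by (intro bexI[of _ c] exI[of _ "[]"]) (auto dest: polys_over_pConsD)
  next
    case False
    then obtain x where x: "x \<in> k" "poly p x = 0" using assms(1) less(2) unfolding alg_closed_def by auto
    let ?q = "synthetic_div p x"
    have pq: "p = [:- x, 1:] * ?q" using synthetic_div_correct'[of x p] x by simp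
    have "degree ?q < degree p" using False by (simp add: degree_synthetic_div)
    moreover have "?q \<in> polys_over k" using synthetic_div_closed[OF subfield_subring[OF k] x(1) less(2)] .
    ultimately obtain c rs where "c \<in> k" "set rs \<subseteq> k" "?q = smult c (\<Prod>r\<leftarrow>rs. [:- r, 1:])"
      using less(1) by blast
    then show ?thesis using x
      by (intro bexI[of _ c] exI[of _ "x # rs"]) (subst pq, auto simp: mult_smult_right)
  qed
qed

lemma alg_closed_algebraic:
  assumes "alg_closed k" "algebraic_over k x" shows "x \<in> k"
proof -
  obtain p where p: "p \<in> polys_over k" "p \<noteq> 0" "poly p x = 0" using assms unfolding algebraic_over_def by auto
  obtain c rs where "set rs \<subseteq> k" "p = smult c (\<Prod>r\<leftarrow>rs. [:- r, 1:])"
    using alg_closed_splits[OF assms(1) p(1)] by auto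
  moreover from calculation have "c \<noteq> 0" "poly (\<Prod>r\<leftarrow>rs. [:- r, 1:]) x = 0" using p by auto
  moreover have "poly (\<Prod>r\<leftarrow>rs. [:- r, 1:]) x = 0 \<Longrightarrow> x \<in> set rs" by (induction rs) auto
  ultimately show ?thesis by auto
qed

section \<open>Derivations and discrete valuations\<close>

locale diff_field =
  fixes E :: "'a::field_char_0 set" and D :: "'a \<Rightarrow> 'a"
  assumes E: "is_subfield E" and deriv: "is_derivation_on E D"
begin

lemma D_in [intro]: "x \<in> E \<Longrightarrow> D x \<in> E"
  and D_add: "x \<in> E \<Longrightarrow> y \<in> E \<Longrightarrow> D (x + y) = D x + D y"
  and D_mult: "x \<in> E \<Longrightarrow> y \<in> E \<Longrightarrow> D (x * y) = D x * y + x * D y"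
  using deriv by (auto simp: is_derivation_on_def)

lemma D_0 [simp]: "D 0 = 0"
  using D_add[OF subfield_0[OF E] subfield_0[OF E]] by simp

lemma D_1 [simp]: "D 1 = 0"
  using D_mult[OF subfield_1[OF E] subfield_1[OF E]] by simp

lemma D_minus: "x \<in> E \<Longrightarrow> D (- x) = - D x"
  using D_add[of x "- x"] subfield_minus[OF E] by (simp add: add_eq_0_iff)

lemma D_diff: "x \<in> E \<Longrightarrow> y \<in> E \<Longrightarrow> D (x - y) = D x - D y"
  using D_add[of x "- y"] subfield_minus[OF E] D_minus by simp

lemma D_inverse:
  assumes "x \<in> E" shows "D (inverse x) = - D x / x\<^sup>2"
proof (cases "x = 0")
  case False
  have "D (x * inverse x) = 0" using False by simp
  then have "x * D (inverse x) = - D x * inverse x"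
    using D_mult[OF assms subfield_inverse[OF E assms]] by (simp add: eq_neg_iff_add_eq_0 add.commute)
  then have "D (inverse x) = - D x * inverse x * inverse x" using False by (simp add: field_simps)
  then show ?thesis by (simp add: power2_eq_square divide_inverse)
qed simp

lemma D_divide:
  assumes "x \<in> E" "y \<in> E" "y \<noteq> 0" shows "D (x / y) = (D x * y - x * D y) / y\<^sup>2"
proof -
  have "D (x / y) = D x * inverse y + x * (- D y / y\<^sup>2)"
    unfolding divide_inverse[of x y] using D_mult[OF assms(1) subfield_inverse[OF E assms(2)]] D_inverse[OF assms(2)]
    by simp
  then show ?thesis using assms(3) by (simp add: power2_eq_square divide_simps)
qed

lemma D_power: "x \<in> E \<Longrightarrow> D (x ^ n) = of_nat n * x ^ (n - 1) * D x"
proof (induction n)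
  case (Suc n)
  then show ?case
    by (cases n) (simp_all add: D_mult subfield_power[OF E] subfield_mult[OF E] algebra_simps)
qed simp

lemma D_sum: "(\<And>i. i \<in> I \<Longrightarrow> f i \<in> E) \<Longrightarrow> D (sum f I) = (\<Sum>i\<in>I. D (f i))"
  by (induction I rule: infinite_finite_induct) (auto simp: D_add subfield_sum[OF E])

lemma D_powi:
  assumes "x \<in> E" "x \<noteq> 0" shows "D (x powi n) = of_int n * x powi (n - 1) * D x"
proof (cases "n \<ge> 0")
  case True
  then obtain m where n: "n = int m" using nonneg_int_cases by blast
  show ?thesis
  proof (cases m)
    case (Suc m')
    have e: "int (Suc m') - 1 = int m'" by simp
    then show ?thesis using D_power[OF assms(1), of m] unfolding n Suc e by (simp del: of_nat_Suc power_Suc)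
  qed (simp add: n)
next
  case False
  define m where "m = nat (- n)"
  have n: "n = - int m" "m > 0" using False by (auto simp: m_def)
  have "D (x powi n) = D (inverse (x ^ m))" using n by (simp add: power_int_minus)
  also have "\<dots> = - (of_nat m * x ^ (m - 1) * D x) / (x ^ m)\<^sup>2"
    using D_inverse[OF subfield_power[OF E assms(1)]] D_power[OF assms(1)] by simp
  also have "\<dots> = of_int n * (x powi (int (m - 1)) / (x powi (int m))\<^sup>2) * D x"
    by (simp add: n power_int_of_nat)
  also have "x powi (int (m - 1)) / (x powi (int m))\<^sup>2 = x powi (n - 1)"
  proof -
    have "(x powi (int m))\<^sup>2 = x powi (int m + int m)"
      using assms(2) by (simp only: power2_eq_square power_int_add[of x] simp_thms)
    moreover have "n - 1 = int (m - 1) - (int m + int m)" using n by simp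
    ultimately show ?thesis using assms(2) power_int_diff[of x "int (m - 1)" "int m + int m"] by metis
  qed
  finally show ?thesis .
qed

lemma D_poly:
  assumes "p \<in> polys_over E" "x \<in> E"
  shows "D (poly p x) = poly (map_poly D p) x + poly (pderiv p) x * D x"
  using assms(1)
proof (induction p)
  case (pCons a p)
  then have a: "a \<in> E" "p \<in> polys_over E" by (auto dest: polys_over_pConsD)
  have px: "poly p x \<in> E" using poly_closed[OF subfield_subring[OF E] a(2) assms(2)] .
  have "D (poly (pCons a p) x) = D a + (D x * poly p x + x * D (poly p x))"
    using a px assms(2) by (simp add: D_add D_mult subfield_mult[OF E])
  then show ?case using pCons.IH[OF a(2)] pCons.hyps
    by (simp add: map_poly_pCons pderiv_pCons algebra_simps)
qed simp

lemma D_const_poly: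
  assumes "p \<in> polys_over E" "x \<in> E" "\<And>i. D (coeff p i) = 0"
  shows "D (poly p x) = poly (pderiv p) x * D x"
proof -
  have "map_poly D p = 0" using assms(3) by (intro poly_eqI) (simp add: coeff_map_poly)
  then show ?thesis using D_poly[OF assms(1,2)] by simp
qed

lemma subfield_constants: "is_subfield {x\<in>E. D x = 0}"
  unfolding is_subfield_def is_subring_def
  by (auto simp: subfield_closed[OF E] D_minus D_add D_mult D_inverse)

text \<open>The elements of the generated field whose derivative stays in it form a subfield, so
  stability has to be tested on generators only.\<close>

lemma stable_field_gen:
  assumes "X \<subseteq> E" "\<And>x. x \<in> X \<Longrightarrow> D x \<in> field_gen X" "z \<in> field_gen X"
  shows "D z \<in> field_gen X"
proof -
  have XE: "field_gen X \<subseteq> E" using field_gen_subset[OF assms(1) E] .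
  note c = subfield_closed[OF subfield_hull[of X]]
  have "x + y \<in> field_gen X \<and> D (x + y) \<in> field_gen X" "x * y \<in> field_gen X \<and> D (x * y) \<in> field_gen X"
    if xy: "x \<in> field_gen X" "D x \<in> field_gen X"  "y \<in> field_gen X" "D y \<in> field_gen X" for x y
  proof -
    have "x \<in> E" "y \<in> E" using xy XE by auto
    then have e: "D (x + y) = D x + D y" "D (x * y) = D x * y + x * D y" by (rule D_add, rule D_mult)
    show "x + y \<in> field_gen X \<and> D (x + y) \<in> field_gen X" "x * y \<in> field_gen X \<and> D (x * y) \<in> field_gen X"
      unfolding e using c(3)[OF xy(1,3)] c(3)[OF xy(2,4)] c(4)[OF xy(1,3)]
        c(3)[OF c(4)[OF xy(2,3)] c(4)[OF xy(1,4)]] by auto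
  qed
  moreover have "- x \<in> field_gen X \<and> D (- x) \<in> field_gen X" "inverse x \<in> field_gen X \<and> D (inverse x) \<in> field_gen X"
    if xy: "x \<in> field_gen X" "D x \<in> field_gen X" for x
  proof -
    have "x \<in> E" using xy XE by auto
    then have e: "D (- x) = - D x" "D (inverse x) = - D x / x\<^sup>2" by (rule D_minus, rule D_inverse)
    show "- x \<in> field_gen X \<and> D (- x) \<in> field_gen X" "inverse x \<in> field_gen X \<and> D (inverse x) \<in> field_gen X"
      unfolding e using c(5)[OF xy(1)] c(5)[OF xy(2)] c(8)[OF xy(1)] c(9)[OF c(5)[OF xy(2)] c(7)[OF xy(1)]] by auto
  qed
  ultimately have "is_subfield {z \<in> field_gen X. D z \<in> field_gen X}"
    unfolding is_subfield_def[of "{z \<in> field_gen X. D z \<in> field_gen X}"]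
      is_subring_def[of "{z \<in> field_gen X. D z \<in> field_gen X}"] using c(1,2) by simp
  moreover have "X \<subseteq> {z \<in> field_gen X. D z \<in> field_gen X}"
    using assms(2) field_gen_inc by auto
  ultimately show ?thesis using assms(3) field_gen_subset by blast
qed

end

section \<open>Discrete valuations and lower bounds for values\<close>

locale valued_field =
  fixes E :: "'a::field_char_0 set" and v :: "'a \<Rightarrow> int"
  assumes E_v: "is_subfield E" and dval: "is_discrete_valuation E v"
begin

text \<open>The value of 0 is infinity while the integer \<open>v 0\<close> is arbitrary; this
  predicate is the lower bound that stays correct at 0.\<close>

definition vge :: "int \<Rightarrow> 'a \<Rightarrow> bool" where "vge n x \<longleftrightarrow> x = 0 \<or> n \<le> v x"

lemma v_mult: "x \<in> E \<Longrightarrow> y \<in> E \<Longrightarrow> x \<noteq> 0 \<Longrightarrow> y \<noteq> 0 \<Longrightarrow> v (x * y) = v x + v y"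
  using dval by (auto simp: is_discrete_valuation_def)

lemma v_1 [simp]: "v 1 = 0"
  using v_mult[of 1 1] subfield_1[OF E_v] by simp

lemma v_minus_1 [simp]: "v (- 1) = 0"
  using v_mult[of "- 1" "- 1"] subfield_1[OF E_v] subfield_minus[OF E_v] by simp

lemma v_minus: "x \<in> E \<Longrightarrow> v (- x) = v x"
  using v_mult[of "- 1" x] subfield_1[OF E_v] subfield_minus[OF E_v] by (cases "x = 0") auto

lemma v_inverse: "x \<in> E \<Longrightarrow> x \<noteq> 0 \<Longrightarrow> v (inverse x) = - v x"
  using v_mult[of x "inverse x"] subfield_inverse[OF E_v] by simp

lemma v_divide: "x \<in> E \<Longrightarrow> y \<in> E \<Longrightarrow> x \<noteq> 0 \<Longrightarrow> y \<noteq> 0 \<Longrightarrow> v (x / y) = v x - v y"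
  using v_mult[of x "inverse y"] subfield_inverse[OF E_v] by (simp add: divide_inverse v_inverse)

lemma v_power: "x \<in> E \<Longrightarrow> x \<noteq> 0 \<Longrightarrow> v (x ^ n) = int n * v x"
  by (induction n) (simp_all add: v_mult subfield_power[OF E_v] algebra_simps)

lemma v_powi: "x \<in> E \<Longrightarrow> x \<noteq> 0 \<Longrightarrow> v (x powi n) = n * v x"
  by (simp add: power_int_def v_power v_inverse subfield_inverse[OF E_v])

lemma vge_0 [simp]: "vge n 0" by (simp add: vge_def)

lemma vge_add: "x \<in> E \<Longrightarrow> y \<in> E \<Longrightarrow> vge n x \<Longrightarrow> vge n y \<Longrightarrow> vge n (x + y)"
proof -
  assume a: "x \<in> E" "y \<in> E" "vge n x" "vge n y"
  have "min (v x) (v y) \<le> v (x + y)" if "x \<noteq> 0" "y \<noteq> 0" "x + y \<noteq> 0"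
    using dval a that unfolding is_discrete_valuation_def by blast
  then show "vge n (x + y)" using a(3,4) unfolding vge_def by fastforce
qed

lemma vge_minus: "x \<in> E \<Longrightarrow> vge n (- x) \<longleftrightarrow> vge n x"
  by (simp add: vge_def v_minus)

lemma vge_diff: "x \<in> E \<Longrightarrow> y \<in> E \<Longrightarrow> vge n x \<Longrightarrow> vge n y \<Longrightarrow> vge n (x - y)"
  using vge_add[of x "- y"] subfield_minus[OF E_v] vge_minus by simp

lemma vge_mult: "x \<in> E \<Longrightarrow> y \<in> E \<Longrightarrow> vge n x \<Longrightarrow> vge m y \<Longrightarrow> vge (n + m) (x * y)"
  unfolding vge_def using v_mult by fastforce

lemma vge_mono: "vge n x \<Longrightarrow> m \<le> n \<Longrightarrow> vge m x"
  by (auto simp: vge_def)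

lemma vge_mult_0: "x \<in> E \<Longrightarrow> y \<in> E \<Longrightarrow> vge 0 x \<Longrightarrow> vge n y \<Longrightarrow> vge n (x * y)"
  using vge_mult[of x y 0 n] by simp

lemma vge_power: "x \<in> E \<Longrightarrow> vge 0 x \<Longrightarrow> vge 0 (x ^ n)"
proof (induction n)
  case (Suc n)
  then show ?case using vge_mult[of x "x ^ n" 0 0] subfield_power[OF E_v] by simp
qed (simp add: vge_def)

lemma vge_sum: "(\<And>i. i \<in> I \<Longrightarrow> f i \<in> E \<and> vge n (f i)) \<Longrightarrow> vge n (sum f I)"
proof (induction I rule: infinite_finite_induct)
  case (insert i I)
  then show ?case using subfield_sum[OF E_v, of I f] vge_add[of "f i" "sum f I" n] by simp
qed auto

lemma vge_of_nat: "vge 0 (of_nat n)"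
  by (induction n) (auto intro!: vge_add subfield_1[OF E_v] subfield_of_nat[OF E_v] simp: vge_def[of 0 1])

lemma vge_of_int: "vge 0 (of_int n)"
  by (cases n rule: int_cases2) (simp_all add: vge_of_nat vge_minus subfield_of_nat[OF E_v])

lemma v_add_lt:
  assumes "x \<in> E" "y \<in> E" "x \<noteq> 0" "vge (v x + 1) y"
  shows "x + y \<noteq> 0" "v (x + y) = v x"
proof -
  show n: "x + y \<noteq> 0"
  proof
    assume "x + y = 0"
    then have "y = - x" by (simp add: add_eq_0_iff)
    then show False using assms v_minus[of x] by (simp add: vge_def)
  qed
  have "vge (v x) (x + y)" using assms vge_mono by (intro vge_add) (auto simp: vge_def)
  moreover have "v (x + y) \<le> v x"
  proof (rule ccontr)
    assume "\<not> ?thesis"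
    then have "vge (v x + 1) (x + y)" by (simp add: vge_def)
    from vge_diff[OF subfield_add[OF E_v assms(1,2)] assms(2) this assms(4)] assms(3)
    show False by (simp add: vge_def)
  qed
  ultimately show "v (x + y) = v x" using n by (auto simp: vge_def)
qed

lemma vge_divide: "x \<in> E \<Longrightarrow> y \<in> E \<Longrightarrow> y \<noteq> 0 \<Longrightarrow> vge n x \<Longrightarrow> vge (n - v y) (x / y)"
  using v_divide[of x y] by (cases "x = 0") (auto simp: vge_def)

lemma val_ring_iff: "x \<in> val_ring E v \<longleftrightarrow> x \<in> E \<and> vge 0 x"
  by (auto simp: val_ring_def vge_def)

lemma val_ideal_iff: "x \<in> val_ideal E v \<longleftrightarrow> x \<in> E \<and> vge 1 x"
  by (auto simp: val_ideal_def vge_def)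

lemma subfield_trivial:
  assumes "is_subring R" "R \<subseteq> E" "\<And>x. x \<in> R \<Longrightarrow> x \<noteq> 0 \<Longrightarrow> v x = 0" "R = ring_gen X" "c \<in> field_gen X" "c \<noteq> 0"
  shows "v c = 0"
proof -
  obtain a b where "a \<in> R" "b \<in> R" "b \<noteq> 0" "c = a / b" using ring_gen_frac[OF assms(5)] assms(4) by auto
  then show ?thesis using assms v_divide[of a b] by auto
qed

end

section \<open>Generalised eigenvectors of a derivation\<close>

context diff_field
begin

abbreviation consts_D :: "'a set" where "consts_D \<equiv> {x\<in>E. D x = 0}"

definition op :: "'a \<Rightarrow> 'a \<Rightarrow> 'a" where "op \<alpha> x = D x - \<alpha> * x"

definition gev :: "'a \<Rightarrow> 'a \<Rightarrow> bool" where "gev \<alpha> x \<longleftrightarrow> (\<exists>n. (op \<alpha> ^^ n) x = 0)"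

lemma op_in: "\<alpha> \<in> E \<Longrightarrow> x \<in> E \<Longrightarrow> op \<alpha> x \<in> E"
  by (simp add: op_def subfield_diff[OF E] subfield_mult[OF E] D_in)

lemma op_pow_in: "\<alpha> \<in> E \<Longrightarrow> x \<in> E \<Longrightarrow> (op \<alpha> ^^ n) x \<in> E"
  by (induction n) (auto simp: op_in)

lemma op_0 [simp]: "op \<alpha> 0 = 0"
  by (simp add: op_def)

lemma op_pow_0 [simp]: "(op \<alpha> ^^ n) 0 = 0"
  by (induction n) auto

lemma op_add: "x \<in> E \<Longrightarrow> y \<in> E \<Longrightarrow> op \<alpha> (x + y) = op \<alpha> x + op \<alpha> y"
  by (simp add: op_def D_add algebra_simps)

lemma op_pow_add: "\<alpha> \<in> E \<Longrightarrow> x \<in> E \<Longrightarrow> y \<in> E \<Longrightarrow> (op \<alpha> ^^ n) (x + y) = (op \<alpha> ^^ n) x + (op \<alpha> ^^ n) y"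
  by (induction n) (auto simp: op_add op_pow_in)

lemma op_pow_sum:
  assumes "\<alpha> \<in> E" "\<And>i. i \<in> I \<Longrightarrow> f i \<in> E"
  shows "(op \<alpha> ^^ n) (sum f I) = (\<Sum>i\<in>I. (op \<alpha> ^^ n) (f i))"
  using assms(2)
proof (induction I rule: infinite_finite_induct)
  case (insert i I)
  then show ?case using op_pow_add[OF assms(1), of "f i" "sum f I"] subfield_sum[OF E, of I f] by simp
qed auto

lemma op_scale: "c \<in> consts_D \<Longrightarrow> x \<in> E \<Longrightarrow> op \<alpha> (c * x) = c * op \<alpha> x"
  by (simp add: op_def D_mult algebra_simps)

lemma op_commute:
  assumes "\<alpha> \<in> consts_D" "\<beta> \<in> consts_D" "x \<in> E" shows "op \<alpha> (op \<beta> x) = op \<beta> (op \<alpha> x)"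
  using assms by (simp add: op_def D_diff D_mult D_in subfield_mult[OF E] algebra_simps)

lemma op_pow_commute:
  assumes "\<alpha> \<in> consts_D" "\<beta> \<in> consts_D" "x \<in> E"
  shows "(op \<alpha> ^^ n) (op \<beta> x) = op \<beta> ((op \<alpha> ^^ n) x)"
  using assms by (induction n) (auto simp: op_commute op_pow_in)

lemma gev_op: "\<alpha> \<in> consts_D \<Longrightarrow> \<beta> \<in> consts_D \<Longrightarrow> x \<in> E \<Longrightarrow> gev \<alpha> x \<Longrightarrow> gev \<alpha> (op \<beta> x)"
  unfolding gev_def
proof (elim exE)
  fix n assume a: "\<alpha> \<in> consts_D" "\<beta> \<in> consts_D" "x \<in> E" and n: "(op \<alpha> ^^ n) x = 0"
  have "(op \<alpha> ^^ n) (op \<beta> x) = 0" unfolding op_pow_commute[OF a] n by (rule op_0)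
  then show "\<exists>n. (op \<alpha> ^^ n) (op \<beta> x) = 0" by (rule exI)
qed

lemma gev_op_pow: "\<alpha> \<in> consts_D \<Longrightarrow> \<beta> \<in> consts_D \<Longrightarrow> x \<in> E \<Longrightarrow> gev \<alpha> x \<Longrightarrow> gev \<alpha> ((op \<beta> ^^ n) x)"
proof (induction n)
  case (Suc n)
  then have "gev \<alpha> (op \<beta> ((op \<beta> ^^ n) x))" by (intro gev_op op_pow_in) auto
  then show ?case by simp
qed simp

lemma op_pow_mono:
  assumes "(op \<alpha> ^^ n) x = 0" "n \<le> m" shows "(op \<alpha> ^^ m) x = 0"
proof -
  have "(op \<alpha> ^^ m) x = (op \<alpha> ^^ (m - n)) ((op \<alpha> ^^ n) x)"
    using assms(2) funpow_add[of "m - n" n "op \<alpha>"] by simp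
  then show ?thesis using assms by simp
qed

lemma gev_0 [simp]: "gev \<alpha> 0" by (simp add: gev_def)

lemma gev_add:
  assumes "\<alpha> \<in> E" "x \<in> E" "y \<in> E" "gev \<alpha> x" "gev \<alpha> y" shows "gev \<alpha> (x + y)"
proof -
  obtain n m where "(op \<alpha> ^^ n) x = 0" "(op \<alpha> ^^ m) y = 0" using assms by (auto simp: gev_def)
  then have "(op \<alpha> ^^ max n m) x = 0" "(op \<alpha> ^^ max n m) y = 0"
    using op_pow_mono max.cobounded1 max.cobounded2 by blast+
  then show ?thesis using op_pow_add[OF assms(1-3), of "max n m"] by (auto simp: gev_def intro!: exI[of _ "max n m"])
qed

lemma op_mult: "x \<in> E \<Longrightarrow> y \<in> E \<Longrightarrow> op (\<alpha> + \<beta>) (x * y) = op \<alpha> x * y + x * op \<beta> y"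
  by (simp add: op_def D_mult algebra_simps)

text \<open>By the Leibniz rule, applying \<open>op (\<alpha> + \<beta>)\<close> to a product lowers
  the nilpotency order of one factor in each summand; hence the induction on
  \<open>n + m\<close>.\<close>

lemma op_pow_mult:
  assumes "\<alpha> \<in> E" "\<beta> \<in> E" "x \<in> E" "y \<in> E" "(op \<alpha> ^^ n) x = 0" "(op \<beta> ^^ m) y = 0"
  shows "(op (\<alpha> + \<beta>) ^^ (n + m)) (x * y) = 0"
  using assms(3-)
proof (induction "n + m" arbitrary: n m x y)
  case 0 then show ?case by simp
next
  case (Suc N)
  have ab: "\<alpha> + \<beta> \<in> E" using assms by (simp add: subfield_add[OF E])
  show ?case
  proof (cases "n = 0 \<or> m = 0")
    case True then show ?thesis using Suc by auto
  next
    case False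
    then obtain n' m' where nm: "n = Suc n'" "m = Suc m'" by (meson not0_implies_Suc)
    have xy: "op \<alpha> x \<in> E" "op \<beta> y \<in> E" using op_in assms Suc by auto
    have 1: "(op (\<alpha> + \<beta>) ^^ N) (op \<alpha> x * y) = 0"
      using Suc.hyps(1)[of n' m "op \<alpha> x" y] Suc.hyps(2) Suc.prems xy nm by (auto simp: funpow_swap1)
    have 2: "(op (\<alpha> + \<beta>) ^^ N) (x * op \<beta> y) = 0"
      using Suc.hyps(1)[of n m' x "op \<beta> y"] Suc.hyps(2) Suc.prems xy nm by (auto simp: funpow_swap1)
    have "(op (\<alpha> + \<beta>) ^^ Suc N) (x * y) = (op (\<alpha> + \<beta>) ^^ N) (op \<alpha> x * y + x * op \<beta> y)"
      using op_mult[OF Suc.prems(1,2)] by (simp add: funpow_swap1)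
    also have "\<dots> = 0" using op_pow_add[OF ab, of "op \<alpha> x * y" "x * op \<beta> y" N] 1 2 xy Suc.prems
      by (simp add: subfield_mult[OF E])
    finally show ?thesis using Suc.hyps(2) by metis
  qed
qed

lemma gev_mult: "\<alpha> \<in> E \<Longrightarrow> \<beta> \<in> E \<Longrightarrow> x \<in> E \<Longrightarrow> y \<in> E \<Longrightarrow> gev \<alpha> x \<Longrightarrow> gev \<beta> y \<Longrightarrow> gev (\<alpha> + \<beta>) (x * y)"
  unfolding gev_def using op_pow_mult by blast

lemma gev_eigen: "D x = \<alpha> * x \<Longrightarrow> gev \<alpha> x"
  unfolding gev_def by (rule exI[of _ 1]) (simp add: op_def)

lemma gev_minus: "\<alpha> \<in> E \<Longrightarrow> x \<in> E \<Longrightarrow> gev \<alpha> x \<Longrightarrow> gev \<alpha> (- x)"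
  using gev_mult[of 0 \<alpha> "- 1" x] gev_eigen[of "- 1" 0] D_minus[of 1]
  by (simp add: subfield_closed[OF E])

text \<open>Induction on the nilpotency order makes \<open>op \<alpha> x\<close> vanish. On the true
  eigenvector that remains, \<open>op \<beta>\<close> acts as the nonzero constant
  \<open>\<alpha> - \<beta>\<close>, so none of its powers kills \<open>x\<close> unless
  \<open>x = 0\<close>.\<close>

lemma gev_distinct_eq_0:
  assumes ab: "\<alpha> \<in> consts_D" "\<beta> \<in> consts_D" "\<alpha> \<noteq> \<beta>" and "x \<in> E" "gev \<alpha> x" "gev \<beta> x"
  shows "x = 0"
proof -
  obtain n where n: "(op \<alpha> ^^ n) x = 0" using assms by (auto simp: gev_def)
  show ?thesis using n assms(4,6)
  proof (induction n arbitrary: x)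
    case (Suc n)
    have "op \<alpha> x \<in> E" "gev \<beta> (op \<alpha> x)" using Suc ab by (auto intro: op_in gev_op)
    moreover have "(op \<alpha> ^^ n) (op \<alpha> x) = 0" using Suc by (simp add: funpow_swap1)
    ultimately have "op \<alpha> x = 0" using Suc.IH by blast
    then have b: "op \<beta> x = (\<alpha> - \<beta>) * x" by (simp add: op_def algebra_simps)
    have c: "\<alpha> - \<beta> \<in> consts_D" using ab by (auto simp: D_diff subfield_diff[OF E])
    have "(op \<beta> ^^ m) x = (\<alpha> - \<beta>) ^ m * x" for m
    proof (induction m)
      case (Suc m)
      have "(\<alpha> - \<beta>) ^ m \<in> consts_D" by (rule subfield_power[OF subfield_constants c])
      then have "op \<beta> ((\<alpha> - \<beta>) ^ m * x) = (\<alpha> - \<beta>) ^ m * op \<beta> x" using op_scale Suc.prems \<open>x \<in> E\<close> by blast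
      then show ?case using Suc b by simp
    qed simp
    then show ?case using Suc.prems ab(3) by (auto simp: gev_def)
  qed simp
qed

text \<open>A power of \<open>op b\<close> kills the component at \<open>b\<close>, and by induction
  it kills all the others too. Each of these then belongs to \<open>b\<close> as well as to its own
  eigenvalue, and so vanishes.\<close>

lemma gev_independent:
  assumes "finite B" "B \<subseteq> consts_D" "\<And>\<beta>. \<beta> \<in> B \<Longrightarrow> f \<beta> \<in> E \<and> gev \<beta> (f \<beta>)" "(\<Sum>\<beta>\<in>B. f \<beta>) = 0"
  shows "\<forall>\<beta>\<in>B. f \<beta> = 0"
  using assms
proof (induction B arbitrary: f rule: finite_induct)
  case (insert b B)
  have b: "b \<in> consts_D" "b \<in> E" "f b \<in> E" using insert by auto
  obtain N where N: "(op b ^^ N) (f b) = 0" using insert.prems(2)[of b] by (auto simp: gev_def)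
  have "(op b ^^ N) (sum f (insert b B)) = (\<Sum>\<beta>\<in>insert b B. (op b ^^ N) (f \<beta>))"
    using insert.prems(2) b by (intro op_pow_sum) auto
  then have s: "(\<Sum>\<beta>\<in>B. (op b ^^ N) (f \<beta>)) = 0" using insert N by simp
  have "\<forall>\<beta>\<in>B. (op b ^^ N) (f \<beta>) = 0"
  proof (rule insert.IH[OF _ _ s])
    show "B \<subseteq> consts_D" using insert by auto
    show "(op b ^^ N) (f \<beta>) \<in> E \<and> gev \<beta> ((op b ^^ N) (f \<beta>))" if "\<beta> \<in> B" for \<beta>
      using that insert.prems b by (auto intro!: op_pow_in gev_op_pow)
  qed
  then have "f \<beta> = 0" if "\<beta> \<in> B" for \<beta>
  proof -
    have "gev b (f \<beta>)" using \<open>\<forall>\<beta>\<in>B. _\<close> that by (auto simp: gev_def)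
    moreover have "\<beta> \<in> consts_D" "b \<noteq> \<beta>" "f \<beta> \<in> E" "gev \<beta> (f \<beta>)" using that insert by auto
    ultimately show ?thesis using gev_distinct_eq_0[OF b(1)] by blast
  qed
  then show ?case using insert by simp
qed simp

text \<open>Comparing components in \<open>f * h = g\<close>, with numerator and denominator written as sums of
  generalised eigenvectors, exhibits an eigenvector \<open>f\<close> as a quotient of two of them.\<close>

lemma eigenvector_quotient:
  fixes G :: "'a \<Rightarrow> 'a set"
  assumes G0: "0 \<in> \<Gamma>" "\<Gamma> \<subseteq> consts_D" "\<And>\<beta> \<gamma>. \<beta> \<in> \<Gamma> \<Longrightarrow> \<gamma> \<in> \<Gamma> \<Longrightarrow> \<beta> + \<gamma> \<in> \<Gamma>"
    and G1: "\<And>\<beta> x. \<beta> \<in> \<Gamma> \<Longrightarrow> x \<in> G \<beta> \<Longrightarrow> x \<in> E \<and> gev \<beta> x"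
    and G2: "\<And>\<beta>. \<beta> \<in> \<Gamma> \<Longrightarrow> 0 \<in> G \<beta>" "1 \<in> G 0" "-1 \<in> G 0"
      "\<And>\<beta> x y. \<beta> \<in> \<Gamma> \<Longrightarrow> x \<in> G \<beta> \<Longrightarrow> y \<in> G \<beta> \<Longrightarrow> x + y \<in> G \<beta>"
      "\<And>\<beta> \<gamma> x y. \<beta> \<in> \<Gamma> \<Longrightarrow> \<gamma> \<in> \<Gamma> \<Longrightarrow> x \<in> G \<beta> \<Longrightarrow> y \<in> G \<gamma> \<Longrightarrow> x * y \<in> G (\<beta> + \<gamma>)"
    and X: "\<And>x. x \<in> X \<Longrightarrow> \<exists>\<beta>\<in>\<Gamma>. x \<in> G \<beta>"
    and f: "f \<in> field_gen X" "f \<noteq> 0" "f \<in> E" "\<alpha> \<in> consts_D" "gev \<alpha> f"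
  obtains \<beta> h where "\<beta> \<in> \<Gamma>" "\<alpha> + \<beta> \<in> \<Gamma>" "h \<in> G \<beta>" "h \<noteq> 0" "f * h \<in> G (\<alpha> + \<beta>)"
proof -
  \<comment> \<open>Components are total functions vanishing off a finite set, so that sums with
    different supports can be added and compared index by index.\<close>
  define R where "R = {\<Sum>\<beta>\<in>B. c \<beta> |B c. finite B \<and> B \<subseteq> \<Gamma> \<and> (\<forall>\<beta>. \<beta> \<in> \<Gamma> \<longrightarrow> c \<beta> \<in> G \<beta>) \<and> (\<forall>\<beta>. \<beta> \<notin> B \<longrightarrow> c \<beta> = 0)}"
  have RI: "x + y \<in> R" if \<beta>: "\<beta> \<in> \<Gamma>" "x \<in> G \<beta>" and y: "y \<in> R" for \<beta> x y
  proof -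
    obtain B c where c: "y = (\<Sum>\<beta>\<in>B. c \<beta>)" "finite B" "B \<subseteq> \<Gamma>" "\<forall>\<beta>. \<beta> \<in> \<Gamma> \<longrightarrow> c \<beta> \<in> G \<beta>" "\<forall>\<beta>. \<beta> \<notin> B \<longrightarrow> c \<beta> = 0"
      using y unfolding R_def by auto
    let ?c = "c(\<beta> := x + c \<beta>)"
    have "(\<Sum>\<gamma>\<in>insert \<beta> B. ?c \<gamma>) = ?c \<beta> + (\<Sum>\<gamma>\<in>B - {\<beta>}. ?c \<gamma>)"
      using c(2) by (simp add: sum.insert_remove)
    also have "(\<Sum>\<gamma>\<in>B - {\<beta>}. ?c \<gamma>) = (\<Sum>\<gamma>\<in>B - {\<beta>}. c \<gamma>)" by (rule sum.cong) auto
    also have "?c \<beta> + (\<Sum>\<gamma>\<in>B - {\<beta>}. c \<gamma>) = x + (\<Sum>\<gamma>\<in>insert \<beta> B. c \<gamma>)"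
      using c(2) by (simp add: sum.insert_remove)
    also have "(\<Sum>\<gamma>\<in>insert \<beta> B. c \<gamma>) = y"
      using c by (cases "\<beta> \<in> B") (auto simp: insert_absorb)
    finally have "x + y = (\<Sum>\<gamma>\<in>insert \<beta> B. ?c \<gamma>)" by simp
    moreover have "insert \<beta> B \<subseteq> \<Gamma>" "\<forall>\<gamma>. \<gamma> \<in> \<Gamma> \<longrightarrow> ?c \<gamma> \<in> G \<gamma>" "\<forall>\<gamma>. \<gamma> \<notin> insert \<beta> B \<longrightarrow> ?c \<gamma> = 0"
      using \<beta> c G2(4) by auto
    ultimately show ?thesis unfolding R_def using c(2)
      by (intro CollectI exI[of _ "insert \<beta> B"] exI[of _ ?c]) auto
  qed
  have R0: "0 \<in> R" unfolding R_def using G2(1) by (intro CollectI exI[of _ "{}"] exI[of _ "\<lambda>_. 0"]) auto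
  have R1: "x \<in> R" if "\<beta> \<in> \<Gamma>" "x \<in> G \<beta>" for x \<beta> using RI[OF that R0] by simp
  have sumR: "sum c B + y \<in> R" if "B \<subseteq> \<Gamma>" "\<forall>\<beta>\<in>B. c \<beta> \<in> G \<beta>" "y \<in> R" for B c y
    using that
  proof (induction B rule: infinite_finite_induct)
    case (insert x F)
    then have "c x + (sum c F + y) \<in> R" using RI[of x "c x" "sum c F + y"] by auto
    then show ?case using insert by (simp add: add.assoc)
  qed auto
  have Radd: "x + y \<in> R" if x: "x \<in> R" and y: "y \<in> R" for x y
  proof -
    obtain B c where c: "x = (\<Sum>\<beta>\<in>B. c \<beta>)" "B \<subseteq> \<Gamma>" "\<forall>\<beta>. \<beta> \<in> \<Gamma> \<longrightarrow> c \<beta> \<in> G \<beta>"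
      using x unfolding R_def by auto
    then show ?thesis using sumR[of B c y] y by blast
  qed
  have Rmult1: "x * y \<in> R" if x: "\<beta> \<in> \<Gamma>" "x \<in> G \<beta>" and y: "y \<in> R" for \<beta> x y
  proof -
    obtain B c where c: "y = (\<Sum>\<beta>\<in>B. c \<beta>)" "finite B" "B \<subseteq> \<Gamma>" "\<forall>\<beta>. \<beta> \<in> \<Gamma> \<longrightarrow> c \<beta> \<in> G \<beta>"
      using y unfolding R_def by auto
    have "(\<Sum>\<gamma>\<in>B. x * c \<gamma>) \<in> R" using c(2,3)
    proof (induction B rule: finite_induct)
      case (insert b F)
      have "x * c b \<in> G (\<beta> + b)" "\<beta> + b \<in> \<Gamma>" using insert c x G2(5) G0(3) by auto
      then show ?case using insert RI by simp
    qed (simp add: R0)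
    then show ?thesis unfolding c(1) by (simp add: sum_distrib_left)
  qed
  have Rmult: "x * y \<in> R" if x: "x \<in> R" and y: "y \<in> R" for x y
  proof -
    obtain B c where c: "x = (\<Sum>\<beta>\<in>B. c \<beta>)" "finite B" "B \<subseteq> \<Gamma>" "\<forall>\<beta>. \<beta> \<in> \<Gamma> \<longrightarrow> c \<beta> \<in> G \<beta>"
      using x unfolding R_def by auto
    have "(\<Sum>\<gamma>\<in>B. c \<gamma> * y) \<in> R" using c(2,3)
    proof (induction B rule: finite_induct)
      case (insert b F)
      have "c b * y \<in> R" using insert c Rmult1 y by auto
      then show ?case using insert Radd by simp
    qed (simp add: R0)
    then show ?thesis unfolding c(1) by (simp add: sum_distrib_right)
  qed
  have "is_subring R" unfolding is_subring_def
    using R0 R1[OF G0(1) G2(2)] Radd Rmult Rmult[OF R1[OF G0(1) G2(3)]] by auto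
  moreover have "X \<subseteq> R" using X R1 by blast
  ultimately have XR: "ring_gen X \<subseteq> R" by (rule ring_gen_subset[rotated])
  obtain a b where ab: "a \<in> R" "b \<in> R" "b \<noteq> 0" "f = a / b" using ring_gen_frac[OF f(1)] XR by blast
  obtain B h where h: "b = (\<Sum>\<beta>\<in>B. h \<beta>)" "finite B" "B \<subseteq> \<Gamma>" "\<forall>\<beta>. \<beta> \<in> \<Gamma> \<longrightarrow> h \<beta> \<in> G \<beta>" "\<forall>\<beta>. \<beta> \<notin> B \<longrightarrow> h \<beta> = 0"
    using ab(2) unfolding R_def by auto
  obtain B' g where g: "a = (\<Sum>\<beta>\<in>B'. g \<beta>)" "finite B'" "B' \<subseteq> \<Gamma>" "\<forall>\<beta>. \<beta> \<in> \<Gamma> \<longrightarrow> g \<beta> \<in> G \<beta>" "\<forall>\<beta>. \<beta> \<notin> B' \<longrightarrow> g \<beta> = 0"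
    using ab(1) unfolding R_def by auto
  have hE: "h \<beta> \<in> E \<and> gev \<beta> (h \<beta>)" for \<beta>
    using h(3-5) G1 by (cases "\<beta> \<in> B") (auto simp: subfield_0[OF E])
  have gE: "g \<beta> \<in> E \<and> gev \<beta> (g \<beta>)" for \<beta>
    using g(3-5) G1 by (cases "\<beta> \<in> B'") (auto simp: subfield_0[OF E])
  \<comment> \<open>Multiplication by \<open>f\<close> shifts weights by \<open>\<alpha>\<close>:
    the two terms of \<open>?F \<delta>\<close> are both of weight \<open>\<delta>\<close>, and
    \<open>?B\<close> contains all weights that occur.\<close>
  let ?B = "(+) \<alpha> ` B \<union> B'"
  let ?F = "\<lambda>\<delta>. f * h (\<delta> - \<alpha>) - g \<delta>"
  have "\<forall>\<delta>\<in>?B. ?F \<delta> = 0"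
  proof (rule gev_independent)
    show "finite ?B" using h g by auto
    show B: "?B \<subseteq> consts_D" using h(3) g(3) G0(2) subfield_add[OF subfield_constants] f(4) by blast
    show "?F \<delta> \<in> E \<and> gev \<delta> (?F \<delta>)" if "\<delta> \<in> ?B" for \<delta>
    proof -
      have \<delta>: "\<delta> \<in> consts_D" using that B by blast
      have da: "\<delta> - \<alpha> \<in> E" "\<alpha> \<in> E" "\<delta> \<in> E" using \<delta> f subfield_diff[OF E] by auto
      have fh: "f * h (\<delta> - \<alpha>) \<in> E" using f(3) hE subfield_mult[OF E] by blast
      have 1: "gev \<delta> (f * h (\<delta> - \<alpha>))"
        using gev_mult[OF da(2,1) f(3) _ f(5), of "h (\<delta> - \<alpha>)"] hE by simp
      have 2: "gev \<delta> (- g \<delta>)" "- g \<delta> \<in> E" using gev_minus gE da subfield_minus[OF E] by auto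
      then show ?thesis using gev_add[OF da(3) fh 2(2) 1 2(1)] subfield_add[OF E fh 2(2)] by simp
    qed
    have "(\<Sum>\<delta>\<in>?B. h (\<delta> - \<alpha>)) = (\<Sum>\<delta>\<in>(+) \<alpha> ` B. h (\<delta> - \<alpha>))"
    proof (rule sum.mono_neutral_right)
      show "\<forall>i\<in>?B - (+) \<alpha> ` B. h (i - \<alpha>) = 0"
      proof
        fix i assume i: "i \<in> ?B - (+) \<alpha> ` B"
        have "i - \<alpha> \<notin> B"
        proof
          assume "i - \<alpha> \<in> B"
          then have "\<alpha> + (i - \<alpha>) \<in> (+) \<alpha> ` B" by blast
          then show False using i by simp
        qed
        then show "h (i - \<alpha>) = 0" using h(5) by blast
      qed
    qed (use h g in auto)
    also have "\<dots> = b" unfolding h(1) by (subst sum.reindex) auto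
    finally have s1: "(\<Sum>\<delta>\<in>?B. h (\<delta> - \<alpha>)) = b" .
    have s2: "(\<Sum>\<delta>\<in>?B. g \<delta>) = a" unfolding g(1) using h(2) g(2,5)
      by (intro sum.mono_neutral_right) auto
    have "(\<Sum>\<delta>\<in>?B. ?F \<delta>) = f * (\<Sum>\<delta>\<in>?B. h (\<delta> - \<alpha>)) - (\<Sum>\<delta>\<in>?B. g \<delta>)"
      by (simp add: sum_subtractf sum_distrib_left)
    then show "(\<Sum>\<delta>\<in>?B. ?F \<delta>) = 0" unfolding s1 s2 using ab by simp
  qed
  \<comment> \<open>A nonzero denominator has a nonzero component. Its product with \<open>f\<close>
    is a nonzero component of the numerator, which places the shifted weight in
    \<open>\<Gamma>\<close>, since \<open>g\<close> vanishes off its support.\<close>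
  moreover obtain \<beta> where \<beta>: "\<beta> \<in> B" "h \<beta> \<noteq> 0" using ab(3) h(1) by (metis sum.neutral)
  ultimately have fg: "f * h \<beta> = g (\<alpha> + \<beta>)" by force
  then have "g (\<alpha> + \<beta>) \<noteq> 0" using \<beta> f by (metis mult_eq_0_iff)
  then have "\<alpha> + \<beta> \<in> \<Gamma>" using g by auto
  then show ?thesis using that[of \<beta> "h \<beta>"] \<beta> fg h g by auto
qed

end

section \<open>The tower\<close>

locale tower =
  fixes T :: "'a::field_char_0 tower"
  assumes tower: "is_tower T"
begin

abbreviation "k \<equiv> Fb T"
abbreviation "E \<equiv> FbL T"
abbreviation "K \<equiv> FbK0y T"
abbreviation "D \<equiv> der T"
abbreviation "t \<equiv> gen T"

lemma Fld: "is_subfield (Fld T)" and closure: "is_alg_closure (Fld T) (Fb T)"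
  and nlow: "1 \<le> nlow T" "nlow T \<le> ngen T" "1 \<le> rdeg T"
  and derE: "is_derivation_on E D" and D_Fld: "c \<in> Fld T \<Longrightarrow> D c \<in> Fld T"
  and D_k: "c \<in> k \<Longrightarrow> D c = 0"
  and radical: "radicand T \<in> R0 T" "radical T ^ rdeg T = radicand T"
    "power_free_in (R0 T) (rdeg T) (radicand T)"
  and L_consts: "{x \<in> L_field T. D x = 0} = Fld T"
  using tower unfolding is_tower_def by blast+

lemma gen_transc: "i \<in> {1..ngen T} \<Longrightarrow> \<not> algebraic_over (below T i) (t i)"
  and D_gen: "i \<in> {1..ngen T} \<Longrightarrow> D (t i) \<in> field_gen (below T i \<union> {t i})"
  using tower unfolding is_tower_def by blast+

lemma E: "is_subfield E" and K: "is_subfield K" and k: "is_subfield k"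
  and L: "is_subfield (L_field T)" and K0y: "is_subfield (K0y T)"
  using closure by (simp_all add: FbL_def FbK0y_def L_field_def K0y_def is_alg_closure_def subfield_hull)

lemma k_closed: "alg_closed k"
  using closure by (auto simp: is_alg_closure_def alg_closed_def)

lemma Fld_k: "Fld T \<subseteq> k"
  using closure by (auto simp: is_alg_closure_def)

lemma k_algebraic: "c \<in> k \<Longrightarrow> algebraic_over (Fld T) c"
  using closure by (auto simp: is_alg_closure_def)

lemma k_K: "k \<subseteq> K" and K0y_K: "K0y T \<subseteq> K" and L_E: "L_field T \<subseteq> E" and k_E: "k \<subseteq> E"
  and K0y_L: "K0y T \<subseteq> L_field T"
  by (auto simp: FbK0y_def FbL_def L_field_def intro: field_gen_inc)

lemma K_E: "K \<subseteq> E"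
  unfolding FbK0y_def by (rule field_gen_subset[OF _ E]) (use k_E K0y_L L_E in auto)

lemma K_gens: "i \<in> {1..nlow T} \<Longrightarrow> t i \<in> K0y T" "radical T \<in> K0y T" "Fld T \<subseteq> K0y T"
  by (auto simp: K0y_def intro: field_gen_inc)

lemma upper_E: "i \<in> upper T \<Longrightarrow> t i \<in> L_field T"
  by (auto simp: L_field_def intro: field_gen_inc)

lemma index_cases: "i \<in> {1..ngen T} \<Longrightarrow> i \<in> {1..nlow T} \<or> i \<in> upper T"
  by (auto simp: upper_def)

lemma upper_index: "i \<in> upper T \<Longrightarrow> i \<in> {1..ngen T}"
  using nlow by (auto simp: upper_def)

lemma gen_L: "i \<in> {1..ngen T} \<Longrightarrow> t i \<in> L_field T"
  using index_cases[of i] upper_E K_gens K0y_L by blast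

lemma gen_E: "i \<in> {1..ngen T} \<Longrightarrow> t i \<in> E"
  using gen_L L_E by blast

lemma K_eq: "K = field_gen (k \<union> t ` {1..nlow T} \<union> {radical T})"
proof
  show "K \<subseteq> field_gen (k \<union> t ` {1..nlow T} \<union> {radical T})"
    unfolding FbK0y_def
  proof (rule field_gen_subset[OF _ subfield_hull], rule Un_least)
    show "K0y T \<subseteq> field_gen (k \<union> t ` {1..nlow T} \<union> {radical T})"
      unfolding K0y_def using Fld_k by (intro hull_mono) auto
  qed (auto intro: field_gen_inc)
  show "field_gen (k \<union> t ` {1..nlow T} \<union> {radical T}) \<subseteq> K"
    using k_K K_gens K0y_K by (intro field_gen_subset[OF _ K]) blast
qed

lemma E_eq: "E = field_gen (K \<union> t ` upper T)"
proof
  show "E \<subseteq> field_gen (K \<union> t ` upper T)"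
    unfolding FbL_def L_field_def
  proof (rule field_gen_subset[OF _ subfield_hull], rule Un_least)
    show "field_gen (K0y T \<union> t ` upper T) \<subseteq> field_gen (K \<union> t ` upper T)"
      using K0y_K by (intro hull_mono) auto
  qed (use k_K in \<open>auto intro: field_gen_inc\<close>)
  show "field_gen (K \<union> t ` upper T) \<subseteq> E"
    using K_E upper_E L_E by (intro field_gen_subset[OF _ E]) blast
qed

lemma below_subset:
  assumes "i \<in> {1..ngen T}" shows "below T i \<subseteq> L_field T"
proof -
  have "field_gen (Fld T \<union> t ` {1..<i}) \<subseteq> L_field T"
    using K_gens(3) K0y_L gen_L assms by (intro field_gen_subset[OF _ L]) auto
  moreover have "field_gen (K0y T \<union> t ` {nlow T + 1..<i}) \<subseteq> L_field T"
    using K0y_L gen_L assms by (intro field_gen_subset[OF _ L]) auto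
  ultimately show ?thesis unfolding below_def by simp
qed

sublocale diff_field E D
  by unfold_locales (fact E derE)+

text \<open>If y = 0 then q = 0, and 0 = 0 ^ m * h; power-freeness would make 0 a unit.\<close>

lemma radical_nz: "radical T \<noteq> 0"
proof
  assume "radical T = 0"
  then have "radicand T = 0" using radical(2) nlow(3) by (simp add: power_0_left)
  moreover have R: "0 \<in> R0 T" "1 \<in> R0 T" unfolding R0_def by (auto intro: subring_0 subring_1 subring_hull)
  ultimately have "unit_in (R0 T) 0"
    using radical(3) nlow(3) unfolding power_free_in_def by (metis mult_zero_right)
  then show False by (simp add: unit_in_def)
qed

lemma R0_field: "R0 T \<subseteq> field_gen (Fld T \<union> t ` {1..nlow T})"
  unfolding R0_def by (rule ring_gen_subset_field_gen)

lemma D_low: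
  assumes "x \<in> field_gen (Fld T \<union> t ` {1..nlow T})" shows "D x \<in> field_gen (Fld T \<union> t ` {1..nlow T})"
proof (rule stable_field_gen[OF _ _ assms])
  show "Fld T \<union> t ` {1..nlow T} \<subseteq> E" using Fld_k k_E gen_E nlow by auto
  fix x assume x: "x \<in> Fld T \<union> t ` {1..nlow T}"
  show "D x \<in> field_gen (Fld T \<union> t ` {1..nlow T})"
  proof (cases "x \<in> Fld T")
    case True then show ?thesis using D_Fld by (intro field_gen_inc) auto
  next
    case False
    then obtain i where i: "i \<in> {1..nlow T}" "x = t i" using x by auto
    have "field_gen (below T i \<union> {t i}) \<subseteq> field_gen (Fld T \<union> t ` {1..nlow T})"
      using i unfolding below_def by (simp add: field_gen_insert_absorb[of _ "{t i}", simplified]) (rule hull_mono, auto)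
    then show ?thesis using D_gen[of i] i nlow by auto
  qed
qed

text \<open>The relation y ^ m = q is differentiated and solved for the derivative of y, which is
  possible because y is nonzero.\<close>

lemma D_radical: "D (radical T) \<in> K0y T"
proof -
  let ?y = "radical T" and ?m = "rdeg T"
  have y: "?y \<in> E" using K_gens(2) K0y_L L_E by blast
  have low: "field_gen (Fld T \<union> t ` {1..nlow T}) \<subseteq> K0y T" unfolding K0y_def by (rule hull_mono) auto
  have q: "D (radicand T) \<in> K0y T" using D_low R0_field radical(1) low by blast
  have "of_nat ?m * ?y ^ (?m - 1) * D ?y = D (radicand T)"
    using D_power[OF y, of ?m] radical(2) by simp
  then have "D ?y = D (radicand T) / (of_nat ?m * ?y ^ (?m - 1))"
    using radical_nz nlow(3) by (simp add: field_simps)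
  also have "\<dots> \<in> K0y T"
    using q K_gens(2) by (intro subfield_divide[OF K0y] subfield_mult[OF K0y] subfield_power[OF K0y] subfield_of_nat[OF K0y])
  finally show ?thesis .
qed

lemma D_K:
  assumes "x \<in> K" shows "D x \<in> K"
proof -
  let ?X = "k \<union> t ` {1..nlow T} \<union> {radical T}"
  have low: "field_gen (Fld T \<union> t ` {1..nlow T}) \<subseteq> K0y T" unfolding K0y_def by (rule hull_mono) auto
  have "D x \<in> field_gen ?X"
  proof (rule stable_field_gen)
    show "?X \<subseteq> E" using k_E K_gens K0y_K K_E by blast
    show "x \<in> field_gen ?X" using assms K_eq by simp
    fix z assume z: "z \<in> ?X"
    consider "z \<in> k" | "z \<in> t ` {1..nlow T}" | "z = radical T" using z by blast
    then have "D z \<in> K"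
    proof cases
      case 1 then show ?thesis using D_k subfield_0[OF K] by simp
    next
      case 2 then show ?thesis using D_low[of z] low K0y_K by (auto intro: field_gen_inc)
    next
      case 3 then show ?thesis using D_radical K0y_K by blast
    qed
    then show "D z \<in> field_gen ?X" using K_eq by simp
  qed
  then show ?thesis using K_eq by simp
qed

lemma D_L:
  assumes "x \<in> L_field T" shows "D x \<in> L_field T"
proof -
  let ?X = "Fld T \<union> {radical T} \<union> t ` {1..ngen T}"
  have XL: "?X \<subseteq> L_field T" using K_gens K0y_L gen_L by blast
  have L_eq: "L_field T = field_gen ?X"
  proof
    show "field_gen ?X \<subseteq> L_field T" by (rule field_gen_subset[OF XL L])
    have "K0y T \<subseteq> field_gen ?X" unfolding K0y_def using nlow by (intro hull_mono) auto
    then show "L_field T \<subseteq> field_gen ?X" unfolding L_field_def using upper_index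
      by (intro field_gen_subset[OF _ subfield_hull]) (auto intro!: field_gen_inc)
  qed
  have "D x \<in> field_gen ?X"
  proof (rule stable_field_gen)
    show "?X \<subseteq> E" using XL L_E by blast
    show "x \<in> field_gen ?X" using assms L_eq by simp
    fix z assume z: "z \<in> ?X"
    consider "z \<in> Fld T" | "z = radical T" | i where "i \<in> {1..ngen T}" "z = t i" using z by blast
    then have "D z \<in> L_field T"
    proof cases
      case 1 then show ?thesis using D_Fld K_gens K0y_L by blast
    next
      case 2 then show ?thesis using D_radical K0y_L by blast
    next
      case 3
      then have "field_gen (below T i \<union> {t i}) \<subseteq> L_field T"
        using below_subset gen_L by (intro field_gen_subset[OF _ L]) auto
      then show ?thesis using D_gen 3 by blast
    qed
    then show "D z \<in> field_gen ?X" using L_eq by simp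
  qed
  then show ?thesis using L_eq by simp
qed

section \<open>Constants and transcendence over the algebraic closure\<close>

lemma algebraic_compositum:
  assumes M: "is_subfield M" "Fld T \<subseteq> M" and x: "x \<in> field_gen (k \<union> M)"
  shows "algebraic_over M x"
proof -
  have "k \<union> M \<subseteq> {x. algebraic_over M x}"
  proof
    fix z assume "z \<in> k \<union> M"
    then consider "z \<in> k" | "z \<in> M" by blast
    then have "algebraic_over M z"
    proof cases
      case 1 show ?thesis by (rule algebraic_over_mono[OF k_algebraic[OF 1] M(2)])
    next
      case 2 show ?thesis by (rule algebraic_over_elem[OF M(1) 2])
    qed
    then show "z \<in> {x. algebraic_over M x}" by (rule CollectI)
  qed
  from field_gen_subset[OF this subfield_algebraic[OF M(1)]] x have "x \<in> {x. algebraic_over M x}" by (rule subsetD)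
  then show ?thesis by (rule CollectD)
qed

text \<open>A constant \<open>x\<close> of the compositum is algebraic over L. Applying D to the
  coefficients of its monic minimal equation kills the leading one, so by minimality it kills them
  all: the coefficients lie in F, and \<open>x\<close> is algebraic over the closed field
  \<open>k\<close>.\<close>

lemma constants:
  assumes x: "x \<in> E" "D x = 0" shows "x \<in> k"
proof -
  let ?P = "\<lambda>p. p \<in> polys_over (L_field T) \<and> p \<noteq> 0 \<and> poly p x = 0"
  have "algebraic_over (L_field T) x"
    by (rule algebraic_compositum[OF L]) (use x(1) K_gens(3) K0y_L in \<open>auto simp: FbL_def\<close>)
  then obtain p0 where "?P p0" unfolding algebraic_over_def by auto
  then obtain p where p: "?P p" "\<And>q. ?P q \<Longrightarrow> degree p \<le> degree q"
    using ex_has_least_nat[of ?P p0 degree] by blast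
  define q where "q = smult (inverse (lead_coeff p)) p"
  have lc: "lead_coeff p \<in> L_field T" "lead_coeff p \<noteq> 0" using p(1) by (auto simp: polys_over_def)
  have q: "q \<in> polys_over (L_field T)" "poly q x = 0" "degree q = degree p" "lead_coeff q = 1"
    using p(1) lc unfolding q_def
    by (auto intro!: polys_over_smult subfield_subring[OF L] subfield_inverse[OF L])
  have qE: "q \<in> polys_over E" using q(1) polys_over_mono[OF L_E] by blast
  have "poly (map_poly D q) x = 0" using D_poly[OF qE x(1)] q(2) x(2) by simp
  moreover have "map_poly D q \<in> polys_over (L_field T)"
    using q(1) D_L by (auto simp: polys_over_def coeff_map_poly)
  moreover have "degree (map_poly D q) < degree p" if nz: "map_poly D q \<noteq> 0"
  proof -
    have "degree (map_poly D q) \<le> degree q" by (rule map_poly_degree_leq)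
    moreover have "coeff (map_poly D q) (degree q) = 0" using q(4) by (simp add: coeff_map_poly)
    ultimately show ?thesis using nz q(3) by (metis leading_coeff_0_iff le_neq_implies_less)
  qed
  ultimately have "map_poly D q = 0" using p(2)[of "map_poly D q"] by fastforce
  then have "D (coeff q i) = 0" for i by (metis coeff_0 coeff_map_poly D_0)
  then have "coeff q i \<in> Fld T" for i using q(1) L_consts by (auto simp: polys_over_def)
  then have "q \<in> polys_over k" using Fld_k by (auto simp: polys_over_def)
  moreover have "q \<noteq> 0" using q(4) by auto
  ultimately have "algebraic_over k x" using q(2) by (auto simp: algebraic_over_def)
  then show ?thesis by (rule alg_closed_algebraic[OF k_closed])
qed

text \<open>The compositum with \<open>k\<close> consists of elements algebraic over
  \<open>M\<close>, so an element algebraic over it would be algebraic over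
  \<open>M\<close>.\<close>

lemma transc_compositum:
  assumes M: "is_subfield M" "Fld T \<subseteq> M" and x: "\<not> algebraic_over M x"
  shows "\<not> algebraic_over (field_gen (k \<union> M)) x"
proof
  assume "algebraic_over (field_gen (k \<union> M)) x"
  then have "algebraic_over {x. algebraic_over M x} x"
  proof (rule algebraic_over_mono)
    show "field_gen (k \<union> M) \<subseteq> {x. algebraic_over M x}"
      using algebraic_compositum[OF M] by (intro subsetI CollectI)
  qed
  then show False using algebraic_trans[OF M(1)] x by blast
qed

lemma below_subfield: "is_subfield (below T i)" "Fld T \<subseteq> below T i"
  using K_gens(3) by (auto simp: below_def subfield_hull intro: field_gen_inc)

lemma upper_transc:
  assumes "i \<in> upper T" shows "\<not> algebraic_over (field_gen (K \<union> t ` {nlow T + 1..<i})) (t i)"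
proof -
  have b: "below T i = field_gen (K0y T \<union> t ` {nlow T + 1..<i})" using assms by (auto simp: below_def upper_def)
  have "field_gen (k \<union> below T i) = field_gen (below T i \<union> k)" by (simp add: Un_commute)
  also have "\<dots> = field_gen (K0y T \<union> t ` {nlow T + 1..<i} \<union> k)" unfolding b by (rule field_gen_insert_absorb)
  also have "K0y T \<union> t ` {nlow T + 1..<i} \<union> k = (k \<union> K0y T) \<union> t ` {nlow T + 1..<i}" by auto
  also have "field_gen \<dots> = field_gen (K \<union> t ` {nlow T + 1..<i})"
    unfolding FbK0y_def by (rule field_gen_insert_absorb[symmetric])
  finally show ?thesis
    using transc_compositum[OF below_subfield gen_transc[OF upper_index[OF assms]]] by simp
qed

lemma C_upper_transc: "i \<in> upper T \<Longrightarrow> \<not> algebraic_over (C_upper T i) (t i)"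
  unfolding C_upper_def using transcendental_over_others[of "nlow T" "ngen T" K t i] upper_transc
  by (auto simp: upper_def)

lemma gen_not_k:
  assumes "i \<in> {1..ngen T}" shows "t i \<notin> k"
proof
  assume "t i \<in> k"
  then have "algebraic_over (below T i) (t i)"
    by (rule algebraic_over_mono[OF k_algebraic below_subfield(2)])
  then show False using gen_transc assms by blast
qed

lemma D_gen_nz: "i \<in> {1..ngen T} \<Longrightarrow> D (t i) \<noteq> 0"
  using constants gen_E gen_not_k by blast

lemma finite_upper [simp]: "finite (upper T)"
  by (simp add: upper_def)

lemma C_upper: "is_subfield (C_upper T i)" "K \<subseteq> C_upper T i" "C_upper T i \<subseteq> E"
  "j \<in> upper T \<Longrightarrow> j \<noteq> i \<Longrightarrow> t j \<in> C_upper T i"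
proof -
  show "C_upper T i \<subseteq> E" unfolding C_upper_def
    using K_E upper_E L_E by (intro field_gen_subset[OF _ E]) blast
qed (auto simp: C_upper_def subfield_hull intro: field_gen_inc)

lemma E_adjoin:
  assumes "i \<in> upper T" shows "E = field_gen (C_upper T i \<union> {t i})"
proof -
  have "C_upper T i \<union> {t i} = field_gen (K \<union> t ` (upper T - {i})) \<union> {t i}" by (simp add: C_upper_def)
  then have "field_gen (C_upper T i \<union> {t i}) = field_gen (K \<union> t ` (upper T - {i}) \<union> {t i})"
    by (simp only: field_gen_insert_absorb)
  also have "K \<union> t ` (upper T - {i}) \<union> {t i} = K \<union> t ` upper T" using assms by auto
  finally show ?thesis using E_eq by simp
qed

end

section \<open>Places with a coefficient field\<close>

text \<open>On the integers \<open>LEAST\<close> is meaningful only for a nonempty set that is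
  bounded below; this is where a lower bound for the shift is consumed.\<close>

lemma int_Least:
  fixes P :: "int \<Rightarrow> bool"
  assumes "P x" "\<And>y. P y \<Longrightarrow> b \<le> y"
  shows "P (LEAST y. P y)" "\<And>y. P y \<Longrightarrow> (LEAST y. P y) \<le> y"
proof -
  obtain m where m: "P m" "\<And>y. P y \<Longrightarrow> nat (m - b) \<le> nat (y - b)"
    using ex_has_least_nat[of P x "\<lambda>y. nat (y - b)"] assms(1) by blast
  have le: "m \<le> y" if "P y" for y using m(2)[OF that] assms(2)[OF that] assms(2)[OF m(1)] by simp
  have "(LEAST y. P y) = m" using m(1) le by (intro Least_equality) auto
  then show "P (LEAST y. P y)" "\<And>y. P y \<Longrightarrow> (LEAST y. P y) \<le> y" using m le by auto
qed

text \<open>A homomorphism on a field is injective, so a polynomial over the image can be pulled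
  back without change of degree, and a root pushed forward.\<close>

lemma alg_closed_hom_image:
  fixes h :: "'a::field \<Rightarrow> 'b::field"
  assumes k: "alg_closed k" and h: "\<And>x y. x \<in> k \<Longrightarrow> y \<in> k \<Longrightarrow> h (x + y) = h x + h y \<and> h (x * y) = h x * h y"
    and h1: "h 1 = 1"
  shows "alg_closed (h ` k)"
proof -
  have kf: "is_subfield k" using k by (simp add: alg_closed_def)
  have "h (0 + 0) = h 0 + h 0" using h subfield_0[OF kf] by blast
  then have "h 0 = h 0 + h 0" by (simp only: add_0_left)
  then have h0: "h 0 = 0" by (simp only: add_cancel_right_right)
  have hm: "h (- x) = - h x" if "x \<in> k" for x
    using h[of x "- x"] subfield_minus[OF kf that] that h0 by (simp add: add_eq_0_iff)
  have hi: "h (inverse x) = inverse (h x)" if "x \<in> k" for x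
  proof (cases "x = 0")
    case False
    then have "h x * h (inverse x) = 1" using h[of x "inverse x"] subfield_inverse[OF kf that] that h1 by simp
    then show ?thesis by (metis inverse_unique)
  qed (simp add: h0)
  have inj: "h x = 0 \<Longrightarrow> x = 0" if "x \<in> k" for x
    using h[of x "inverse x"] subfield_inverse[OF kf that] that h1 by (cases "x = 0") auto
  have img: "is_subfield (h ` k)"
    unfolding is_subfield_def is_subring_def
  proof (intro conjI ballI)
    show "0 \<in> h ` k" using h0 subfield_0[OF kf] by (metis imageI)
    show "1 \<in> h ` k" using h1 subfield_1[OF kf] by (metis imageI)
    fix x assume "x \<in> h ` k" then obtain a where a: "a \<in> k" "x = h a" by auto
    show "- x \<in> h ` k" using a hm[OF a(1)] subfield_minus[OF kf a(1)] by (metis imageI)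
    show "inverse x \<in> h ` k" using a hi[OF a(1)] subfield_inverse[OF kf a(1)] by (metis imageI)
    fix y assume "y \<in> h ` k" then obtain b where b: "b \<in> k" "y = h b" by auto
    show "x + y \<in> h ` k" using a b h subfield_add[OF kf a(1) b(1)] by (metis imageI)
    show "x * y \<in> h ` k" using a b h subfield_mult[OF kf a(1) b(1)] by (metis imageI)
  qed
  have hp: "poly (map_poly h p) (h x) = h (poly p x)" if "x \<in> k" "p \<in> polys_over k" for p x
    using that(2)
  proof (induction p)
    case (pCons a p)
    then have "a \<in> k" "p \<in> polys_over k" by (auto dest: polys_over_pConsD)
    then show ?case using pCons that h poly_closed[OF subfield_subring[OF kf] _ that(1), of p] subfield_mult[OF kf]
      by (simp add: map_poly_pCons h0)
  qed (simp add: h0)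
  have "\<exists>x\<in>h ` k. poly p x = 0" if p: "p \<in> polys_over (h ` k)" "degree p > 0" for p
  proof -
    \<comment> \<open>The guard sends 0 to 0, as \<open>coeff_map_poly\<close> requires.\<close>
    define q where "q = map_poly (\<lambda>y. if y = 0 then 0 else inv_into k h y) p"
    have cq: "coeff q i = (if coeff p i = 0 then 0 else inv_into k h (coeff p i))" for i
      by (simp add: q_def coeff_map_poly)
    have pi: "coeff p i \<in> h ` k" for i using p by (simp add: polys_over_def)
    have hq: "coeff q i \<in> k \<and> h (coeff q i) = coeff p i" for i
      using pi[of i] by (auto simp: cq h0 subfield_0[OF kf] inv_into_into f_inv_into_f)
    have "map_poly h q = p" using hq by (intro poly_eqI) (simp add: coeff_map_poly h0)
    moreover have "degree q = degree p"
    proof -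
      have "coeff q i = 0 \<longleftrightarrow> coeff p i = 0" for i using hq[of i] inj[of "coeff q i"] h0 by auto
      then show ?thesis unfolding degree_def by simp
    qed
    moreover have "q \<in> polys_over k" using hq by (simp add: polys_over_def)
    ultimately obtain x where "x \<in> k" "poly q x = 0" using k p(2) unfolding alg_closed_def by metis
    then show ?thesis using hp[of x q] \<open>q \<in> _\<close> \<open>map_poly h q = p\<close> h0 by (metis imageI)
  qed
  with img show ?thesis by (simp add: alg_closed_def)
qed

text \<open>The interface shared by all four kinds. By \<open>triv\<close> and \<open>cover\<close>
  the field \<open>C\<close> is a set of representatives of the residue field, and
  \<open>bound\<close> makes the shift an attained minimum. \<open>X\<close> is kept apart from
  \<open>C\<close> because (K1) constrains generators only.\<close>

locale coeff_place = tower T + valued_field "FbL T" v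
  for T :: "'a::field_char_0 tower" and v +
  fixes \<pi> :: 'a and res :: "'a \<Rightarrow> 'k::field_char_0" and C X :: "'a set"
  assumes unif: "is_uniformiser E v \<pi>" and res: "is_residue_map E v res"
    and X: "X \<subseteq> E" and C_eq: "C = field_gen (k \<union> X)"
    and triv: "\<And>c. c \<in> C \<Longrightarrow> c \<noteq> 0 \<Longrightarrow> v c = 0"
    and cover: "\<And>x. x \<in> E \<Longrightarrow> vge 0 x \<Longrightarrow> \<exists>c\<in>C. vge 1 (x - c)"
    and bound: "\<exists>b. \<forall>h\<in>E. D h \<noteq> 0 \<longrightarrow> b \<le> v (D h) - v h"
begin

abbreviation "s \<equiv> shift T v"
abbreviation "\<kappa> \<equiv> kappa T v res"
abbreviation "del' \<equiv> del T v \<pi> res"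
abbreviation "\<rho> \<equiv> rho T v \<pi> res"

lemma pi: "\<pi> \<in> E" "\<pi> \<noteq> 0" "v \<pi> = 1"
  using unif by (auto simp: is_uniformiser_def)

lemma C: "is_subfield C" "C \<subseteq> E" "k \<subseteq> C" "X \<subseteq> C"
  unfolding C_eq using X k_E field_gen_subset[of "k \<union> X" E] E by (auto simp: subfield_hull intro: field_gen_inc)

text \<open>The set of which the shift is the minimum is nonempty because \<open>t 1\<close> is not
  a constant.\<close>

lemma shift_attained: "\<exists>h\<in>E. D h \<noteq> 0 \<and> v (D h) - v h = s"
  and shift_least: "\<And>h. h \<in> E \<Longrightarrow> D h \<noteq> 0 \<Longrightarrow> s \<le> v (D h) - v h"
proof -
  let ?P = "\<lambda>s. \<exists>h\<in>E. D h \<noteq> 0 \<and> s = v (D h) - v h"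
  have "1 \<in> {1..ngen T}" using nlow by auto
  then have P: "?P (v (D (t 1)) - v (t 1))" using gen_E D_gen_nz by blast
  obtain b where "\<And>s. ?P s \<Longrightarrow> b \<le> s" using bound by blast
  from int_Least[of ?P, OF P this]
  show "\<exists>h\<in>E. D h \<noteq> 0 \<and> v (D h) - v h = s" "\<And>h. h \<in> E \<Longrightarrow> D h \<noteq> 0 \<Longrightarrow> s \<le> v (D h) - v h"
    unfolding shift_def shift_at_def by (metis, metis)
qed

lemma vge_D: "x \<in> E \<Longrightarrow> vge n x \<Longrightarrow> vge (s + n) (D x)"
  using shift_least[of x] by (cases "x = 0"; cases "D x = 0") (auto simp: vge_def)

lemma pis: "\<pi> powi m \<in> E" "\<pi> powi m \<noteq> 0" "v (\<pi> powi m) = m"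
  using pi by (auto simp: subfield_powi[OF E] v_powi)

lemma vge_pis: "x \<in> E \<Longrightarrow> vge (n + m) x \<Longrightarrow> vge n (\<pi> powi (- m) * x)"
  using vge_mult[of "\<pi> powi (- m)" x "- m" "n + m"] pis[of "- m"] by (simp add: vge_def[of "- m"])

lemma scaled_D: "x \<in> E \<Longrightarrow> vge n x \<Longrightarrow> vge n (\<pi> powi (- s) * D x) \<and> \<pi> powi (- s) * D x \<in> E"
  using vge_pis[of "D x" n s] vge_D[of x n] D_in[of x] pis subfield_mult[OF E] by (simp add: add.commute)

lemma res_1 [simp]: "res 1 = 1"
  using res by (simp add: is_residue_map_def)

lemma res_add: "x \<in> E \<Longrightarrow> y \<in> E \<Longrightarrow> vge 0 x \<Longrightarrow> vge 0 y \<Longrightarrow> res (x + y) = res x + res y"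
  and res_mult: "x \<in> E \<Longrightarrow> y \<in> E \<Longrightarrow> vge 0 x \<Longrightarrow> vge 0 y \<Longrightarrow> res (x * y) = res x * res y"
  and res_eq_0: "x \<in> E \<Longrightarrow> vge 0 x \<Longrightarrow> res x = 0 \<longleftrightarrow> vge 1 x"
  using res by (auto simp: is_residue_map_def val_ring_iff val_ideal_iff)

lemma res_0 [simp]: "res 0 = 0"
  using res_add[of 0 0] subfield_0[OF E] by simp

lemma res_minus: "x \<in> E \<Longrightarrow> vge 0 x \<Longrightarrow> res (- x) = - res x"
  using res_add[of x "- x"] subfield_minus[OF E] vge_minus by (simp add: add_eq_0_iff)

lemma res_diff: "x \<in> E \<Longrightarrow> y \<in> E \<Longrightarrow> vge 0 x \<Longrightarrow> vge 0 y \<Longrightarrow> res (x - y) = res x - res y"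
  using res_add[of x "- y"] res_minus[of y] subfield_minus[OF E] vge_minus by simp

lemma res_eq: "x \<in> E \<Longrightarrow> y \<in> E \<Longrightarrow> vge 0 x \<Longrightarrow> vge 0 y \<Longrightarrow> res x = res y \<longleftrightarrow> vge 1 (x - y)"
  using res_diff[of x y] res_eq_0[of "x - y"] subfield_diff[OF E] vge_diff[of x y 0] by simp

lemma in_kappa: "x \<in> E \<Longrightarrow> vge 0 x \<Longrightarrow> res x \<in> \<kappa>"
  by (auto simp: kappa_def val_ring_iff)

lemma kappaE: assumes "y \<in> \<kappa>" obtains x where "x \<in> E" "vge 0 x" "y = res x"
  using assms by (auto simp: kappa_def val_ring_iff)

text \<open>The scaled derivation maps the maximal ideal into itself, so the representative picked
  by \<open>inv_into\<close> may be replaced by any other.\<close>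

lemma del_res: assumes x: "x \<in> E" "vge 0 x" shows "del' (res x) = res (\<pi> powi (- s) * D x)"
proof -
  let ?y = "inv_into (val_ring E v) res (res x)"
  have "res x \<in> res ` val_ring E v" using x by (simp add: val_ring_iff)
  then have y: "?y \<in> E" "vge 0 ?y" "res ?y = res x"
    using inv_into_into[of "res x" res "val_ring E v"] f_inv_into_f[of "res x" res "val_ring E v"]
    by (auto simp: val_ring_iff)
  have "vge 1 (?y - x)" using res_eq[of ?y x] x y by simp
  then have "vge 1 (\<pi> powi (- s) * D (?y - x))" using scaled_D x y subfield_diff[OF E] by blast
  also have "\<pi> powi (- s) * D (?y - x) = \<pi> powi (- s) * D ?y - \<pi> powi (- s) * D x"
    using x y by (simp add: D_diff algebra_simps)
  finally show ?thesis unfolding del_def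
    using res_eq scaled_D[of ?y 0] scaled_D[of x 0] x y by blast
qed

lemma vge_C: "c \<in> C \<Longrightarrow> vge 0 c"
  using triv[of c] by (cases "c = 0") (auto simp: vge_def)

lemma C_E: "c \<in> C \<Longrightarrow> c \<in> E"
  using C(2) by blast

lemma res_inj:
  assumes "c \<in> C" "d \<in> C" "res c = res d" shows "c = d"
proof (rule ccontr)
  assume "c \<noteq> d"
  then have "v (c - d) = 0" using triv[of "c - d"] subfield_diff[OF C(1) assms(1,2)] by simp
  moreover have "vge 1 (c - d)" using assms res_eq C_E vge_C by blast
  ultimately show False using \<open>c \<noteq> d\<close> by (simp add: vge_def)
qed

lemma kappa_C: "\<kappa> = res ` C"
proof
  show "\<kappa> \<subseteq> res ` C"
  proof
    fix y assume "y \<in> \<kappa>"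
    then obtain x where x: "x \<in> E" "vge 0 x" "y = res x" by (rule kappaE)
    then obtain c where c: "c \<in> C" "vge 1 (x - c)" using cover by blast
    then have "res x = res c" using res_eq x C vge_C by blast
    then show "y \<in> res ` C" using x c by simp
  qed
  show "res ` C \<subseteq> \<kappa>" using C vge_C in_kappa by blast
qed

lemma res_C: "c \<in> C \<Longrightarrow> d \<in> C \<Longrightarrow> res (c + d) = res c + res d \<and> res (c * d) = res c * res d"
  by (simp add: res_add res_mult C_E vge_C)

lemma res_inverse: assumes "c \<in> C" shows "res (inverse c) = inverse (res c)"
proof (cases "c = 0")
  case False
  then have "res c * res (inverse c) = 1" using res_C[of c "inverse c"] assms subfield_inverse[OF C(1)] by simp
  then show ?thesis by (metis inverse_unique)
qed simp

lemma kappa_subfield: "is_subfield \<kappa>"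
  unfolding is_subfield_def is_subring_def
proof (intro conjI ballI)
  show "0 \<in> \<kappa>" using in_kappa[OF subfield_0[OF E] vge_0] by (simp only: res_0)
  have "vge 0 1" by (simp add: vge_def)
  from in_kappa[OF subfield_1[OF E] this] show "1 \<in> \<kappa>" by (simp only: res_1)
  fix x assume "x \<in> \<kappa>" then obtain a where a: "a \<in> C" "x = res a" using kappa_C by auto
  show "- x \<in> \<kappa>" using a res_minus[of a] C_E vge_C subfield_minus[OF C(1) a(1)] kappa_C by (metis imageI)
  show "inverse x \<in> \<kappa>" using a res_inverse[OF a(1)] subfield_inverse[OF C(1) a(1)] kappa_C by (metis imageI)
  fix y assume "y \<in> \<kappa>" then obtain b where b: "b \<in> C" "y = res b" using kappa_C by auto
  show "x + y \<in> \<kappa>" using res_C[OF a(1) b(1)] a b subfield_add[OF C(1) a(1) b(1)] kappa_C by (metis imageI)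
  show "x * y \<in> \<kappa>" using res_C[OF a(1) b(1)] a b subfield_mult[OF C(1) a(1) b(1)] kappa_C by (metis imageI)
qed

lemma del_derivation: "is_derivation_on \<kappa> del'"
  unfolding is_derivation_on_def
proof (intro conjI ballI)
  fix x assume "x \<in> \<kappa>" then obtain a where a: "a \<in> E" "vge 0 a" "x = res a" by (rule kappaE)
  let ?p = "\<pi> powi (- s)"
  have p: "?p \<in> E" using pis by blast
  have a': "vge 0 (?p * D a)" "?p * D a \<in> E" using scaled_D[OF a(1,2)] by auto
  show "del' x \<in> \<kappa>" unfolding a(3) del_res[OF a(1,2)] using a' by (simp add: in_kappa)
  fix y assume "y \<in> \<kappa>" then obtain b where b: "b \<in> E" "vge 0 b" "y = res b" by (rule kappaE)
  have b': "vge 0 (?p * D b)" "?p * D b \<in> E" using scaled_D[OF b(1,2)] by auto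
  have ab: "a + b \<in> E" "vge 0 (a + b)" "a * b \<in> E" "vge 0 (a * b)"
    using a b vge_add vge_mult_0 subfield_add[OF E] subfield_mult[OF E] by auto
  have "del' (x + y) = res (?p * D a + ?p * D b)"
    using res_add[OF a(1) b(1) a(2) b(2)] del_res[OF ab(1,2)] a b by (simp add: D_add algebra_simps)
  also have "\<dots> = del' x + del' y" using res_add a' b' del_res a b by metis
  finally show "del' (x + y) = del' x + del' y" .
  have "del' (x * y) = res (?p * D a * b + a * (?p * D b))"
    using res_mult[OF a(1) b(1) a(2) b(2)] del_res[OF ab(3,4)] a b by (simp add: D_mult algebra_simps)
  also have "\<dots> = res (?p * D a * b) + res (a * (?p * D b))"
    using a a' b b' vge_mult_0[of "?p * D a" b 0] vge_mult_0[of a "?p * D b" 0] subfield_mult[OF E]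
    by (intro res_add) auto
  also have "\<dots> = res (?p * D a) * res b + res a * res (?p * D b)"
    using a a' b b' by (simp add: res_mult)
  finally show "del' (x * y) = del' x * y + x * del' y" using del_res a b by metis
qed

sublocale kap: diff_field \<kappa> del'
  by unfold_locales (fact kappa_subfield del_derivation)+

lemma consts_del: "kap.consts_D = del_consts T v \<pi> res"
  by (simp add: del_consts_def)

lemma del_k: assumes "c \<in> k" shows "del' (res c) = 0"
  using del_res[of c] assms D_k C(3) C_E vge_C by (simp add: subset_iff)

lemma res_k_closed: "alg_closed (res ` k)"
  using res_C C(3) by (intro alg_closed_hom_image[OF k_closed]) auto

lemma res_k_kappa: "res ` k \<subseteq> \<kappa>"
  using kappa_C C(3) by (simp add: image_mono)

lemma kappa_gen: "\<kappa> = field_gen (res ` k \<union> res ` X)"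
proof
  let ?F = "field_gen (res ` k \<union> res ` X)"
  note c = subfield_closed[OF subfield_hull[of "res ` k \<union> res ` X"]]
  let ?S = "{c\<in>C. res c \<in> ?F}"
  have "is_subfield ?S"
    unfolding is_subfield_def[of ?S] is_subring_def[of ?S]
  proof (intro conjI ballI)
    show "0 \<in> ?S" "1 \<in> ?S" using c(1,2) subfield_closed(1,2)[OF C(1)] by auto
    fix x assume x: "x \<in> ?S"
    then show "- x \<in> ?S" using res_minus[of x] C_E vge_C subfield_minus[OF C(1)] c(5) by auto
    show "inverse x \<in> ?S" using x res_inverse[of x] subfield_inverse[OF C(1)] c(8) by auto
    fix y assume y: "y \<in> ?S"
    show "x + y \<in> ?S" using x y res_C[of x y] subfield_add[OF C(1)] c(3) by auto
    show "x * y \<in> ?S" using x y res_C[of x y] subfield_mult[OF C(1)] c(4) by auto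
  qed
  moreover have "k \<union> X \<subseteq> ?S" using C(3,4) by (auto intro: field_gen_inc)
  ultimately have "field_gen (k \<union> X) \<subseteq> ?S" by (rule field_gen_subset[rotated])
  then have "C \<subseteq> ?S" using C_eq by simp
  then show "\<kappa> \<subseteq> ?F" unfolding kappa_C by auto
  show "?F \<subseteq> \<kappa>" using res_k_kappa C kappa_C by (intro field_gen_subset[OF _ kappa_subfield]) auto
qed

text \<open>For an element of the valuation ring the derivative has value at least the shift; not
  attaining makes this strict, so the scaled derivative has residue 0.\<close>

lemma del_nonattaining:
  assumes "x \<in> C" "\<not> attains T v x" shows "del' (res x) = 0"
proof -
  have x: "x \<in> E" "vge 0 x" using assms C vge_C by auto
  have "vge s (D x)" using vge_D[OF x] by simp
  then have "vge (1 + s) (D x)" using assms(2) by (auto simp: attains_def vge_def)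
  then have "vge 1 (\<pi> powi (- s) * D x)" using vge_pis[of "D x" 1 s] x by auto
  then show ?thesis using del_res[OF x] res_eq_0 scaled_D[OF x] by simp
qed

lemma NN_0: "0 \<in> NN T v \<pi> res"
  unfolding NN_def using kap.D_1 subfield_1[OF kappa_subfield] by (auto intro!: bexI[of _ 1])

lemma NN_trivial:
  assumes I: "finite I" and \<mu>: "\<And>i. i \<in> I \<Longrightarrow> \<mu> i \<in> del_consts T v \<pi> res"
    and \<rho>: "\<rho> \<in> del_consts T v \<pi> res" and nr: "\<not> rat_combination I \<mu> \<rho>"
    and gens: "\<And>x. x \<in> X \<Longrightarrow> del' (res x) \<in> del_consts T v \<pi> res \<or> (\<exists>i\<in>I. del' (res x) = \<mu> i * res x)"
  shows "NN T v \<pi> res = {0}"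
proof -
  have "a = 0" if aN: "a \<in> NN T v \<pi> res" for a
  proof (rule ccontr)
    assume a: "a \<noteq> 0"
    obtain c where c: "c \<in> \<kappa>" "c \<noteq> 0" "del' c = - of_int a * \<rho> * c" using aN by (auto simp: NN_def)
    \<comment> \<open>The weights of products of generators. Natural multiples suffice, since
      numerator and denominator of an eigenvector are polynomials in the generators.\<close>
    define \<Gamma> where "\<Gamma> = {\<Sum>i\<in>I. of_nat (n i) * \<mu> i |n :: _ \<Rightarrow> nat. True}"
    define G where "G \<beta> = {x\<in>\<kappa>. kap.gev \<beta> x}" for \<beta>
    note cs = subfield_closed[OF kap.subfield_constants, unfolded consts_del]
    have \<Gamma>c: "\<Gamma> \<subseteq> del_consts T v \<pi> res" unfolding \<Gamma>_def using \<mu> cs(10)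
      by (auto intro!: subfield_sum[OF kap.subfield_constants, unfolded consts_del] cs(4))
    have \<Gamma>0: "0 \<in> \<Gamma>" unfolding \<Gamma>_def by (intro CollectI exI[of _ "\<lambda>_. 0"]) simp
    have \<Gamma>add: "\<beta> + \<gamma> \<in> \<Gamma>" if bg: "\<beta> \<in> \<Gamma>" "\<gamma> \<in> \<Gamma>" for \<beta> \<gamma>
    proof -
      obtain n m where "\<beta> = (\<Sum>i\<in>I. of_nat (n i) * \<mu> i)" "\<gamma> = (\<Sum>i\<in>I. of_nat (m i) * \<mu> i)"
        using bg unfolding \<Gamma>_def by auto
      then have "\<beta> + \<gamma> = (\<Sum>i\<in>I. of_nat (n i + m i) * \<mu> i)" by (simp add: sum.distrib algebra_simps)
      then show ?thesis unfolding \<Gamma>_def by (intro CollectI exI[of _ "\<lambda>i. n i + m i"]) simp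
    qed
    have ck: "del_consts T v \<pi> res \<subseteq> \<kappa>" by (auto simp: del_consts_def)
    have gev0: "kap.gev 0 x" if "del' x = 0" for x using kap.gev_eigen[of x 0] that by simp
    have \<alpha>: "- of_int a * \<rho> \<in> del_consts T v \<pi> res" using cs(4,5,11) \<rho> by blast
    obtain \<beta> where \<beta>: "\<beta> \<in> \<Gamma>" "- of_int a * \<rho> + \<beta> \<in> \<Gamma>"
    proof (rule kap.eigenvector_quotient[of \<Gamma> G "res ` k \<union> res ` X" c "- of_int a * \<rho>"])
      show "\<Gamma> \<subseteq> kap.consts_D" using \<Gamma>c consts_del by simp
      show "\<And>\<beta> x. \<beta> \<in> \<Gamma> \<Longrightarrow> x \<in> G \<beta> \<Longrightarrow> x \<in> \<kappa> \<and> kap.gev \<beta> x" by (simp add: G_def)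
      show "0 \<in> G \<beta>" for \<beta> using subfield_0[OF kappa_subfield] by (simp add: G_def)
      show "1 \<in> G 0" "-1 \<in> G 0" using subfield_1[OF kappa_subfield] subfield_minus[OF kappa_subfield]
          kap.D_minus[of 1] by (auto simp: G_def gev0)
      show "x + y \<in> G \<beta>" if "\<beta> \<in> \<Gamma>" "x \<in> G \<beta>" "y \<in> G \<beta>" for \<beta> x y
        using that kap.gev_add[of \<beta> x y] \<Gamma>c ck subfield_add[OF kappa_subfield] by (auto simp: G_def)
      show "x * y \<in> G (\<beta> + \<gamma>)" if "\<beta> \<in> \<Gamma>" "\<gamma> \<in> \<Gamma>" "x \<in> G \<beta>" "y \<in> G \<gamma>" for \<beta> \<gamma> x y
        using that kap.gev_mult[of \<beta> \<gamma> x y] \<Gamma>c ck subfield_mult[OF kappa_subfield] by (auto simp: G_def)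
      show "\<exists>\<beta>\<in>\<Gamma>. x \<in> G \<beta>" if xX: "x \<in> res ` k \<union> res ` X" for x
      proof -
        have xk: "x \<in> \<kappa>" using xX res_k_kappa kappa_C C by auto
        consider "del' x = 0" | "del' x \<in> del_consts T v \<pi> res" | i where "i \<in> I" "del' x = \<mu> i * x"
          using xX del_k gens by blast
        then show ?thesis
        proof cases
          case 1 then show ?thesis using \<Gamma>0 xk gev0 by (auto simp: G_def)
        next
          case 2
          \<comment> \<open>Such a generator need not be an eigenvector, but it is killed by
            applying \<open>del'\<close> twice; this case is the reason for working with generalised
            eigenvectors.\<close>
          then have "del' (del' x) = 0" by (simp add: del_consts_def)
          then have "kap.gev 0 x" unfolding kap.gev_def by (intro exI[of _ 2]) (simp add: numeral_2_eq_2 kap.op_def)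
          then show ?thesis using \<Gamma>0 xk by (auto simp: G_def)
        next
          case 3
          have "(\<Sum>j\<in>I. of_nat (if j = i then 1 else 0) * \<mu> j) = (\<Sum>j\<in>I. if j = i then \<mu> j else 0)"
            by (rule sum.cong) auto
          then have "\<mu> i = (\<Sum>j\<in>I. of_nat (if j = i then 1 else 0) * \<mu> j)" using 3 I by simp
          then have "\<mu> i \<in> \<Gamma>" unfolding \<Gamma>_def
            by (intro CollectI exI[of _ "\<lambda>j. if j = i then 1 else 0"]) simp
          then show ?thesis using 3 xk kap.gev_eigen by (auto simp: G_def)
        qed
      qed
      show "c \<in> field_gen (res ` k \<union> res ` X)" using c kappa_gen by simp
      show "- of_int a * \<rho> \<in> kap.consts_D" using \<alpha> consts_del by simp
      show "kap.gev (- of_int a * \<rho>) c" using c by (intro kap.gev_eigen) simp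
    qed (use c \<Gamma>0 \<Gamma>add in auto)
    then obtain n m where nm: "\<beta> = (\<Sum>i\<in>I. of_nat (n i) * \<mu> i)" "- of_int a * \<rho> + \<beta> = (\<Sum>i\<in>I. of_nat (m i) * \<mu> i)"
      unfolding \<Gamma>_def by auto
    have "of_int a * \<rho> = (\<Sum>i\<in>I. of_nat (n i) * \<mu> i) - (\<Sum>i\<in>I. of_nat (m i) * \<mu> i)"
      using nm by (simp add: algebra_simps)
    then have "\<rho> = ((\<Sum>i\<in>I. of_nat (n i) * \<mu> i) - (\<Sum>i\<in>I. of_nat (m i) * \<mu> i)) / of_int a"
      using a by (simp add: field_simps)
    \<comment> \<open>The integral relation between \<open>\<rho>\<close> and the
      \<open>\<mu> i\<close> becomes a rational one on division by the nonzero
      \<open>a\<close>.\<close>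
    also have "\<dots> = (\<Sum>i\<in>I. of_rat ((of_nat (n i) - of_nat (m i)) / of_int a) * \<mu> i)"
      by (simp add: of_rat_divide of_rat_diff sum_divide_distrib sum_subtractf diff_divide_distrib algebra_simps)
    finally have "rat_combination I \<mu> \<rho>" unfolding rat_combination_def by (intro exI)
    with nr show False by blast
  qed
  with NN_0 show ?thesis by blast
qed

lemma first_kernel_of_NN: "excess T v \<pi> = 0 \<Longrightarrow> NN T v \<pi> res = {0} \<Longrightarrow> first_kernel_hyp T v \<pi> res"
  by (simp add: first_kernel_hyp_def)

lemma K1_kernel:
  assumes Ckd: "C = coeff_field T kd" and Xkd: "X \<subseteq> generators T kd - place_generators T kd"
    and shape: "attaining_shape T kd v \<pi> res \<mu>"
    and co: "attaining_coeffs_in (del_consts T v \<pi> res) T kd v \<pi> res \<mu>"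
    and nr: "\<not> rat_combination (attaining_hyper T kd v) \<mu> (rho T v \<pi> res)"
  shows "NN T v \<pi> res = {0}"
proof (rule NN_trivial[OF _ _ _ nr])
  show "finite (attaining_hyper T kd v)" unfolding attaining_hyper_def using finite_upper by simp
  show "\<And>i. i \<in> attaining_hyper T kd v \<Longrightarrow> \<mu> i \<in> del_consts T v \<pi> res" "\<rho> \<in> del_consts T v \<pi> res"
    using co by (auto simp: attaining_coeffs_in_def)
  fix x assume x: "x \<in> X"
  show "del' (res x) \<in> del_consts T v \<pi> res \<or> (\<exists>i\<in>attaining_hyper T kd v. del' (res x) = \<mu> i * res x)"
  proof (cases "attains T v x")
    case True
    have xC: "x \<in> coeff_field T kd" using x C Ckd by auto
    obtain i where i: "i \<in> upper T" "x = t i" "primitive T i \<or>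
            hyperexponential T i \<and> lam T v \<pi> res i = \<mu> i * res (t i) \<and> \<mu> i \<noteq> 0"
      using shape True x Xkd unfolding attaining_shape_def by blast
    from i(3) show ?thesis
    proof
      assume "primitive T i"
      then have "i \<in> attaining_prim T kd v" using i True xC by (simp add: attaining_prim_def)
      then have "lam T v \<pi> res i \<in> del_consts T v \<pi> res" using co by (auto simp: attaining_coeffs_in_def)
      then show ?thesis using i by (simp add: lam_def)
    next
      assume h: "hyperexponential T i \<and> lam T v \<pi> res i = \<mu> i * res (t i) \<and> \<mu> i \<noteq> 0"
      then have "i \<in> attaining_hyper T kd v" using i True xC by (simp add: attaining_hyper_def)
      then show ?thesis using i h by (auto simp: lam_def)
    qed
  next
    case False
    have "x \<in> C" using x C by auto
    then show ?thesis using del_nonattaining False subfield_0[OF kap.subfield_constants] consts_del by auto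
  qed
qed

lemma nonattaining_field_consts:
  assumes Ckd: "C = coeff_field T kd"
  shows "nonattaining_field T kd v res \<subseteq> del_consts T v \<pi> res"
  unfolding nonattaining_field_def
proof (rule field_gen_subset)
  show "is_subfield (del_consts T v \<pi> res)" using kap.subfield_constants consts_del by simp
  show "res ` Fb T \<union> {res (t i) |i. i \<in> {1..ngen T} \<and> t i \<in> coeff_field T kd \<and> \<not> attains T v (t i)}
    \<subseteq> del_consts T v \<pi> res"
    using del_k res_k_kappa del_nonattaining kappa_C Ckd by (auto simp: del_consts_def)
qed

end

section \<open>Rational places over the field of the other variables\<close>

context tower
begin

abbreviation "other_gens i \<equiv> t ` {1..nlow T} \<union> {radical T} \<union> t ` (upper T - {i})"

lemma C_upper_eq: "C_upper T i = field_gen (k \<union> other_gens i)"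
proof -
  have "C_upper T i = field_gen ((k \<union> t ` {1..nlow T} \<union> {radical T}) \<union> t ` (upper T - {i}))"
    unfolding C_upper_def K_eq by (rule field_gen_insert_absorb)
  then show ?thesis by (simp only: Un_assoc)
qed

lemma other_gens_E: "other_gens i \<subseteq> E"
  using K_gens K0y_K K_E gen_E upper_index by blast

text \<open>Since \<open>v\<close> is trivial on \<open>C\<close>, products and inverses do not
  worsen a lower bound for the derivative: the elements of \<open>C\<close> obeying it form a
  subfield, so the bound may be read off the generators.\<close>

lemma gen_D_bound:
  assumes "is_subfield C" "C = field_gen (k \<union> X)" "finite X" "X \<subseteq> E" "C \<subseteq> E"
    and "valued_field E v" and triv: "\<And>c. c \<in> C \<Longrightarrow> c \<noteq> 0 \<Longrightarrow> v c = 0"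
  shows "\<exists>M. \<forall>c\<in>C. valued_field.vge v M (D c)"
proof -
  interpret valued_field E v by fact
  \<comment> \<open>0 is inserted so that the minimum is taken over a nonempty set.\<close>
  define M where "M = Min (insert 0 ((\<lambda>x. v (D x)) ` X))"
  have MX: "vge M (D x)" if "x \<in> X" for x
    unfolding vge_def M_def using that assms(3) by (intro disjI2 Min_le) auto
  have vC: "vge 0 c" if "c \<in> C" for c using triv[OF that] by (cases "c = 0") (auto simp: vge_def)
  let ?S = "{c\<in>C. vge M (D c)}"
  have CE: "c \<in> E" if "c \<in> C" for c using that assms(5) by blast
  have "is_subfield ?S"
    unfolding is_subfield_def[of ?S] is_subring_def[of ?S]
  proof (intro conjI ballI)
    note c = subfield_closed[OF assms(1)]
    show "0 \<in> ?S" "1 \<in> ?S" using c(1,2) by auto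
    fix x assume x: "x \<in> ?S"
    then show "- x \<in> ?S" using c(5) CE D_minus[of x] vge_minus[of "D x"] by auto
    have "vge M (- D x * inverse (x\<^sup>2))"
      using x CE vge_mult_0[of "inverse (x\<^sup>2)" "- D x" M] vC[OF c(8)[OF c(7)], of x] c(8)[OF c(7), of x]
        vge_minus[of "D x"] subfield_minus[OF E] D_in[of x] by (auto simp: mult.commute)
    then show "inverse x \<in> ?S" using x c(8)[of x] D_inverse[of x] CE by (auto simp: divide_inverse)
    fix y assume y: "y \<in> ?S"
    show "x + y \<in> ?S" using x y c(3) D_add[of x y] vge_add[of "D x" "D y"] CE D_in by simp
    have "vge M (D x * y + x * D y)"
      using x y CE vC vge_mult_0[of y "D x" M] vge_mult_0[of x "D y" M] D_in subfield_mult[OF E]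
      by (intro vge_add) (auto simp: mult.commute)
    then show "x * y \<in> ?S" using x y c(4) D_mult[of x y] CE by auto
  qed
  moreover have "k \<union> X \<subseteq> ?S" using MX D_k assms(2) by (auto intro: field_gen_inc)
  ultimately have "C \<subseteq> ?S" unfolding assms(2) by (rule field_gen_subset[rotated])
  then show ?thesis by blast
qed

end

text \<open>Serves twice: with \<open>C = C_upper T i\<close>, where C and \<open>\<tau>\<close>
  generate the whole field, and with \<open>C = Fb T\<close> and a uniformiser of the curve, where
  they generate only a rational subfield.\<close>

locale simple_place = tower T + valued_field "FbL T" v
  for T :: "'a::field_char_0 tower" and v +
  fixes C :: "'a set" and \<tau> :: 'a
  assumes subC: "is_subfield C" "C \<subseteq> FbL T" and trivC: "\<And>c. c \<in> C \<Longrightarrow> c \<noteq> 0 \<Longrightarrow> v c = 0"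
    and \<tau>: "\<tau> \<in> FbL T" "\<tau> \<noteq> 0" "v \<tau> = 1"
begin

lemma C_E: "c \<in> C \<Longrightarrow> c \<in> E"
  using subC by blast

lemma vge_C: "c \<in> C \<Longrightarrow> vge 0 c"
  using trivC[of c] by (cases "c = 0") (auto simp: vge_def)

lemma tau_vge: "vge 0 \<tau>" "vge 1 \<tau>"
  using \<tau> by (auto simp: vge_def)

definition D_bounded :: "int \<Rightarrow> bool" where
  "D_bounded M \<longleftrightarrow> (\<forall>c\<in>C. vge M (D c)) \<and> vge M (D \<tau>)"

lemma D_prod_vge:
  assumes "x \<in> E" "y \<in> E" "vge 0 x" "vge 0 y" "vge M (D x)" "vge M (D y)" shows "vge M (D (x * y))"
  using assms vge_mult_0[of y "D x" M] vge_mult_0[of x "D y" M] D_in subfield_mult[OF E]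
  by (auto simp: D_mult mult.commute intro!: vge_add)

lemma poly_tau:
  assumes "p \<in> polys_over C"
  shows "poly p \<tau> \<in> E" "vge 0 (poly p \<tau>)" "D_bounded M \<Longrightarrow> vge M (D (poly p \<tau>))"
proof -
  have "poly p \<tau> \<in> E \<and> vge 0 (poly p \<tau>) \<and> (D_bounded M \<longrightarrow> vge M (D (poly p \<tau>)))"
    using assms
  proof (induction p)
    case (pCons c p)
    then have c: "c \<in> C" "p \<in> polys_over C" by (auto dest: polys_over_pConsD)
    note IH = pCons.IH[OF c(2)]
    have m: "\<tau> * poly p \<tau> \<in> E" "vge 0 (\<tau> * poly p \<tau>)"
      using IH \<tau> subfield_mult[OF E] vge_mult_0[OF \<tau>(1) _ tau_vge(1)] by auto
    have 1: "c + \<tau> * poly p \<tau> \<in> E" using m C_E[OF c(1)] subfield_add[OF E] by blast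
    have 2: "vge 0 (c + \<tau> * poly p \<tau>)" using vge_add[OF C_E[OF c(1)] m(1) vge_C[OF c(1)] m(2)] .
    have 3: "vge M (D (c + \<tau> * poly p \<tau>))" if DB: "D_bounded M"
    proof -
      have "vge M (D (\<tau> * poly p \<tau>))" using IH DB \<tau> tau_vge by (intro D_prod_vge) (auto simp: D_bounded_def)
      then show ?thesis unfolding D_add[OF C_E[OF c(1)] m(1)]
        using DB c m C_E[OF c(1)] by (intro vge_add D_in) (auto simp: D_bounded_def)
    qed
    show ?case using 1 2 3 by simp
  qed (auto simp: subfield_0[OF E])
  then show "poly p \<tau> \<in> E" "vge 0 (poly p \<tau>)" "D_bounded M \<Longrightarrow> vge M (D (poly p \<tau>))" by auto
qed

text \<open>What is left of an element after a power of \<open>\<tau>\<close> is split off. Besides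
  having value 0, it is differentiated no worse than the generators, and its residue is represented
  by a nonzero element of \<open>C\<close>; all of this passes to quotients.\<close>

definition unit_dec :: "'a \<Rightarrow> bool" where
  "unit_dec u \<longleftrightarrow> u \<in> E \<and> u \<noteq> 0 \<and> v u = 0 \<and> (\<forall>M. D_bounded M \<longrightarrow> vge M (D u)) \<and>
     (\<exists>c\<in>C. c \<noteq> 0 \<and> vge 1 (u - c))"

text \<open>The power of \<open>\<tau>\<close> counts the vanishing lowest coefficients, and the
  first nonzero coefficient represents the residue of the unit.\<close>

lemma poly_dec:
  assumes "p \<in> polys_over C" "p \<noteq> 0"
  shows "\<exists>n u. poly p \<tau> = \<tau> ^ n * u \<and> unit_dec u"
  using assms
proof (induction p)
  case (pCons c p)
  then have c: "c \<in> C" "p \<in> polys_over C" by (auto dest: polys_over_pConsD)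
  show ?case
  proof (cases "c = 0")
    case True
    then have "p \<noteq> 0" using pCons by auto
    then obtain n u where "poly p \<tau> = \<tau> ^ n * u" "unit_dec u" using pCons.IH c by blast
    then show ?thesis using True by (intro exI[of _ "Suc n"] exI[of _ u]) simp
  next
    case False
    have p: "poly p \<tau> \<in> E" "vge 0 (poly p \<tau>)" using poly_tau[OF c(2)] by auto
    have m: "\<tau> * poly p \<tau> \<in> E" "vge 1 (\<tau> * poly p \<tau>)"
      using p \<tau> subfield_mult[OF E] vge_mult[OF \<tau>(1) p(1) tau_vge(2) p(2)] by auto
    have "v c = 0" using trivC[OF c(1) False] .
    then have u: "c + \<tau> * poly p \<tau> \<noteq> 0" "v (c + \<tau> * poly p \<tau>) = 0"
      using v_add_lt[OF C_E[OF c(1)] m(1) False] m(2) by auto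
    have "unit_dec (poly (pCons c p) \<tau>)"
      unfolding unit_dec_def using poly_tau[OF pCons.prems(1)] u c(1) False m(2)
      by (auto intro!: bexI[of _ c])
    then show ?thesis by (intro exI[of _ 0] exI[of _ "poly (pCons c p) \<tau>"]) simp
  qed
qed simp

lemma unit_dec_divide:
  assumes "unit_dec u" "unit_dec w" shows "unit_dec (u / w)"
proof -
  obtain c d where c: "c \<in> C" "c \<noteq> 0" "vge 1 (u - c)" and d: "d \<in> C" "d \<noteq> 0" "vge 1 (w - d)"
    using assms by (auto simp: unit_dec_def)
  have u: "u \<in> E" "u \<noteq> 0" "v u = 0" and w: "w \<in> E" "w \<noteq> 0" "v w = 0" using assms by (auto simp: unit_dec_def)
  have vg: "vge 0 u" "vge 0 w" using u w by (auto simp: vge_def)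
  have "vge M (D (u / w))" if M: "D_bounded M" for M
  proof -
    have D: "vge M (D u)" "vge M (D w)" using assms M by (auto simp: unit_dec_def)
    have "vge M (D u * w - u * D w)"
      using vge_mult_0[OF w(1) D_in[OF u(1)] vg(2) D(1)] vge_mult_0[OF u(1) D_in[OF w(1)] vg(1) D(2)]
        u w subfield_mult[OF E] D_in by (intro vge_diff) (auto simp: mult.commute)
    then have "vge (M - v (w\<^sup>2)) ((D u * w - u * D w) / w\<^sup>2)"
      using u w by (intro vge_divide subfield_diff[OF E] subfield_mult[OF E] subfield_power[OF E] D_in) auto
    then show ?thesis using u w by (simp add: D_divide v_power)
  qed
  moreover have "vge 1 (u / w - c / d)"
  proof -
    have e: "u / w - c / d = ((u - c) * d - c * (w - d)) / (w * d)"
      using w(2) d(2) by (simp add: field_simps)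
    have E': "c \<in> E" "d \<in> E" "u - c \<in> E" "w - d \<in> E" using c d u w C_E subfield_diff[OF E] by auto
    have "vge 1 ((u - c) * d - c * (w - d))"
      using vge_mult_0[OF E'(2,3) vge_C[OF d(1)] c(3)] vge_mult_0[OF E'(1,4) vge_C[OF c(1)] d(3)] E' subfield_mult[OF E]
      by (intro vge_diff) (auto simp: mult.commute)
    then have "vge (1 - v (w * d)) (((u - c) * d - c * (w - d)) / (w * d))"
      using E' u w d by (intro vge_divide subfield_diff[OF E] subfield_mult[OF E]) auto
    moreover have "v (w * d) = 0" using v_mult[OF w(1) E'(2) w(2) d(2)] w trivC d by simp
    ultimately show ?thesis using e by simp
  qed
  ultimately show ?thesis unfolding unit_dec_def using u w c d v_divide[of u w]
    by (auto intro!: bexI[of _ "c / d"] subfield_divide[OF E] subfield_divide[OF subC(1)])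
qed

lemma adjoin_dec:
  assumes "x \<in> field_gen (C \<union> {\<tau>})" "x \<noteq> 0"
  obtains n u where "x = \<tau> powi n * u" "unit_dec u" "v x = n"
proof -
  obtain p q where pq: "p \<in> polys_over C" "q \<in> polys_over C" "poly q \<tau> \<noteq> 0" "x = poly p \<tau> / poly q \<tau>"
    by (rule field_gen_adjoin[OF subfield_subring[OF subC(1)] assms(1)])
  then have "p \<noteq> 0" "q \<noteq> 0" using assms(2) by auto
  then obtain n u m w where d: "poly p \<tau> = \<tau> ^ n * u" "unit_dec u" "poly q \<tau> = \<tau> ^ m * w" "unit_dec w"
    using poly_dec pq by meson
  have "x = \<tau> powi (int n - int m) * (u / w)"
    using pq d \<tau> by (simp add: power_int_diff)
  moreover have uw: "unit_dec (u / w)" using unit_dec_divide d by blast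
  moreover have "v (\<tau> powi (int n - int m) * (u / w)) = int n - int m"
    using uw \<tau> v_mult[of "\<tau> powi (int n - int m)" "u / w"] v_powi[of \<tau> "int n - int m"]
    by (simp add: unit_dec_def subfield_powi[OF E])
  ultimately show ?thesis using that[of "int n - int m" "u / w"] by simp
qed

lemma adjoin_cover:
  assumes "x \<in> field_gen (C \<union> {\<tau>})" "vge 0 x" shows "\<exists>c\<in>C. vge 1 (x - c)"
proof (cases "vge 1 x")
  case True then show ?thesis using subfield_0[OF subC(1)] by (intro bexI[of _ 0]) auto
next
  case False
  then have "x \<noteq> 0" "v x = 0" using assms by (auto simp: vge_def)
  obtain n u where "x = \<tau> powi n * u" "unit_dec u" "v x = n" by (rule adjoin_dec[OF assms(1) \<open>x \<noteq> 0\<close>])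
  then show ?thesis using \<open>v x = 0\<close> by (auto simp: unit_dec_def)
qed

lemma D_element:
  assumes "n = v x" "x = \<tau> powi n * u" "unit_dec u"
  shows "D x = of_int n * \<tau> powi (n - 1) * u * D \<tau> + \<tau> powi n * D u"
  using assms \<tau> D_mult[of "\<tau> powi n" u] by (simp add: D_powi unit_dec_def subfield_powi[OF E] mult_ac)

text \<open>Differentiating \<open>\<tau> powi n\<close> lowers its value by one before
  \<open>D \<tau>\<close> is counted, with the factor \<open>n\<close>. For \<open>v x = 0\<close>
  this factor vanishes and the loss with it, whence the second bound.\<close>

lemma adjoin_D_vge:
  assumes x: "x \<in> field_gen (C \<union> {\<tau>})" "x \<noteq> 0" and M: "D_bounded M" and N: "vge N (D \<tau>)"
  shows "vge (min (M + v x) (N + v x - 1)) (D x)" "v x = 0 \<Longrightarrow> vge M (D x)"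
proof -
  obtain n u where d: "x = \<tau> powi n * u" "unit_dec u" "v x = n" by (rule adjoin_dec[OF x])
  have u: "u \<in> E" "u \<noteq> 0" "v u = 0" "vge M (D u)" using d M by (auto simp: unit_dec_def)
  have Dx: "D x = of_int n * \<tau> powi (n - 1) * u * D \<tau> + \<tau> powi n * D u" using D_element d by simp
  have p: "vge m (\<tau> powi m)" "\<tau> powi m \<in> E" for m using \<tau> by (auto simp: vge_def v_powi subfield_powi[OF E])
  have 2: "vge (n + M) (\<tau> powi n * D u)" using vge_mult[OF p(2) _ p(1) u(4)] u by blast
  have E2: "\<tau> powi n * D u \<in> E" using p u subfield_mult[OF E] by blast
  have E1': "of_int n * (\<tau> powi (n - 1) * u) \<in> E" using p u by (intro subfield_mult[OF E] subfield_of_int[OF E]) auto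
  then have E1: "of_int n * \<tau> powi (n - 1) * u * D \<tau> \<in> E" using subfield_mult[OF E E1' D_in[OF \<tau>(1)]] by (simp add: mult.assoc)
  have "vge (n - 1 + 0) (\<tau> powi (n - 1) * u)" using u p by (intro vge_mult) (auto simp: vge_def)
  then have "vge (n - 1) (of_int n * (\<tau> powi (n - 1) * u))"
    using vge_mult_0[OF subfield_of_int[OF E] _ vge_of_int, of "\<tau> powi (n - 1) * u" "n - 1" n] p u subfield_mult[OF E] by simp
  then have "vge (n - 1 + N) (of_int n * (\<tau> powi (n - 1) * u) * D \<tau>)"
    using vge_mult[OF E1' D_in[OF \<tau>(1)] _ N] by simp
  then have 1: "vge (n - 1 + N) (of_int n * \<tau> powi (n - 1) * u * D \<tau>)" by (simp add: mult.assoc)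
  show "vge (min (M + v x) (N + v x - 1)) (D x)"
    unfolding Dx d(3) using 1 2 by (intro vge_add E1 E2) (auto intro: vge_mono)
  show "vge M (D x)" if "v x = 0" using 2 that d(3) unfolding Dx by simp
qed

end

section \<open>Places at which one uniformiser generates the field over C\<close>

locale rational_place = tower T + valued_field "FbL T" v
  for T :: "'a::field_char_0 tower" and v +
  fixes i :: nat and \<tau> :: 'a
  assumes i: "i \<in> upper T" and trivC: "\<And>c. c \<in> C_upper T i \<Longrightarrow> c \<noteq> 0 \<Longrightarrow> v c = 0"
    and \<tau>: "\<tau> \<in> E" "\<tau> \<noteq> 0" "v \<tau> = 1" and E_gen: "E = field_gen (C_upper T i \<union> {\<tau>})"
begin

abbreviation "C \<equiv> C_upper T i"

lemma C: "is_subfield C" "C \<subseteq> E" "k \<subseteq> C"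
  using C_upper k_K by blast+

sublocale simple_place T v "C_upper T i" \<tau>
  by unfold_locales (use C trivC \<tau> in auto)

lemmas element_dec = adjoin_dec[folded E_gen]
  and cover_C = adjoin_cover[folded E_gen]
  and D_element_vge = adjoin_D_vge[folded E_gen]

lemma exists_D_bounded: "\<exists>M. D_bounded M"
proof -
  have "valued_field E v" by unfold_locales
  moreover have "finite (other_gens i)" by (simp add: finite_upper)
  ultimately have "\<exists>M. \<forall>c\<in>C. vge M (D c)"
    using trivC by (intro gen_D_bound[OF C(1) C_upper_eq _ other_gens_E C(2)]) auto
  then obtain M where M: "\<forall>c\<in>C. vge M (D c)" by blast
  have "D_bounded (min M (v (D \<tau>)))" unfolding D_bounded_def using M
    by (auto intro: vge_mono simp: vge_def)
  then show ?thesis by blast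
qed

lemma shift_bounded: "\<exists>b. \<forall>h\<in>E. D h \<noteq> 0 \<longrightarrow> b \<le> v (D h) - v h"
proof -
  obtain M where M: "D_bounded M" using exists_D_bounded by blast
  then have "vge M (D \<tau>)" by (simp add: D_bounded_def)
  have "M - 1 \<le> v (D h) - v h" if h: "h \<in> E" "D h \<noteq> 0" for h
  proof -
    have "h \<noteq> 0" using h by auto
    from D_element_vge(1)[OF h(1) this M \<open>vge M (D \<tau>)\<close>] h show ?thesis by (auto simp: vge_def)
  qed
  then show ?thesis by blast
qed

lemma coeff_place:
  assumes "is_residue_map E v res" shows "coeff_place T v \<tau> res C (other_gens i)"
proof (intro coeff_place.intro coeff_place_axioms.intro)
  show "tower T" "valued_field E v" by unfold_locales
  show "is_uniformiser E v \<tau>" using \<tau> by (simp add: is_uniformiser_def)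
  show "C = field_gen (k \<union> other_gens i)" by (rule C_upper_eq)
qed (fact assms other_gens_E cover_C shift_bounded | use trivC in blast)+

text \<open>Being special allows any uniformiser, not only \<open>\<tau>\<close>. Another one is
  \<open>\<tau> * u\<close> with a unit \<open>u\<close>, and \<open>\<tau> * D u\<close> has
  positive value, so its derivative is a unit as well; since \<open>eta\<close> is 0, the required 1
  is missed.\<close>

lemma not_special:
  assumes DC: "\<And>c. c \<in> C \<Longrightarrow> D c \<in> C" "D \<tau> \<in> C" "D \<tau> \<noteq> 0" and A: "FbA T \<subseteq> val_ring E v"
  shows "\<not> is_special T v"
proof
  assume sp: "is_special T v"
  have B: "D_bounded 0" using DC vge_C by (simp add: D_bounded_def)
  have vD\<tau>: "v (D \<tau>) = 0" using trivC DC by blast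
  have "vge 0 (D a)" if "a \<in> FbA T" for a
  proof (cases "a = 0")
    case False
    have a: "a \<in> E" "0 \<le> v a" using that A False by (auto simp: val_ring_def)
    have "vge 1 (D \<tau>) \<or> v a - 1 \<ge> 0 \<or> v a = 0" using a by linarith
    then show ?thesis
      using D_element_vge[OF a(1) False B vge_C[OF DC(2)]] a vge_mono[of _ "D a" 0] by (cases "v a = 0") auto
  qed simp
  then have "0 \<le> v (D a)" if "a \<in> FbA T" "D a \<noteq> 0" for a using that by (auto simp: vge_def)
  then have "eta T v = 0" unfolding eta_def by (intro cSup_eq_maximum) auto
  then obtain \<pi> where \<pi>: "\<pi> \<in> E" "\<pi> \<noteq> 0" "v \<pi> = 1" "D \<pi> = 0 \<or> v (D \<pi>) \<ge> 1"
    using sp unfolding is_special_def is_uniformiser_def by auto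
  obtain n u where d: "\<pi> = \<tau> powi n * u" "unit_dec u" "v \<pi> = n" by (rule element_dec[OF \<pi>(1,2)])
  then have n: "n = 1" using \<pi> by simp
  have u: "u \<in> E" "u \<noteq> 0" "v u = 0" "vge 0 (D u)" using d B by (auto simp: unit_dec_def)
  have D\<pi>: "D \<pi> = u * D \<tau> + \<tau> * D u" using D_element[OF _ d(1,2)] d(3) n by simp
  have "vge 1 (\<tau> * D u)" using vge_mult[OF \<tau>(1) D_in[OF u(1)] tau_vge(2) u(4)] by simp
  moreover have "v (u * D \<tau>) = 0" "u * D \<tau> \<noteq> 0" using v_mult[OF u(1) _ u(2) DC(3)] \<tau> vD\<tau> u DC by auto
  ultimately show False using v_add_lt[of "u * D \<tau>" "\<tau> * D u"] \<pi>(4) u \<tau> subfield_mult[OF E] D_in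
    unfolding D\<pi> by auto
qed

end

context tower
begin

lemma independent_D_C:
  assumes "independent_gen T i" "c \<in> C_upper T i" shows "D c \<in> C_upper T i"
proof -
  have "D c \<in> field_gen (k \<union> other_gens i)"
  proof (rule stable_field_gen)
    show "k \<union> other_gens i \<subseteq> E" using k_E other_gens_E by blast
    show "c \<in> field_gen (k \<union> other_gens i)" using assms C_upper_eq by simp
    fix x assume "x \<in> k \<union> other_gens i"
    then consider "x \<in> K" | j where "j \<in> upper T - {i}" "x = t j"
      using k_K K_gens K0y_K by blast
    then have "D x \<in> C_upper T i"
    proof cases
      case 1 then show ?thesis using D_K C_upper(2) by blast
    next
      case 2
      then have "j \<in> {1..ngen T} - {i}" using upper_index by blast
      then have "D x \<in> field_gen (K0y T \<union> t ` (upper T - {i}))"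
        using assms(1) 2 unfolding independent_gen_def by blast
      also have "\<dots> \<subseteq> C_upper T i" unfolding C_upper_def using K0y_K by (intro hull_mono) auto
      finally show ?thesis .
    qed
    then show "D x \<in> field_gen (k \<union> other_gens i)" using C_upper_eq by simp
  qed
  then show ?thesis using C_upper_eq by simp
qed

lemma below_C_upper: "i \<in> upper T \<Longrightarrow> below T i \<subseteq> C_upper T i"
proof -
  assume i: "i \<in> upper T"
  have "field_gen (K0y T \<union> t ` {nlow T + 1..<i}) \<subseteq> field_gen (K \<union> t ` (upper T - {i}))"
  proof (rule hull_mono)
    have "{nlow T + 1..<i} \<subseteq> upper T - {i}" using i by (auto simp: upper_def)
    then show "K0y T \<union> t ` {nlow T + 1..<i} \<subseteq> K \<union> t ` (upper T - {i})" using K0y_K by blast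
  qed
  then show ?thesis using i by (simp add: below_def C_upper_def upper_def)
qed

end

locale residue_rational_place = rational_place T v i \<tau>
  for T :: "'a::field_char_0 tower" and v i \<tau> +
  fixes res :: "'a \<Rightarrow> 'k::field_char_0"
  assumes res: "is_residue_map (FbL T) v res"
begin

sublocale cp: coeff_place T v \<tau> res "C_upper T i" "other_gens i"
  by (rule coeff_place[OF res])

text \<open>The assumption on \<open>D \<tau>\<close> compensates the loss of one in differentiating
  powers of \<open>\<tau>\<close>, so \<open>M\<close> is a lower bound for the shift;
  \<open>h\<close> attains it.\<close>

lemma shift_eq:
  assumes "D_bounded M" "vge (M + 1) (D \<tau>)" "h \<in> E" "D h \<noteq> 0" "v (D h) - v h = M"
  shows "shift T v = M"
proof -
  obtain x where x: "x \<in> E" "D x \<noteq> 0" "v (D x) - v x = shift T v" using cp.shift_attained by blast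
  then have "x \<noteq> 0" by auto
  have "M \<le> shift T v" using D_element_vge(1)[OF x(1) \<open>x \<noteq> 0\<close> assms(1,2)] x by (auto simp: vge_def)
  moreover have "shift T v \<le> M" using cp.shift_least[OF assms(3,4)] assms(5) by simp
  ultimately show ?thesis by simp
qed

text \<open>An element of \<open>N\<^sub>v\<close> would make the product of a coefficient and a power of the exponential
  \<open>\<theta>\<close> a constant.\<close>

lemma exponential_kernel:
  assumes DC: "\<And>c. c \<in> C \<Longrightarrow> D c \<in> C" and w: "D \<tau> = \<tau> * w" "w \<in> E" "vge 1 (w - b)" and b: "b \<in> C" "b \<noteq> 0"
    and \<theta>: "\<theta> \<in> E" "\<theta> \<noteq> 0" "D \<theta> = b * \<theta>" "\<not> algebraic_over C \<theta>"
  shows "excess T v \<tau> = 0" "NN T v \<tau> res = {0}"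
proof -
  have vb: "v b = 0" using trivC b by blast
  have wv: "w \<noteq> 0" "v w = 0" using v_add_lt[of b "w - b"] w b vb C_E subfield_diff[OF E] by auto
  have D\<tau>: "D \<tau> \<noteq> 0" "v (D \<tau>) = 1" unfolding w(1) using v_mult[OF \<tau>(1) w(2) \<tau>(2) wv(1)] wv \<tau> by auto
  have B: "D_bounded 0" using DC vge_C D\<tau> by (simp add: D_bounded_def vge_def)
  have s: "shift T v = 0" by (rule shift_eq[OF B, of \<tau>]) (use D\<tau> \<tau> in \<open>auto simp: vge_def\<close>)
  show "excess T v \<tau> = 0" using s D\<tau> \<tau> by (simp add: excess_def shift_at_def)
  have \<rho>: "rho T v \<tau> res = res b"
  proof -
    have "rho T v \<tau> res = res w" using s w \<tau> by (simp add: rho_def power_int_minus field_simps)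
    also have "\<dots> = res b" using cp.res_eq[of w b] w wv b vb C_E by (simp add: vge_def)
    finally show ?thesis .
  qed
  have "a = 0" if "a \<in> NN T v \<tau> res" for a
  proof (rule ccontr)
    assume a: "a \<noteq> 0"
    obtain y where y: "y \<in> kappa T v res - {0}" "del T v \<tau> res y = - of_int a * rho T v \<tau> res * y"
      using \<open>a \<in> _\<close> by (auto simp: NN_def)
    then obtain c where c: "c \<in> C" "y = res c" using cp.kappa_C by auto
    then have "c \<noteq> 0" using y(1) by auto
    note c = c(1) this c(2)
    note cl = subfield_closed[OF C(1)]
    have "res (D c) = del T v \<tau> res (res c)" using cp.del_res[of c] s c C_E vge_C by simp
    also have "\<dots> = - (of_int a * (res b * res c))" using y c \<rho> by simp
    also have "\<dots> = res (- (of_int a * (b * c)))"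
    proof -
      \<comment> \<open>The residue map is a homomorphism on the valuation ring only, so integers
        are carried through by induction.\<close>
      have ri: "res (of_int a) = of_int a"
      proof -
        have rn: "res (of_nat n) = of_nat n" for n
        proof (induction n)
          case (Suc n)
          then show ?case using cp.res_C[OF cl(2) cl(10)[of n]] by simp
        qed simp
        show ?thesis
          by (cases a rule: int_cases2) (use rn cp.res_minus[OF subfield_of_nat[OF E] vge_of_nat] in auto)
      qed
      have "res (- (of_int a * (b * c))) = - res (of_int a * (b * c))"
        using cl(4)[OF cl(11) cl(4)[OF b(1) c(1)], of a] by (simp add: cp.res_minus C_E vge_C)
      also have "res (of_int a * (b * c)) = of_int a * (res b * res c)"
        using b c cl(4)[of b c] cl(11)[of a] cp.res_C ri by simp
      finally show ?thesis by simp
    qed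
    finally have "res (D c) = res (- (of_int a * (b * c)))" .
    \<comment> \<open>Both sides lie in \<open>C\<close>, on which the residue map is injective, so
      the residue equation becomes an equation in the tower.\<close>
    then have Dc: "D c = - (of_int a * (b * c))"
      using b c DC cl(4,5,11) by (intro cp.res_inj) auto
    have e1: "D (c * \<theta> powi a) = D c * \<theta> powi a + c * (of_int a * \<theta> powi (a - 1) * (b * \<theta>))"
      using c \<theta> C_E by (simp add: D_mult D_powi subfield_powi[OF E])
    have th: "\<theta> * \<theta> powi (a - 1) = \<theta> powi a"
      using \<theta>(2) power_int_add_1[of \<theta> "a - 1"] by (simp add: mult.commute)
    have e2: "c * (of_int a * \<theta> powi (a - 1) * (b * \<theta>)) = of_int a * (b * c) * \<theta> powi a"
      using th by (simp add: mult_ac)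
    have "D (c * \<theta> powi a) = 0" unfolding e1 e2 by (simp add: Dc)
    moreover have "c * \<theta> powi a \<in> E" using c \<theta> C_E by (intro subfield_mult[OF E] subfield_powi[OF E]) auto
    \<comment> \<open>Constants lie in \<open>k\<close>, hence in \<open>C\<close>. Dividing by
      \<open>c\<close> leaves a nonzero power of \<open>\<theta>\<close> in \<open>C\<close>, which
      makes \<open>\<theta>\<close> algebraic over \<open>C\<close>.\<close>
    ultimately have "c * \<theta> powi a \<in> C" using constants C(3) by blast
    then have "c * \<theta> powi a / c \<in> C" using c cl(9) by blast
    then have pa: "\<theta> powi a \<in> C" using c by simp
    have "\<theta> ^ nat \<bar>a\<bar> \<in> C"
    proof (cases "a \<ge> 0")
      case True then show ?thesis using pa by (simp add: power_int_def)
    next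
      case False
      then have "inverse (\<theta> powi a) = \<theta> ^ nat \<bar>a\<bar>" by (simp add: power_int_def power_inverse)
      then show ?thesis using cl(8)[OF pa] by simp
    qed
    then have "algebraic_over C \<theta>"
      using algebraic_of_power[OF C(1) algebraic_over_elem[OF C(1)]] a by simp
    then show False using \<theta> by blast
  qed
  then show "NN T v \<tau> res = {0}" using cp.NN_0 by blast
qed

text \<open>Here \<open>D \<tau>\<close> is a unit, which pushes the shift down to -1, while D maps
  \<open>C\<close> into itself, where \<open>v\<close> is trivial. So the leading derivation
  vanishes on the whole residue field but rho does not, and the kernel equation leaves only
  0.\<close>

lemma tangent_kernel:
  assumes DC: "\<And>c. c \<in> C \<Longrightarrow> D c \<in> C" and b: "b \<in> C" "b \<noteq> 0" and D\<tau>: "D \<tau> = b * (1 + \<tau>\<^sup>2)"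
  shows "excess T v \<tau> = 0" "NN T v \<tau> res = {0}"
proof -
  have vb: "v b = 0" using trivC b by blast
  have t2: "\<tau>\<^sup>2 \<in> E" "vge 1 (\<tau>\<^sup>2)" using \<tau> by (auto simp: vge_def v_power subfield_power[OF E])
  have u: "1 + \<tau>\<^sup>2 \<noteq> 0" "v (1 + \<tau>\<^sup>2) = 0" "1 + \<tau>\<^sup>2 \<in> E"
    using v_add_lt[of 1 "\<tau>\<^sup>2"] t2 subfield_1[OF E] subfield_add[OF E] by auto
  have bE: "b \<in> E" using b C_E by blast
  have D: "D \<tau> \<noteq> 0" "v (D \<tau>) = 0" unfolding D\<tau> using v_mult[OF bE u(3) b(2) u(1)] vb u b by auto
  have B: "D_bounded (- 1)" using DC vge_C D vge_mono[of 0 _ "-1"] by (auto simp: D_bounded_def vge_def[of "-1" "D \<tau>"])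
  have s: "shift T v = - 1" by (rule shift_eq[OF B, of \<tau>]) (use D \<tau> in \<open>auto simp: vge_def\<close>)
  show "excess T v \<tau> = 0" using s D \<tau> by (simp add: excess_def shift_at_def)
  have \<rho>: "rho T v \<tau> res \<noteq> 0"
    using s cp.res_eq_0[of "D \<tau>"] D \<tau> by (simp add: rho_def vge_def D_in)
  have "a = 0" if aN: "a \<in> NN T v \<tau> res" for a
  proof -
    obtain y where y: "y \<in> kappa T v res - {0}" "del T v \<tau> res y = - of_int a * rho T v \<tau> res * y"
      using aN by (auto simp: NN_def)
    then obtain c where c: "c \<in> C" "y = res c" using cp.kappa_C by auto
    have "vge 1 (\<tau> * D c)" using vge_mult[OF \<tau>(1) _ tau_vge(2) vge_C[OF DC[OF c(1)]]] C_E DC c by simp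
    then have "del T v \<tau> res (res c) = 0"
      using cp.del_res[of c] cp.res_eq_0[of "\<tau> * D c"] s c C_E vge_C DC \<tau> subfield_mult[OF E]
        vge_mono[of 1 "\<tau> * D c" 0] by simp
    then show ?thesis using y c \<rho> by simp
  qed
  then show "NN T v \<tau> res = {0}" using cp.NN_0 by blast
qed

text \<open>With shift 0 no power of \<open>\<tau>\<close> intervenes, and the residue field with
  its derivation is a copy of \<open>C\<close> with D.\<close>

lemma consts_stable:
  assumes DC: "\<And>c. c \<in> C \<Longrightarrow> D c \<in> C" and s: "shift T v = 0"
  shows "del_consts T v \<tau> res = res ` k" "\<And>c. c \<in> C \<Longrightarrow> del T v \<tau> res (res c) = res (D c)"
proof -
  show d: "del T v \<tau> res (res c) = res (D c)" if "c \<in> C" for c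
    using cp.del_res[of c] s that C_E vge_C by simp
  show "del_consts T v \<tau> res = res ` k"
  proof
    show "res ` k \<subseteq> del_consts T v \<tau> res" using cp.del_k cp.res_k_kappa by (auto simp: del_consts_def)
    show "del_consts T v \<tau> res \<subseteq> res ` k"
    proof
      fix y assume "y \<in> del_consts T v \<tau> res"
      then obtain c where c: "c \<in> C" "y = res c" "del T v \<tau> res y = 0" using cp.kappa_C by (auto simp: del_consts_def)
      then have "res (D c) = res 0" using d by simp
      then have "D c = 0" using cp.res_inj DC c subfield_0[OF C(1)] by blast
      then show "y \<in> res ` k" using constants c C_E by blast
    qed
  qed
qed

text \<open>The square in \<open>D \<tau>\<close> raises its value to 2 while the shift is 0; this
  gives r = 1, and the leading coefficient is the residue of \<open>b\<close>. Its only candidates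
  for antiderivatives are \<open>- u\<close> plus a constant, and these lie outside
  \<open>C\<close>.\<close>

lemma primitive_kernel:
  assumes DC: "\<And>c. c \<in> C \<Longrightarrow> D c \<in> C" and b: "b \<in> C" "b \<noteq> 0" and D\<tau>: "D \<tau> = b * \<tau>\<^sup>2"
    and u: "u \<in> E" "u \<notin> C" "D u = - b"
  shows "second_kernel_hyp T v \<tau> res \<and> excess T v \<tau> = 1"
proof -
  have vb: "v b = 0" using trivC b by blast
  have bE: "b \<in> E" using b C_E by blast
  have D: "D \<tau> \<noteq> 0" "v (D \<tau>) = 2" unfolding D\<tau>
    using v_mult[OF bE subfield_power[OF E \<tau>(1)], of 2] vb \<tau> b by (auto simp: v_power)
  have B: "D_bounded 0" using DC vge_C D by (simp add: D_bounded_def vge_def)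
  have 1: "1 \<in> {1..ngen T}" "1 \<in> {1..nlow T}" using nlow by auto
  \<comment> \<open>The shift is attained at \<open>t 1\<close>: a lower generator lies in
    \<open>C\<close>, and it is not a constant.\<close>
  have t1: "t 1 \<in> C" "t 1 \<in> E" "D (t 1) \<noteq> 0" "t 1 \<noteq> 0"
    using K_gens(1)[OF 1(2)] K0y_K C_upper(2) gen_E[OF 1(1)] D_gen_nz[OF 1(1)] by auto
  have s: "shift T v = 0"
    by (rule shift_eq[OF B, of "t 1"]) (use D \<tau> t1 trivC DC in \<open>auto simp: vge_def\<close>)
  have ex: "excess T v \<tau> = 1" using s D \<tau> by (simp add: excess_def shift_at_def)
  note cs = consts_stable[OF DC s]
  have "rho_r T v \<tau> res 1 = res b"
    using s \<tau> by (simp add: rho_r_def D\<tau> power_int_minus field_simps)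
  moreover have "res b \<notin> del T v \<tau> res ` kappa T v res"
  proof
    assume "res b \<in> del T v \<tau> res ` kappa T v res"
    then obtain c where c: "c \<in> C" "res b = res (D c)" using cp.kappa_C cs(2) by auto
    then have "D c = b" using cp.res_inj DC b by metis
    then have "D (c + u) = 0" using c u C_E by (simp add: D_add)
    then have "c + u \<in> C" using constants[of "c + u"] c u C_E subfield_add[OF E] C(3) by blast
    then have "c + u - c \<in> C" using c subfield_diff[OF C(1)] by blast
    then show False using u by simp
  qed
  ultimately show ?thesis using ex cs(1) by (simp add: second_kernel_hyp_def)
qed

end

section \<open>Places at infinity and moving primes in one upper variable; (K2)\<close>

context tower
begin

lemma upper_gen_nz: "i \<in> upper T \<Longrightarrow> t i \<noteq> 0"
  using gen_not_k[OF upper_index] subfield_0[OF k] by metis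

lemma upper_gen_notin_C: "i \<in> upper T \<Longrightarrow> t i \<notin> C_upper T i"
  using C_upper_transc algebraic_over_elem[OF C_upper(1)] by blast

lemma Upper_inf_rational_place:
  assumes "is_place_of_kind T (Upper_inf i) v \<pi>"
  shows "rational_place T v i \<pi>"
proof -
  have i: "i \<in> upper T" and dv: "is_discrete_valuation E v"
    and deg: "\<And>p. p \<in> polys_over (C_upper T i) \<Longrightarrow> p \<noteq> 0 \<Longrightarrow> v (poly p (t i)) = - int (degree p)"
    and \<pi>: "\<pi> = inverse (t i)" using assms by (auto simp: divide_inverse)
  interpret valued_field E v by unfold_locales (fact E dv)+
  note C = C_upper[of i]
  note CR = subfield_subring[OF C(1)]
  have tE: "t i \<in> E" "t i \<noteq> 0" using gen_E upper_index i upper_gen_nz by auto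
  have vt: "v (t i) = - 1"
    using deg[of "[:0,1:]"] polys_over_pCons[OF CR subring_0[OF CR] polys_over_const[OF CR subring_1[OF CR]]] by simp
  show ?thesis
  proof (intro rational_place.intro rational_place_axioms.intro)
    show "tower T" "valued_field E v" by unfold_locales
    show "i \<in> upper T" by fact
    show "v c = 0" if "c \<in> C_upper T i" "c \<noteq> 0" for c
      using deg[of "[:c:]"] polys_over_const[OF CR that(1)] that(2) by simp
    show \<pi>E: "\<pi> \<in> E" "\<pi> \<noteq> 0" "v \<pi> = 1" using \<pi> tE vt subfield_inverse[OF E] v_inverse by auto
    show "E = field_gen (C_upper T i \<union> {\<pi>})"
    proof
      show "field_gen (C_upper T i \<union> {\<pi>}) \<subseteq> E" using C \<pi>E by (intro field_gen_subset[OF _ E]) auto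
      have "\<pi> \<in> field_gen (C_upper T i \<union> {\<pi>})" by (rule field_gen_inc) auto
      from subfield_inverse[OF subfield_hull this] have "t i \<in> field_gen (C_upper T i \<union> {\<pi>})" by (simp add: \<pi>)
      then have "field_gen (C_upper T i \<union> {t i}) \<subseteq> field_gen (C_upper T i \<union> {\<pi>})"
        by (intro field_gen_subset[OF _ subfield_hull]) (auto intro: field_gen_inc)
      then show "E \<subseteq> field_gen (C_upper T i \<union> {\<pi>})" using E_adjoin[OF i] by simp
    qed
  qed
qed

lemma integral_elem:
  assumes "is_subring R" "x \<in> R" shows "integral_over R x"
  unfolding integral_over_def using assms
  by (intro bexI[of _ "[:- x, 1:]"]) (auto intro!: polys_over_pCons polys_over_0 subring_1 subring_minus)

lemma integral_root:
  fixes x :: 'a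
  assumes R: "is_subring R" and "x ^ n \<in> R" "n > 0" shows "integral_over R x"
  unfolding integral_over_def
proof (intro bexI[of _ "monom 1 n + [:- (x ^ n):]"] conjI)
  have "degree (monom (1::'a) n + [:- (x ^ n):]) = n"
    using assms(3) by (subst degree_add_eq_left) (auto simp: degree_monom_eq)
  then show "lead_coeff (monom 1 n + [:- (x ^ n):]) = 1" using assms(3) by (simp add: coeff_pCons split: nat.split)
  show "poly (monom 1 n + [:- (x ^ n):]) x = 0" by (simp add: poly_monom)
  show "monom 1 n + [:- (x ^ n):] \<in> polys_over R"
    using assms by (intro polys_over_add polys_over_monom polys_over_const subring_1 subring_minus)
qed

lemma R0_sub: "is_subring (R0 T)" "Fld T \<subseteq> R0 T" "j \<in> {1..nlow T} \<Longrightarrow> t j \<in> R0 T"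
  by (auto simp: R0_def subring_hull intro: ring_gen_inc)

lemma R0_K0y: "R0 T \<subseteq> K0y T"
proof -
  have "field_gen (Fld T \<union> t ` {1..nlow T}) \<subseteq> K0y T" unfolding K0y_def by (rule hull_mono) auto
  then show ?thesis using R0_field by blast
qed

lemma R0_O: "R0 T \<subseteq> O_ring T"
  using R0_K0y integral_elem[OF R0_sub(1)] by (auto simp: O_ring_def)

lemma radical_O: "radical T \<in> O_ring T"
  using integral_root[OF R0_sub(1), of "radical T" "rdeg T"] radical nlow K_gens(2) by (simp add: O_ring_def)

lemma O_K: "O_ring T \<subseteq> K0y T"
  by (auto simp: O_ring_def)

lemma FbO: "is_subring (FbO T)" "FbO T \<subseteq> K" "k \<subseteq> FbO T" "O_ring T \<subseteq> FbO T"
proof -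
  show "FbO T \<subseteq> K" unfolding FbO_def
    using k_K O_K K0y_K by (intro ring_gen_subset[OF _ subfield_subring[OF K]]) blast
qed (auto simp: FbO_def subring_hull intro: ring_gen_inc)

lemma FbA_eq: "FbA T = ring_gen (FbO T \<union> t ` upper T)"
proof
  have "A_ring T \<subseteq> ring_gen (FbO T \<union> t ` upper T)" unfolding A_ring_def
    using FbO(4) by (intro hull_mono) auto
  then show "FbA T \<subseteq> ring_gen (FbO T \<union> t ` upper T)" unfolding FbA_def
    using FbO(3) ring_gen_inc[of _ "FbO T \<union> t ` upper T"] by (intro ring_gen_subset[OF _ subring_hull]) blast
  have A: "O_ring T \<subseteq> A_ring T" "t ` upper T \<subseteq> A_ring T" by (auto simp: A_ring_def intro: ring_gen_inc)
  have "FbO T \<subseteq> FbA T" unfolding FbO_def FbA_def using A(1) by (intro hull_mono) auto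
  moreover have "t ` upper T \<subseteq> FbA T" unfolding FbA_def using A(2) ring_gen_inc[of _ "k \<union> A_ring T"] by blast
  ultimately show "ring_gen (FbO T \<union> t ` upper T) \<subseteq> FbA T"
    by (intro ring_gen_subset) (auto simp: FbA_def subring_hull)
qed

lemma FbA: "is_subring (FbA T)" "FbO T \<subseteq> FbA T" "j \<in> upper T \<Longrightarrow> t j \<in> FbA T" "FbA T \<subseteq> E"
proof -
  show "FbA T \<subseteq> E" unfolding FbA_eq
    using FbO(2) K_E gen_E upper_index by (intro ring_gen_subset[OF _ subfield_subring[OF E]]) blast
qed (auto simp: FbA_eq subring_hull intro: ring_gen_inc)

text \<open>An element of the ring outside \<open>P\<close> is inverted in the localization, so its
  value is 0. If \<open>x\<close> in \<open>P\<close> had value 0, its inverse would be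
  \<open>a / b\<close> with \<open>b\<close> outside \<open>P\<close>, yet
  \<open>b = a * x\<close>.\<close>

lemma prime_valuation:
  assumes P: "is_prime_ideal (FbA T) P" and v: "is_prime_valuation T P v"
  shows "valued_field E v" "FbA T \<subseteq> val_ring E v"
    "x \<in> FbA T \<Longrightarrow> x \<notin> P \<Longrightarrow> x \<noteq> 0 \<and> v x = 0" "x \<in> P \<Longrightarrow> valued_field.vge v 1 x"
proof -
  have dv: "is_discrete_valuation E v" and loc: "val_ring E v = localization_at (FbA T) P"
    using v by (auto simp: is_prime_valuation_def)
  show "valued_field E v" by unfold_locales (fact E dv)+
  then interpret valued_field E v .
  have PI: "is_ideal (FbA T) P" "P \<noteq> FbA T" using P by (auto simp: is_prime_ideal_def)
  have P1: "P \<subseteq> FbA T" "0 \<in> P" "\<And>a x. a \<in> FbA T \<Longrightarrow> x \<in> P \<Longrightarrow> a * x \<in> P"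
    using PI(1) by (auto simp: is_ideal_def)
  have one: "1 \<notin> P"
  proof
    assume "1 \<in> P"
    then have "FbA T \<subseteq> P" using P1(3)[of _ 1] by auto
    then show False using PI(2) P1(1) by blast
  qed
  have sub: "x \<in> val_ring E v" if "x \<in> FbA T" for x
    unfolding loc localization_at_def using that one subring_1[OF FbA(1)]
    by (intro CollectI exI[of _ x] exI[of _ 1]) auto
  then show "FbA T \<subseteq> val_ring E v" by blast
  show "x \<noteq> 0 \<and> v x = 0" if x: "x \<in> FbA T" "x \<notin> P"
  proof -
    have xE: "x \<in> E" "x \<noteq> 0" "0 \<le> v x" using sub[OF x(1)] x P1(2) by (auto simp: val_ring_def)
    have "1 / x \<in> val_ring E v"
      unfolding loc localization_at_def using x subring_1[OF FbA(1)] by blast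
    then have "0 \<le> v (1 / x)" using xE by (auto simp: val_ring_def)
    then have "v x \<le> 0" using xE v_inverse[of x] by (simp add: inverse_eq_divide[symmetric])
    then show ?thesis using xE by simp
  qed
  show "vge 1 x" if x: "x \<in> P"
  proof (rule ccontr)
    assume n: "\<not> vge 1 x"
    have "x \<in> FbA T" using x P1 by blast
    then have xE: "x \<in> E" "x \<noteq> 0" "v x = 0" using n sub[of x] by (auto simp: val_ring_def vge_def)
    then have "1 / x \<in> val_ring E v"
      using v_inverse[of x] subfield_inverse[OF E] by (simp add: val_ring_def inverse_eq_divide[symmetric])
    then obtain a b where ab: "1 / x = a / b" "a \<in> FbA T" "b \<in> FbA T" "b \<notin> P"
      unfolding loc localization_at_def by blast
    then have "b = a * x" using xE P1(2) by (metis divide_eq_0_iff div_by_0 frac_eq_eq mult_1 zero_neq_one)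
    then show False using ab P1(3)[OF ab(2) x] by simp
  qed
qed

text \<open>Brings the generators of \<open>C_upper T i\<close> into the ring in which
  \<open>P\<close> lives, so that their values can be read off \<open>P\<close>.\<close>

lemma other_ring_FbA: "ring_gen (k \<union> other_gens i) \<subseteq> FbA T"
  using FbO(3,4) FbA(2,3) R0_O R0_sub(3) radical_O by (intro ring_gen_subset[OF _ FbA(1)]) blast

text \<open>The valuation is known only through the localization at P, so three facts have to be
  extracted: it is trivial on \<open>C_upper T i\<close>, it is positive at \<open>\<pi>\<close>,
  and its value there is exactly 1. The multiple \<open>\<pi> / a\<close>, in which
  \<open>t i\<close> has coefficient 1, is returned too, because its derivative is easy to
  locate.\<close>

lemma Moving_rational_places:
  assumes "is_place_of_kind T (Moving i) v \<pi>"
  obtains a b where "rational_place T v i \<pi>" "a \<in> C_upper T i" "b \<in> C_upper T i" "a \<noteq> 0"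
    "\<pi> = a * t i + b" "rational_place T v i (\<pi> / a)" "is_special T v" "FbA T \<subseteq> val_ring E v"
proof -
  obtain P a b where i: "i \<in> upper T" and P: "is_height_one_prime (FbA T) P" "is_prime_valuation T P v"
    and sp: "is_special T v" and irr: "irreducible_in (T_ring T) \<pi>"
    and P\<pi>: "P = {\<pi> * h | h. h \<in> T_ring T} \<inter> FbA T"
    and ab0: "{a, b} \<subseteq> ring_gen (K \<union> t ` (upper T - {i}))" and a: "a \<noteq> 0" and \<pi>: "\<pi> = a * t i + b"
    using assms by auto
  have PP: "is_prime_ideal (FbA T) P" using P by (simp add: is_height_one_prime_def)
  note pv = prime_valuation[OF PP P(2)]
  interpret valued_field E v by (rule pv(1))
  let ?C = "C_upper T i" and ?R = "ring_gen (K \<union> t ` (upper T - {i}))" and ?X = "k \<union> other_gens i"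
  note C = C_upper[of i]
  note CR = subfield_subring[OF C(1)]
  have RC: "?R \<subseteq> ?C" unfolding C_upper_def by (rule ring_gen_subset_field_gen)
  have ab: "a \<in> ?C" "b \<in> ?C" using ab0 RC by auto
  have T_R: "T_ring T = {poly p (t i) |p. p \<in> polys_over ?R}"
  proof -
    have "T_ring T = ring_gen (?R \<union> {t i})"
    proof
      show "T_ring T \<subseteq> ring_gen (?R \<union> {t i})" unfolding T_ring_def
      proof (rule ring_gen_subset[OF _ subring_hull])
        have "K \<union> t ` upper T \<subseteq> ?R \<union> {t i}" using ring_gen_inc[of _ "K \<union> t ` (upper T - {i})"] by blast
        then show "K \<union> t ` upper T \<subseteq> ring_gen (?R \<union> {t i})" using ring_gen_inc[of _ "?R \<union> {t i}"] by blast
      qed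
      have "?R \<subseteq> T_ring T" unfolding T_ring_def by (rule hull_mono) auto
      moreover have "t i \<in> T_ring T" unfolding T_ring_def using i by (intro ring_gen_inc) auto
      ultimately show "ring_gen (?R \<union> {t i}) \<subseteq> T_ring T"
        by (intro ring_gen_subset) (auto simp: T_ring_def subring_hull)
    qed
    then show ?thesis by (simp only: ring_gen_adjoin[OF subring_hull])
  qed
  have tr: "p = 0" if "p \<in> polys_over ?C" "poly p (t i) = 0" for p
    using C_upper_transc[OF i] that unfolding algebraic_over_def by blast
  \<comment> \<open>Comparison of degrees in \<open>t i\<close>: a nonzero expression free of
    \<open>t i\<close> is no multiple of \<open>\<pi>\<close>, which has degree 1.\<close>
  have notP: "f \<notin> P" if f: "f \<in> ring_gen ?X" "f \<noteq> 0" for f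
  proof
    assume "f \<in> P"
    then obtain h where h: "h \<in> T_ring T" "f = \<pi> * h" using P\<pi> by auto
    then obtain p where p: "p \<in> polys_over ?R" "h = poly p (t i)" unfolding T_R by auto
    have pC: "p \<in> polys_over ?C" using p(1) polys_over_mono[OF RC] by blast
    have fC: "f \<in> ?C" using f(1) ring_gen_subset_field_gen C_upper_eq by blast
    have abp: "[:b, a:] \<in> polys_over ?C" using ab by (intro polys_over_pCons[OF CR] polys_over_0[OF CR])
    have "poly ([:b, a:] * p - [:f:]) (t i) = 0" using h p \<pi> by (simp add: algebra_simps)
    then have e: "[:b, a:] * p - [:f:] = 0"
      by (intro tr polys_over_diff[OF CR] polys_over_mult[OF CR] abp pC polys_over_const[OF CR fC])
    then have e': "[:b, a:] * p = [:f:]" by (simp only: right_minus_eq)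
    have "p \<noteq> 0" using e' f(2) by auto
    then have "degree ([:b, a:] * p) = 1 + degree p" using a by (subst degree_mult_eq) auto
    then show False unfolding e' by simp
  qed
  have vC: "v c = 0" if c: "c \<in> ?C" "c \<noteq> 0" for c
  proof (rule subfield_trivial[OF subring_hull _ _ refl, of ?X])
    show "ring_gen ?X \<subseteq> E" using other_ring_FbA FbA(4) by blast
    show "v x = 0" if "x \<in> ring_gen ?X" "x \<noteq> 0" for x
      using pv(3)[of x] notP[OF that] other_ring_FbA that by blast
    show "c \<in> field_gen ?X" using c C_upper_eq by simp
  qed fact
  have CE: "c \<in> E" if "c \<in> ?C" for c using C that by blast
  have tiE: "t i \<in> E" using gen_E upper_index i by blast
  have \<pi>E: "\<pi> \<in> E" unfolding \<pi> using ab CE tiE subfield_add[OF E] subfield_mult[OF E] by blast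
  have \<pi>0: "\<pi> \<noteq> 0" using irr by (simp add: irreducible_in_def)
  \<comment> \<open>\<open>\<pi>\<close> need not lie in \<open>FbA T\<close>; a common denominator
    \<open>d\<close> of its coefficients brings it there, and \<open>d\<close> has value 0.\<close>
  have e1: "v \<pi> \<ge> 1"
  proof -
    have "[:b, a:] \<in> polys_over (field_gen ?X)"
      using ab CR C_upper_eq by (metis polys_over_0 polys_over_pCons)
    then obtain d where d: "d \<in> ring_gen ?X" "d \<noteq> 0" "smult d [:b, a:] \<in> polys_over (ring_gen ?X)"
      using clear_denominators by blast
    then have dab: "d * b \<in> ring_gen ?X" "d * a \<in> ring_gen ?X" by (auto dest!: polys_over_pConsD)
    have "d * \<pi> = (d * a) * t i + d * b" by (simp add: \<pi> algebra_simps)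
    also have "\<dots> \<in> FbA T"
      using dab other_ring_FbA FbA(3)[OF i] subring_add[OF FbA(1)] subring_mult[OF FbA(1)] by blast
    finally have dA: "\<pi> * d \<in> FbA T" by (simp add: mult.commute)
    have "?X \<subseteq> T_ring T" unfolding T_ring_def
      using k_K K_gens K0y_K ring_gen_inc[of _ "K \<union> t ` upper T"] by blast
    then have "ring_gen ?X \<subseteq> T_ring T" by (intro ring_gen_subset) (simp_all add: T_ring_def subring_hull)
    then have "\<pi> * d \<in> P" unfolding P\<pi> using d(1) dA by blast
    then have "vge 1 (\<pi> * d)" using pv(4) by blast
    moreover have dC: "d \<in> ?C" using d(1) ring_gen_subset_field_gen C_upper_eq by blast
    ultimately show ?thesis using v_mult[OF \<pi>E CE[OF dC] \<pi>0 d(2)] vC[OF dC d(2)] \<pi>0 d(2) by (simp add: vge_def)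
  qed
  have E_gen: "E = field_gen (?C \<union> {x})" if x: "x \<in> E" "t i = c * x + d" "c \<in> ?C" "d \<in> ?C" for x c d
  proof
    show "field_gen (?C \<union> {x}) \<subseteq> E" using C x by (intro field_gen_subset[OF _ E]) auto
    have g: "c \<in> field_gen (?C \<union> {x})" "d \<in> field_gen (?C \<union> {x})" "x \<in> field_gen (?C \<union> {x})"
      using x by (auto intro: field_gen_inc)
    have "t i \<in> field_gen (?C \<union> {x})"
      unfolding x(2) by (intro subfield_add[OF subfield_hull] subfield_mult[OF subfield_hull] g)
    then have "field_gen (?C \<union> {t i}) \<subseteq> field_gen (?C \<union> {x})"
      by (intro field_gen_subset[OF _ subfield_hull]) (auto intro: field_gen_inc)
    then show "E \<subseteq> field_gen (?C \<union> {x})" using E_adjoin[OF i] by simp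
  qed
  have ti: "t i = inverse a * \<pi> + (- b / a)" using a by (simp add: \<pi> field_simps)
  have g1: "E = field_gen (?C \<union> {\<pi>})"
    by (rule E_gen[OF \<pi>E ti]) (use ab in \<open>auto intro!: subfield_inverse[OF C(1)] subfield_divide[OF C(1)] subfield_minus[OF C(1)]\<close>)
  \<comment> \<open>The lowest nonzero coefficient decides the value of a polynomial in
    \<open>\<pi>\<close>, so all values are multiples of \<open>v \<pi>\<close>. As 1 is a value,
    \<open>v \<pi>\<close> divides it.\<close>
  have multiple: "\<exists>n. v (poly p \<pi>) = n * v \<pi>" if "p \<in> polys_over ?C" "poly p \<pi> \<noteq> 0" for p
    using that
  proof (induction p)
    case (pCons c p)
    then have c: "c \<in> ?C" "p \<in> polys_over ?C" by (auto dest: polys_over_pConsD)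
    have pE: "poly p \<pi> \<in> E" using poly_closed[OF subfield_subring[OF E] _ \<pi>E] c(2) polys_over_mono[OF C(3)] by blast
    have vp: "vge 0 (poly p \<pi>)" using c(2)
    proof (induction p)
      case (pCons c p)
      then have c: "c \<in> ?C" "p \<in> polys_over ?C" by (auto dest: polys_over_pConsD)
      have pE: "poly p \<pi> \<in> E" using poly_closed[OF subfield_subring[OF E] _ \<pi>E] c(2) polys_over_mono[OF C(3)] by blast
      have "vge 0 c" using vC[OF c(1)] by (cases "c = 0") (auto simp: vge_def)
      moreover have "vge 0 (\<pi> * poly p \<pi>)" using vge_mult_0[OF \<pi>E pE _ pCons.IH[OF c(2)]] e1 by (simp add: vge_def)
      ultimately show ?case using vge_add[OF CE[OF c(1)] subfield_mult[OF E \<pi>E pE]] by simp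
    qed simp
    show ?case
    proof (cases "c = 0")
      case True
      then have nz: "poly p \<pi> \<noteq> 0" using pCons by auto
      then obtain n where "v (poly p \<pi>) = n * v \<pi>" using pCons.IH c by blast
      then show ?thesis using True v_mult[OF \<pi>E pE \<pi>0 nz] by (intro exI[of _ "n + 1"]) (simp add: algebra_simps)
    next
      case False
      have "vge 1 (\<pi> * poly p \<pi>)" using vge_mult[OF \<pi>E pE _ vp, of 1] e1 by (simp add: vge_def)
      then have "v (c + \<pi> * poly p \<pi>) = 0"
        using v_add_lt(2)[OF CE[OF c(1)] subfield_mult[OF E \<pi>E pE] False] vC[OF c(1) False] by simp
      then show ?thesis by (intro exI[of _ 0]) simp
    qed
  qed simp
  obtain x where x: "x \<in> E" "x \<noteq> 0" "v x = 1" using dval unfolding is_discrete_valuation_def by blast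
  have "x \<in> field_gen (?C \<union> {\<pi>})" using x g1 by simp
  then obtain p q where pq: "p \<in> polys_over ?C" "q \<in> polys_over ?C" "poly q \<pi> \<noteq> 0" "x = poly p \<pi> / poly q \<pi>"
    by (rule field_gen_adjoin[OF CR])
  have pqE: "poly p \<pi> \<in> E" "poly q \<pi> \<in> E"
    using poly_closed[OF subfield_subring[OF E] _ \<pi>E] pq polys_over_mono[OF C(3)] by blast+
  have p0: "poly p \<pi> \<noteq> 0" using pq x by auto
  obtain n m where "v (poly p \<pi>) = n * v \<pi>" "v (poly q \<pi>) = m * v \<pi>"
    using multiple pq p0 by meson
  then have "(n - m) * v \<pi> = 1" using v_divide[OF pqE p0 pq(3)] x pq(4) by (simp add: algebra_simps)
  then have "v \<pi> dvd 1" by (metis dvd_triv_right)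
  then have v1: "v \<pi> = 1" using e1 by simp
  have \<pi>a: "\<pi> / a \<in> E" "\<pi> / a \<noteq> 0" "v (\<pi> / a) = 1"
    using \<pi>E \<pi>0 a ab CE subfield_divide[OF E] v_divide[OF \<pi>E CE[OF ab(1)] \<pi>0 a] v1 vC[OF ab(1) a] by auto
  have g2: "E = field_gen (?C \<union> {\<pi> / a})"
    by (rule E_gen[OF \<pi>a(1), of 1 "- b / a"])
      (use ab a in \<open>auto simp: \<pi> field_simps intro!: subfield_1[OF C(1)] subfield_divide[OF C(1)] subfield_minus[OF C(1)]\<close>)
  have tw: "tower T" "valued_field E v" by unfold_locales
  have 1: "rational_place T v i \<pi>"
    by (intro rational_place.intro rational_place_axioms.intro) (fact tw i vC \<pi>E \<pi>0 v1 g1)+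
  have 2: "rational_place T v i (\<pi> / a)"
    by (intro rational_place.intro rational_place_axioms.intro) (fact tw i vC \<pi>a g2)+
  show ?thesis using that[OF 1 ab a \<pi> 2 sp pv(2)] .
qed

lemma monomial_coefficients:
  assumes "i \<in> upper T"
  shows "primitive T i \<Longrightarrow> D (t i) \<in> C_upper T i"
    "hyperexponential T i \<Longrightarrow> \<exists>a\<in>C_upper T i. a \<noteq> 0 \<and> D (t i) = a * t i"
    "hypertangent T i \<Longrightarrow> \<exists>a\<in>C_upper T i. a \<noteq> 0 \<and> D (t i) = a * (1 + (t i)\<^sup>2)"
proof -
  note b = below_C_upper[OF assms] and nz = D_gen_nz[OF upper_index[OF assms]]
  show "primitive T i \<Longrightarrow> D (t i) \<in> C_upper T i" using b by (auto simp: primitive_def)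
  show "\<exists>a\<in>C_upper T i. a \<noteq> 0 \<and> D (t i) = a * t i" if "hyperexponential T i"
    using that b nz upper_gen_nz[OF assms] unfolding hyperexponential_def by (intro bexI[of _ "D (t i) / t i"]) auto
  have "1 + (t i)\<^sup>2 \<noteq> 0"
  proof
    assume e: "1 + (t i)\<^sup>2 = 0"
    have "(t i)\<^sup>2 \<in> C_upper T i"
      using e subfield_minus[OF C_upper(1) subfield_1[OF C_upper(1)]] by (metis add_eq_0_iff)
    then show False
      using algebraic_of_power[OF C_upper(1) algebraic_over_elem[OF C_upper(1)], of "t i" 2 i] C_upper_transc[OF assms] by simp
  qed
  then show "\<exists>a\<in>C_upper T i. a \<noteq> 0 \<and> D (t i) = a * (1 + (t i)\<^sup>2)" if "hypertangent T i"
    using that b nz unfolding hypertangent_def by (intro bexI[of _ "D (t i) / (1 + (t i)\<^sup>2)"]) auto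
qed

lemma transc_transfer:
  assumes "i \<in> upper T" "algebraic_over (C_upper T i) x \<Longrightarrow> algebraic_over (C_upper T i) (t i)"
  shows "\<not> algebraic_over (C_upper T i) x"
  using assms C_upper_transc by blast

lemma Upper_inf_kernel:
  assumes pl: "is_place_of_kind T (Upper_inf i) v \<pi>" and res: "is_residue_map E v (res :: 'a \<Rightarrow> 'k::field_char_0)"
    and ind: "independent_gen T i"
  shows "hyperexponential T i \<or> hypertangent T i \<Longrightarrow> excess T v \<pi> = 0 \<and> NN T v \<pi> res = {0}"
    "primitive T i \<Longrightarrow> second_kernel_hyp T v \<pi> res \<and> excess T v \<pi> = 1"
proof -
  interpret rational_place T v i \<pi> by (rule Upper_inf_rational_place[OF pl])
  interpret residue_rational_place T v i \<pi> res by unfold_locales (fact res)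
  note DC = independent_D_C[OF ind]
  note co = monomial_coefficients[OF i]
  have \<pi>: "\<pi> = inverse (t i)" using pl by (simp add: divide_inverse)
  have t: "t i \<in> E" "t i \<noteq> 0" using gen_E upper_index i upper_gen_nz by auto
  have D\<pi>: "D \<pi> = - D (t i) / (t i)\<^sup>2" unfolding \<pi> using D_inverse t by simp
  note al = subfield_algebraic[OF C(1)]
  show "excess T v \<pi> = 0 \<and> NN T v \<pi> res = {0}" if "hyperexponential T i \<or> hypertangent T i"
    using that
  proof
    assume "hyperexponential T i"
    then obtain a where a: "a \<in> C" "a \<noteq> 0" "D (t i) = a * t i" using co(2) by blast
    \<comment> \<open>At infinity the uniformiser is itself an exponential, with the opposite
      exponent.\<close>
    have D: "D \<pi> = \<pi> * (- a)" using D\<pi> a(3) t by (simp add: \<pi> power2_eq_square field_simps)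
    have na: "- a \<in> C" using a subfield_minus[OF C(1)] by blast
    have tr: "\<not> algebraic_over C \<pi>"
      by (rule transc_transfer[OF i]) (use subfield_inverse[OF al, of \<pi>] \<pi> in simp)
    show ?thesis
      using exponential_kernel[OF DC D C_E[OF na] _ na _ \<tau>(1,2) _ tr] D a by (simp add: mult.commute)
  next
    assume "hypertangent T i"
    then obtain a where a: "a \<in> C" "a \<noteq> 0" "D (t i) = a * (1 + (t i)\<^sup>2)" using co(3) by blast
    \<comment> \<open>The hypertangent equation is invariant, up to sign, under passing to the
      inverse of \<open>t i\<close>.\<close>
    have D: "D \<pi> = (- a) * (1 + \<pi>\<^sup>2)" using D\<pi> a(3) t by (simp add: \<pi> power2_eq_square field_simps)
    have na: "- a \<in> C" "- a \<noteq> 0" using a subfield_minus[OF C(1)] by auto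
    show ?thesis using tangent_kernel[OF DC na D] by blast
  qed
  show "second_kernel_hyp T v \<pi> res \<and> excess T v \<pi> = 1" if p: "primitive T i"
  proof -
    have a: "D (t i) \<in> C" "D (t i) \<noteq> 0" using co(1)[OF p] D_gen_nz upper_index i by auto
    have D: "D \<pi> = (- D (t i)) * \<pi>\<^sup>2" using D\<pi> t by (simp add: \<pi> divide_inverse power_inverse)
    have na: "- D (t i) \<in> C" "- D (t i) \<noteq> 0" using a subfield_minus[OF C(1)] by auto
    show ?thesis using primitive_kernel[OF DC na D t(1) upper_gen_notin_C[OF i]] by simp
  qed
qed

lemma Moving_kernel:
  assumes pl: "is_place_of_kind T (Moving i) v \<pi>" and res: "is_residue_map E v (res :: 'a \<Rightarrow> 'k::field_char_0)"
    and ind: "independent_gen T i"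
  shows "hyperexponential T i \<Longrightarrow> \<pi> = t i \<Longrightarrow> excess T v \<pi> = 0 \<and> NN T v \<pi> res = {0}"
    "hypertangent T i \<Longrightarrow> \<iota> \<in> k \<Longrightarrow> \<iota>\<^sup>2 = - 1 \<Longrightarrow> \<pi> = t i - \<iota> \<Longrightarrow> excess T v \<pi> = 0 \<and> NN T v \<pi> res = {0}"
    "\<not> primitive T i"
proof -
  obtain a0 b0 where ab: "rational_place T v i \<pi>" "a0 \<in> C_upper T i" "b0 \<in> C_upper T i" "a0 \<noteq> 0"
    "\<pi> = a0 * t i + b0" "rational_place T v i (\<pi> / a0)" "is_special T v" "FbA T \<subseteq> val_ring E v"
    by (rule Moving_rational_places[OF pl])
  interpret rational_place T v i \<pi> by (rule ab(1))
  interpret residue_rational_place T v i \<pi> res by unfold_locales (fact res)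
  note DC = independent_D_C[OF ind]
  note co = monomial_coefficients[OF i]
  have t: "t i \<in> E" "t i \<noteq> 0" using gen_E upper_index i upper_gen_nz by auto
  note al = subfield_closed[OF subfield_algebraic[OF C(1)]]
  show "excess T v \<pi> = 0 \<and> NN T v \<pi> res = {0}" if h: "hyperexponential T i" and \<pi>: "\<pi> = t i"
  proof -
    obtain a where a: "a \<in> C" "a \<noteq> 0" "D (t i) = a * t i" using co(2)[OF h] by blast
    have D: "D \<pi> = \<pi> * a" using a \<pi> by (simp add: mult.commute)
    show ?thesis using exponential_kernel[OF DC D C_E[OF a(1)] _ a(1,2) \<tau>(1,2) _] a \<pi> C_upper_transc[OF i] by simp
  qed
  show "excess T v \<pi> = 0 \<and> NN T v \<pi> res = {0}"
    if h: "hypertangent T i" and \<iota>: "\<iota> \<in> k" "\<iota>\<^sup>2 = - 1" and \<pi>: "\<pi> = t i - \<iota>" for \<iota>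
  proof -
    obtain a where a: "a \<in> C" "a \<noteq> 0" "D (t i) = a * (1 + (t i)\<^sup>2)" using co(3)[OF h] by blast
    note cl = subfield_closed[OF C(1)]
    have iC: "\<iota> \<in> C" "\<iota> \<noteq> 0" "D \<iota> = 0" "\<iota> \<in> E" using \<iota> C D_k k_E by auto
    have ii: "\<iota> * \<iota> = - 1" using \<iota> by (simp add: power2_eq_square)
    have ne: "t i + \<iota> \<noteq> 0" "t i - \<iota> \<noteq> 0"
      using upper_gen_notin_C[OF i] iC cl(5)[OF iC(1)] by (auto simp: add_eq_0_iff2)
    \<comment> \<open>The logarithmic derivative of \<open>\<pi>\<close>. Modulo
      \<open>\<pi>\<close> the generator is \<open>\<iota>\<close>, so \<open>w\<close> has the
      residue of \<open>2 * \<iota> * a\<close>.\<close>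
    define w where "w = a * (t i + \<iota>)"
    have aE: "a \<in> E" using a C_E by blast
    have wE: "w \<in> E" unfolding w_def using aE t iC subfield_mult[OF E] subfield_add[OF E] by blast
    have f: "1 + (t i)\<^sup>2 = (t i - \<iota>) * (t i + \<iota>)" using ii by (simp add: power2_eq_square algebra_simps)
    have D\<pi>: "D \<pi> = \<pi> * w" using a(3) f t iC by (simp add: \<pi> w_def D_diff mult_ac)
    have b: "2 * \<iota> * a \<in> C" "2 * \<iota> * a \<noteq> 0"
      using cl(4)[OF cl(4)[OF _ iC(1)] a(1), of 2] cl(10)[of 2] a iC by auto
    have "w - 2 * \<iota> * a = a * \<pi>" by (simp add: w_def \<pi> algebra_simps)
    then have wb: "vge 1 (w - 2 * \<iota> * a)" using vge_mult_0[OF aE \<tau>(1) vge_C[OF a(1)] tau_vge(2)] by simp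
    \<comment> \<open>The logarithmic derivative of \<open>\<pi>\<close> itself involves
      \<open>t i\<close>; this Moebius transform has the logarithmic derivative
      \<open>2 * \<iota> * a\<close>, which lies in \<open>C\<close>.\<close>
    define \<theta> where "\<theta> = (t i - \<iota>) / (t i + \<iota>)"
    have \<theta>E: "\<theta> \<in> E" "\<theta> \<noteq> 0"
      using ne t iC by (auto simp: \<theta>_def intro!: subfield_divide[OF E] subfield_diff[OF E] subfield_add[OF E])
    have "D \<theta> = (D (t i) * (t i + \<iota>) - (t i - \<iota>) * D (t i)) / (t i + \<iota>)\<^sup>2"
      unfolding \<theta>_def using t iC ne by (simp add: D_divide D_diff D_add subfield_diff[OF E] subfield_add[OF E])
    also have "D (t i) * (t i + \<iota>) - (t i - \<iota>) * D (t i) = (2 * \<iota> * a * (t i - \<iota>)) * (t i + \<iota>)"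
      unfolding a(3) f by (simp add: algebra_simps)
    also have "\<dots> / (t i + \<iota>)\<^sup>2 = 2 * \<iota> * a * \<theta>" using ne(1) by (simp add: \<theta>_def power2_eq_square)
    finally have D\<theta>: "D \<theta> = 2 * \<iota> * a * \<theta>" .
    have \<theta>1: "\<theta> \<noteq> 1"
    proof
      assume "\<theta> = 1"
      then have "t i - \<iota> = t i + \<iota>" using ne by (simp add: \<theta>_def)
      then have "2 * \<iota> = 0" by (simp add: algebra_simps)
      then show False using iC by simp
    qed
    have tr: "\<not> algebraic_over C \<theta>"
    proof (rule transc_transfer[OF i])
      assume A: "algebraic_over C \<theta>"
      \<comment> \<open>The Moebius transformation is invertible over \<open>C\<close>, so
        \<open>\<theta>\<close> is as transcendental as \<open>t i\<close>.\<close>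
      have "t i = \<iota> * (1 + \<theta>) / (1 - \<theta>)"
      proof -
        have "\<theta> * (t i + \<iota>) = t i - \<iota>" using ne by (simp add: \<theta>_def)
        then have "t i * (1 - \<theta>) = \<iota> * (1 + \<theta>)" by (simp add: algebra_simps)
        then show ?thesis using \<theta>1 by (simp add: eq_divide_eq)
      qed
      moreover have "\<iota> * (1 + \<theta>) / (1 - \<theta>) \<in> {x. algebraic_over C x}"
        using A algebraic_over_elem[OF C(1) iC(1)] by (intro al(9) al(4) al(3) al(6) al(2)) auto
      ultimately show "algebraic_over C (t i)" by simp
    qed
    show ?thesis using exponential_kernel[OF DC D\<pi> wE wb b \<theta>E D\<theta> tr] by blast
  qed
  show "\<not> primitive T i"
  proof
    assume p: "primitive T i"
    \<comment> \<open>With the coefficient of \<open>t i\<close> normalised to 1, the derivative of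
      the uniformiser stays in \<open>C\<close> for primitive \<open>t i\<close>.\<close>
    interpret r2: rational_place T v i "\<pi> / a0" by (rule ab(6))
    note cl = subfield_closed[OF C(1)]
    have e: "\<pi> / a0 = t i + b0 / a0" using ab(4) by (simp add: ab(5) field_simps)
    have ba: "b0 / a0 \<in> C" using ab cl(9) by blast
    have De: "D (\<pi> / a0) = D (t i) + D (b0 / a0)" unfolding e using D_add t ba C_E by blast
    have "D (\<pi> / a0) \<in> C" unfolding De using co(1)[OF p] DC[OF ba] cl(3) by blast
    moreover have "D (\<pi> / a0) \<noteq> 0"
    proof
      assume "D (\<pi> / a0) = 0"
      then have "t i + b0 / a0 \<in> C" using constants[OF r2.\<tau>(1)] C(3) e by auto
      then have "t i + b0 / a0 - b0 / a0 \<in> C" using ba cl(6) by blast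
      then show False using upper_gen_notin_C[OF i] by simp
    qed
    ultimately show False using r2.not_special[OF DC _ _ ab(8)] ab(7) by blast
  qed
qed

end

section \<open>Residues and antiderivatives of rational functions\<close>

text \<open>The Taylor expansion at \<open>a\<close>, placed among Laurent series because these form
  a field in which quotients of polynomials expand. It is a ring homomorphism commuting with
  differentiation.\<close>

definition laurent_at :: "'k::field_char_0 \<Rightarrow> 'k poly \<Rightarrow> 'k fls" where
  "laurent_at a P = fps_to_fls (fps_of_poly (P \<circ>\<^sub>p [:a, 1:]))"

lemma laurent_at_add: "laurent_at a (P + Q) = laurent_at a P + laurent_at a Q"
  and laurent_at_diff: "laurent_at a (P - Q) = laurent_at a P - laurent_at a Q"
  and laurent_at_mult: "laurent_at a (P * Q) = laurent_at a P * laurent_at a Q"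
  by (simp_all add: laurent_at_def pcompose_add pcompose_diff pcompose_mult fps_of_poly_add fps_of_poly_diff
    fps_of_poly_mult fls_times_fps_to_fls)

lemma laurent_at_eq_0: "laurent_at a P = 0 \<longleftrightarrow> P = 0"
proof -
  have "fps_of_poly (P \<circ>\<^sub>p [:a, 1:]) = 0 \<longleftrightarrow> P \<circ>\<^sub>p [:a, 1:] = 0"
    using fps_of_poly_eq_iff[of "P \<circ>\<^sub>p [:a, 1:]" 0] by simp
  then show ?thesis by (simp add: laurent_at_def pcompose_eq_0_iff)
qed

lemma laurent_at_pderiv: "laurent_at a (pderiv P) = fls_deriv (laurent_at a P)"
proof -
  have "pderiv (P \<circ>\<^sub>p [:a, 1:]) = pderiv P \<circ>\<^sub>p [:a, 1:]"
    by (simp add: pderiv_pcompose pderiv_pCons)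
  then show ?thesis
    by (simp add: laurent_at_def fls_deriv_fps_to_fls fps_of_poly_pderiv[symmetric])
qed

lemma fls_deriv_quotient:
  fixes f g :: "'k::field_char_0 fls"
  assumes "g \<noteq> 0" shows "fls_deriv (f / g) = (fls_deriv f * g - f * fls_deriv g) / (g * g)"
proof -
  have "fls_deriv f = fls_deriv (f / g * g)" using assms by simp
  also have "\<dots> = f / g * fls_deriv g + fls_deriv (f / g) * g" by (rule fls_deriv_mult)
  finally have "fls_deriv (f / g) * g = fls_deriv f - f / g * fls_deriv g" by simp
  then have "fls_deriv (f / g) * g * g = (fls_deriv f - f / g * fls_deriv g) * g" by simp
  also have "\<dots> = fls_deriv f * g - f / g * g * fls_deriv g" by (simp only: left_diff_distrib) (simp only: mult_ac)
  finally have "fls_deriv (f / g) * (g * g) = fls_deriv f * g - f * fls_deriv g"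
    using assms by (simp add: mult.assoc)
  then show ?thesis using assms by (simp add: eq_divide_eq)
qed

text \<open>1 / (X - b) is the logarithmic derivative of X - b, so its residue at \<open>a\<close>
  is the order to which X - b vanishes there.\<close>

lemma residue_simple_pole:
  "fls_residue (laurent_at a [:c:] / laurent_at a [:- b, 1:]) = (if a = b then c else 0)"
proof -
  let ?q = "fps_of_poly [:a - b, 1:]"
  have Q: "laurent_at a [:- b, 1:] = fps_to_fls ?q" by (simp add: laurent_at_def pcompose_pCons)
  have P: "laurent_at a [:c:] = fls_const c"
    by (simp add: laurent_at_def pcompose_pCons fps_of_poly_const)
  have "fls_deriv (fps_to_fls ?q) = 1"
    by (simp add: fls_deriv_fps_to_fls fps_of_poly_pderiv[symmetric] pderiv_pCons)
  moreover have "?q \<noteq> 0" using fps_of_poly_eq_iff[of "[:a - b, 1:]" 0] by simp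
  ultimately have "fls_residue (inverse (fps_to_fls ?q)) = of_int (fls_subdegree (fps_to_fls ?q))"
    using fls_residue_deriv_times_inverse_eq_subdegree(1)[of "fps_to_fls ?q"] by simp
  also have "\<dots> = of_nat (subdegree ?q)" by (simp add: fls_subdegree_fls_to_fps)
  also have "subdegree ?q = (if a = b then 1 else 0)"
    by (auto simp: fps_of_poly_linear subdegree_eq_0)
  finally have "fls_residue (inverse (fps_to_fls ?q)) = (if a = b then 1 else 0)" by simp
  then show ?thesis unfolding Q P divide_inverse fls_residue_fls_const_times by simp
qed

locale rational_functions = diff_field \<kappa> \<delta>
  for \<kappa> :: "'k::field_char_0 set" and \<delta> +
  fixes k :: "'k set" and x :: 'k
  assumes kc: "alg_closed k" and kappa: "\<kappa> = field_gen (k \<union> {x})" and transc: "\<not> algebraic_over k x"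
    and \<delta>k: "\<And>c. c \<in> k \<Longrightarrow> \<delta> c = 0" and \<delta>x: "\<delta> x = 1"
begin

lemma k: "is_subfield k" and kR: "is_subring k"
  using kc subfield_subring by (auto simp: alg_closed_def)

lemma k_kappa: "k \<subseteq> \<kappa>" and x_kappa: "x \<in> \<kappa>"
  by (auto simp: kappa intro: field_gen_inc)

lemma poly_eq_0: "P \<in> polys_over k \<Longrightarrow> poly P x = 0 \<Longrightarrow> P = 0"
  using transc unfolding algebraic_over_def by blast

lemma poly_kappa: "P \<in> polys_over k \<Longrightarrow> poly P x \<in> \<kappa>"
  using poly_closed[OF subfield_subring[OF E] _ x_kappa] polys_over_mono[OF k_kappa] by blast

lemma \<delta>_poly: "P \<in> polys_over k \<Longrightarrow> \<delta> (poly P x) = poly (pderiv P) x"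
  using D_const_poly[of P x] polys_over_mono[OF k_kappa] x_kappa \<delta>k \<delta>x by (auto simp: polys_over_def)

lemma \<delta>_quotient:
  assumes "P \<in> polys_over k" "Q \<in> polys_over k" "Q \<noteq> 0"
  shows "\<delta> (poly P x / poly Q x) = poly (pderiv P * Q - P * pderiv Q) x / (poly Q x)\<^sup>2"
proof -
  have "poly Q x \<noteq> 0" using poly_eq_0 assms by blast
  then show ?thesis using assms by (simp add: D_divide poly_kappa \<delta>_poly)
qed

text \<open>A relation, because an element of the field carries no preferred numerator and
  denominator; \<open>rep_unique\<close> shows that the expansion depends on the element
  alone.\<close>

definition rep :: "'k \<Rightarrow> 'k \<Rightarrow> 'k fls \<Rightarrow> bool" where
  "rep a f F \<longleftrightarrow> (\<exists>P\<in>polys_over k. \<exists>Q\<in>polys_over k. Q \<noteq> 0 \<and> f = poly P x / poly Q x \<and>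
     F = laurent_at a P / laurent_at a Q)"

lemma kappaE:
  assumes "f \<in> \<kappa>"
  obtains P Q where "P \<in> polys_over k" "Q \<in> polys_over k" "Q \<noteq> 0" "f = poly P x / poly Q x"
proof -
  obtain P Q where PQ: "P \<in> polys_over k" "Q \<in> polys_over k" "poly Q x \<noteq> 0" "f = poly P x / poly Q x"
    by (rule field_gen_adjoin[OF kR assms[unfolded kappa]])
  moreover from PQ(3) have "Q \<noteq> 0" by auto
  ultimately show ?thesis using that[of P Q] by blast
qed

lemma rep_exists: "f \<in> \<kappa> \<Longrightarrow> \<exists>F. rep a f F"
  using kappaE[of f] unfolding rep_def by metis

text \<open>As \<open>x\<close> is transcendental, the cross-multiplied equation at \<open>x\<close>
  is an identity of polynomials, which can be expanded at \<open>a\<close>.\<close>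

lemma rep_unique: assumes "rep a f F" "rep a f G" shows "F = G"
proof -
  obtain P Q where 1: "P \<in> polys_over k" "Q \<in> polys_over k" "Q \<noteq> 0" "f = poly P x / poly Q x"
    "F = laurent_at a P / laurent_at a Q" using assms(1) unfolding rep_def by auto
  obtain P' Q' where 2: "P' \<in> polys_over k" "Q' \<in> polys_over k" "Q' \<noteq> 0" "f = poly P' x / poly Q' x"
    "G = laurent_at a P' / laurent_at a Q'" using assms(2) unfolding rep_def by auto
  have nz: "poly Q x \<noteq> 0" "poly Q' x \<noteq> 0" using 1 2 poly_eq_0 by blast+
  have "poly (P * Q' - P' * Q) x = 0" using 1(4) 2(4) nz by (simp add: frac_eq_eq)
  then have "P * Q' - P' * Q = 0"
    using 1 2 by (intro poly_eq_0 polys_over_diff[OF kR] polys_over_mult[OF kR])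
  then have "P * Q' = P' * Q" by simp
  then have "laurent_at a P * laurent_at a Q' = laurent_at a P' * laurent_at a Q"
    by (simp only: laurent_at_mult[symmetric])
  then show ?thesis using 1(3,5) 2(3,5) by (simp add: frac_eq_eq laurent_at_eq_0)
qed

lemma rep_add: assumes "rep a f F" "rep a g G" shows "rep a (f + g) (F + G)"
proof -
  obtain P Q where 1: "P \<in> polys_over k" "Q \<in> polys_over k" "Q \<noteq> 0" "f = poly P x / poly Q x"
    "F = laurent_at a P / laurent_at a Q" using assms(1) unfolding rep_def by auto
  obtain P' Q' where 2: "P' \<in> polys_over k" "Q' \<in> polys_over k" "Q' \<noteq> 0" "g = poly P' x / poly Q' x"
    "G = laurent_at a P' / laurent_at a Q'" using assms(2) unfolding rep_def by auto
  have nz: "poly Q x \<noteq> 0" "poly Q' x \<noteq> 0" using 1 2 poly_eq_0 by blast+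
  have "f + g = poly (P * Q' + P' * Q) x / poly (Q * Q') x" using 1 2 nz by (simp add: add_frac_eq)
  moreover have "F + G = laurent_at a (P * Q' + P' * Q) / laurent_at a (Q * Q')"
    using 1 2 by (simp add: add_frac_eq laurent_at_eq_0 laurent_at_add laurent_at_mult)
  moreover have "P * Q' + P' * Q \<in> polys_over k" "Q * Q' \<in> polys_over k" "Q * Q' \<noteq> 0"
    using 1 2 polys_over_add[OF kR] polys_over_mult[OF kR] by auto
  ultimately show ?thesis unfolding rep_def by blast
qed

lemma rep_deriv: assumes "rep a f F" shows "rep a (\<delta> f) (fls_deriv F)"
proof -
  obtain P Q where 1: "P \<in> polys_over k" "Q \<in> polys_over k" "Q \<noteq> 0" "f = poly P x / poly Q x"
    "F = laurent_at a P / laurent_at a Q" using assms(1) unfolding rep_def by auto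
  have "\<delta> f = poly (pderiv P * Q - P * pderiv Q) x / poly (Q * Q) x"
    using \<delta>_quotient[OF 1(1-3)] 1(4) by (simp add: power2_eq_square)
  moreover have "fls_deriv F = laurent_at a (pderiv P * Q - P * pderiv Q) / laurent_at a (Q * Q)"
    using 1 fls_deriv_quotient[of "laurent_at a Q" "laurent_at a P"]
    by (simp add: laurent_at_eq_0 laurent_at_diff laurent_at_mult laurent_at_pderiv)
  moreover have "pderiv P * Q - P * pderiv Q \<in> polys_over k" "Q * Q \<in> polys_over k" "Q * Q \<noteq> 0"
    using 1 polys_over_diff[OF kR] polys_over_mult[OF kR] polys_over_pderiv[OF kR] by auto
  ultimately show ?thesis unfolding rep_def by blast
qed

lemma residue_rep:
  assumes "P \<in> polys_over k" "Q \<in> polys_over k" "Q \<noteq> 0" "rep a (poly P x / poly Q x) F"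
  shows "ratfun_residue P Q a = fls_residue F"
proof -
  have "rep a (poly P x / poly Q x) (laurent_at a P / laurent_at a Q)" using assms unfolding rep_def by blast
  then have "F = laurent_at a P / laurent_at a Q" using rep_unique assms by blast
  then show ?thesis by (simp add: ratfun_residue_def laurent_at_def)
qed

lemma x_minus: "b \<in> k \<Longrightarrow> x - b \<noteq> 0"
  using transc algebraic_over_elem[OF k] by auto

lemma rep_simple_poles:
  assumes "finite B" "B \<subseteq> k" "\<And>b. c b \<in> k"
  shows "\<exists>F. rep a (\<Sum>b\<in>B. c b / (x - b)) F \<and> fls_residue F = (if a \<in> B then c a else 0)"
  using assms(1,2)
proof (induction B rule: finite_induct)
  case empty
  have "rep a 0 0" unfolding rep_def using polys_over_0[OF kR] polys_over_1[OF kR]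
    by (intro bexI[of _ 0] bexI[of _ 1]) (auto simp: laurent_at_def)
  then show ?case by (intro exI[of _ 0]) simp
next
  case (insert b B)
  then obtain F where F: "rep a (\<Sum>b\<in>B. c b / (x - b)) F" "fls_residue F = (if a \<in> B then c a else 0)" by auto
  have b: "b \<in> k" using insert by auto
  let ?G = "laurent_at a [:c b:] / laurent_at a [:- b, 1:]"
  have "[:c b:] \<in> polys_over k" "[:- b, 1:] \<in> polys_over k"
    using b assms(3) by (auto intro!: polys_over_pCons[OF kR] polys_over_0[OF kR] subring_minus[OF kR] subring_1[OF kR])
  then have "rep a (c b / (x - b)) ?G" unfolding rep_def by (intro bexI[of _ "[:c b:]"] bexI[of _ "[:- b, 1:]"]) auto
  then have "rep a (c b / (x - b) + (\<Sum>b\<in>B. c b / (x - b))) (?G + F)" using F(1) by (rule rep_add)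
  moreover have "fls_residue (?G + F) = (if a \<in> insert b B then c a else 0)"
    using insert.hyps F(2) residue_simple_pole[of a "c b" b] by (simp only: fls_residue_add) auto
  ultimately show ?case using insert by (intro exI[of _ "?G + F"]) simp
qed

text \<open>The span of the partial fractions over \<open>k\<close>; rule induction takes the place
  of bookkeeping with finite sums.\<close>

inductive_set PF :: "'k set" where
  PF_power: "x ^ n \<in> PF"
| PF_pole: "b \<in> k \<Longrightarrow> 1 / (x - b) ^ Suc n \<in> PF"
| PF_add: "f \<in> PF \<Longrightarrow> g \<in> PF \<Longrightarrow> f + g \<in> PF"
| PF_scale: "c \<in> k \<Longrightarrow> f \<in> PF \<Longrightarrow> c * f \<in> PF"

lemma PF_0: "0 \<in> PF"
  using PF_scale[OF subfield_0[OF k] PF_power[of 0]] by simp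

lemma PF_diff: "f \<in> PF \<Longrightarrow> g \<in> PF \<Longrightarrow> f - g \<in> PF"
  using PF_add[of f "(- 1) * g"] PF_scale[OF subfield_minus[OF k subfield_1[OF k]], of g] by simp

text \<open>Denominators split over \<open>k\<close>, so closure under division by a single linear
  factor is enough to reach every rational function.\<close>

lemma PF_divide:
  assumes "f \<in> PF" "a \<in> k" shows "f / (x - a) \<in> PF"
  using assms(1)
proof (induction f)
  case (PF_power n)
  show ?case
  proof (induction n)
    case 0 show ?case using PF_pole[OF assms(2), of 0] by simp
  next
    case (Suc n)
    have "x ^ Suc n / (x - a) = x ^ n + a * (x ^ n / (x - a))"
      using x_minus[OF assms(2)] by (simp add: field_simps)
    then show ?case using Suc PF.intros assms(2) by metis
  qed
next
  case (PF_pole b n)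
  show ?case
  proof (cases "a = b")
    case True
    have "1 / (x - b) ^ Suc n / (x - a) = 1 / (x - b) ^ Suc (Suc n)" using True by (simp add: mult.commute)
    then show ?thesis using PF.PF_pole[OF PF_pole, of "Suc n"] by (simp only:)
  next
    case False
    have nz: "x - a \<noteq> 0" "x - b \<noteq> 0" "b - a \<noteq> 0" using x_minus assms(2) PF_pole False by auto
    have ba: "inverse (a - b) \<in> k" using assms(2) PF_pole subfield_inverse[OF k] subfield_diff[OF k] by blast
    \<comment> \<open>Distinct poles separate, at the price of lowering the order at
      \<open>b\<close> by one in the mixed term; hence the induction on the order.\<close>
    have step: "1 / (x - b) ^ Suc m / (x - a) =
      inverse (a - b) * (1 / (x - b) ^ m / (x - a) - 1 / (x - b) ^ Suc m)" for m
    proof -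
      have "1 / (x - a) - 1 / (x - b) = (a - b) / ((x - a) * (x - b))"
        using nz by (simp add: diff_frac_eq)
      then have "inverse (a - b) * (1 / (x - a) - 1 / (x - b)) = 1 / (x - b) / (x - a)"
        using nz False by (simp add: divide_simps)
      then have "1 / (x - b) ^ m * (inverse (a - b) * (1 / (x - a) - 1 / (x - b))) = 1 / (x - b) ^ m * (1 / (x - b) / (x - a))"
        by simp
      then show ?thesis by (simp add: algebra_simps)
    qed
    show ?thesis
    proof (induction n)
      case 0
      have "1 / (x - b) ^ 0 / (x - a) \<in> PF" "1 / (x - b) ^ Suc 0 \<in> PF"
        using PF.PF_pole[OF assms(2), of 0] PF.PF_pole[OF PF_pole, of 0] by auto
      then show ?case unfolding step[of 0] using ba PF_diff PF_scale by blast
    next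
      case (Suc n)
      have "1 / (x - b) ^ Suc (Suc n) \<in> PF" by (rule PF.PF_pole[OF PF_pole])
      then show ?case unfolding step[of "Suc n"] using Suc ba PF_diff PF_scale by blast
    qed
  qed
next
  case (PF_add f g)
  then show ?case using PF.PF_add[of "f / (x - a)" "g / (x - a)"] by (simp add: add_divide_distrib)
next
  case (PF_scale c f)
  then show ?case using PF.PF_scale[of c "f / (x - a)"] by simp
qed

lemma kappa_PF: assumes "f \<in> \<kappa>" shows "f \<in> PF"
proof -
  obtain P Q where PQ: "P \<in> polys_over k" "Q \<in> polys_over k" "Q \<noteq> 0" "f = poly P x / poly Q x"
    by (rule kappaE[OF assms])
  obtain c rs where c: "c \<in> k" "set rs \<subseteq> k" "Q = smult c (\<Prod>r\<leftarrow>rs. [:- r, 1:])"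
    using alg_closed_splits[OF kc PQ(2)] by auto
  have "(\<Sum>i\<in>I. coeff P i * x ^ i) \<in> PF" if "finite I" for I :: "nat set"
    using that by (induction I rule: finite_induct) (auto intro!: PF_0 PF.intros polys_over_coeff[OF PQ(1)])
  then have "poly P x \<in> PF" unfolding poly_altdef by blast
  then have 1: "inverse c * poly P x \<in> PF" using c subfield_inverse[OF k] PF_scale by blast
  have "g / poly (\<Prod>r\<leftarrow>rs. [:- r, 1:]) x \<in> PF" if "g \<in> PF" "set rs \<subseteq> k" for g rs
    using that
  proof (induction rs arbitrary: g)
    case (Cons r rs)
    have "g / (x - r) \<in> PF" using Cons.prems by (intro PF_divide) auto
    from Cons.IH[OF this] have "(g / (x - r)) / poly (\<Prod>r\<leftarrow>rs. [:- r, 1:]) x \<in> PF" using Cons.prems by simp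
    then show ?case by (simp add: divide_divide_eq_left algebra_simps)
  qed simp
  from this[OF 1 c(2)] show ?thesis using PQ(4) c(3) by (simp add: divide_inverse mult_ac)
qed

text \<open>In characteristic 0 powers of \<open>x\<close> and poles of order at least two have
  antiderivatives, so only simple poles survive modulo derivatives.\<close>

lemma partial_fractions:
  assumes "f \<in> PF"
  shows "\<exists>g\<in>\<kappa>. \<exists>B c. finite B \<and> B \<subseteq> k \<and> (\<forall>b. c b \<in> k) \<and> f = \<delta> g + (\<Sum>b\<in>B. c b / (x - b))"
  using assms
proof (induction f)
  case (PF_power n)
  have nk: "inverse (of_nat (Suc n)) \<in> \<kappa>" by (intro subfield_inverse[OF E] subfield_of_nat[OF E])
  have "\<delta> (inverse (of_nat (Suc n))) = 0" using subfield_inverse[OF k subfield_of_nat[OF k]] \<delta>k by blast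
  then have "\<delta> (inverse (of_nat (Suc n)) * x ^ Suc n) = inverse (of_nat (Suc n)) * (of_nat (Suc n) * x ^ n)"
    using D_mult[OF nk subfield_power[OF E x_kappa, of "Suc n"]] D_power[OF x_kappa, of "Suc n"] \<delta>x by simp
  also have "\<dots> = x ^ n" by (simp del: of_nat_Suc)
  finally have "x ^ n = \<delta> (inverse (of_nat (Suc n)) * x ^ Suc n) + (\<Sum>b\<in>{}. 0 / (x - b))" by simp
  then show ?case using subfield_mult[OF E nk subfield_power[OF E x_kappa, of "Suc n"]] subfield_0[OF k]
    by (intro bexI[of _ "inverse (of_nat (Suc n)) * x ^ Suc n"] exI[of _ "{}"] exI[of _ "\<lambda>_. 0"]) auto
next
  case (PF_pole b n)
  show ?case
  proof (cases n)
    case 0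
    then show ?thesis using PF_pole subfield_0[OF E] subfield_1[OF k]
      by (intro bexI[of _ 0] exI[of _ "{b}"] exI[of _ "\<lambda>_. 1"]) auto
  next
    case (Suc m)
    have nz: "x - b \<noteq> 0" using x_minus PF_pole by blast
    have xb: "x - b \<in> \<kappa>" "\<delta> (x - b) = 1"
      using x_kappa k_kappa PF_pole \<delta>x \<delta>k by (auto simp: D_diff subset_iff intro!: subfield_diff[OF E])
    let ?c = "- inverse (of_nat (Suc m))"
    let ?g = "?c * (x - b) powi (- int (Suc m))"
    have ck: "?c \<in> k" by (intro subfield_minus[OF k] subfield_inverse[OF k] subfield_of_nat[OF k])
    have "\<delta> ?g = ?c * (of_int (- int (Suc m)) * (x - b) powi (- int (Suc m) - 1))"
      using D_mult[of ?c "(x - b) powi (- int (Suc m))"] ck k_kappa \<delta>k[OF ck] D_powi[OF xb(1) nz] xb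
      by (simp add: subset_iff subfield_powi[OF E])
    also have "\<dots> = (x - b) powi (- int (Suc m) - 1)" by (simp del: of_nat_Suc)
    also have "\<dots> = 1 / (x - b) ^ Suc n"
    proof -
      have e: "- int (Suc m) - 1 = - int (Suc n)" using Suc by simp
      show ?thesis unfolding e by (simp only: power_int_minus power_int_of_nat inverse_eq_divide)
    qed
    finally have "1 / (x - b) ^ Suc n = \<delta> ?g + (\<Sum>b\<in>{}. 0 / (x - b))" by simp
    moreover have "?g \<in> \<kappa>" using ck k_kappa xb by (intro subfield_mult[OF E] subfield_powi[OF E]) auto
    ultimately show ?thesis using subfield_0[OF k]
      by (intro bexI[of _ ?g] exI[of _ "{}"] exI[of _ "\<lambda>_. 0"]) blast+
  qed
next
  case (PF_add f g)
  then obtain g1 B1 c1 g2 B2 c2 where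
    1: "g1 \<in> \<kappa>" "finite B1" "B1 \<subseteq> k" "\<forall>b. c1 b \<in> k" "f = \<delta> g1 + (\<Sum>b\<in>B1. c1 b / (x - b))" and
    2: "g2 \<in> \<kappa>" "finite B2" "B2 \<subseteq> k" "\<forall>b. c2 b \<in> k" "g = \<delta> g2 + (\<Sum>b\<in>B2. c2 b / (x - b))" by blast
  \<comment> \<open>Both coefficient functions are extended by zero before they are added, since the
    two sets of poles may overlap or differ.\<close>
  let ?c = "\<lambda>b. (if b \<in> B1 then c1 b else 0) + (if b \<in> B2 then c2 b else 0)"
  have e: "(\<Sum>b\<in>B1 \<union> B2. (if b \<in> B then c b else 0) / (x - b)) = (\<Sum>b\<in>B. c b / (x - b))"
    if "B \<subseteq> B1 \<union> B2" for B c
    using that 1(2) 2(2) by (intro sum.mono_neutral_cong_right) auto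
  have "(\<Sum>b\<in>B1 \<union> B2. ?c b / (x - b)) = (\<Sum>b\<in>B1. c1 b / (x - b)) + (\<Sum>b\<in>B2. c2 b / (x - b))"
    unfolding add_divide_distrib sum.distrib using e[of B1 c1] e[of B2 c2] by simp
  then have "f + g = \<delta> (g1 + g2) + (\<Sum>b\<in>B1 \<union> B2. ?c b / (x - b))"
    using 1 2 by (simp add: D_add)
  then show ?case using 1 2 subfield_add[OF E 1(1) 2(1)]
    by (intro bexI[of _ "g1 + g2"] exI[of _ "B1 \<union> B2"] exI[of _ ?c]) (auto intro: subfield_add[OF k] subfield_0[OF k])
next
  case (PF_scale d f)
  then obtain g B c where
    1: "g \<in> \<kappa>" "finite B" "B \<subseteq> k" "\<forall>b. c b \<in> k" "f = \<delta> g + (\<Sum>b\<in>B. c b / (x - b))" by blast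
  have d: "d \<in> \<kappa>" "\<delta> d = 0" using PF_scale k_kappa \<delta>k by auto
  have "d * f = \<delta> (d * g) + (\<Sum>b\<in>B. (d * c b) / (x - b))"
    using 1 d by (simp add: D_mult distrib_left sum_distrib_left)
  then show ?case using 1 PF_scale(1) subfield_mult[OF E d(1) 1(1)]
    by (intro bexI[of _ "d * g"] exI[of _ B] exI[of _ "\<lambda>b. d * c b"]) (auto intro: subfield_mult[OF k])
qed

text \<open>The derivative of a Laurent series has residue 0. Conversely the residue of
  \<open>f\<close> at \<open>a\<close> is the coefficient of the simple pole at \<open>a\<close>, so
  without residues only the derivative remains.\<close>

lemma antiderivative_iff_residues:
  assumes f: "f \<in> \<kappa>" shows "f \<in> \<delta> ` \<kappa> \<longleftrightarrow> \<not> has_nonzero_residue k x f"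
proof
  assume "f \<in> \<delta> ` \<kappa>"
  then obtain g where g: "g \<in> \<kappa>" "f = \<delta> g" by auto
  have "ratfun_residue P Q a = 0"
    if "P \<in> polys_over k" "Q \<in> polys_over k" "Q \<noteq> 0" "f = poly P x / poly Q x" for P Q a
  proof -
    obtain G where "rep a g G" using rep_exists[OF g(1)] by blast
    then have "rep a f (fls_deriv G)" using rep_deriv g by blast
    then show ?thesis using residue_rep[OF that(1-3)] that(4) fls_residue_deriv by metis
  qed
  then show "\<not> has_nonzero_residue k x f" unfolding has_nonzero_residue_def by blast
next
  assume n: "\<not> has_nonzero_residue k x f"
  obtain g B c where
    1: "g \<in> \<kappa>" "finite B" "B \<subseteq> k" "\<forall>b. c b \<in> k" "f = \<delta> g + (\<Sum>b\<in>B. c b / (x - b))"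
    using partial_fractions[OF kappa_PF[OF f]] by blast
  obtain P Q where PQ: "P \<in> polys_over k" "Q \<in> polys_over k" "Q \<noteq> 0" "f = poly P x / poly Q x"
    by (rule kappaE[OF f])
  have "c a = 0" if a: "a \<in> B" for a
  proof -
    obtain F where F: "rep a (\<Sum>b\<in>B. c b / (x - b)) F" "fls_residue F = c a"
      using rep_simple_poles[OF 1(2,3), of c a] 1(4) a by auto
    obtain G where G: "rep a g G" using rep_exists[OF 1(1)] by blast
    have "rep a f (fls_deriv G + F)" using rep_add[OF rep_deriv[OF G] F(1)] 1(5) by simp
    then have "ratfun_residue P Q a = fls_residue (fls_deriv G + F)" using residue_rep[OF PQ(1-3)] PQ(4) by simp
    also have "\<dots> = c a" using F(2) by (simp only: fls_residue_add fls_residue_deriv) simp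
    finally have "ratfun_residue P Q a = c a" .
    moreover have "a \<in> k" using a 1(3) by blast
    ultimately show ?thesis using n PQ unfolding has_nonzero_residue_def by metis
  qed
  then have "f = \<delta> g" using 1(5) by simp
  then show "f \<in> \<delta> ` \<kappa>" using 1(1) by blast
qed

end

section \<open>The residue criterion of (K3)\<close>

context tower
begin

lemma Upper_inf_residue_kernel:
  assumes pl: "is_place_of_kind T (Upper_inf 2) v \<pi>" and res: "is_residue_map E v (res :: 'a \<Rightarrow> 'k::field_char_0)"
    and ex: "excess T v \<pi> \<ge> 1" and n: "nlow T = 1" "ngen T = 2" "rdeg T = 1" and x: "D (t 1) = 1"
  shows "kappa T v res = field_gen (res ` k \<union> {res (t 1)}) \<and>
        (\<forall>P\<in>polys_over (res ` k). \<forall>Q\<in>polys_over (res ` k). Q \<noteq> 0 \<longrightarrow>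
           del T v \<pi> res (poly P (res (t 1)) / poly Q (res (t 1))) =
             poly (pderiv P * Q - P * pderiv Q) (res (t 1)) / (poly Q (res (t 1)))\<^sup>2) \<and>
        (second_kernel_hyp T v \<pi> res \<longleftrightarrow>
           has_nonzero_residue (res ` k) (res (t 1)) (rho_r T v \<pi> res (excess T v \<pi>)))"
proof -
  interpret rational_place T v 2 \<pi> by (rule Upper_inf_rational_place[OF pl])
  interpret residue_rational_place T v 2 \<pi> res by unfold_locales (fact res)
  have up: "upper T - {2} = {}" using n by (auto simp: upper_def)
  then have CK: "C = K" using field_gen_subfield[OF K] unfolding C_upper_def by (simp only: image_empty Un_empty_right)
  then have DC: "D c \<in> C" if "c \<in> C" for c using D_K that by simp
  let ?X = "k \<union> {t 1}"
  have KX: "K = field_gen ?X"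
  proof
    have y: "radical T \<in> field_gen ?X"
    proof -
      \<comment> \<open>Degree 1 means that the radical equals the radicand, so it adds nothing to
        the rational functions.\<close>
      have "radical T \<in> R0 T" using radical n(3) by simp
      then have "radical T \<in> field_gen (Fld T \<union> t ` {1..nlow T})" using R0_field by blast
      also have "\<dots> \<subseteq> field_gen ?X" using Fld_k n by (intro hull_mono) auto
      finally show ?thesis .
    qed
    show "K \<subseteq> field_gen ?X" unfolding K_eq using y n
      by (intro field_gen_subset[OF _ subfield_hull]) (auto intro: field_gen_inc)
    show "field_gen ?X \<subseteq> K" using k_K K_gens(1)[of 1] K0y_K n by (intro field_gen_subset[OF _ K]) auto
  qed
  have t1: "t 1 \<in> C" "t 1 \<in> E" "t 1 \<noteq> 0" using K_gens(1)[of 1] K0y_K CK K_E n gen_not_k[of 1] subfield_0[OF k] by auto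
  have D\<pi>0: "D \<pi> \<noteq> 0"
  proof
    assume "D \<pi> = 0"
    then have "\<pi> \<in> C" using constants \<tau> C by blast
    then show False using trivC \<tau> by fastforce
  qed
  \<comment> \<open>The generator with derivative 1 shows that the shift is at most 0. A smaller one
    could only come from differentiating \<open>\<pi>\<close>, but r >= 1 says that
    \<open>\<pi>\<close> itself stays above the shift, by enough to exclude this.\<close>
  have s: "shift T v = 0"
  proof -
    have le: "shift T v \<le> 0" using cp.shift_least[OF t1(2)] x trivC[OF t1(1) t1(3)] by simp
    have B: "D_bounded (min 0 (v (D \<pi>)))" unfolding D_bounded_def
      using vge_mono[OF vge_C[OF DC], of _ "min 0 (v (D \<pi>))"] by (auto simp: vge_def[of _ "D \<pi>"])
    obtain h where h: "h \<in> E" "D h \<noteq> 0" "v (D h) - v h = shift T v" using cp.shift_attained by blast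
    then have "h \<noteq> 0" by auto
    have "vge (v (D \<pi>)) (D \<pi>)" by (simp add: vge_def)
    from D_element_vge(1)[OF h(1) \<open>h \<noteq> 0\<close> B this]
    have "min (min 0 (v (D \<pi>))) (v (D \<pi>) - 1) \<le> shift T v" using h by (simp add: vge_def)
    moreover have "v (D \<pi>) - 1 - shift T v \<ge> 1" using ex \<tau> by (simp add: excess_def shift_at_def)
    ultimately show ?thesis using le by linarith
  qed
  note cs = consts_stable[OF DC s]
  \<comment> \<open>The same place with the smaller generating set, so that the residue field is
    generated by the residue of \<open>t 1\<close> alone.\<close>
  have "coeff_place T v \<pi> res C {t 1}"
  proof (intro coeff_place.intro coeff_place_axioms.intro)
    show "tower T" "valued_field E v" by unfold_locales
    show "{t 1} \<subseteq> E" using t1(2) by blast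
    show "C = field_gen (k \<union> {t 1})" unfolding CK by (rule KX)
  qed (fact cp.unif cp.res cp.cover cp.bound | use cp.triv in blast)+
  from coeff_place.kappa_gen[OF this]
  have \<kappa>: "kappa T v res = field_gen (res ` k \<union> {res (t 1)})" by (simp only: image_insert image_empty)
  have transc: "\<not> algebraic_over (res ` k) (res (t 1))"
  proof
    assume "algebraic_over (res ` k) (res (t 1))"
    then have "res (t 1) \<in> res ` k" by (rule alg_closed_algebraic[OF cp.res_k_closed])
    then have "t 1 \<in> k" using cp.res_inj t1 C(3) by blast
    then show False using gen_not_k[of 1] n by simp
  qed
  interpret rf: rational_functions "kappa T v res" "del T v \<pi> res" "res ` k" "res (t 1)"
  proof unfold_locales
    show "del T v \<pi> res (res (t 1)) = 1" using cs(2)[OF _ t1(1)] x by simp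
    show "\<And>c. c \<in> res ` k \<Longrightarrow> del T v \<pi> res c = 0" using cp.del_k by auto
  qed (fact cp.res_k_closed \<kappa> transc)+
  have \<rho>: "rho_r T v \<pi> res (excess T v \<pi>) \<in> kappa T v res"
  proof -
    let ?m = "- shift T v - 1 - excess T v \<pi>"
    have "v (\<pi> powi ?m * D \<pi>) = 0"
      using v_mult[of "\<pi> powi ?m" "D \<pi>"] D\<pi>0 \<tau> v_powi[OF \<tau>(1,2), of ?m] D_in[OF \<tau>(1)]
      by (simp add: subfield_powi[OF E] excess_def shift_at_def)
    then show ?thesis unfolding rho_r_def
      using \<tau> D_in[OF \<tau>(1)] by (intro cp.in_kappa subfield_mult[OF E] subfield_powi[OF E]) (auto simp: vge_def)
  qed
  show ?thesis
    using \<kappa> rf.\<delta>_quotient rf.antiderivative_iff_residues[OF \<rho>] ex cs(1) by (auto simp: second_kernel_hyp_def)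
qed

end

section \<open>Monomials in the upper variables\<close>

text \<open>Sorted by powers of the last variable, the sum is a polynomial over the field below with
  a transcendental root, hence zero; each of its coefficients is a sum of the same kind in fewer
  variables.\<close>

lemma monomials_independent:
  fixes t :: "nat \<Rightarrow> 'a::field"
  assumes K: "is_subfield K"
    and "\<And>i. i \<in> {a+1..m} \<Longrightarrow> \<not> algebraic_over (field_gen (K \<union> t ` {a+1..<i})) (t i)"
    and "finite S" "\<And>\<alpha> i. \<alpha> \<in> S \<Longrightarrow> i \<notin> {a+1..m} \<Longrightarrow> \<alpha> i = 0" "\<And>\<alpha>. \<alpha> \<in> S \<Longrightarrow> c \<alpha> \<in> K"
    and "(\<Sum>\<alpha>\<in>S. c \<alpha> * (\<Prod>i\<in>{a+1..m}. t i ^ \<alpha> i)) = 0"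
  shows "\<forall>\<alpha>\<in>S. c \<alpha> = 0"
  using assms(2-)
proof (induction m arbitrary: S c)
  case 0
  then have "S \<subseteq> {\<lambda>_. 0}" by (auto simp: fun_eq_iff)
  then consider "S = {}" | "S = {\<lambda>_. 0}" by blast
  then show ?case using 0 by cases auto
next
  case (Suc m)
  show ?case
  proof (cases "a + 1 \<le> Suc m")
    case False
    then have "{a+1..Suc m} = {}" by auto
    then have "S \<subseteq> {\<lambda>_. 0}" using Suc.prems(3) by (auto simp: fun_eq_iff)
    then consider "S = {}" | "S = {\<lambda>_. 0}" by blast
    then show ?thesis using Suc.prems False by cases auto
  next
    case True
    let ?M = "field_gen (K \<union> t ` {a+1..<Suc m})"
    let ?w = "\<lambda>\<alpha>. \<Prod>i\<in>{a+1..m}. t i ^ \<alpha> i"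
    have set: "{a+1..Suc m} = insert (Suc m) {a+1..m}" using True by auto
    define p where "p = (\<Sum>\<alpha>\<in>S. monom (c \<alpha> * ?w \<alpha>) (\<alpha> (Suc m)))"
    have "poly p (t (Suc m)) = (\<Sum>\<alpha>\<in>S. c \<alpha> * (\<Prod>i\<in>{a+1..Suc m}. t i ^ \<alpha> i))"
      unfolding p_def set by (simp add: poly_sum poly_monom mult_ac)
    then have p0: "poly p (t (Suc m)) = 0" using Suc.prems(5) by simp
    have wM: "?w \<alpha> \<in> ?M" for \<alpha>
      by (intro subfield_prod[OF subfield_hull] subfield_power[OF subfield_hull] field_gen_inc) auto
    have cM: "c \<alpha> * ?w \<alpha> \<in> ?M" if "\<alpha> \<in> S" for \<alpha>
      using Suc.prems(4)[OF that] by (intro subfield_mult[OF subfield_hull] wM field_gen_inc) auto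
    have cf: "coeff p j = (\<Sum>\<alpha>\<in>{\<alpha>\<in>S. \<alpha> (Suc m) = j}. c \<alpha> * ?w \<alpha>)" for j
      unfolding p_def coeff_sum coeff_monom using Suc.prems(2) by (subst sum.inter_filter) auto
    have "p \<in> polys_over ?M" unfolding polys_over_def
      using cM by (auto simp: cf intro!: subfield_sum[OF subfield_hull])
    moreover have "\<not> algebraic_over ?M (t (Suc m))" using Suc.prems(1)[of "Suc m"] True by simp
    ultimately have p: "p = 0" using p0 unfolding algebraic_over_def by blast
    show ?thesis
    proof
      fix \<alpha> assume \<alpha>: "\<alpha> \<in> S"
      define j where "j = \<alpha> (Suc m)"
      \<comment> \<open>The slice with last exponent \<open>j\<close>. Erasing that exponent is
        injective on the slice and brings it into the form of the induction hypothesis.\<close>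
      let ?S = "{\<alpha>\<in>S. \<alpha> (Suc m) = j}" and ?r = "\<lambda>\<alpha>::nat \<Rightarrow> nat. \<alpha>(Suc m := 0)"
      have bk: "(?r \<beta>)(Suc m := j) = \<beta>" if "\<beta> \<in> ?S" for \<beta> using that by (auto simp: fun_eq_iff)
      have inj: "inj_on ?r ?S" by (rule inj_on_inverseI[of _ "\<lambda>\<beta>. \<beta>(Suc m := j)"]) (rule bk)
      have w: "?w (?r \<beta>) = ?w \<beta>" for \<beta> by (rule prod.cong) auto
      have "\<forall>\<beta>\<in>?r ` ?S. c (\<beta>(Suc m := j)) = 0"
      proof (rule Suc.IH)
        show "\<not> algebraic_over (field_gen (K \<union> t ` {a+1..<i})) (t i)" if "i \<in> {a+1..m}" for i
          using Suc.prems(1)[of i] that by auto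
        show "finite (?r ` ?S)" using Suc.prems(2) by auto
        show "\<beta> i = 0" if "\<beta> \<in> ?r ` ?S" "i \<notin> {a+1..m}" for \<beta> i
          using that Suc.prems(3) set by (cases "i = Suc m") auto
        show "c (\<beta>(Suc m := j)) \<in> K" if "\<beta> \<in> ?r ` ?S" for \<beta>
          using that Suc.prems(4) bk by auto
        have "(\<Sum>\<beta>\<in>?r ` ?S. c (\<beta>(Suc m := j)) * ?w \<beta>) = (\<Sum>\<beta>\<in>?S. c ((?r \<beta>)(Suc m := j)) * ?w (?r \<beta>))"
          using inj by (simp only: sum.reindex comp_def)
        also have "\<dots> = (\<Sum>\<beta>\<in>?S. c \<beta> * ?w \<beta>)"
          by (rule sum.cong[OF refl]) (simp only: w bk)
        also have "\<dots> = 0" using cf[of j] p by simp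
        finally show "(\<Sum>\<beta>\<in>?r ` ?S. c (\<beta>(Suc m := j)) * ?w \<beta>) = 0" .
      qed
      moreover have "\<alpha> \<in> ?S" using \<alpha> j_def by simp
      ultimately show "c \<alpha> = 0" using bk[of \<alpha>] by (metis (no_types, lifting) imageI)
    qed
  qed
qed

context tower
begin

definition tmon :: "(nat \<Rightarrow> nat) \<Rightarrow> 'a" where
  "tmon \<alpha> = (\<Prod>i\<in>upper T. t i ^ \<alpha> i)"

definition supported :: "(nat \<Rightarrow> nat) set" where
  "supported = {\<alpha>. \<forall>i. i \<notin> upper T \<longrightarrow> \<alpha> i = 0}"

text \<open>Polynomials in the upper generators. \<open>R\<close> may be an ideal, such as the prime
  below an extended one, and not only a ring. The coefficient function is total and zero off
  \<open>S\<close>, so that two representations can be compared as functions.\<close>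

definition polyset :: "'a set \<Rightarrow> 'a set" where
  "polyset R = {\<Sum>\<alpha>\<in>S. c \<alpha> * tmon \<alpha> |S c. finite S \<and> S \<subseteq> supported \<and> (\<forall>\<alpha>. c \<alpha> \<in> R) \<and> (\<forall>\<alpha>. \<alpha> \<notin> S \<longrightarrow> c \<alpha> = 0)}"

lemma polysetE:
  assumes "f \<in> polyset R"
  obtains S c where "f = (\<Sum>\<alpha>\<in>S. c \<alpha> * tmon \<alpha>)" "finite S" "S \<subseteq> supported" "\<And>\<alpha>. c \<alpha> \<in> R" "\<And>\<alpha>. \<alpha> \<notin> S \<Longrightarrow> c \<alpha> = 0"
proof -
  obtain S c where "f = (\<Sum>\<alpha>\<in>S. c \<alpha> * tmon \<alpha>)" "finite S" "S \<subseteq> supported" "\<forall>\<alpha>. c \<alpha> \<in> R" "\<forall>\<alpha>. \<alpha> \<notin> S \<longrightarrow> c \<alpha> = 0"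
    using assms unfolding polyset_def by auto
  then show ?thesis using that by blast
qed

lemma tmon_0: "tmon (\<lambda>_. 0) = 1"
  by (simp add: tmon_def)

lemma tmon_mult: "tmon (\<lambda>i. \<alpha> i + \<beta> i) = tmon \<alpha> * tmon \<beta>"
  by (simp add: tmon_def power_add prod.distrib)

lemma polyset_0: "0 \<in> R \<Longrightarrow> 0 \<in> polyset R"
  unfolding polyset_def by (intro CollectI exI[of _ "{}"] exI[of _ "\<lambda>_. 0"]) auto

lemma polyset_term: "0 \<in> R \<Longrightarrow> c \<in> R \<Longrightarrow> \<alpha> \<in> supported \<Longrightarrow> c * tmon \<alpha> \<in> polyset R"
  unfolding polyset_def by (intro CollectI exI[of _ "{\<alpha>}"] exI[of _ "\<lambda>\<beta>. if \<beta> = \<alpha> then c else 0"]) auto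

lemma polyset_base: "0 \<in> R \<Longrightarrow> c \<in> R \<Longrightarrow> c \<in> polyset R"
  using polyset_term[of R c "\<lambda>_. 0"] by (simp add: tmon_0 supported_def)

lemma polyset_add:
  assumes R: "\<And>x y. x \<in> R \<Longrightarrow> y \<in> R \<Longrightarrow> x + y \<in> R" and f: "f \<in> polyset R" and g: "g \<in> polyset R"
  shows "f + g \<in> polyset R"
proof -
  obtain S c where c: "f = (\<Sum>\<alpha>\<in>S. c \<alpha> * tmon \<alpha>)" "finite S" "S \<subseteq> supported" "\<And>\<alpha>. c \<alpha> \<in> R" "\<And>\<alpha>. \<alpha> \<notin> S \<Longrightarrow> c \<alpha> = 0"
    by (rule polysetE[OF f]) blast
  obtain S' c' where c': "g = (\<Sum>\<alpha>\<in>S'. c' \<alpha> * tmon \<alpha>)" "finite S'" "S' \<subseteq> supported" "\<And>\<alpha>. c' \<alpha> \<in> R" "\<And>\<alpha>. \<alpha> \<notin> S' \<Longrightarrow> c' \<alpha> = 0"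
    by (rule polysetE[OF g]) blast
  have "f = (\<Sum>\<alpha>\<in>S \<union> S'. c \<alpha> * tmon \<alpha>)" unfolding c(1) using c c' by (intro sum.mono_neutral_left) auto
  moreover have "g = (\<Sum>\<alpha>\<in>S \<union> S'. c' \<alpha> * tmon \<alpha>)" unfolding c'(1) using c c' by (intro sum.mono_neutral_left) auto
  ultimately have "f + g = (\<Sum>\<alpha>\<in>S \<union> S'. (c \<alpha> + c' \<alpha>) * tmon \<alpha>)" by (simp add: sum.distrib distrib_right)
  then show ?thesis unfolding polyset_def using c c' R
    by (intro CollectI exI[of _ "S \<union> S'"] exI[of _ "\<lambda>\<alpha>. c \<alpha> + c' \<alpha>"]) auto
qed

lemma polyset_sum:
  assumes "\<And>x y. x \<in> R \<Longrightarrow> y \<in> R \<Longrightarrow> x + y \<in> R" "0 \<in> R" "\<And>i. i \<in> I \<Longrightarrow> f i \<in> polyset R"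
  shows "sum f I \<in> polyset R"
  using assms(3) by (induction I rule: infinite_finite_induct) (auto intro: polyset_0 polyset_add assms(1,2))

text \<open>Three coefficient sets, so that one statement serves both for a ring and for a ring
  times an ideal.\<close>

lemma polyset_mult:
  assumes R: "\<And>x y. x \<in> R \<Longrightarrow> y \<in> I \<Longrightarrow> x * y \<in> J"
    and J: "\<And>x y. x \<in> J \<Longrightarrow> y \<in> J \<Longrightarrow> x + y \<in> J" "0 \<in> J" and f: "f \<in> polyset R" and g: "g \<in> polyset I"
  shows "f * g \<in> polyset J"
proof -
  obtain S c where c: "f = (\<Sum>\<alpha>\<in>S. c \<alpha> * tmon \<alpha>)" "finite S" "S \<subseteq> supported" "\<And>\<alpha>. c \<alpha> \<in> R" "\<And>\<alpha>. \<alpha> \<notin> S \<Longrightarrow> c \<alpha> = 0"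
    by (rule polysetE[OF f]) blast
  obtain S' c' where c': "g = (\<Sum>\<alpha>\<in>S'. c' \<alpha> * tmon \<alpha>)" "finite S'" "S' \<subseteq> supported" "\<And>\<alpha>. c' \<alpha> \<in> I" "\<And>\<alpha>. \<alpha> \<notin> S' \<Longrightarrow> c' \<alpha> = 0"
    by (rule polysetE[OF g]) blast
  have "f * g = (\<Sum>\<alpha>\<in>S. \<Sum>\<beta>\<in>S'. (c \<alpha> * c' \<beta>) * tmon (\<lambda>i. \<alpha> i + \<beta> i))"
    unfolding c(1) c'(1) sum_product by (simp add: tmon_mult mult_ac)
  also have "\<dots> \<in> polyset J"
  proof -
    have "(c \<alpha> * c' \<beta>) * tmon (\<lambda>i. \<alpha> i + \<beta> i) \<in> polyset J" if "\<alpha> \<in> S" "\<beta> \<in> S'" for \<alpha> \<beta>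
    proof (rule polyset_term[OF J(2)])
      show "(\<lambda>i. \<alpha> i + \<beta> i) \<in> supported" using that c(3) c'(3) unfolding supported_def by fastforce
      show "c \<alpha> * c' \<beta> \<in> J" using c c' R by blast
    qed
    then show ?thesis using J by (intro polyset_sum) auto
  qed
  finally show ?thesis .
qed

lemma subring_polyset: assumes R: "is_subring R" shows "is_subring (polyset R)"
proof -
  note c = subring_closed[OF R]
  have m: "f * g \<in> polyset R" if "f \<in> polyset R" "g \<in> polyset R" for f g
    using polyset_mult[of R R R f g] c(1,3,4) that by blast
  have "- 1 \<in> polyset R" using polyset_base[OF c(1) c(5)[OF c(2)]] .
  then have "- f \<in> polyset R" if "f \<in> polyset R" for f using m[of "- 1" f] that by simp
  then show ?thesis unfolding is_subring_def
    using polyset_0[OF c(1)] polyset_base[OF c(1,2)] m polyset_add[of R] c(3) by blast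
qed

lemma ring_gen_polyset: assumes R: "is_subring R" shows "ring_gen (R \<union> t ` upper T) \<subseteq> polyset R"
proof (rule ring_gen_subset[OF _ subring_polyset[OF R]])
  note c = subring_closed[OF R]
  have "t i \<in> polyset R" if i: "i \<in> upper T" for i
  proof -
    have "tmon (\<lambda>j. if j = i then 1 else 0) = (\<Prod>j\<in>upper T. if j = i then t j else 1)"
      unfolding tmon_def by (rule prod.cong) auto
    also have "\<dots> = t i" using i by simp
    finally have "1 * tmon (\<lambda>j. if j = i then 1 else 0) = t i" by simp
    moreover have "(\<lambda>j. if j = i then 1 else 0) \<in> supported" using i by (auto simp: supported_def)
    ultimately show ?thesis using polyset_term[OF c(1,2)] by metis
  qed
  then show "R \<union> t ` upper T \<subseteq> polyset R" using polyset_base[OF c(1)] by blast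
qed

lemma tmon_E: "tmon \<alpha> \<in> E"
  unfolding tmon_def using gen_E upper_index by (intro subfield_prod[OF E] subfield_power[OF E]) auto

lemma tmon_independent:
  assumes "finite S" "S \<subseteq> supported" "\<And>\<alpha>. \<alpha> \<in> S \<Longrightarrow> c \<alpha> \<in> K" "(\<Sum>\<alpha>\<in>S. c \<alpha> * tmon \<alpha>) = 0" "\<alpha> \<in> S"
  shows "c \<alpha> = 0"
proof -
  have "\<forall>\<alpha>\<in>S. c \<alpha> = 0"
  proof (rule monomials_independent[OF K, of "nlow T" "ngen T" t])
    show "\<not> algebraic_over (field_gen (K \<union> t ` {nlow T + 1..<i})) (t i)" if "i \<in> {nlow T + 1..ngen T}" for i
      using upper_transc[of i] that by (simp add: upper_def)
    show "\<alpha> i = 0" if "\<alpha> \<in> S" "i \<notin> {nlow T + 1..ngen T}" for \<alpha> i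
      using assms(2) that by (auto simp: supported_def upper_def)
    show "(\<Sum>\<alpha>\<in>S. c \<alpha> * (\<Prod>i\<in>{nlow T + 1..ngen T}. t i ^ \<alpha> i)) = 0"
      using assms(4) by (simp add: tmon_def upper_def)
  qed (use assms in auto)
  then show ?thesis using assms(5) by blast
qed

lemma tmon_unique:
  assumes "finite S" "S \<subseteq> supported" "\<And>\<alpha>. c \<alpha> \<in> K" "\<And>\<alpha>. \<alpha> \<notin> S \<Longrightarrow> c \<alpha> = 0"
    and "finite S'" "S' \<subseteq> supported" "\<And>\<alpha>. c' \<alpha> \<in> K" "\<And>\<alpha>. \<alpha> \<notin> S' \<Longrightarrow> c' \<alpha> = 0"
    and eq: "(\<Sum>\<alpha>\<in>S. c \<alpha> * tmon \<alpha>) = (\<Sum>\<alpha>\<in>S'. c' \<alpha> * tmon \<alpha>)"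
  shows "c = c'"
proof
  fix \<alpha>
  have 1: "(\<Sum>\<alpha>\<in>S. c \<alpha> * tmon \<alpha>) = (\<Sum>\<alpha>\<in>S \<union> S'. c \<alpha> * tmon \<alpha>)"
    using assms by (intro sum.mono_neutral_left) auto
  have 2: "(\<Sum>\<alpha>\<in>S'. c' \<alpha> * tmon \<alpha>) = (\<Sum>\<alpha>\<in>S \<union> S'. c' \<alpha> * tmon \<alpha>)"
    using assms by (intro sum.mono_neutral_left) auto
  have "(\<Sum>\<alpha>\<in>S \<union> S'. (c \<alpha> - c' \<alpha>) * tmon \<alpha>) = 0"
    using eq unfolding 1 2 by (simp add: left_diff_distrib sum_subtractf)
  then have "c \<alpha> - c' \<alpha> = 0" if "\<alpha> \<in> S \<union> S'"
    using tmon_independent[of "S \<union> S'" "\<lambda>\<alpha>. c \<alpha> - c' \<alpha>" \<alpha>] assms that subfield_diff[OF K] by auto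
  then show "c \<alpha> = c' \<alpha>" using assms(4,8) by (cases "\<alpha> \<in> S \<union> S'") auto
qed

lemma E_polyset_quotient:
  assumes "x \<in> E" obtains f g where "f \<in> polyset K" "g \<in> polyset K" "g \<noteq> 0" "x = f / g"
  using ring_gen_frac[of x "K \<union> t ` upper T"] ring_gen_polyset[OF subfield_subring[OF K]] assms E_eq that by blast

lemma polyset_E: assumes "R \<subseteq> E" "f \<in> polyset R" shows "f \<in> E"
proof -
  obtain S c where c: "f = (\<Sum>\<alpha>\<in>S. c \<alpha> * tmon \<alpha>)" "finite S" "S \<subseteq> supported" "\<And>\<alpha>. c \<alpha> \<in> R" "\<And>\<alpha>. \<alpha> \<notin> S \<Longrightarrow> c \<alpha> = 0"
    by (rule polysetE[OF assms(2)]) blast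
  then show ?thesis using assms(1) tmon_E by (auto intro!: subfield_sum[OF E] subfield_mult[OF E])
qed

lemma polyset_ring_gen:
  assumes "is_subring R" "f \<in> polyset R" shows "f \<in> ring_gen (R \<union> t ` upper T)"
proof -
  obtain S c where c: "f = (\<Sum>\<alpha>\<in>S. c \<alpha> * tmon \<alpha>)" "finite S" "S \<subseteq> supported" "\<And>\<alpha>. c \<alpha> \<in> R" "\<And>\<alpha>. \<alpha> \<notin> S \<Longrightarrow> c \<alpha> = 0"
    by (rule polysetE[OF assms(2)]) blast
  then show ?thesis unfolding c(1) tmon_def
    by (intro subring_sum[OF subring_hull] subring_mult[OF subring_hull] subring_prod[OF subring_hull]
      subring_power[OF subring_hull] ring_gen_inc) auto
qed

end

section \<open>Gauss extensions of places of the curve\<close>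

lemma (in valued_field) poly_vge:
  assumes "p \<in> polys_over E" "\<And>i. vge e (coeff p i)" "x \<in> E" "vge 0 x"
  shows "poly p x \<in> E \<and> vge e (poly p x)"
  using assms(1,2)
proof (induction p)
  case (pCons c p)
  have c: "c \<in> E" "p \<in> polys_over E" using polys_over_pConsD[OF pCons.prems(1)] by auto
  have v: "vge e c" using pCons.prems(2)[of 0] by simp
  have "vge e (coeff p i)" for i using pCons.prems(2)[of "Suc i"] by simp
  then have IH: "poly p x \<in> E" "vge e (poly p x)" using pCons.IH[OF c(2)] by auto
  then show ?case using c v assms(3,4) vge_mult_0[OF assms(3) IH(1) assms(4) IH(2)]
    by (auto intro!: vge_add subfield_add[OF E_v] subfield_mult[OF E_v])
qed (simp add: subfield_0[OF E_v])

text \<open>\<open>x - y\<close> divides the difference of the two values; each Horner step splits x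
  p(x) - y p(y) as x (p(x) - p(y)) + (x - y) p(y).\<close>

lemma (in valued_field) poly_congruence:
  assumes "p \<in> polys_over E" "\<And>i. vge e (coeff p i)" "x \<in> E" "vge 0 x" "y \<in> E" "vge 0 y" "vge n (x - y)"
  shows "vge (e + n) (poly p x - poly p y)"
  using assms(1,2)
proof (induction p)
  case (pCons c p)
  have c: "c \<in> E" "p \<in> polys_over E" using polys_over_pConsD[OF pCons.prems(1)] by auto
  have v: "\<And>i. vge e (coeff p i)" using pCons.prems(2)[of "Suc _"] by simp
  have IH: "vge (e + n) (poly p x - poly p y)" using pCons.IH[OF c(2) v] .
  have px: "poly p x \<in> E" and py: "poly p y \<in> E" "vge e (poly p y)" using poly_vge[OF c(2) v] assms by auto
  have "vge (e + n) (x * (poly p x - poly p y) + (x - y) * poly p y)"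
  proof (rule vge_add)
    show "vge (e + n) (x * (poly p x - poly p y))"
      using vge_mult_0[OF assms(3) subfield_diff[OF E_v px py(1)] assms(4) IH] .
    show "vge (e + n) ((x - y) * poly p y)"
      using vge_mult[OF subfield_diff[OF E_v assms(3,5)] py(1) assms(7) py(2)] by (simp add: add.commute)
  qed (use assms(3,5) px py in \<open>auto intro!: subfield_mult[OF E_v] subfield_diff[OF E_v]\<close>)
  then show ?case by (simp add: algebra_simps)
qed simp

text \<open>The Gauss formula is phrased through the values of \<open>v\<close> on the curve, which
  fits both kinds: at infinity it is given, over an irreducible it is derived from the prime.
  \<open>p0\<close> is a uniformiser on the curve, whereas the uniformiser of the place may involve
  upper generators.\<close>

locale gauss_place = tower T + valued_field "FbL T" v
  for T :: "'a::field_char_0 tower" and v +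
  fixes p0 :: 'a
  assumes n1: "nlow T = 1" and trivk: "\<And>c. c \<in> Fb T \<Longrightarrow> c \<noteq> 0 \<Longrightarrow> v c = 0"
    and gauss: "\<And>S c. finite S \<Longrightarrow> S \<noteq> {} \<Longrightarrow> S \<subseteq> tower.supported T \<Longrightarrow>
      (\<And>\<alpha>. \<alpha> \<in> S \<Longrightarrow> c \<alpha> \<in> FbK0y T - {0}) \<Longrightarrow>
      v (\<Sum>\<alpha>\<in>S. c \<alpha> * tower.tmon T \<alpha>) = Min ((\<lambda>\<alpha>. v (c \<alpha>)) ` S)"
    and p0: "p0 \<in> FbK0y T" "p0 \<noteq> 0" "v p0 = 1"
begin

lemma K_in_E: "a \<in> K \<Longrightarrow> a \<in> E" using K_E by blast

lemma gauss_vge: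
  assumes "finite S" "S \<subseteq> supported" "\<And>\<alpha>. c \<alpha> \<in> K"
  shows "vge n (\<Sum>\<alpha>\<in>S. c \<alpha> * tmon \<alpha>) \<longleftrightarrow> (\<forall>\<alpha>\<in>S. vge n (c \<alpha>))"
proof -
  let ?S = "{\<alpha>\<in>S. c \<alpha> \<noteq> 0}"
  have e: "(\<Sum>\<alpha>\<in>S. c \<alpha> * tmon \<alpha>) = (\<Sum>\<alpha>\<in>?S. c \<alpha> * tmon \<alpha>)"
    using assms(1) by (intro sum.mono_neutral_right) auto
  show ?thesis
  proof (cases "?S = {}")
    case True
    then have "(\<Sum>\<alpha>\<in>?S. c \<alpha> * tmon \<alpha>) = 0" by (simp only: sum.empty)
    then show ?thesis using True e by auto
  next
    case False
    have v: "v (\<Sum>\<alpha>\<in>?S. c \<alpha> * tmon \<alpha>) = Min ((\<lambda>\<alpha>. v (c \<alpha>)) ` ?S)"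
      using assms False by (intro gauss) auto
    have "(\<Sum>\<alpha>\<in>?S. c \<alpha> * tmon \<alpha>) \<noteq> 0"
      using tmon_independent[of ?S c] assms False by auto
    moreover have "n \<le> Min ((\<lambda>\<alpha>. v (c \<alpha>)) ` ?S) \<longleftrightarrow> (\<forall>\<alpha>\<in>?S. n \<le> v (c \<alpha>))"
      using assms(1) False by (subst Min_ge_iff) auto
    ultimately show ?thesis unfolding e vge_def[of n "\<Sum>\<alpha>\<in>?S. c \<alpha> * tmon \<alpha>"] v by (auto simp: vge_def)
  qed
qed

sublocale sp: simple_place T v "Fb T" p0
  by unfold_locales (use k k_E trivk p0 K_in_E in auto)

abbreviation "M \<equiv> field_gen (k \<union> {p0})"

lemma M: "is_subfield M" "M \<subseteq> K" "k \<subseteq> M" "p0 \<in> M"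
proof -
  show "M \<subseteq> K" using p0 k_K by (intro field_gen_subset[OF _ K]) auto
qed (auto simp: subfield_hull intro: field_gen_inc)

lemma p0_notin_k: "p0 \<notin> k"
  using p0 trivk by fastforce

text \<open>The curve has transcendence degree 1: \<open>p0\<close> is algebraic over the field
  generated by \<open>t 1\<close> but not in \<open>k\<close>, so by exchange \<open>t 1\<close> is
  algebraic over \<open>M\<close>, and the radical with it.\<close>

lemma K_algebraic: assumes "a \<in> K" shows "algebraic_over M a"
proof -
  let ?K1 = "field_gen (k \<union> {t 1})"
  have K1: "is_subfield ?K1" by (rule subfield_hull)
  have low: "field_gen (Fld T \<union> t ` {1..nlow T}) \<subseteq> ?K1" using Fld_k n1 by (intro hull_mono) auto
  have q: "radical T ^ rdeg T \<in> ?K1" using radical R0_field low by auto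
  have K_sub: "K \<subseteq> {x. algebraic_over F x}" if F: "is_subfield F" "k \<subseteq> F" "algebraic_over F (t 1)" for F
  proof -
    let ?A = "{x. algebraic_over F x}"
    have A: "is_subfield ?A" by (rule subfield_algebraic[OF F(1)])
    have kA: "k \<subseteq> ?A" using F(2) algebraic_over_elem[OF F(1)] by blast
    then have K1A: "?K1 \<subseteq> ?A" using F(3) by (intro field_gen_subset[OF _ A]) auto
    then have "algebraic_over F (radical T ^ rdeg T)" using q by blast
    then have "algebraic_over F (radical T)" using algebraic_of_power[OF F(1)] nlow by auto
    then show ?thesis unfolding K_eq using kA F(3) n1 by (intro field_gen_subset[OF _ A]) auto
  qed
  have "algebraic_over ?K1 (t 1)" by (rule algebraic_over_elem[OF K1 field_gen_inc]) simp
  then have "K \<subseteq> {x. algebraic_over ?K1 x}" by (intro K_sub[OF K1]) (auto intro: field_gen_inc)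
  then have "algebraic_over ?K1 p0" using p0(1) by blast
  moreover have "\<not> algebraic_over k p0" using alg_closed_algebraic[OF k_closed] p0_notin_k by blast
  ultimately have "algebraic_over M (t 1)" using algebraic_exchange[OF k] by blast
  then show ?thesis using K_sub[OF M(1,3)] assms by blast
qed

text \<open>Division by a coefficient of least value; the result can be reduced modulo the maximal
  ideal and does not reduce to zero.\<close>

lemma normalised_polynomial:
  assumes "p \<in> polys_over M" "p \<noteq> 0"
  obtains b i where "b \<noteq> 0" "b \<in> M" "coeff (smult b p) i = 1" "\<And>j. vge 0 (coeff (smult b p) j)"
proof -
  let ?I = "{i. coeff p i \<noteq> 0}"
  have fin: "finite ?I" by (rule finite_subset[of _ "{..degree p}"]) (auto intro: le_degree)
  have ne: "?I \<noteq> {}" using assms(2) by (auto simp: poly_eq_iff)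
  have "Min ((\<lambda>i. v (coeff p i)) ` ?I) \<in> (\<lambda>i. v (coeff p i)) ` ?I" using fin ne by (intro Min_in) auto
  then obtain i where i: "i \<in> ?I" and m: "Min ((\<lambda>i. v (coeff p i)) ` ?I) = v (coeff p i)" by blast
  have i2: "v (coeff p i) \<le> v (coeff p j)" if "j \<in> ?I" for j
    unfolding m[symmetric] using that fin by (intro Min_le) auto
  have pE: "coeff p j \<in> E" "coeff p j \<in> M" for j using assms(1) M K_E by (auto simp: polys_over_def)
  let ?b = "inverse (coeff p i)"
  have b: "?b \<in> E" "?b \<noteq> 0" "v ?b = - v (coeff p i)" "?b \<in> M"
    using i pE subfield_inverse[OF E] subfield_inverse[OF M(1)] v_inverse by auto
  have "vge 0 (coeff (smult ?b p) j)" for j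
    using i2[of j] b v_mult[OF b(1) pE(1)[of j] b(2)] by (cases "coeff p j = 0") (auto simp: vge_def)
  then show ?thesis using that[of ?b i] b i by simp
qed

text \<open>The place of the curve has residue field \<open>k\<close>: a normalised equation of
  \<open>a\<close> reduces to a nonzero polynomial over \<open>k\<close> with positive value at
  \<open>a\<close>. It splits over \<open>k\<close>, so one factor \<open>a - z\<close> must have
  positive value.\<close>

lemma K_residue: assumes a: "a \<in> K" "vge 0 a" shows "\<exists>c\<in>k. vge 1 (a - c)"
proof -
  have aE: "a \<in> E" using a K_in_E by blast
  obtain p where p: "p \<in> polys_over M" "p \<noteq> 0" "poly p a = 0"
    using K_algebraic[OF a(1)] unfolding algebraic_over_def by auto
  obtain b i where b: "b \<noteq> 0" "b \<in> M" "coeff (smult b p) i = 1" "\<And>j. vge 0 (coeff (smult b p) j)"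
    by (rule normalised_polynomial[OF p(1,2)]) blast
  define q where "q = smult b p"
  have q: "q \<in> polys_over M" "poly q a = 0" "coeff q i = 1" "\<And>j. vge 0 (coeff q j)"
    using p b polys_over_smult[OF subfield_subring[OF M(1)]] by (auto simp: q_def)
  have qM: "coeff q j \<in> M" for j using q(1) by (simp add: polys_over_def)
  have ME: "z \<in> E" if "z \<in> M" for z using that M K_E by blast
  have "\<forall>j. \<exists>c. c \<in> k \<and> vge 1 (coeff q j - c)" using sp.adjoin_cover[OF qM q(4)] by blast
  then obtain c where c: "\<And>j. c j \<in> k" "\<And>j. vge 1 (coeff q j - c j)" by metis
  define r where "r = (\<Sum>j\<le>degree q. monom (c j) j)"
  have cr: "coeff r j = (if j \<le> degree q then c j else 0)" for j
    unfolding r_def by (simp add: coeff_sum if_distrib cong: if_cong)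
  have rk: "r \<in> polys_over k" using c(1) subfield_0[OF k] by (auto simp: polys_over_def cr)
  have "c i \<noteq> 0" using c(2)[of i] q(3) by (auto simp: vge_def)
  moreover have "i \<le> degree q" using q(3) by (intro le_degree) simp
  ultimately have r0: "r \<noteq> 0" using cr[of i] by auto
  have d: "q - r \<in> polys_over E"
    using q(1) rk polys_over_mono[of M E] polys_over_mono[OF k_E] ME polys_over_diff[OF subfield_subring[OF E]] by blast
  have "vge 1 (coeff (q - r) j)" for j
    using c(2)[of j] by (cases "j \<le> degree q") (simp_all add: cr coeff_eq_0)
  then have "vge 1 (poly (q - r) a)" using poly_vge[OF d _ aE a(2)] by blast
  then have v1: "vge 1 (poly r a)" using q(2) vge_minus[of "poly r a" 1] poly_closed[OF subfield_subring[OF E] _ aE]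
      rk polys_over_mono[OF k_E] by auto
  obtain l rs where l: "l \<in> k" "set rs \<subseteq> k" "r = smult l (\<Prod>z\<leftarrow>rs. [:- z, 1:])"
    using alg_closed_splits[OF k_closed rk] by auto
  show ?thesis
  proof (rule ccontr)
    assume n: "\<not> ?thesis"
    have az: "a - z \<noteq> 0 \<and> v (a - z) = 0 \<and> a - z \<in> E" if "z \<in> k" for z
    proof -
      have zE: "z \<in> E" using that k_E by blast
      have "vge 0 (a - z)" using vge_diff[OF aE zE a(2) sp.vge_C[OF that]] .
      then show ?thesis using n that aE zE subfield_diff[OF E] by (force simp: vge_def)
    qed
    have "poly (\<Prod>z\<leftarrow>rs. [:- z, 1:]) a \<noteq> 0 \<and> v (poly (\<Prod>z\<leftarrow>rs. [:- z, 1:]) a) = 0 \<and> poly (\<Prod>z\<leftarrow>rs. [:- z, 1:]) a \<in> E"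
      using l(2)
    proof (induction rs)
      case (Cons z rs)
      then have z: "a - z \<noteq> 0" "v (a - z) = 0" "a - z \<in> E" and IH: "poly (\<Prod>z\<leftarrow>rs. [:- z, 1:]) a \<noteq> 0"
        "v (poly (\<Prod>z\<leftarrow>rs. [:- z, 1:]) a) = 0" "poly (\<Prod>z\<leftarrow>rs. [:- z, 1:]) a \<in> E" using az by auto
      have e: "poly (\<Prod>z\<leftarrow>z # rs. [:- z, 1:]) a = (a - z) * poly (\<Prod>z\<leftarrow>rs. [:- z, 1:]) a" by (simp add: algebra_simps)
      show ?case unfolding e using z IH v_mult[OF z(3) IH(3) z(1) IH(1)] subfield_mult[OF E] by simp
    qed (simp add: subfield_1[OF E])
    moreover have "l \<noteq> 0" "v l = 0" "l \<in> E" using l r0 trivk k_E by auto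
    ultimately have "v (poly r a) = 0" "poly r a \<noteq> 0" using v_mult l(3) by auto
    then show False using v1 by (simp add: vge_def)
  qed
qed

text \<open>The expansion in powers of \<open>p0\<close>: the error divided by \<open>p0 ^ n\<close>
  is integral, and its residue is the next coefficient.\<close>

lemma K_truncation:
  assumes a: "a \<in> K" "vge 0 a" shows "\<exists>S\<in>polys_over k. vge (int n) (a - poly S p0)"
proof (induction n)
  case 0
  show ?case using a polys_over_0[OF subfield_subring[OF k]] by (intro bexI[of _ 0]) auto
next
  case (Suc n)
  then obtain S where S: "S \<in> polys_over k" "vge (int n) (a - poly S p0)" by auto
  have SK: "poly S p0 \<in> K" using poly_closed[OF subfield_subring[OF K] _ p0(1)] S polys_over_mono[OF k_K] by blast
  define b where "b = (a - poly S p0) / p0 ^ n"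
  have bK: "b \<in> K" unfolding b_def using a SK p0 by (intro subfield_divide[OF K] subfield_diff[OF K] subfield_power[OF K])
  have pn: "p0 ^ n \<in> E" "p0 ^ n \<noteq> 0" "v (p0 ^ n) = int n" using p0 K_in_E v_power[of p0 n] subfield_power[OF E] by auto
  have "vge (int n - int n) b" unfolding b_def using vge_divide[OF _ pn(1,2) S(2)] pn(3) a SK K_in_E subfield_diff[OF E] by simp
  then obtain c where c: "c \<in> k" "vge 1 (b - c)" using K_residue[OF bK] by auto
  have bc: "b - c \<in> E" using bK c K_in_E k_E subfield_diff[OF E] by blast
  have "a - poly (S + monom c n) p0 = p0 ^ n * (b - c)"
  proof -
    have "p0 ^ n * b = a - poly S p0" using pn(2) by (simp add: b_def)
    then show ?thesis by (simp add: poly_monom right_diff_distrib mult.commute[of c])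
  qed
  moreover have "vge (int n + 1) (p0 ^ n * (b - c))" using vge_mult[OF pn(1) bc _ c(2)] pn(3) by (simp add: vge_def[of "int n"])
  moreover have "S + monom c n \<in> polys_over k"
    using S c by (intro polys_over_add polys_over_monom subfield_subring[OF k])
  ultimately show ?case by (intro bexI[of _ "S + monom c n"]) (auto simp: add.commute)
qed

abbreviation "e0 \<equiv> v (D p0)"

lemma D_bounded_e0: "sp.D_bounded e0"
  using D_k by (auto simp: sp.D_bounded_def vge_def[of _ "D p0"])

lemma M_D_vge:
  assumes "z \<in> M" "vge n z" shows "vge (n - 1 + e0) (D z)" "n = 0 \<Longrightarrow> vge e0 (D z)"
proof -
  have p: "vge e0 (D p0)" by (simp add: vge_def)
  show "vge (n - 1 + e0) (D z)"
    using sp.adjoin_D_vge(1)[OF assms(1) _ D_bounded_e0 p] assms(2) vge_mono[of _ "D z" "n - 1 + e0"]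
    by (cases "z = 0") (auto simp: vge_def[of n])
  show "vge e0 (D z)" if "n = 0"
  proof (cases "z = 0 \<or> v z = 0")
    case True then show ?thesis using sp.adjoin_D_vge(2)[OF assms(1) _ D_bounded_e0 p] by (cases "z = 0") auto
  next
    case False
    then have "v z \<ge> 1" using assms(2) that by (auto simp: vge_def)
    then show ?thesis using False sp.adjoin_D_vge(1)[OF assms(1) _ D_bounded_e0 p] vge_mono[of _ "D z" e0] by auto
  qed
qed

text \<open>Differentiating the minimal equation of \<open>a\<close> over the rational function field in the uniformiser,
  at \<open>a\<close> and at a truncation \<open>b\<close> of its expansion, bounds \<open>D a - D b\<close>.\<close>

lemma K_D_vge_0: assumes a: "a \<in> K" "vge 0 a" shows "vge e0 (D a)"
proof -
  have aE: "a \<in> E" using a K_in_E by blast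
  have ME: "M \<subseteq> E" using M K_E by blast
  \<comment> \<open>Minimal degree is what prevents \<open>pderiv q\<close> from vanishing at
    \<open>a\<close>.\<close>
  let ?P = "\<lambda>p. p \<in> polys_over M \<and> p \<noteq> 0 \<and> poly p a = 0"
  obtain p1 where "?P p1" using K_algebraic[OF a(1)] unfolding algebraic_over_def by auto
  then obtain p where p: "?P p" "\<And>q. ?P q \<Longrightarrow> degree p \<le> degree q"
    using ex_has_least_nat[of ?P p1 degree] by blast
  obtain c i where c: "c \<noteq> 0" "c \<in> M" "coeff (smult c p) i = 1" "\<And>j. vge 0 (coeff (smult c p) j)"
    using normalised_polynomial[of p] p(1) by blast
  define q where "q = smult c p"
  note MR = subfield_subring[OF M(1)]
  have q: "q \<in> polys_over M" "q \<noteq> 0" "poly q a = 0" "degree q = degree p" "\<And>j. vge 0 (coeff q j)"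
    using p(1) c polys_over_smult[OF MR] by (auto simp: q_def)
  have qE: "q \<in> polys_over E" using q(1) polys_over_mono[OF ME] by blast
  have dq: "degree q \<noteq> 0"
  proof
    assume "degree q = 0"
    then obtain d where "q = [:d:]" by (metis degree_eq_zeroE)
    then show False using q by simp
  qed
  have q'M: "pderiv q \<in> polys_over M" by (rule polys_over_pderiv[OF MR q(1)])
  then have q'E: "pderiv q \<in> polys_over E" using polys_over_mono[OF ME] by blast
  have q'a: "poly (pderiv q) a \<noteq> 0"
  proof
    assume "poly (pderiv q) a = 0"
    moreover have "pderiv q \<noteq> 0" using dq by (simp add: pderiv_eq_0_iff)
    ultimately have "degree p \<le> degree (pderiv q)" using p(2) q'M by blast
    then show False using dq q(4) by (simp add: degree_pderiv)
  qed
  have q'v: "vge 0 (coeff (pderiv q) j)" for j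
    using vge_mult_0[OF subfield_of_nat[OF E] _ vge_of_nat q(5)[of "Suc j"], of "Suc j"] polys_over_coeff[OF qE]
    by (simp add: coeff_pderiv del: of_nat_Suc)
  let ?qa = "poly (pderiv q) a"
  have qaE: "?qa \<in> E" "vge 0 ?qa" using poly_vge[OF q'E q'v aE a(2)] by auto
  \<comment> \<open>Dividing by \<open>?qa\<close> costs its value, and differentiating
    \<open>poly q b\<close>, an element of \<open>M\<close> of value at least \<open>n\<close>,
    costs one more.\<close>
  define n where "n = nat (v ?qa) + 1"
  obtain S where S: "S \<in> polys_over k" "vge (int n) (a - poly S p0)" using K_truncation[OF a] by blast
  define b where "b = poly S p0"
  have bM: "b \<in> M" unfolding b_def using poly_closed[OF MR _ M(4)] S(1) polys_over_mono[OF M(3)] by blast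
  have bE: "b \<in> E" using bM ME by blast
  have bv: "vge 0 b" unfolding b_def using sp.poly_tau(2)[OF S(1)] .
  have ab: "vge (int n) (a - b)" using S(2) by (simp add: b_def)
  have Db: "vge e0 (D b)" using M_D_vge(2)[OF bM bv] by simp
  have qbM: "poly q b \<in> M" by (rule poly_closed[OF MR q(1) bM])
  have qbE: "poly q b \<in> E" using qbM ME by blast
  have "vge (int n) (poly q b)"
    using poly_congruence[OF qE q(5) aE a(2) bE bv ab] q(3) vge_minus[OF qbE] by simp
  then have Dqb: "vge (int n - 1 + e0) (D (poly q b))" by (rule M_D_vge(1)[OF qbM])
  let ?m = "map_poly D q"
  have mE: "?m \<in> polys_over E" using polys_over_coeff[OF qE] by (auto simp: polys_over_def coeff_map_poly)
  have mv: "vge e0 (coeff ?m j)" for j using M_D_vge(2)[OF polys_over_coeff[OF q(1)] q(5)] by (simp add: coeff_map_poly)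
  have m: "vge (e0 + int n) (poly ?m a - poly ?m b)" by (rule poly_congruence[OF mE mv aE a(2) bE bv ab])
  have d: "vge (int n + e0) ((?qa - poly (pderiv q) b) * D b)"
    using poly_congruence[OF q'E q'v aE a(2) bE bv ab] poly_vge[OF q'E q'v bE bv] qaE Db bE
    by (intro vge_mult subfield_diff[OF E]) auto
  have e1: "poly ?m a + ?qa * D a = 0" using D_poly[OF qE aE] q(3) by simp
  have e2: "D (poly q b) = poly ?m b + poly (pderiv q) b * D b" by (rule D_poly[OF qE bE])
  have "poly ?m a = - (?qa * D a)" using e1 by (simp only: eq_neg_iff_add_eq_0)
  \<comment> \<open>The difference of the differentiated equations at \<open>a\<close> and at
    \<open>b\<close>; every term on the right has value at least n - 1 + e0.\<close>
  then have e: "?qa * (D b - D a) = D (poly q b) + ((poly ?m a - poly ?m b) + (?qa - poly (pderiv q) b) * D b)"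
    unfolding e2 by (simp add: algebra_simps)
  have in_E: "poly ?m a \<in> E" "poly ?m b \<in> E" "poly (pderiv q) b \<in> E" "D b \<in> E" "D a \<in> E" "D (poly q b) \<in> E"
    using poly_vge[OF mE mv] poly_vge[OF q'E q'v] aE bE a(2) bv qbE by auto
  have s: "vge (int n - 1 + e0) (?qa * (D b - D a))"
    unfolding e using Dqb vge_mono[OF m] vge_mono[OF d] in_E qaE
    by (intro vge_add subfield_add[OF E] subfield_mult[OF E] subfield_diff[OF E]) auto
  have "vge e0 (D b - D a)"
  proof (cases "D b - D a = 0")
    case False
    have "v (?qa * (D b - D a)) = v ?qa + v (D b - D a)"
      using v_mult[OF qaE(1) subfield_diff[OF E in_E(4,5)] q'a False] .
    moreover have "?qa * (D b - D a) \<noteq> 0" using q'a False by simp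
    ultimately have "int n - 1 + e0 \<le> v ?qa + v (D b - D a)" using s by (simp add: vge_def)
    moreover have "int n - 1 = v ?qa" using qaE(2) q'a by (simp add: n_def vge_def)
    ultimately show ?thesis by (simp add: vge_def)
  qed simp
  then have "vge e0 (D b - (D b - D a))" by (rule vge_diff[OF in_E(4) subfield_diff[OF E in_E(4,5)] Db])
  then show ?thesis by simp
qed

text \<open>Splitting off a power of \<open>p0\<close> reduces to integral elements; differentiating
  that power is responsible for the loss of one.\<close>

lemma K_D_vge: assumes a: "a \<in> K" "vge n a" shows "vge (n + e0 - 1) (D a)"
proof -
  define u where "u = p0 powi (- n) * a"
  have p: "p0 \<in> E" "p0 powi m \<in> E" "v (p0 powi m) = m" "p0 powi m \<noteq> 0" for m
    using p0 K_in_E v_powi subfield_powi[OF E] by auto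
  have aE: "a \<in> E" using a K_in_E by blast
  have uK: "u \<in> K" unfolding u_def using a p0 by (intro subfield_mult[OF K] subfield_powi[OF K])
  then have uE: "u \<in> E" using K_in_E by blast
  have "vge (- n + n) u" unfolding u_def by (rule vge_mult[OF p(2) aE _ a(2)]) (simp add: vge_def p)
  then have u: "vge 0 u" by simp
  have Du: "vge e0 (D u)" by (rule K_D_vge_0[OF uK u])
  have "a = p0 powi n * u" unfolding u_def using p0 power_int_add[of p0 n "- n"] by (simp add: mult.assoc[symmetric])
  then have e: "D a = of_int n * (p0 powi (n - 1) * (u * D p0)) + p0 powi n * D u"
    using D_mult[OF p(2) uE, of n] D_powi[OF p(1) p0(2), of n] by (simp add: mult_ac)
  have 1: "u * D p0 \<in> E" "vge e0 (u * D p0)"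
    using uE D_in[OF p(1)] subfield_mult[OF E] vge_mult_0[OF uE D_in[OF p(1)] u] by (auto simp: vge_def[of _ "D p0"])
  have 2: "p0 powi (n - 1) * (u * D p0) \<in> E" "vge (n - 1 + e0) (p0 powi (n - 1) * (u * D p0))"
    using vge_mult[OF p(2) 1(1) _ 1(2), of "n - 1"] p 1 subfield_mult[OF E] by (auto simp: vge_def[of "n - 1"])
  have 3: "vge (n - 1 + e0) (of_int n * (p0 powi (n - 1) * (u * D p0)))"
    using vge_mult_0[OF subfield_of_int[OF E] 2(1) vge_of_int 2(2)] .
  have 4: "vge (n + e0) (p0 powi n * D u)"
    using vge_mult[OF p(2) D_in[OF uE] _ Du, of n n] p by (simp add: vge_def[of n])
  have "vge (n - 1 + e0) (D a)" unfolding e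
    using 3 vge_mono[OF 4] 2 p uE D_in by (intro vge_add subfield_mult[OF E] subfield_of_int[OF E]) auto
  then show ?thesis by (simp add: algebra_simps)
qed

lemma gen_vge: assumes "i \<in> upper T" shows "vge 0 (t i)"
proof -
  have s: "(\<lambda>j. if j = i then 1 else 0) \<in> supported" using assms by (auto simp: supported_def)
  have "tmon (\<lambda>j. if j = i then 1 else 0) = (\<Prod>j\<in>upper T. if j = i then t j else 1)"
    unfolding tmon_def by (rule prod.cong) auto
  then have "tmon (\<lambda>j. if j = i then 1 else 0) = t i" using assms by simp
  then show ?thesis
    using gauss_vge[of "{\<lambda>j. if j = i then 1 else 0}" "\<lambda>_. 1" 0] s subfield_1[OF K] by (simp add: vge_def)
qed

lemma tmon_vge: "vge 0 (tmon \<alpha>)"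
  unfolding tmon_def
proof -
  have "(\<Prod>i\<in>I. t i ^ \<alpha> i) \<in> E \<and> vge 0 (\<Prod>i\<in>I. t i ^ \<alpha> i)" if "I \<subseteq> upper T" for I
    using finite_subset[OF that finite_upper] that
  proof (induction I rule: finite_induct)
    case (insert i I)
    then have ti: "t i ^ \<alpha> i \<in> E" "vge 0 (t i ^ \<alpha> i)"
      using gen_vge gen_E[OF upper_index] vge_power subfield_power[OF E] by auto
    show ?case using insert ti vge_mult_0[of "t i ^ \<alpha> i" _ 0] subfield_mult[OF E] by auto
  qed (simp add: subfield_1[OF E] vge_def)
  then show "vge 0 (\<Prod>i\<in>upper T. t i ^ \<alpha> i)" by blast
qed

text \<open>The bound is uniform in the exponents, because elements of the valuation ring with
  derivative of value at least \<open>N\<close> are closed under products.\<close>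

lemma tmon_D_vge: "\<exists>N. \<forall>\<alpha>. vge N (D (tmon \<alpha>))"
proof -
  define N where "N = Min (insert 0 ((\<lambda>i. v (D (t i))) ` upper T))"
  have N: "vge N (D (t i))" if "i \<in> upper T" for i
    unfolding vge_def N_def using that by (intro disjI2 Min_le) auto
  let ?S = "{x\<in>E. vge 0 x \<and> vge N (D x)}"
  have m: "x * y \<in> ?S" if x: "x \<in> ?S" and y: "y \<in> ?S" for x y
  proof -
    have "vge N (D x * y + x * D y)"
      using x y vge_mult_0[of y "D x" N] vge_mult_0[of x "D y" N] D_in subfield_mult[OF E]
      by (intro vge_add) (auto simp: mult.commute)
    then show ?thesis using x y by (auto simp: D_mult subfield_mult[OF E] vge_mult_0)
  qed
  have one: "1 \<in> ?S" by (auto simp: subfield_1[OF E] vge_def)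
  have "x ^ n \<in> ?S" if "x \<in> ?S" for x n using that by (induction n) (use one m in auto)
  then have "t i ^ n \<in> ?S" if "i \<in> upper T" for i n using that gen_vge gen_E[OF upper_index] N by blast
  then have ti: "t i ^ n \<in> ?S" if "i \<in> upper T" for i n using that by blast
  have "(\<Prod>i\<in>I. t i ^ \<alpha> i) \<in> ?S" if sub: "I \<subseteq> upper T" for \<alpha> I
    using finite_subset[OF sub finite_upper] sub
  proof (induction I rule: finite_induct)
    case (insert i I)
    then have "t i ^ \<alpha> i * (\<Prod>i\<in>I. t i ^ \<alpha> i) \<in> ?S" using ti[of i "\<alpha> i"] by (intro m) auto
    then show ?case using insert by simp
  qed (use one in simp)
  then show ?thesis unfolding tmon_def by blast
qed

text \<open>By the Gauss formula each coefficient has at least the value of the whole polynomial, so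
  differentiation loses no more than on the curve or on monomials. The quotient rule worsens neither
  bound.\<close>

lemma shift_bounded: "\<exists>b. \<forall>h\<in>E. D h \<noteq> 0 \<longrightarrow> b \<le> v (D h) - v h"
proof -
  obtain N where N: "\<And>\<alpha>. vge N (D (tmon \<alpha>))" using tmon_D_vge by blast
  define b where "b = min N (e0 - 1)"
  have f: "vge (v f + b) (D f)" if f: "f \<in> polyset K" "f \<noteq> 0" for f
  proof -
    obtain S c where c: "f = (\<Sum>\<alpha>\<in>S. c \<alpha> * tmon \<alpha>)" "finite S" "S \<subseteq> supported" "\<And>\<alpha>. c \<alpha> \<in> K" "\<And>\<alpha>. \<alpha> \<notin> S \<Longrightarrow> c \<alpha> = 0"
      by (rule polysetE[OF f(1)]) blast
    have cE: "c \<alpha> \<in> E" for \<alpha> using c(4) K_in_E by blast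
    have "vge (v f) f" by (simp add: vge_def)
    then have vc: "vge (v f) (c \<alpha>)" if "\<alpha> \<in> S" for \<alpha> using gauss_vge[OF c(2,3), of c "v f"] c that by blast
    have "D f = (\<Sum>\<alpha>\<in>S. D (c \<alpha>) * tmon \<alpha> + c \<alpha> * D (tmon \<alpha>))"
      unfolding c(1) using cE tmon_E by (subst D_sum) (auto simp: D_mult subfield_mult[OF E])
    also have "vge (v f + b) \<dots>"
    proof (rule vge_sum)
      fix \<alpha> assume \<alpha>: "\<alpha> \<in> S"
      have in_E: "D (c \<alpha>) * tmon \<alpha> \<in> E" "c \<alpha> * D (tmon \<alpha>) \<in> E" using cE tmon_E D_in subfield_mult[OF E] by auto
      have "vge (v f + e0 - 1) (tmon \<alpha> * D (c \<alpha>))"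
        using vge_mult_0[OF tmon_E D_in[OF cE] tmon_vge K_D_vge[OF c(4) vc[OF \<alpha>]]] .
      then have 1: "vge (v f + b) (D (c \<alpha>) * tmon \<alpha>)" using vge_mono[of _ "tmon \<alpha> * D (c \<alpha>)" "v f + b"]
        by (simp add: b_def mult.commute)
      have "vge (v f + N) (c \<alpha> * D (tmon \<alpha>))" using vge_mult[OF cE D_in[OF tmon_E] vc[OF \<alpha>] N] .
      then have 2: "vge (v f + b) (c \<alpha> * D (tmon \<alpha>))" by (rule vge_mono) (simp add: b_def)
      show "D (c \<alpha>) * tmon \<alpha> + c \<alpha> * D (tmon \<alpha>) \<in> E \<and> vge (v f + b) (D (c \<alpha>) * tmon \<alpha> + c \<alpha> * D (tmon \<alpha>))"
        using vge_add[OF in_E 1 2] subfield_add[OF E in_E] by blast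
    qed
    finally show ?thesis .
  qed
  have "b \<le> v (D h) - v h" if h: "h \<in> E" "D h \<noteq> 0" for h
  proof -
    obtain f g where fg: "f \<in> polyset K" "g \<in> polyset K" "g \<noteq> 0" "h = f / g" by (rule E_polyset_quotient[OF h(1)])
    have f0: "f \<noteq> 0" using fg h by auto
    have fgE: "f \<in> E" "g \<in> E" using polyset_E K_E fg by blast+
    have Dh: "D h = (D f * g - f * D g) / g\<^sup>2" using D_divide[OF fgE fg(3)] fg(4) by simp
    have "vge ((v f + b) + v g) (D f * g)"
      using vge_mult[OF D_in[OF fgE(1)] fgE(2) f[OF fg(1) f0]] by (simp add: vge_def)
    moreover have "vge (v f + (v g + b)) (f * D g)"
      using vge_mult[OF fgE(1) D_in[OF fgE(2)] _ f[OF fg(2,3)]] by (simp add: vge_def)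
    ultimately have "vge (v f + v g + b) (D f * g - f * D g)"
      using fgE D_in subfield_mult[OF E] by (intro vge_diff) (auto simp: algebra_simps)
    then have "vge (v f + v g + b - v (g\<^sup>2)) (D h)"
      unfolding Dh using fgE fg(3) D_in by (intro vge_divide subfield_diff[OF E] subfield_mult[OF E] subfield_power[OF E]) auto
    moreover have "v (g\<^sup>2) = 2 * v g" "v h = v f - v g" using v_power[OF fgE(2) fg(3), of 2] v_divide[OF fgE f0 fg(3)] fg(4) by auto
    ultimately show ?thesis using h by (simp add: vge_def)
  qed
  then show ?thesis by blast
qed

section \<open>The residue field of a Gauss extension\<close>

abbreviation "CG \<equiv> field_gen (k \<union> t ` upper T)"

lemma CG: "is_subfield CG" "CG \<subseteq> E"
proof -
  show "CG \<subseteq> E" using k_E gen_E[OF upper_index] by (intro field_gen_subset[OF _ E]) auto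
qed (simp add: subfield_hull)

lemma polyset_k_triv:
  assumes "f \<in> polyset k" "f \<noteq> 0" shows "v f = 0"
proof -
  obtain S c where c: "f = (\<Sum>\<alpha>\<in>S. c \<alpha> * tmon \<alpha>)" "finite S" "S \<subseteq> supported" "\<And>\<alpha>. c \<alpha> \<in> k" "\<And>\<alpha>. \<alpha> \<notin> S \<Longrightarrow> c \<alpha> = 0"
    by (rule polysetE[OF assms(1)]) blast
  have ck: "c \<alpha> \<in> K" for \<alpha> using c(4) k_K by blast
  have "vge 0 f" using gauss_vge[OF c(2,3) ck] c(1,4) sp.vge_C by simp
  moreover have "\<not> vge 1 f"
  proof
    assume "vge 1 f"
    then have v1: "vge 1 (c \<alpha>)" if "\<alpha> \<in> S" for \<alpha> using gauss_vge[OF c(2,3) ck, of 1] c(1) that by simp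
    then have "c \<alpha> = 0" if "\<alpha> \<in> S" for \<alpha> using v1[OF that] trivk[OF c(4)[of \<alpha>]] by (cases "c \<alpha> = 0") (simp_all add: vge_def)
    then have "f = 0" unfolding c(1) by simp
    then show False using assms by simp
  qed
  ultimately show ?thesis using assms(2) by (simp add: vge_def)
qed

lemma CG_triv: assumes "c \<in> CG" "c \<noteq> 0" shows "v c = 0"
proof (rule subfield_trivial[OF subring_hull _ _ refl assms])
  show "ring_gen (k \<union> t ` upper T) \<subseteq> E" using CG ring_gen_subset_field_gen by blast
  show "v x = 0" if "x \<in> ring_gen (k \<union> t ` upper T)" "x \<noteq> 0" for x
    using polyset_k_triv[OF _ that(2)] ring_gen_polyset[OF subfield_subring[OF k]] that(1) by blast
qed

text \<open>Reduction is done coefficient by coefficient: after scaling, each coefficient is an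
  integral element of the curve and has a residue in \<open>k\<close>.\<close>

lemma polyset_residue:
  assumes f: "f \<in> polyset K" "vge n f"
  shows "\<exists>g\<in>CG. vge 1 (p0 powi (- n) * f - g)"
proof -
  obtain S c where c: "f = (\<Sum>\<alpha>\<in>S. c \<alpha> * tmon \<alpha>)" "finite S" "S \<subseteq> supported" "\<And>\<alpha>. c \<alpha> \<in> K" "\<And>\<alpha>. \<alpha> \<notin> S \<Longrightarrow> c \<alpha> = 0"
    by (rule polysetE[OF f(1)]) blast
  have p: "p0 powi (- n) \<in> E" "p0 powi (- n) \<in> K" "v (p0 powi (- n)) = - n"
    using p0 K_in_E v_powi[of p0 "- n"] subfield_powi[OF E] subfield_powi[OF K] by auto
  have cE: "c \<alpha> \<in> E" for \<alpha> using c(4) K_in_E by blast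
  have "\<exists>d\<in>k. vge 1 (p0 powi (- n) * c \<alpha> - d)" if "\<alpha> \<in> S" for \<alpha>
  proof (rule K_residue)
    show "p0 powi (- n) * c \<alpha> \<in> K" using p c subfield_mult[OF K] by blast
    have "vge n (c \<alpha>)" using gauss_vge[OF c(2,3), of c n] c f(2) that by blast
    then show "vge 0 (p0 powi (- n) * c \<alpha>)" using vge_mult[OF p(1) cE, of "- n" n \<alpha>] p(3) by (simp add: vge_def[of "- n"])
  qed
  then obtain d where d: "\<And>\<alpha>. \<alpha> \<in> S \<Longrightarrow> d \<alpha> \<in> k \<and> vge 1 (p0 powi (- n) * c \<alpha> - d \<alpha>)" by metis
  let ?g = "\<Sum>\<alpha>\<in>S. d \<alpha> * tmon \<alpha>"
  have "?g \<in> CG"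
    unfolding tmon_def using d
    by (intro subfield_sum[OF CG(1)] subfield_mult[OF CG(1)] subfield_prod[OF CG(1)] subfield_power[OF CG(1)] field_gen_inc) auto
  moreover have "p0 powi (- n) * f - ?g = (\<Sum>\<alpha>\<in>S. (p0 powi (- n) * c \<alpha> - d \<alpha>) * tmon \<alpha>)"
    unfolding c(1) by (simp add: sum_distrib_left sum_subtractf left_diff_distrib mult.assoc)
  moreover have "vge 1 \<dots>"
  proof (rule vge_sum)
    fix \<alpha> assume \<alpha>: "\<alpha> \<in> S"
    have 1: "p0 powi (- n) * c \<alpha> - d \<alpha> \<in> E" using p cE d[OF \<alpha>] k_E subfield_diff[OF E] subfield_mult[OF E] by blast
    have "vge 1 (tmon \<alpha> * (p0 powi (- n) * c \<alpha> - d \<alpha>))" using vge_mult_0[OF tmon_E 1 tmon_vge] d[OF \<alpha>] by blast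
    then show "(p0 powi (- n) * c \<alpha> - d \<alpha>) * tmon \<alpha> \<in> E \<and> vge 1 ((p0 powi (- n) * c \<alpha> - d \<alpha>) * tmon \<alpha>)"
      using subfield_mult[OF E 1 tmon_E] by (simp add: mult.commute)
  qed
  ultimately show ?thesis by metis
qed

lemma CG_cover: assumes x: "x \<in> E" "vge 0 x" shows "\<exists>c\<in>CG. vge 1 (x - c)"
proof (cases "vge 1 x")
  case True then show ?thesis using subfield_0[OF CG(1)] by (intro bexI[of _ 0]) auto
next
  case False
  then have x0: "x \<noteq> 0" "v x = 0" using x by (auto simp: vge_def)
  obtain f g where fg: "f \<in> polyset K" "g \<in> polyset K" "g \<noteq> 0" "x = f / g" by (rule E_polyset_quotient[OF x(1)])
  have f0: "f \<noteq> 0" using fg x0 by auto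
  have fgE: "f \<in> E" "g \<in> E" using polyset_E K_E fg by blast+
  \<comment> \<open>Numerator and denominator have this common value; scaling both by the same power
    of \<open>p0\<close> makes them units without changing the quotient.\<close>
  define n where "n = v g"
  have vf: "v f = n" using v_divide[OF fgE f0 fg(3)] fg(4) x0 by (simp add: n_def)
  let ?p = "p0 powi (- n)"
  have p: "?p \<in> E" "?p \<noteq> 0" "v ?p = - n" using p0 K_in_E v_powi[of p0 "- n"] subfield_powi[OF E] by auto
  have F: "?p * f \<in> E" "?p * f \<noteq> 0" "v (?p * f) = 0" "?p * g \<in> E" "?p * g \<noteq> 0" "v (?p * g) = 0"
    using p fgE f0 fg(3) v_mult[OF p(1) fgE(1) p(2) f0] v_mult[OF p(1) fgE(2) p(2) fg(3)] vf n_def subfield_mult[OF E] by auto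
  have vn: "vge n f" "vge n g" using vf n_def by (auto simp: vge_def)
  obtain a where a: "a \<in> CG" "vge 1 (?p * f - a)" using polyset_residue[OF fg(1) vn(1)] by auto
  obtain b where b: "b \<in> CG" "vge 1 (?p * g - b)" using polyset_residue[OF fg(2) vn(2)] by auto
  have abE: "a \<in> E" "b \<in> E" using a b CG by auto
  have b0: "b \<noteq> 0" using b F by (auto simp: vge_def)
  have vb: "v b = 0" using CG_triv[OF b(1) b0] .
  have e: "x - a / b = ((?p * f - a) * b - a * (?p * g - b)) / ((?p * g) * b)"
  proof -
    have x: "x = (?p * f) / (?p * g)" using fg(4) p0(2) by simp
    have "x - a / b = ((?p * f) * b - a * (?p * g)) / ((?p * g) * b)"
      unfolding x by (rule diff_frac_eq[OF F(5) b0])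
    then show ?thesis by (simp add: algebra_simps)
  qed
  have va: "vge 0 a" using CG_triv[OF a(1)] by (cases "a = 0") (auto simp: vge_def)
  have vb': "vge 0 b" using vb by (simp add: vge_def)
  have E1: "?p * f - a \<in> E" "?p * g - b \<in> E" using F abE subfield_diff[OF E] by auto
  have "vge 1 (b * (?p * f - a))" "vge 1 (a * (?p * g - b))"
    using vge_mult_0[OF abE(2) E1(1) vb' a(2)] vge_mult_0[OF abE(1) E1(2) va b(2)] by auto
  then have "vge 1 ((?p * f - a) * b - a * (?p * g - b))"
    using E1 abE subfield_mult[OF E] by (intro vge_diff) (auto simp: mult.commute)
  moreover have "(?p * g) * b \<noteq> 0" using F(5) b0 by (simp only: mult_eq_0_iff simp_thms)
  ultimately have "vge (1 - v ((?p * g) * b)) (x - a / b)"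
    unfolding e by (intro vge_divide subfield_diff[OF E subfield_mult[OF E E1(1) abE(2)] subfield_mult[OF E abE(1) E1(2)]]
      subfield_mult[OF E F(4) abE(2)])
  moreover have "v ((?p * g) * b) = 0" using v_mult[OF F(4) abE(2) F(5) b0] F vb by simp
  ultimately show ?thesis using subfield_divide[OF CG(1) a(1) b(1)] by auto
qed

lemma coeff_place:
  assumes "is_residue_map E v res" "is_uniformiser E v \<pi>"
  shows "coeff_place T v \<pi> res CG (t ` upper T)"
proof (intro coeff_place.intro coeff_place_axioms.intro)
  show "tower T" "valued_field E v" by unfold_locales
  show "t ` upper T \<subseteq> E" using gen_E[OF upper_index] by blast
qed (fact assms refl CG_cover shift_bounded | use CG_triv in blast)+

end

section \<open>The two kinds over the curve as Gauss extensions\<close>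

context tower
begin

lemma P_inf_gauss_place:
  assumes "is_place_of_kind T P_inf v \<pi>" shows "\<exists>p0. gauss_place T v p0"
proof -
  obtain w where n1: "nlow T = 1" and dv: "is_discrete_valuation E v"
    and w: "is_discrete_valuation K w" "\<forall>c\<in>k - {0}. w c = 0" "is_gauss_extension T w v"
    using assms by auto
  have g: "v (\<Sum>\<alpha>\<in>S. a \<alpha> * tmon \<alpha>) = Min ((\<lambda>\<alpha>. w (a \<alpha>)) ` S)"
    if "finite S" "S \<noteq> {}" "S \<subseteq> supported" "\<And>\<alpha>. \<alpha> \<in> S \<Longrightarrow> a \<alpha> \<in> K - {0}" for S a
    using w(3) that unfolding is_gauss_extension_def tmon_def supported_def by blast
  \<comment> \<open>Sums with the single exponent 0 show that \<open>v\<close> restricts to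
    \<open>w\<close> on the curve.\<close>
  have vw: "v a = w a" if "a \<in> K" "a \<noteq> 0" for a
    using g[of "{\<lambda>_. 0}" "\<lambda>_. a"] that by (simp add: tmon_0 supported_def)
  obtain p0 where p0: "p0 \<in> K" "p0 \<noteq> 0" "w p0 = 1" using w(1) unfolding is_discrete_valuation_def by blast
  have "gauss_place T v p0"
  proof (intro gauss_place.intro gauss_place_axioms.intro)
    show "tower T" by unfold_locales
    show "valued_field E v" by unfold_locales (fact E dv)+
    show "v c = 0" if "c \<in> k" "c \<noteq> 0" for c using vw[of c] w(2) that k_K by auto
    show "v (\<Sum>\<alpha>\<in>S. c \<alpha> * tmon \<alpha>) = Min ((\<lambda>\<alpha>. v (c \<alpha>)) ` S)"
      if S: "finite S" "S \<noteq> {}" "S \<subseteq> supported" "\<And>\<alpha>. \<alpha> \<in> S \<Longrightarrow> c \<alpha> \<in> K - {0}" for S c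
    proof -
      have "(\<lambda>\<alpha>. w (c \<alpha>)) ` S = (\<lambda>\<alpha>. v (c \<alpha>)) ` S" using S(4) vw by (intro image_cong) auto
      then show ?thesis using g[OF S] by simp
    qed
    show "v p0 = 1" using vw p0 by simp
  qed (use n1 p0 in auto)
  then show ?thesis by blast
qed

text \<open>The Gauss formula has to be read off the prime. An extended prime consists of the
  polynomials with all coefficients in \<open>P0\<close>, so a polynomial over \<open>FbO T\<close>
  with some coefficient outside \<open>P0\<close> has value 0. The general case is brought to this
  form by dividing by a coefficient of least value and clearing denominators.\<close>

lemma P_sigma_gauss_place:
  assumes pl: "is_place_of_kind T P_sigma v \<pi>" shows "\<exists>p0. gauss_place T v p0"
proof -
  obtain P where n1: "nlow T = 1" and P: "is_height_one_prime (FbA T) P" "is_prime_valuation T P v" "is_type_E T P"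
    using pl by auto
  have PP: "is_prime_ideal (FbA T) P" using P(1) by (simp add: is_height_one_prime_def)
  note pv = prime_valuation[OF PP P(2)]
  interpret valued_field E v by (rule pv(1))
  obtain P0 where P0: "is_prime_ideal (FbO T) P0" "P = is_ideal (FbA T) hull P0"
    using P(3) unfolding is_type_E_def by blast
  have loc: "val_ring E v = localization_at (FbA T) P" using P(2) by (simp add: is_prime_valuation_def)
  have I0: "P0 \<subseteq> FbO T" "0 \<in> P0" "\<And>x y. x \<in> P0 \<Longrightarrow> y \<in> P0 \<Longrightarrow> x + y \<in> P0" "\<And>a x. a \<in> FbO T \<Longrightarrow> x \<in> P0 \<Longrightarrow> a * x \<in> P0"
    "P0 \<noteq> FbO T" "\<And>a b. a \<in> FbO T \<Longrightarrow> b \<in> FbO T \<Longrightarrow> a * b \<in> P0 \<Longrightarrow> a \<in> P0 \<or> b \<in> P0"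
    using P0(1) by (auto simp: is_prime_ideal_def is_ideal_def)
  have I1: "P \<subseteq> FbA T" "0 \<in> P" "\<And>x y. x \<in> P \<Longrightarrow> y \<in> P \<Longrightarrow> x + y \<in> P" "\<And>a x. a \<in> FbA T \<Longrightarrow> x \<in> P \<Longrightarrow> a * x \<in> P"
    using PP by (auto simp: is_prime_ideal_def is_ideal_def)
  have one: "1 \<notin> P0"
  proof
    assume "1 \<in> P0"
    then have "FbO T \<subseteq> P0" using I0(4)[of _ 1] by auto
    then show False using I0(1,5) by blast
  qed
  have A_poly: "FbA T \<subseteq> polyset (FbO T)" unfolding FbA_eq by (rule ring_gen_polyset[OF FbO(1)])
  have tA: "tmon \<alpha> \<in> FbA T" for \<alpha>
    unfolding tmon_def by (intro subring_prod[OF FbA(1)] subring_power[OF FbA(1)] FbA(3))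
  have P_poly: "P \<subseteq> polyset P0" unfolding P0(2)
  proof (rule hull_minimal)
    show "P0 \<subseteq> polyset P0" using polyset_base[OF I0(2)] by blast
    have "polyset P0 \<subseteq> polyset (FbO T)" unfolding polyset_def using I0(1) by blast
    then have "polyset P0 \<subseteq> FbA T" using polyset_ring_gen[OF FbO(1)] FbA_eq by blast
    moreover have "a * x \<in> polyset P0" if "a \<in> FbA T" "x \<in> polyset P0" for a x
      using polyset_mult[of "FbO T" P0 P0 a x] I0 A_poly that by blast
    ultimately show "is_ideal (FbA T) (polyset P0)"
      unfolding is_ideal_def using polyset_0[OF I0(2)] polyset_add[of P0] I0(3) by blast
  qed
  \<comment> \<open>Uniqueness of the monomial representation turns membership in the extended prime
    into membership of every coefficient.\<close>
  have coeffs: "c \<alpha> \<in> P0" if h: "finite S" "S \<subseteq> supported" "\<And>\<alpha>. c \<alpha> \<in> FbO T" "\<And>\<alpha>. \<alpha> \<notin> S \<Longrightarrow> c \<alpha> = 0"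
    and hP: "(\<Sum>\<alpha>\<in>S. c \<alpha> * tmon \<alpha>) \<in> P" for S c \<alpha>
  proof -
    obtain S' c' where c': "(\<Sum>\<alpha>\<in>S. c \<alpha> * tmon \<alpha>) = (\<Sum>\<alpha>\<in>S'. c' \<alpha> * tmon \<alpha>)" "finite S'" "S' \<subseteq> supported"
      "\<And>\<alpha>. c' \<alpha> \<in> P0" "\<And>\<alpha>. \<alpha> \<notin> S' \<Longrightarrow> c' \<alpha> = 0"
      by (rule polysetE[OF subsetD[OF P_poly hP]]) blast
    have "c \<alpha> \<in> K" "c' \<alpha> \<in> K" for \<alpha> using h(3) c'(4) I0(1) FbO(2) by blast+
    then have "c = c'" by (intro tmon_unique[of S c S' c']) (use h c' in auto)
    then show ?thesis using c'(4) by simp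
  qed
  have P0P: "P0 \<subseteq> P" unfolding P0(2) by (rule hull_subset)
  have notP: "a \<notin> P" if "a \<in> FbO T" "a \<notin> P0" for a
  proof
    assume "a \<in> P"
    then have "(\<Sum>\<alpha>\<in>{\<lambda>_. 0}. (if \<alpha> = (\<lambda>_. 0) then a else 0) * tmon \<alpha>) \<in> P" by (simp add: tmon_0)
    then have "(if (\<lambda>_. 0) = (\<lambda>_::nat. 0::nat) then a else 0) \<in> P0"
      by (intro coeffs[of "{\<lambda>_. 0}" "\<lambda>\<alpha>. if \<alpha> = (\<lambda>_. 0) then a else 0"])
        (use that subring_0[OF FbO(1)] in \<open>auto simp: supported_def\<close>)
    then show False using that by simp
  qed
  \<comment> \<open>An integral element of the curve is a quotient \<open>x / y\<close> of
    polynomials; comparing the coefficients of \<open>b * y = x\<close> at an exponent where that of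
    \<open>y\<close> avoids \<open>P0\<close> gives a fraction over \<open>FbO T\<close>.\<close>
  have KV: "\<exists>f\<in>FbO T. \<exists>g\<in>FbO T. g \<notin> P0 \<and> b = f / g" if b: "b \<in> K" "vge 0 b" for b
  proof -
    have bE: "b \<in> E" using b K_E by blast
    then have "b \<in> localization_at (FbA T) P" using b loc val_ring_iff by blast
    then obtain x y where xy: "b = x / y" "x \<in> FbA T" "y \<in> FbA T" "y \<notin> P" unfolding localization_at_def by blast
    obtain S c where c: "x = (\<Sum>\<alpha>\<in>S. c \<alpha> * tmon \<alpha>)" "finite S" "S \<subseteq> supported" "\<And>\<alpha>. c \<alpha> \<in> FbO T" "\<And>\<alpha>. \<alpha> \<notin> S \<Longrightarrow> c \<alpha> = 0"
      by (rule polysetE[OF subsetD[OF A_poly xy(2)]]) blast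
    obtain S' c' where c': "y = (\<Sum>\<alpha>\<in>S'. c' \<alpha> * tmon \<alpha>)" "finite S'" "S' \<subseteq> supported" "\<And>\<alpha>. c' \<alpha> \<in> FbO T" "\<And>\<alpha>. \<alpha> \<notin> S' \<Longrightarrow> c' \<alpha> = 0"
      by (rule polysetE[OF subsetD[OF A_poly xy(3)]]) blast
    have "\<exists>\<alpha>\<in>S'. c' \<alpha> \<notin> P0"
    proof (rule ccontr)
      assume "\<not> ?thesis"
      then have tP: "c' \<alpha> * tmon \<alpha> \<in> P" if "\<alpha> \<in> S'" for \<alpha> using that P0P I1(4)[OF tA, of "c' \<alpha>" \<alpha>] by (auto simp: mult.commute)
      have "(\<Sum>\<alpha>\<in>I. c' \<alpha> * tmon \<alpha>) \<in> P" if sub: "I \<subseteq> S'" for I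
        using finite_subset[OF sub c'(2)] sub
        by (induction I rule: finite_induct) (auto simp: I1(2) tP intro!: I1(3))
      then show False using c'(1) xy(4) by blast
    qed
    then obtain \<alpha> where \<alpha>: "\<alpha> \<in> S'" "c' \<alpha> \<notin> P0" by blast
    have y0: "y \<noteq> 0" using xy(4) I1(2) by auto
    then have "b * y = x" using xy(1) by simp
    then have "(\<Sum>\<alpha>\<in>S'. (b * c' \<alpha>) * tmon \<alpha>) = (\<Sum>\<alpha>\<in>S. c \<alpha> * tmon \<alpha>)"
      unfolding c(1) c'(1) by (simp add: sum_distrib_left mult.assoc)
    moreover have "b * c' \<alpha> \<in> K" "c \<alpha> \<in> K" for \<alpha>
      using c(4)[of \<alpha>] c'(4)[of \<alpha>] FbO(2) subfield_mult[OF K b(1)] by blast+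
    ultimately have "(\<lambda>\<alpha>. b * c' \<alpha>) = c"
      by (intro tmon_unique[of S' "\<lambda>\<alpha>. b * c' \<alpha>" S c]) (use c c' in auto)
    then have "b * c' \<alpha> = c \<alpha>" by (rule fun_cong)
    moreover have "c' \<alpha> \<noteq> 0" using \<alpha> I0(2) by auto
    ultimately have "b = c \<alpha> / c' \<alpha>" by (simp add: eq_divide_eq)
    then show ?thesis using c(4) c'(4) \<alpha> by blast
  qed
  have gauss: "v (\<Sum>\<alpha>\<in>S. c \<alpha> * tmon \<alpha>) = Min ((\<lambda>\<alpha>. v (c \<alpha>)) ` S)"
    if S: "finite S" "S \<noteq> {}" "S \<subseteq> supported" "\<And>\<alpha>. \<alpha> \<in> S \<Longrightarrow> c \<alpha> \<in> K - {0}" for S c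
  proof -
    have "Min ((\<lambda>\<alpha>. v (c \<alpha>)) ` S) \<in> (\<lambda>\<alpha>. v (c \<alpha>)) ` S" using S by (intro Min_in) auto
    then obtain \<alpha>0 where \<alpha>0: "\<alpha>0 \<in> S" and m: "Min ((\<lambda>\<alpha>. v (c \<alpha>)) ` S) = v (c \<alpha>0)" by blast
    have le: "v (c \<alpha>0) \<le> v (c \<alpha>)" if "\<alpha> \<in> S" for \<alpha> unfolding m[symmetric] using that S by (intro Min_le) auto
    have cK: "c \<alpha> \<in> K" "c \<alpha> \<in> E" "c \<alpha> \<noteq> 0" if "\<alpha> \<in> S" for \<alpha> using S(4)[OF that] K_E by auto
    define b where "b \<alpha> = c \<alpha> / c \<alpha>0" for \<alpha>
    have b: "b \<alpha> \<in> K" "vge 0 (b \<alpha>)" if "\<alpha> \<in> S" for \<alpha>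
      using cK[OF that] cK[OF \<alpha>0] le[OF that] v_divide[of "c \<alpha>" "c \<alpha>0"] subfield_divide[OF K]
      by (auto simp: b_def vge_def)
    have "\<forall>\<alpha>\<in>S. \<exists>f g. f \<in> FbO T \<and> g \<in> FbO T \<and> g \<notin> P0 \<and> b \<alpha> = f / g" using KV b by blast
    then obtain f g where fg: "\<And>\<alpha>. \<alpha> \<in> S \<Longrightarrow> f \<alpha> \<in> FbO T \<and> g \<alpha> \<in> FbO T \<and> g \<alpha> \<notin> P0 \<and> b \<alpha> = f \<alpha> / g \<alpha>"
      by metis
    \<comment> \<open>A common denominator of the normalised coefficients. Primality keeps it
      outside \<open>P0\<close>, so its value is 0.\<close>
    define G where "G = (\<Prod>\<alpha>\<in>S. g \<alpha>)"
    have GO: "G \<in> FbO T" unfolding G_def using fg by (intro subring_prod[OF FbO(1)]) auto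
    have "(\<Prod>\<alpha>\<in>I. g \<alpha>) \<notin> P0" if sub: "I \<subseteq> S" for I
      using finite_subset[OF sub S(1)] sub
    proof (induction I rule: finite_induct)
      case (insert \<alpha> I)
      have "(\<Prod>\<alpha>\<in>I. g \<alpha>) \<in> FbO T" using insert fg by (intro subring_prod[OF FbO(1)]) auto
      then show ?case using insert I0(6)[of "g \<alpha>" "\<Prod>\<alpha>\<in>I. g \<alpha>"] fg[of \<alpha>] by auto
    qed (simp add: one)
    then have GP: "G \<notin> P0" unfolding G_def by blast
    have G0: "G \<noteq> 0" using GP I0(2) by auto
    define h where "h \<alpha> = (if \<alpha> \<in> S then G * b \<alpha> else 0)" for \<alpha>
    have hO: "h \<alpha> \<in> FbO T" for \<alpha>
    proof (cases "\<alpha> \<in> S")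
      case True
      have "g \<alpha> \<noteq> 0" using fg[OF True] I0(2) by auto
      then have "G * b \<alpha> = (\<Prod>\<beta>\<in>S - {\<alpha>}. g \<beta>) * f \<alpha>"
        unfolding G_def prod.remove[OF S(1) True] using fg[OF True] by simp
      also have "\<dots> \<in> FbO T" using fg True by (intro subring_mult[OF FbO(1)] subring_prod[OF FbO(1)]) auto
      finally show ?thesis using True by (simp add: h_def)
    qed (simp add: h_def subring_0[OF FbO(1)])
    let ?F = "\<Sum>\<alpha>\<in>S. h \<alpha> * tmon \<alpha>"
    have b1: "b \<alpha>0 = 1" using cK[OF \<alpha>0] by (simp add: b_def)
    have "?F \<in> FbA T" using hO FbA(2) tA by (intro subring_sum[OF FbA(1)] subring_mult[OF FbA(1)]) auto
    moreover have "?F \<notin> P"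
    proof
      assume "?F \<in> P"
      then have "h \<alpha>0 \<in> P0" by (intro coeffs[of S h]) (use S hO in \<open>auto simp: h_def\<close>)
      then show False using GP b1 \<alpha>0 by (simp add: h_def)
    qed
    ultimately have F: "?F \<noteq> 0" "v ?F = 0" "?F \<in> E" using pv(3) FbA(4) by auto
    have G: "v G = 0" "G \<in> E" using pv(3)[of G] notP[OF GO GP] GO FbA(2,4) by auto
    have c0: "c \<alpha>0 \<in> E" "c \<alpha>0 \<noteq> 0" using cK[OF \<alpha>0] by auto
    have "G * (\<Sum>\<alpha>\<in>S. c \<alpha> * tmon \<alpha>) = c \<alpha>0 * ?F"
      unfolding sum_distrib_left by (rule sum.cong) (use c0 in \<open>auto simp: h_def b_def\<close>)
    then have e: "(\<Sum>\<alpha>\<in>S. c \<alpha> * tmon \<alpha>) = c \<alpha>0 * ?F / G" using G0 by (simp add: eq_divide_eq mult.commute)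
    have "v (c \<alpha>0 * ?F / G) = v (c \<alpha>0)"
      using v_divide[OF subfield_mult[OF E c0(1) F(3)] G(2) _ G0] v_mult[OF c0(1) F(3) c0(2) F(1)] c0 F G by simp
    then show ?thesis using e m by simp
  qed
  have trivk: "v c = 0" if c: "c \<in> k" "c \<noteq> 0" for c
  proof -
    have "c \<in> E" "c \<in> val_ring E v" "inverse c \<in> val_ring E v"
      using c k_E pv(2) FbA(2) FbO(3) subfield_inverse[OF k] by blast+
    then show ?thesis using v_inverse[of c] c by (auto simp: val_ring_def)
  qed
  \<comment> \<open>Every value is already a value on the curve; this yields a uniformiser
    there.\<close>
  have vf: "\<exists>a\<in>K. a \<noteq> 0 \<and> v f = v a" if f: "f \<in> polyset K" "f \<noteq> 0" for f
  proof -
    obtain S c where c: "f = (\<Sum>\<alpha>\<in>S. c \<alpha> * tmon \<alpha>)" "finite S" "S \<subseteq> supported" "\<And>\<alpha>. c \<alpha> \<in> K" "\<And>\<alpha>. \<alpha> \<notin> S \<Longrightarrow> c \<alpha> = 0"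
      by (rule polysetE[OF f(1)]) blast
    let ?S = "{\<alpha>\<in>S. c \<alpha> \<noteq> 0}"
    have e: "f = (\<Sum>\<alpha>\<in>?S. c \<alpha> * tmon \<alpha>)" unfolding c(1)
      using c(2) by (intro sum.mono_neutral_right) auto
    have ne: "?S \<noteq> {}"
    proof
      assume "?S = {}"
      then have "f = 0" using e by (simp only: sum.empty)
      then show False using f by simp
    qed
    have "v f = Min ((\<lambda>\<alpha>. v (c \<alpha>)) ` ?S)" unfolding e using c ne by (intro gauss) auto
    also have "\<dots> \<in> (\<lambda>\<alpha>. v (c \<alpha>)) ` ?S" using c(2) ne by (intro Min_in) auto
    finally show ?thesis using c(4) by auto
  qed
  obtain x where x: "x \<in> E" "x \<noteq> 0" "v x = 1" using dval unfolding is_discrete_valuation_def by blast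
  obtain f g where fg: "f \<in> polyset K" "g \<in> polyset K" "g \<noteq> 0" "x = f / g" by (rule E_polyset_quotient[OF x(1)])
  have f0: "f \<noteq> 0" using fg x by auto
  have fgE: "f \<in> E" "g \<in> E" using polyset_E K_E fg by blast+
  obtain a b where ab: "a \<in> K" "a \<noteq> 0" "v f = v a" "b \<in> K" "b \<noteq> 0" "v g = v b"
    using vf[OF fg(1) f0] vf[OF fg(2,3)] by auto
  have "v (a / b) = 1" using ab x fg f0 v_divide[OF fgE f0 fg(3)] v_divide[of a b] K_E by auto
  then have "gauss_place T v (a / b)"
  proof (intro gauss_place.intro gauss_place_axioms.intro)
    show "tower T" "valued_field E v" by unfold_locales
  qed (use n1 trivk gauss ab subfield_divide[OF K] in auto)
  then show ?thesis by blast
qed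

text \<open>The two equations together would be a quadratic equation for \<open>t i\<close> over the
  other variables. So the case distinction in \<open>exponent\<close> is unambiguous.\<close>

lemma not_hyperexponential_and_hypertangent:
  assumes i: "i \<in> upper T" shows "\<not> (hyperexponential T i \<and> hypertangent T i)"
proof
  assume "hyperexponential T i \<and> hypertangent T i"
  then obtain a b where ab: "a \<in> C_upper T i" "a \<noteq> 0" "D (t i) = a * t i"
    "b \<in> C_upper T i" "b \<noteq> 0" "D (t i) = b * (1 + (t i)\<^sup>2)"
    using monomial_coefficients(2,3)[OF i] by blast
  note CR = subfield_subring[OF C_upper(1)]
  have "poly [:b, - a, b:] (t i) = 0" using ab(3,6) by (simp add: power2_eq_square algebra_simps)
  moreover have "[:b, - a, b:] \<in> polys_over (C_upper T i)"
    using ab by (intro polys_over_pCons[OF CR] polys_over_0[OF CR] subring_minus[OF CR])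
  ultimately have "algebraic_over (C_upper T i) (t i)"
    unfolding algebraic_over_def using ab(5) by (intro bexI[of _ "[:b, - a, b:]"]) auto
  then show False using C_upper_transc[OF i] by blast
qed

end

section \<open>Exponentials in the residue field; (K4)\<close>

locale residue_gauss_place = gauss_place T v p0
  for T :: "'a::field_char_0 tower" and v p0 +
  fixes \<pi> :: 'a and res :: "'a \<Rightarrow> 'k::field_char_0"
  assumes res: "is_residue_map (FbL T) v res" and unif: "is_uniformiser (FbL T) v \<pi>"
begin

sublocale cp: coeff_place T v \<pi> res CG "t ` upper T"
  by (rule coeff_place[OF res unif])

text \<open>For \<open>\<pi>\<close> on the curve, its derivative rescaled to value 0 is also on the
  curve, and residues of elements of the curve are represented in \<open>k\<close>.\<close>

lemma rho_r_constant:
  assumes \<pi>: "\<pi> \<in> K" shows "rho_r T v \<pi> res (excess T v \<pi>) \<in> res ` k - {0}"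
proof -
  let ?z = "\<pi> powi (- shift T v - 1 - excess T v \<pi>) * D \<pi>"
  have D0: "D \<pi> \<noteq> 0"
  proof
    assume "D \<pi> = 0"
    then have "\<pi> \<in> k" using constants cp.pi by blast
    then show False using trivk cp.pi by fastforce
  qed
  have zK: "?z \<in> K" using \<pi> D_K by (intro subfield_mult[OF K] subfield_powi[OF K])
  have v0: "v ?z = 0" "?z \<noteq> 0"
    using v_mult[of "\<pi> powi (- shift T v - 1 - excess T v \<pi>)" "D \<pi>"] D0 cp.pi v_powi D_in[OF cp.pi(1)]
    by (simp_all add: subfield_powi[OF E] excess_def shift_at_def)
  obtain c where c: "c \<in> k" "vge 1 (?z - c)" using K_residue[OF zK] v0 by (auto simp: vge_def[of 0])
  have "res ?z = res c" using cp.res_eq[of ?z c] c zK K_in_E k_E v0 sp.vge_C by (auto simp: vge_def[of 0])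
  moreover have "res ?z \<noteq> 0" using cp.res_eq_0[of ?z] zK K_in_E v0 by (simp add: vge_def)
  ultimately show ?thesis using c unfolding rho_r_def by auto
qed

context
  fixes \<mu> :: "nat \<Rightarrow> 'k" and \<iota> :: 'k
  assumes gens: "\<And>i. i \<in> upper T \<Longrightarrow> \<mu> i \<in> res ` k - {0} \<and>
      (hyperexponential T i \<and> lam T v \<pi> res i = \<mu> i * res (t i) \<or>
       hypertangent T i \<and> lam T v \<pi> res i = \<mu> i * (1 + (res (t i))\<^sup>2))"
    and iota: "\<iota> \<in> res ` k" "\<iota>\<^sup>2 = - 1"
begin

abbreviation "\<kappa> \<equiv> kappa T v res"
abbreviation "\<delta> \<equiv> del T v \<pi> res"

definition expo :: "nat \<Rightarrow> 'k" where
  "expo i = (if hypertangent T i then (res (t i) - \<iota>) / (res (t i) + \<iota>) else res (t i))"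

lemma res_gen_notin: assumes "i \<in> upper T" shows "res (t i) \<notin> res ` k"
proof
  assume "res (t i) \<in> res ` k"
  then obtain c where "c \<in> k" "res (t i) = res c" by auto
  then have "t i = c" using cp.res_inj[of "t i" c] cp.C(3,4) assms by blast
  then show False using \<open>c \<in> k\<close> gen_not_k[OF upper_index[OF assms]] by simp
qed

lemma resk: "is_subfield (res ` k)"
  using cp.res_k_closed by (simp add: alg_closed_def)

lemma gen_kappa: "i \<in> upper T \<Longrightarrow> res (t i) \<in> \<kappa>"
  using cp.kappa_C cp.C(4) by blast

lemma iota_nz: "res (t i) + \<iota> \<noteq> 0" "res (t i) - \<iota> \<noteq> 0" "res (t i) \<noteq> 0" if "i \<in> upper T"
  using res_gen_notin[OF that] iota(1) subfield_minus[OF resk iota(1)] subfield_0[OF resk]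
  by (auto simp: add_eq_0_iff2)

lemma expo_kappa: "i \<in> upper T \<Longrightarrow> expo i \<in> \<kappa> \<and> expo i \<noteq> 0"
  using gen_kappa iota_nz iota cp.res_k_kappa
  by (auto simp: expo_def intro!: subfield_divide[OF cp.kappa_subfield] subfield_diff[OF cp.kappa_subfield]
    subfield_add[OF cp.kappa_subfield])

lemma exponent_resk: "i \<in> upper T \<Longrightarrow> exponent T \<iota> \<mu> i \<in> res ` k"
  using gens[of i] iota subfield_mult[OF resk] subfield_of_nat[OF resk, of 2] by (auto simp: exponent_def)

lemma del_expo:
  assumes i: "i \<in> upper T" shows "\<delta> (expo i) = exponent T \<iota> \<mu> i * expo i"
proof (cases "hypertangent T i")
  case True
  let ?u = "res (t i)"
  have d: "\<delta> ?u = \<mu> i * (1 + ?u\<^sup>2)"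
    using gens[OF i] True not_hyperexponential_and_hypertangent[OF i] by (auto simp: lam_def)
  have ii: "\<iota> * \<iota> = - 1" using iota by (simp add: power2_eq_square)
  have f: "1 + ?u\<^sup>2 = (?u - \<iota>) * (?u + \<iota>)" using ii by (simp add: power2_eq_square algebra_simps)
  have k: "?u \<in> \<kappa>" "\<iota> \<in> \<kappa>" "\<delta> \<iota> = 0" using gen_kappa[OF i] iota cp.res_k_kappa cp.del_k by auto
  have "\<delta> (expo i) = (\<delta> ?u * (?u + \<iota>) - (?u - \<iota>) * \<delta> ?u) / (?u + \<iota>)\<^sup>2"
    using True k iota_nz[OF i] subfield_add[OF cp.kappa_subfield] subfield_diff[OF cp.kappa_subfield]
    by (simp add: expo_def cp.kap.D_divide cp.kap.D_add cp.kap.D_diff)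
  also have "\<delta> ?u * (?u + \<iota>) - (?u - \<iota>) * \<delta> ?u = (2 * \<iota> * \<mu> i * (?u - \<iota>)) * (?u + \<iota>)"
    unfolding d f by (simp add: algebra_simps)
  also have "\<dots> / (?u + \<iota>)\<^sup>2 = 2 * \<iota> * \<mu> i * ((?u - \<iota>) / (?u + \<iota>))"
    using iota_nz[OF i] by (simp add: power2_eq_square)
  finally show ?thesis using True by (simp add: expo_def exponent_def)
next
  case False
  then have "lam T v \<pi> res i = \<mu> i * res (t i)" using gens[OF i] by blast
  then show ?thesis using False by (simp add: expo_def exponent_def lam_def)
qed

text \<open>The Moebius transformation is invertible over the residues of \<open>k\<close>, so
  nothing is lost in passing from the generators to their exponentials.\<close>

lemma kappa_expo: "\<kappa> = field_gen (res ` k \<union> expo ` upper T)"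
proof
  let ?F = "field_gen (res ` k \<union> expo ` upper T)"
  note c = subfield_closed[OF subfield_hull[of "res ` k \<union> expo ` upper T"]]
  have kF: "z \<in> ?F" if "z \<in> res ` k" for z using that by (intro field_gen_inc) auto
  have "res (t i) \<in> ?F" if i: "i \<in> upper T" for i
  proof (cases "hypertangent T i")
    case False
    then have "res (t i) = expo i" by (simp add: expo_def)
    then show ?thesis using i by (auto intro: field_gen_inc)
  next
    case True
    let ?u = "res (t i)" and ?e = "expo i"
    have e: "?e \<in> ?F" using i by (intro field_gen_inc) auto
    have "?e * (?u + \<iota>) = ?u - \<iota>" using True iota_nz[OF i] by (simp add: expo_def)
    then have h: "?u * (1 - ?e) = \<iota> * (1 + ?e)" by (simp add: algebra_simps)
    have "1 - ?e \<noteq> 0"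
    proof
      assume "1 - ?e = 0"
      then have "\<iota> * 2 = 0" using h by simp
      then show False using iota by simp
    qed
    then have "?u = \<iota> * (1 + ?e) / (1 - ?e)" using h by (simp add: eq_divide_eq)
    also have "\<dots> \<in> ?F" using e kF[OF iota(1)] by (intro c(9) c(4) c(3) c(6) c(2))
    finally show ?thesis .
  qed
  then show "\<kappa> \<subseteq> ?F" unfolding cp.kappa_gen using kF by (intro field_gen_subset[OF _ subfield_hull]) auto
  show "?F \<subseteq> \<kappa>" using cp.res_k_kappa expo_kappa by (intro field_gen_subset[OF _ cp.kappa_subfield]) auto
qed

lemma resk_consts: "res ` k \<subseteq> cp.kap.consts_D"
  using cp.res_k_kappa cp.del_k by auto

text \<open>If \<open>\<delta> f = c\<close> is constant then \<open>f\<close> is a generalised eigenvector for \<open>0\<close>, hence a quotient of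
  two true eigenvectors for one eigenvalue, and so \<open>\<delta> f = 0\<close>.\<close>

lemma constant_not_derivative:
  assumes c: "c \<in> res ` k" "c \<noteq> 0" shows "c \<notin> \<delta> ` \<kappa>"
proof
  assume "c \<in> \<delta> ` \<kappa>"
  then obtain f where f: "f \<in> \<kappa>" "\<delta> f = c" by auto
  have f0: "f \<noteq> 0" using f c by auto
  note kc = subfield_closed[OF cp.kappa_subfield] and rc = subfield_closed[OF resk]
  define G where "G \<beta> = {x\<in>\<kappa>. \<delta> x = \<beta> * x}" for \<beta>
  have rk: "\<beta> \<in> \<kappa>" if "\<beta> \<in> res ` k" for \<beta> using that cp.res_k_kappa by blast
  obtain \<beta> h where h: "\<beta> \<in> res ` k" "h \<in> G \<beta>" "h \<noteq> 0" "f * h \<in> G (0 + \<beta>)"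
  proof (rule cp.kap.eigenvector_quotient[of "res ` k" G "res ` k \<union> expo ` upper T" f 0])
    show "cp.kap.gev 0 f" unfolding cp.kap.gev_def using f c cp.del_k
      by (intro exI[of _ 2]) (auto simp: numeral_2_eq_2 cp.kap.op_def)
    show "\<exists>\<beta>\<in>res ` k. x \<in> G \<beta>" if "x \<in> res ` k \<union> expo ` upper T" for x
      using that
    proof
      assume "x \<in> res ` k"
      then show ?thesis using rc(1) rk cp.del_k by (intro bexI[of _ 0]) (auto simp: G_def)
    next
      assume "x \<in> expo ` upper T"
      then obtain i where "i \<in> upper T" "x = expo i" by auto
      then show ?thesis using exponent_resk del_expo expo_kappa
        by (intro bexI[of _ "exponent T \<iota> \<mu> i"]) (auto simp: G_def)
    qed
    show "x + y \<in> G \<beta>" if "x \<in> G \<beta>" "y \<in> G \<beta>" for \<beta> x y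
      using that kc(3) by (auto simp: G_def cp.kap.D_add algebra_simps)
    show "x * y \<in> G (\<beta> + \<gamma>)" if "x \<in> G \<beta>" "y \<in> G \<gamma>" for \<beta> \<gamma> x y
      using that kc(4) by (auto simp: G_def cp.kap.D_mult algebra_simps)
    show "x \<in> \<kappa> \<and> cp.kap.gev \<beta> x" if "x \<in> G \<beta>" for x \<beta> using that cp.kap.gev_eigen by (auto simp: G_def)
    show "- 1 \<in> G 0" using kc(2,5) cp.kap.D_minus[OF kc(2)] by (simp add: G_def)
    show "f \<in> field_gen (res ` k \<union> expo ` upper T)" using f kappa_expo by simp
  qed (use resk_consts rc f f0 kc in \<open>auto simp: G_def\<close>)
  have "\<delta> (f * h) = c * h + f * (\<beta> * h)" using h f by (simp add: G_def cp.kap.D_mult)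
  moreover have "\<delta> (f * h) = \<beta> * (f * h)" using h by (simp add: G_def)
  ultimately have "c * h = 0" by (simp add: algebra_simps)
  then show False using c h by simp
qed

text \<open>Rational independence makes the eigenspaces of the polynomial ring in the exponentials
  one-dimensional, spanned by monomials.\<close>

lemma constants_of_independent:
  assumes ind: "rat_independent (upper T) (exponent T \<iota> \<mu>)"
  shows "del_consts T v \<pi> res = res ` k"
proof
  show "res ` k \<subseteq> del_consts T v \<pi> res" using resk_consts cp.consts_del by simp
  show "del_consts T v \<pi> res \<subseteq> res ` k"
  proof
    fix f assume "f \<in> del_consts T v \<pi> res"
    then have f: "f \<in> \<kappa>" "\<delta> f = 0" by (auto simp: del_consts_def)
    show "f \<in> res ` k"
    proof (cases "f = 0")
      case True then show ?thesis using subfield_0[OF resk] by simp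
    next
      case False
      note kc = subfield_closed[OF cp.kappa_subfield] and rc = subfield_closed[OF resk]
      define w where "w n = (\<Sum>i\<in>upper T. of_nat (n i) * exponent T \<iota> \<mu> i)" for n :: "nat \<Rightarrow> nat"
      define m where "m n = (\<Prod>i\<in>upper T. expo i ^ n i)" for n
      \<comment> \<open>Smaller than the eigenspace by definition: the multiples of one monomial
        \<open>m n\<close> of weight \<open>\<beta>\<close>.\<close>
      define G where "G \<beta> = {a * m n |a n. a \<in> res ` k \<and> w n = \<beta>}" for \<beta>
      have rk: "\<beta> \<in> \<kappa>" if "\<beta> \<in> res ` k" for \<beta> using that cp.res_k_kappa by blast
      \<comment> \<open>Independence turns equal weights into equal exponents. This makes
        \<open>G \<beta>\<close> closed under addition and exhibits \<open>f\<close> at the end as a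
        quotient of two multiples of the same monomial.\<close>
      have w_inj: "m n = m n'" if "w n = w n'" for n n'
      proof -
        have "(\<Sum>i\<in>upper T. of_rat (of_nat (n i) - of_nat (n' i)) * exponent T \<iota> \<mu> i) = w n - w n'"
          by (simp add: w_def of_rat_diff sum_subtractf left_diff_distrib)
        then have "(of_nat (n i) :: rat) - of_nat (n' i) = 0" if "i \<in> upper T" for i
          using ind that \<open>w n = w n'\<close> unfolding rat_independent_def by auto
        then show ?thesis unfolding m_def by (intro prod.cong) auto
      qed
      have mk: "m n \<in> \<kappa>" "m n \<noteq> 0" for n unfolding m_def using expo_kappa
        by (auto intro!: subfield_prod[OF cp.kappa_subfield] subfield_power[OF cp.kappa_subfield])
      have dm: "\<delta> (m n) = w n * m n" for n
      proof -
        have "\<delta> (\<Prod>i\<in>I. expo i ^ n i) = (\<Sum>i\<in>I. of_nat (n i) * exponent T \<iota> \<mu> i) * (\<Prod>i\<in>I. expo i ^ n i)"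
          if sub: "I \<subseteq> upper T" for I
          using finite_subset[OF sub finite_upper] sub
        proof (induction I rule: finite_induct)
          case (insert i I)
          have i: "expo i \<in> \<kappa>" "\<delta> (expo i) = exponent T \<iota> \<mu> i * expo i" using insert expo_kappa del_expo by auto
          have I: "(\<Prod>i\<in>I. expo i ^ n i) \<in> \<kappa>" using insert expo_kappa
            by (intro subfield_prod[OF cp.kappa_subfield] kc(7)) auto
          have "\<delta> (expo i ^ n i) = of_nat (n i) * exponent T \<iota> \<mu> i * expo i ^ n i"
            using cp.kap.D_power[OF i(1), of "n i"] i(2) by (cases "n i") auto
          then show ?case using insert cp.kap.D_mult[OF kc(7)[OF i(1)] I] by (simp add: algebra_simps)
        qed simp
        then show ?thesis by (simp add: w_def m_def)
      qed
      have w_add: "w (\<lambda>i. n i + n' i) = w n + w n'" and m_add: "m (\<lambda>i. n i + n' i) = m n * m n'" for n n'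
        by (simp_all add: w_def m_def sum.distrib algebra_simps power_add prod.distrib)
      have w0: "w (\<lambda>_. 0) = 0" "m (\<lambda>_. 0) = 1" by (simp_all add: w_def m_def)
      have w_resk: "w n \<in> res ` k" for n unfolding w_def
        using exponent_resk rc(10) by (intro subfield_sum[OF resk] rc(4))
      have GI: "a * m n \<in> G (w n)" if "a \<in> res ` k" for a n using that unfolding G_def by blast
      obtain \<beta> h where h: "\<beta> \<in> range w" "h \<in> G \<beta>" "h \<noteq> 0" "f * h \<in> G (0 + \<beta>)"
      proof (rule cp.kap.eigenvector_quotient[of "range w" G "res ` k \<union> expo ` upper T" f 0])
        show "0 \<in> range w" using w0(1) by (metis rangeI)
        show "range w \<subseteq> cp.kap.consts_D" using w_resk resk_consts by blast
        show "\<beta> + \<gamma> \<in> range w" if bg: "\<beta> \<in> range w" "\<gamma> \<in> range w" for \<beta> \<gamma>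
        proof -
          obtain n n' where "\<beta> = w n" "\<gamma> = w n'" using bg by blast
          then have "\<beta> + \<gamma> = w (\<lambda>i. n i + n' i)" by (simp add: w_add)
          then show ?thesis by blast
        qed
        show "x \<in> \<kappa> \<and> cp.kap.gev \<beta> x" if x: "x \<in> G \<beta>" for x \<beta>
        proof -
          obtain a n where a: "x = a * m n" "a \<in> res ` k" "w n = \<beta>" using x unfolding G_def by blast
          have ak: "a \<in> \<kappa>" "\<delta> a = 0" using a(2) resk_consts by auto
          have "\<delta> x = \<beta> * x" using cp.kap.D_mult[OF ak(1) mk(1)[of n]] ak dm[of n] a by (simp add: mult_ac)
          then show ?thesis using kc(4)[OF ak(1) mk(1)] a cp.kap.gev_eigen by auto
        qed
        show "0 \<in> G \<beta>" if "\<beta> \<in> range w" for \<beta>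
          using that GI[OF rc(1)] by auto
        show "1 \<in> G 0" "- 1 \<in> G 0" using GI[OF rc(2), of "\<lambda>_. 0"] GI[OF rc(5)[OF rc(2)], of "\<lambda>_. 0"] w0 by auto
        show "x + y \<in> G \<beta>" if xy: "x \<in> G \<beta>" "y \<in> G \<beta>" for \<beta> x y
        proof -
          obtain a n where a: "x = a * m n" "a \<in> res ` k" "w n = \<beta>" using xy(1) unfolding G_def by blast
          obtain b n' where b: "y = b * m n'" "b \<in> res ` k" "w n' = \<beta>" using xy(2) unfolding G_def by blast
          have "x + y = (a + b) * m n" using w_inj[of n n'] a b by (simp add: distrib_right)
          then show ?thesis using GI[OF rc(3)[OF a(2) b(2)], of n] a by simp
        qed
        show "x * y \<in> G (\<beta> + \<gamma>)" if xy: "x \<in> G \<beta>" "y \<in> G \<gamma>" for \<beta> \<gamma> x y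
        proof -
          obtain a n where a: "x = a * m n" "a \<in> res ` k" "w n = \<beta>" using xy(1) unfolding G_def by blast
          obtain b n' where b: "y = b * m n'" "b \<in> res ` k" "w n' = \<gamma>" using xy(2) unfolding G_def by blast
          have e: "x * y = (a * b) * m (\<lambda>i. n i + n' i)" using a b by (simp add: m_add mult_ac)
          have "\<beta> + \<gamma> = w (\<lambda>i. n i + n' i)" using a b by (simp add: w_add)
          then show ?thesis unfolding e by (simp only: GI[OF rc(4)[OF a(2) b(2)]])
        qed
        show "\<exists>\<beta>\<in>range w. x \<in> G \<beta>" if x: "x \<in> res ` k \<union> expo ` upper T" for x
          using x
        proof
          assume "x \<in> res ` k"
          then have "x * m (\<lambda>_. 0) \<in> G (w (\<lambda>_. 0))" by (rule GI)
          then have "x \<in> G (w (\<lambda>_. 0))" by (simp only: w0(2) mult_1_right)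
          then show ?thesis by blast
        next
          assume "x \<in> expo ` upper T"
          then obtain i where i: "i \<in> upper T" "x = expo i" by auto
          have "m (\<lambda>j. if j = i then 1 else 0) = (\<Prod>j\<in>upper T. if j = i then expo j else 1)"
            unfolding m_def by (rule prod.cong) auto
          also have "\<dots> = x" using i finite_upper by simp
          finally have "x \<in> G (w (\<lambda>j. if j = i then 1 else 0))"
            using GI[OF rc(2), of "\<lambda>j. if j = i then 1 else 0"] by simp
          then show ?thesis by blast
        qed
        show "f \<in> field_gen (res ` k \<union> expo ` upper T)" using f kappa_expo by simp
        show "cp.kap.gev 0 f" using f cp.kap.gev_eigen[of f 0] by simp
      qed (use f False kc in auto)
      obtain a n where a: "h = a * m n" "a \<in> res ` k" "w n = \<beta>" using h(2) unfolding G_def by blast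
      obtain b n' where b: "f * h = b * m n'" "b \<in> res ` k" "w n' = \<beta>" using h(4) unfolding G_def by auto
      have "a \<noteq> 0" using h(3) a by auto
      moreover have "f * a * m n = b * m n" using a b w_inj[of n n'] by (simp add: mult.assoc)
      ultimately have "f = b / a" using mk(2)[of n] by (simp add: eq_divide_eq)
      then show ?thesis using rc(9)[OF b(2) a(2)] by simp
    qed
  qed
qed

end

lemma gauss_kernel:
  assumes \<pi>: "\<pi> \<in> K" and ex: "excess T v \<pi> \<ge> 1"
    and gens: "\<forall>i\<in>upper T. \<mu> i \<in> res ` k - {0} \<and>
      (hyperexponential T i \<and> lam T v \<pi> res i = \<mu> i * res (t i) \<or>
       hypertangent T i \<and> lam T v \<pi> res i = \<mu> i * (1 + (res (t i))\<^sup>2))"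
  shows "rho_r T v \<pi> res (excess T v \<pi>) \<notin> del T v \<pi> res ` kappa T v res"
    "(\<forall>\<iota>\<in>res ` k. \<iota>\<^sup>2 = -1 \<longrightarrow> rat_independent (upper T) (exponent T \<iota> \<mu>)) \<Longrightarrow> second_kernel_hyp T v \<pi> res"
proof -
  have rk: "alg_closed (res ` k)" by (rule cp.res_k_closed)
  then have s: "is_subring (res ` k)" using subfield_subring by (auto simp: alg_closed_def)
  \<comment> \<open>A square root of -1 among the residues of \<open>k\<close>, needed to form the
    exponentials of hypertangent generators.\<close>
  have "[:1, 0, 1:] \<in> polys_over (res ` k)"
    by (intro polys_over_pCons[OF s] polys_over_0[OF s] subring_1[OF s] subring_0[OF s])
  then have "\<exists>\<iota>\<in>res ` k. poly [:1, 0, 1:] \<iota> = 0" using rk unfolding alg_closed_def by fastforce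
  then obtain \<iota> where i: "\<iota> \<in> res ` k" "\<iota>\<^sup>2 = - 1"
    by (auto simp: power2_eq_square eq_neg_iff_add_eq_0 add.commute)
  have g: "\<mu> i \<in> res ` k - {0} \<and>
      (hyperexponential T i \<and> lam T v \<pi> res i = \<mu> i * res (t i) \<or>
       hypertangent T i \<and> lam T v \<pi> res i = \<mu> i * (1 + (res (t i))\<^sup>2))" if "i \<in> upper T" for i
    using gens that by blast
  show n: "rho_r T v \<pi> res (excess T v \<pi>) \<notin> del T v \<pi> res ` kappa T v res"
    using constant_not_derivative[OF g i] rho_r_constant[OF \<pi>] by blast
  show "second_kernel_hyp T v \<pi> res" if "\<forall>\<iota>\<in>res ` k. \<iota>\<^sup>2 = -1 \<longrightarrow> rat_independent (upper T) (exponent T \<iota> \<mu>)"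
    using constants_of_independent[OF g i] that i n ex by (simp add: second_kernel_hyp_def)
qed

end

text \<open>Brings the four kinds under one interface, with a generating set that avoids the
  generators defining the place, so that (K1) has to be proved only once.\<close>

lemma place_coefficient_field:
  fixes T :: "'a::field_char_0 tower" and res :: "'a \<Rightarrow> 'k::field_char_0"
  assumes tower: "is_tower T" and place: "is_place_of_kind T kd v \<pi>" and res: "is_residue_map (FbL T) v res"
  shows "\<exists>X. coeff_place T v \<pi> res (coeff_field T kd) X \<and> X \<subseteq> generators T kd - place_generators T kd"
proof -
  interpret tower T by unfold_locales (fact tower)
  have rational: "coeff_place T v \<pi> res (C_upper T i) (other_gens i) \<and>
      other_gens i \<subseteq> (t ` {1..ngen T} \<union> {radical T}) \<inter> C_upper T i" if rp: "rational_place T v i \<pi>" for i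
  proof -
    interpret rational_place T v i \<pi> by (rule rp)
    interpret cp: coeff_place T v \<pi> res "C_upper T i" "other_gens i" by (rule coeff_place[OF res])
    have "other_gens i \<subseteq> t ` {1..ngen T} \<union> {radical T}" using upper_index nlow by fastforce
    then show ?thesis using cp.coeff_place_axioms cp.C(4) by blast
  qed
  have gauss: "coeff_place T v \<pi> res (field_gen (k \<union> t ` {2..ngen T})) (t ` {2..ngen T}) \<and>
     t ` {2..ngen T} \<subseteq> (t ` {1..ngen T} \<union> {radical T}) \<inter> field_gen (k \<union> t ` {2..ngen T}) - {t 1, radical T}"
    if gp: "gauss_place T v p0" and un: "is_uniformiser E v \<pi>" for p0
  proof -
    interpret gauss_place T v p0 by (rule gp)
    have up: "upper T = {2..ngen T}" using n1 by (simp add: upper_def numeral_2_eq_2)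
    \<comment> \<open>An upper generator lies outside \<open>K\<close>, whereas \<open>t 1\<close>
      and the radical lie in it.\<close>
    have "t i \<noteq> t 1 \<and> t i \<noteq> radical T" if i: "i \<in> upper T" for i
    proof -
      have "t i \<notin> K" using upper_gen_notin_C[OF i] C_upper(2) by blast
      moreover have "t 1 \<in> K" "radical T \<in> K" using K_gens K0y_K n1 by auto
      ultimately show ?thesis by auto
    qed
    moreover have "t ` upper T \<subseteq> t ` {1..ngen T}" using upper_index by (intro image_mono) blast
    moreover have "t ` upper T \<subseteq> CG" by (auto intro: field_gen_inc)
    ultimately have "t ` upper T \<subseteq> (t ` {1..ngen T} \<union> {radical T}) \<inter> CG - {t 1, radical T}" by auto
    with coeff_place[OF res un] show ?thesis unfolding up by (rule conjI)
  qed
  show ?thesis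
  proof (cases kd)
    case P_inf
    then obtain p0 where gp: "gauss_place T v p0" using P_inf_gauss_place place by blast
    have "is_uniformiser E v \<pi>" using place P_inf by simp
    from gauss[OF gp this] show ?thesis unfolding P_inf generators_def
      by (intro exI[of _ "t ` {2..ngen T}"]) (simp only: coeff_field.simps place_generators.simps simp_thms)
  next
    case P_sigma
    then obtain p0 where gp: "gauss_place T v p0" using P_sigma_gauss_place place by blast
    have "is_uniformiser E v \<pi>" using place P_sigma by simp
    from gauss[OF gp this] show ?thesis unfolding P_sigma generators_def
      by (intro exI[of _ "t ` {2..ngen T}"]) (simp only: coeff_field.simps place_generators.simps simp_thms)
  next
    case (Upper_inf i)
    then have "rational_place T v i \<pi>" using Upper_inf_rational_place place by blast
    from rational[OF this] show ?thesis unfolding Upper_inf generators_def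
      by (intro exI[of _ "other_gens i"]) (simp only: coeff_field.simps place_generators.simps simp_thms Diff_empty)
  next
    case (Moving i)
    then have pl: "is_place_of_kind T (Moving i) v \<pi>" using place by simp
    obtain a b where "rational_place T v i \<pi>" by (rule Moving_rational_places[OF pl]) blast
    from rational[OF this] show ?thesis unfolding Moving generators_def
      by (intro exI[of _ "other_gens i"]) (simp only: coeff_field.simps place_generators.simps simp_thms Diff_empty)
  qed
qed

theorem proposition8p11:
  fixes T :: "'a::field_char_0 tower" and kd :: kind and v :: "'a \<Rightarrow> int" and \<pi> :: 'a
    and res :: "'a \<Rightarrow> 'k::field_char_0"
  assumes tower: "is_tower T"
    and place: "is_place_of_kind T kd v \<pi>"
    and res: "is_residue_map (FbL T) v res"
  shows
    \<comment> \<open>(K1)\<close>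
    "(\<forall>\<mu>. excess T v \<pi> = 0 \<and> attaining_shape T kd v \<pi> res \<mu> \<and>
          attaining_coeffs_in (del_consts T v \<pi> res) T kd v \<pi> res \<mu> \<and>
          \<not> rat_combination (attaining_hyper T kd v) \<mu> (rho T v \<pi> res) \<longrightarrow>
        NN T v \<pi> res = {0} \<and> first_kernel_hyp T v \<pi> res) \<and>
     (\<forall>\<mu>. attaining_shape T kd v \<pi> res \<mu> \<and>
          attaining_coeffs_in (nonattaining_field T kd v res) T kd v \<pi> res \<mu> \<longrightarrow>
        attaining_coeffs_in (del_consts T v \<pi> res) T kd v \<pi> res \<mu>) \<and>
     \<comment> \<open>(K2)\<close>
     (\<forall>i. (kd = Upper_inf i \<or>
           kd = Moving i \<and>
             (hyperexponential T i \<longrightarrow> \<pi> = gen T i) \<and>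
             (hypertangent T i \<longrightarrow> (\<exists>\<iota>\<in>Fb T. \<iota>\<^sup>2 = -1 \<and> \<pi> = gen T i - \<iota>))) \<and>
          monomial_gen T i \<and> independent_gen T i \<longrightarrow>
        (hyperexponential T i \<or> hypertangent T i \<longrightarrow>
           first_kernel_hyp T v \<pi> res \<and> NN T v \<pi> res = {0}) \<and>
        (primitive T i \<longrightarrow> second_kernel_hyp T v \<pi> res \<and> excess T v \<pi> = 1)) \<and>
     \<comment> \<open>(K3)\<close>
     (excess T v \<pi> \<ge> 1 \<and> nlow T = 1 \<and> ngen T = 2 \<and> rdeg T = 1 \<and>
      der T (gen T 1) = 1 \<and> kd = Upper_inf 2 \<longrightarrow>
        kappa T v res = field_gen (res ` Fb T \<union> {res (gen T 1)}) \<and>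
        (\<forall>P\<in>polys_over (res ` Fb T). \<forall>Q\<in>polys_over (res ` Fb T). Q \<noteq> 0 \<longrightarrow>
           del T v \<pi> res (poly P (res (gen T 1)) / poly Q (res (gen T 1))) =
             poly (pderiv P * Q - P * pderiv Q) (res (gen T 1)) / (poly Q (res (gen T 1)))\<^sup>2) \<and>
        (second_kernel_hyp T v \<pi> res \<longleftrightarrow>
           has_nonzero_residue (res ` Fb T) (res (gen T 1)) (rho_r T v \<pi> res (excess T v \<pi>)))) \<and>
     \<comment> \<open>(K4)\<close>
     (\<forall>\<mu>. (kd = P_inf \<or> kd = P_sigma) \<and> \<pi> \<in> FbK0y T \<and> excess T v \<pi> \<ge> 1 \<and>
          (\<forall>k\<in>upper T. attains T v (gen T k) \<and> \<mu> k \<in> res ` Fb T - {0} \<and>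
             (hyperexponential T k \<and> lam T v \<pi> res k = \<mu> k * res (gen T k) \<or>
              hypertangent T k \<and> lam T v \<pi> res k = \<mu> k * (1 + (res (gen T k))\<^sup>2))) \<and>
          rat_independent {k \<in> upper T. hyperexponential T k} \<mu> \<longrightarrow>
        rho_r T v \<pi> res (excess T v \<pi>) \<notin> del T v \<pi> res ` kappa T v res \<and>
        ((\<forall>\<iota>\<in>res ` Fb T. \<iota>\<^sup>2 = -1 \<longrightarrow> rat_independent (upper T) (exponent T \<iota> \<mu>)) \<longrightarrow>
           second_kernel_hyp T v \<pi> res))"

proof -
  interpret tower T by unfold_locales (fact tower)
  obtain X where X: "coeff_place T v \<pi> res (coeff_field T kd) X" "X \<subseteq> generators T kd - place_generators T kd"
    using place_coefficient_field[OF tower place res] by blast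
  interpret cf: coeff_place T v \<pi> res "coeff_field T kd" X by (rule X(1))
  have K1: "NN T v \<pi> res = {0} \<and> first_kernel_hyp T v \<pi> res"
    if "excess T v \<pi> = 0 \<and> attaining_shape T kd v \<pi> res \<mu> \<and>
          attaining_coeffs_in (del_consts T v \<pi> res) T kd v \<pi> res \<mu> \<and>
          \<not> rat_combination (attaining_hyper T kd v) \<mu> (rho T v \<pi> res)" for \<mu>
    using cf.K1_kernel[OF refl X(2)] cf.first_kernel_of_NN that by blast
  have K1': "attaining_coeffs_in (del_consts T v \<pi> res) T kd v \<pi> res \<mu>"
    if "attaining_coeffs_in (nonattaining_field T kd v res) T kd v \<pi> res \<mu>" for \<mu>
    using that cf.nonattaining_field_consts[OF refl] unfolding attaining_coeffs_in_def by blast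
  have K2: "(hyperexponential T i \<or> hypertangent T i \<longrightarrow> first_kernel_hyp T v \<pi> res \<and> NN T v \<pi> res = {0}) \<and>
        (primitive T i \<longrightarrow> second_kernel_hyp T v \<pi> res \<and> excess T v \<pi> = 1)"
    if h: "(kd = Upper_inf i \<or>
           kd = Moving i \<and>
             (hyperexponential T i \<longrightarrow> \<pi> = gen T i) \<and>
             (hypertangent T i \<longrightarrow> (\<exists>\<iota>\<in>Fb T. \<iota>\<^sup>2 = -1 \<and> \<pi> = gen T i - \<iota>)))"
      and ind: "independent_gen T i" for i
    using h
  proof
    assume "kd = Upper_inf i"
    then have pl: "is_place_of_kind T (Upper_inf i) v \<pi>" using place by simp
    show ?thesis using Upper_inf_kernel[OF pl res ind] cf.first_kernel_of_NN by blast
  next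
    assume m: "kd = Moving i \<and>
             (hyperexponential T i \<longrightarrow> \<pi> = gen T i) \<and>
             (hypertangent T i \<longrightarrow> (\<exists>\<iota>\<in>Fb T. \<iota>\<^sup>2 = -1 \<and> \<pi> = gen T i - \<iota>))"
    then have pl: "is_place_of_kind T (Moving i) v \<pi>" using place by simp
    \<comment> \<open>For primitive \<open>t i\<close> the claim is vacuous, since such a moving
      prime cannot be special.\<close>
    show ?thesis using Moving_kernel[OF pl res ind] m cf.first_kernel_of_NN by blast
  qed
  have K3: "kappa T v res = field_gen (res ` Fb T \<union> {res (gen T 1)}) \<and>
        (\<forall>P\<in>polys_over (res ` Fb T). \<forall>Q\<in>polys_over (res ` Fb T). Q \<noteq> 0 \<longrightarrow>
           del T v \<pi> res (poly P (res (gen T 1)) / poly Q (res (gen T 1))) =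
             poly (pderiv P * Q - P * pderiv Q) (res (gen T 1)) / (poly Q (res (gen T 1)))\<^sup>2) \<and>
        (second_kernel_hyp T v \<pi> res \<longleftrightarrow>
           has_nonzero_residue (res ` Fb T) (res (gen T 1)) (rho_r T v \<pi> res (excess T v \<pi>)))"
    if h: "excess T v \<pi> \<ge> 1 \<and> nlow T = 1 \<and> ngen T = 2 \<and> rdeg T = 1 \<and>
      der T (gen T 1) = 1 \<and> kd = Upper_inf 2"
  proof -
    have pl: "is_place_of_kind T (Upper_inf 2) v \<pi>" using place h by simp
    show ?thesis by (rule Upper_inf_residue_kernel[OF pl res]) (use h in auto)
  qed
  have K4: "rho_r T v \<pi> res (excess T v \<pi>) \<notin> del T v \<pi> res ` kappa T v res \<and>
        ((\<forall>\<iota>\<in>res ` Fb T. \<iota>\<^sup>2 = -1 \<longrightarrow> rat_independent (upper T) (exponent T \<iota> \<mu>)) \<longrightarrow>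
           second_kernel_hyp T v \<pi> res)"
    if h: "kd = P_inf \<or> kd = P_sigma" "\<pi> \<in> FbK0y T" "excess T v \<pi> \<ge> 1"
          "\<forall>k\<in>upper T. attains T v (gen T k) \<and> \<mu> k \<in> res ` Fb T - {0} \<and>
             (hyperexponential T k \<and> lam T v \<pi> res k = \<mu> k * res (gen T k) \<or>
              hypertangent T k \<and> lam T v \<pi> res k = \<mu> k * (1 + (res (gen T k))\<^sup>2))" for \<mu>
  proof -
    obtain p0 where g0: "gauss_place T v p0"
      using h(1) place P_inf_gauss_place P_sigma_gauss_place by blast
    interpret gp: gauss_place T v p0 by (rule g0)
    interpret rg: residue_gauss_place T v p0 \<pi> res by unfold_locales (fact res cf.unif)+
    show ?thesis using rg.gauss_kernel[OF h(2,3), of \<mu>] h(4) by blast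
  qed
  show ?thesis
    by (intro conjI; intro allI impI; (erule K1 | (elim conjE, erule K1') | (elim conjE, rule K2; assumption)
      | erule K3 | (elim conjE, rule K4; assumption)))
qed

end
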